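(* Let $d\geq 1$ and $\Lambda=S\,\mathbb{Z}[i]^d\subseteq\mathbb{C}^d$, where $S$ is an upper triangular complex $d\times d$ matrix with positive diagonal entries $(\gamma_1,\dots,\gamma_d)$. Assume that $\max_{j=1,\dots,d}\gamma_j=1$. Let $\Lambda^\circ=(S^* )^{-1}\mathbb{Z}[i]^d$ be the adjoint lattice and $g(x)=2^{d/4}e^{-\pi|x|^2}$, $x\in\mathbb{R}^d$. (i) There exists $\gamma\in M^\infty(\mathbb{R}^d)$ such that $$\tfrac{1}{\mathrm{vol}(\Lambda)}\langle\gamma,\pi_\mu g\rangle=\delta_{\mu,0}\quad\text{for all }\mu\in\Lambda^\circ,$$ and the weak reconstruction formula $$\langle f,h\rangle=\sum_{\lambda\in\Lambda}\langle f,\pi_\lambda g\rangle\langle\pi_\lambda\gamma,h\rangle$$ holds for every $f,h\in M^1(\mathbb{R}^d)$, with absolute convergence of the sum. (ii) Equivalently, there exists an interpolating function $\tau\in\mathcal{F}^\infty_d$ for the adjoint lattice $\Lambda^\circ$, i.e. $\tau(\mu)=\delta_{\mu,0}$ for all $\mu\in\Lambda^\circ$, such that for all $F\in\mathcal{F}^1_d$ the weak Lagrange interpolation formula $$F(z)=\sum_{\lambda\in\Lambda}F(\lambda)e^{\pi\bar\lambda\cdot z}\tau(z-\lambda)e^{-\pi|\lambda|^2}$$ holds, where the series converges weakly in the sense that for all $H\in\mathcal{F}^1_d$ $$\int_{\mathbb{C}^d}F(z)\overline{H(z)}e^{-\pi|z|^2}\,dz=\sum_{\lambda\in\Lambda}F(\lambda)e^{-\pi|\lambda|^2}\int_{\mathbb{C}^d}e^{\pi\bar\lambda\cdot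 z}\tau(z-\lambda)\overline{H(z)}e^{-\pi|z|^2}\,dz .$$ In particular, $\Lambda$ is a set of uniqueness for $\mathcal{F}^1_d$: if $F\in\mathcal{F}^1_d$ and $F(\lambda)=0$ for all $\lambda\in\Lambda$, then $F\equiv0$.
   Context: $\mathbb{Z}[i]=\mathbb{Z}+i\mathbb{Z}$ denotes the Gaussian integers; $S^*$ is the conjugate transpose. For $z,w\in\mathbb{C}^d$, $z\cdot w=\sum_{j=1}^d z_jw_j$ (no conjugation), $|z|^2=\sum_j|z_j|^2$, and $dz$ is Lebesgue measure on $\mathbb{C}^d\cong\mathbb{R}^{2d}$. $\mathrm{vol}(\Lambda)$ is the Lebesgue measure of a fundamental domain of $\Lambda$ in $\mathbb{C}^d\cong\mathbb{R}^{2d}$. $\mathcal{F}^1_d$ is the space of entire functions $F$ on $\mathbb{C}^d$ with $\int_{\mathbb{C}^d}|F(z)|e^{-\pi|z|^2/2}\,dz<\infty$, and $\mathcal{F}^\infty_d$ is the space of entire functions $F$ on $\mathbb{C}^d$ with $\sup_{z\in\mathbb{C}^d}|F(z)|e^{-\pi|z|^2/2}<\infty$. For $\lambda=\xi+i\eta\in\mathbb{C}^d\cong\mathbb{R}^{2d}$ with $\xi,\eta\in\mathbb{R}^d$, the time-frequency shift of a function (or tempered distribution) $g$ is $\pi_\lambda g(x)=e^{2\pi i\langle\eta,x\rangle}g(x-\xi)$. With the normalized Gaussian $\phi(x)=2^{d/4}e^{-\pi|x|^2}$, the modulation space $M^1(\mathbb{R}^d)$ consists of all $h\in L^2(\mathbb{R}^d)$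 with $\int_{\mathbb{R}^{2d}}|\langle h,\pi_z\phi\rangle|\,dz<\infty$, and $M^\infty(\mathbb{R}^d)$ consists of all tempered distributions $h$ with $\sup_{z\in\mathbb{R}^{2d}}|\langle h,\pi_z\phi\rangle|<\infty$; $M^\infty=(M^1)^*$, and $\langle\cdot,\cdot\rangle$ denotes the corresponding sesquilinear duality (linear in the first and conjugate-linear in the second argument) extending the $L^2$ inner product.
   Formalization: In (ii) a factor vol(Λ) is placed in front of the terms of the Lagrange series (in its weak form); as printed the formula fails when vol(Λ)≠1, since F=H=1 would give 1=1/vol(Λ), e.g. for S=diag(1,1/2); for vol(Λ)=1 nothing changes. *)

theory Defs
  imports "HOL-Analysis.Analysis"
begin

text \<open>\<open>\<complex>\<^sup>d\<close> is \<open>complex ^ 'd\<close>, with its Euclidean norm and with Lebesgue measure from its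
  structure as a real Euclidean space of dimension \<open>2d\<close>.  Elements of \<open>L\<^sup>2\<close> and \<open>M\<^sup>1\<close> are represented by
  Lebesgue measurable functions, not identified almost everywhere.\<close>

section \<open>Lattices\<close>

definition gauss_int :: "complex set" where
  "gauss_int = {of_int a + \<i> * of_int b | a b. True}"

definition matrix_lattice :: "complex ^ 'd ^ 'd \<Rightarrow> (complex ^ 'd) set" where
  "matrix_lattice S = {S *v k | k. \<forall>j. k $ j \<in> gauss_int}"

definition conj_transpose :: "complex ^ 'd ^ 'd \<Rightarrow> complex ^ 'd ^ 'd" where
  "conj_transpose S = (\<chi> i j. cnj (S $ j $ i))"

definition upper_triangular :: "complex ^ ('d :: {finite, linorder}) ^ ('d :: {finite, linorder}) \<Rightarrow> bool" where
  "upper_triangular S \<longleftrightarrow> (\<forall>i j. j < i \<longrightarrow> S $ i $ j = 0)"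

definition fundamental_domain :: "(complex ^ 'd) set \<Rightarrow> (complex ^ 'd) set \<Rightarrow> bool" where
  "fundamental_domain L D \<longleftrightarrow> D \<in> sets lebesgue \<and> (\<forall>z. \<exists>!l. l \<in> L \<and> z - l \<in> D)"

text \<open>All measurable fundamental domains of a lattice have the same measure.\<close>

definition lattice_vol :: "(complex ^ 'd) set \<Rightarrow> real" where
  "lattice_vol L = (THE v. \<exists>D. fundamental_domain L D \<and> v = measure lebesgue D)"

section \<open>Fock spaces\<close>

text \<open>The bilinear product, without conjugation.\<close>

definition cdot :: "complex ^ 'd \<Rightarrow> complex ^ 'd \<Rightarrow> complex" where
  "cdot z w = (\<Sum>j\<in>UNIV. z $ j * w $ j)"

definition cnj_vec :: "complex ^ 'd \<Rightarrow> complex ^ 'd" where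
  "cnj_vec z = (\<chi> j. cnj (z $ j))"

definition entire :: "(complex ^ 'd \<Rightarrow> complex) \<Rightarrow> bool" where
  "entire F \<longleftrightarrow> (\<forall>z. \<exists>D. (F has_derivative D) (at z) \<and> (\<forall>c v. D (c *s v) = c * D v))"

definition fock1 :: "(complex ^ 'd \<Rightarrow> complex) set" where
  "fock1 = {F. entire F \<and> integrable lebesgue (\<lambda>z. cmod (F z) * exp (- pi * (norm z)\<^sup>2 / 2))}"

definition fock_inf :: "(complex ^ 'd \<Rightarrow> complex) set" where
  "fock_inf = {F. entire F \<and> bdd_above (range (\<lambda>z. cmod (F z) * exp (- pi * (norm z)\<^sup>2 / 2)))}"

section \<open>Schwartz functions and tempered distributions\<close>

definition partial :: "'d \<Rightarrow> (real ^ 'd \<Rightarrow> complex) \<Rightarrow> real ^ 'd \<Rightarrow> complex" where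
  "partial j f x = frechet_derivative f (at x) (axis j 1)"

text \<open>Iterated partial derivatives; the multi-index is given as a list of coordinate directions.\<close>

fun partials :: "'d list \<Rightarrow> (real ^ 'd \<Rightarrow> complex) \<Rightarrow> real ^ 'd \<Rightarrow> complex" where
  "partials [] f = f"
| "partials (j # js) f = partial j (partials js f)"

definition smooth :: "(real ^ 'd \<Rightarrow> complex) \<Rightarrow> bool" where
  "smooth f \<longleftrightarrow> (\<forall>js x. partials js f differentiable (at x))"

definition schwartz :: "(real ^ 'd \<Rightarrow> complex) set" where
  "schwartz = {f. smooth f \<and>
     (\<forall>k js. bdd_above (range (\<lambda>x. (1 + norm x) ^ k * cmod (partials js f x))))}"

definition schwartz_seminorm :: "nat \<Rightarrow> 'd list \<Rightarrow> (real ^ 'd \<Rightarrow> complex) \<Rightarrow> real" where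
  "schwartz_seminorm k js f = (SUP x. (1 + norm x) ^ k * cmod (partials js f x))"

text \<open>A tempered distribution is a continuous linear functional on the Schwartz space; its values at
  functions that are not Schwartz are irrelevant.\<close>

type_synonym 'd distr = "(real ^ 'd \<Rightarrow> complex) \<Rightarrow> complex"

definition tempered :: "('d :: finite) distr \<Rightarrow> bool" where
  "tempered u \<longleftrightarrow>
     (\<forall>f\<in>schwartz. \<forall>g\<in>schwartz. u (\<lambda>x. f x + g x) = u f + u g) \<and>
     (\<forall>c. \<forall>f\<in>schwartz. u (\<lambda>x. c * f x) = c * u f) \<and>
     (\<exists>C N. \<forall>f\<in>schwartz. cmod (u f) \<le> C * (\<Sum>js | length js \<le> N. schwartz_seminorm N js f))"

text \<open>The sesquilinear pairing of a tempered distribution with a Schwartz function.\<close>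

definition distr_pair :: "('d :: finite) distr \<Rightarrow> (real ^ 'd \<Rightarrow> complex) \<Rightarrow> complex" where
  "distr_pair u f = u (\<lambda>x. cnj (f x))"

section \<open>Time-frequency shifts and modulation spaces\<close>

definition Re_vec :: "complex ^ 'd \<Rightarrow> real ^ 'd" where
  "Re_vec z = (\<chi> j. Re (z $ j))"

definition Im_vec :: "complex ^ 'd \<Rightarrow> real ^ 'd" where
  "Im_vec z = (\<chi> j. Im (z $ j))"

definition tf_shift :: "complex ^ 'd \<Rightarrow> (real ^ 'd \<Rightarrow> complex) \<Rightarrow> real ^ 'd \<Rightarrow> complex" where
  "tf_shift z f x = exp (2 * pi * \<i> * complex_of_real (Im_vec z \<bullet> x)) * f (x - Re_vec z)"

text \<open>The shift of a distribution is defined by transposition: substitute \<open>x + Re z\<close> for \<open>x\<close> in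
  \<open>\<integral> tf_shift z f x * g x dx\<close>.\<close>

definition tf_shift_distr :: "complex ^ 'd \<Rightarrow> ('d :: finite) distr \<Rightarrow> 'd distr" where
  "tf_shift_distr z u g =
     u (\<lambda>x. exp (2 * pi * \<i> * complex_of_real (Im_vec z \<bullet> (x + Re_vec z))) * g (x + Re_vec z))"

definition gaussian :: "real ^ 'd \<Rightarrow> complex" where
  "gaussian x = complex_of_real (2 powr (real CARD('d) / 4) * exp (- pi * (norm x)\<^sup>2))"

definition l2_inner :: "(real ^ 'd \<Rightarrow> complex) \<Rightarrow> (real ^ 'd \<Rightarrow> complex) \<Rightarrow> complex" where
  "l2_inner f g = integral\<^sup>L lebesgue (\<lambda>x. f x * cnj (g x))"

definition mod1 :: "(real ^ 'd \<Rightarrow> complex) set" where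
  "mod1 = {h. h \<in> borel_measurable lebesgue \<and> integrable lebesgue (\<lambda>x. (cmod (h x))\<^sup>2) \<and>
     integrable lebesgue (\<lambda>z. cmod (l2_inner h (tf_shift z gaussian)))}"

definition mod1_norm :: "(real ^ 'd \<Rightarrow> complex) \<Rightarrow> real" where
  "mod1_norm h = integral\<^sup>L lebesgue (\<lambda>z. cmod (l2_inner h (tf_shift z gaussian)))"

definition mod_inf :: "('d :: finite) distr set" where
  "mod_inf = {u. tempered u \<and> bdd_above (range (\<lambda>z. cmod (distr_pair u (tf_shift z gaussian))))}"

text \<open>The duality \<open>M\<^sup>\<infinity> = (M\<^sup>1)\<^sup>*\<close>: every \<open>u\<close> in \<open>M\<^sup>\<infinity>\<close> extends from the Schwartz space to exactly one bounded
  conjugate-linear functional on \<open>M\<^sup>1\<close>, in which the Schwartz space is dense, and the value of that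
  functional at \<open>h\<close> is the pairing of \<open>u\<close> with \<open>h\<close>.\<close>

definition mod1_extension :: "('d :: finite) distr \<Rightarrow> ((real ^ 'd \<Rightarrow> complex) \<Rightarrow> complex) \<Rightarrow> bool" where
  "mod1_extension u B \<longleftrightarrow>
     (\<forall>f\<in>mod1. \<forall>g\<in>mod1. B (\<lambda>x. f x + g x) = B f + B g) \<and>
     (\<forall>c. \<forall>f\<in>mod1. B (\<lambda>x. c * f x) = cnj c * B f) \<and>
     (\<exists>C. \<forall>f\<in>mod1. cmod (B f) \<le> C * mod1_norm f) \<and>
     (\<forall>f\<in>schwartz. B f = distr_pair u f)"

definition mod_pair :: "('d :: finite) distr \<Rightarrow> (real ^ 'd \<Rightarrow> complex) \<Rightarrow> complex" where
  "mod_pair u h = (THE c. \<exists>B. mod1_extension u B \<and> c = B h)"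

end

theory Submission
  imports Defs "HOL-Complex_Analysis.Cauchy_Integral_Formula"
    "HOL-Probability.Characteristic_Functions" "HOL-Probability.Sinc_Integral"
begin

text \<open>\<^bold>\<open>One variable.\<close> Let \<open>\<Lambda> = g \<int>[i]\<close> with \<open>0 < g \<le> 1\<close>, whose adjoint lattice is \<open>\<int>[i] / g\<close>. Bastiaans'
  dual window is \<open>exp (\<pi> x\<^sup>2)\<close> times a function that is constant on the intervals of length \<open>g\<close> centred at
  \<open>g \<int>\<close>; its values \<open>w\<^sub>k\<close> there are the Laurent coefficients of a theta function divided by one of its
  linear factors. They decay like \<open>exp (- \<pi> (\<bar>k\<bar> + 1/2)\<^sup>2)\<close>, and as \<open>g \<le> 1\<close> the window is bounded. Its
  Bargmann transform (\<open>interp_1\<close>, after normalization) therefore lies in the Fock space of \<open>L\<^sup>\<infinity>\<close> type. At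
  \<open>z = (m + i n) / g\<close> it is, up to a nonzero factor, the product of the Laurent series at \<open>exp (2 \<pi> m)\<close>,
  which vanishes for \<open>m \<noteq> 0\<close>, and of the integral of \<open>exp (2 \<pi> z x)\<close> over one step, which vanishes for
  \<open>m = 0\<close> and \<open>n \<noteq> 0\<close> because \<open>exp (2 \<pi> i n x / g)\<close> then runs through full periods: it interpolates on the
  adjoint lattice (\<open>interp_1_lattice\<close>).

  \<^bold>\<open>Several variables.\<close> The function \<open>\<tau>(z) = \<Prod>\<tau>\<^sub>j(z\<^sub>j)\<close> (\<open>interp\<close>), with \<open>\<tau>\<^sub>j\<close> the function above for
  \<open>g = \<gamma>\<^sub>j\<close>, interpolates on the whole adjoint lattice of the triangular lattice \<open>\<Lambda>\<close>: since \<open>S\<^sup>*\<close> is lower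
  triangular, the first nonzero coordinate of a nonzero point of the adjoint lattice lies in \<open>\<int>[i] / \<gamma>\<^sub>j\<close>.

  \<^bold>\<open>The interpolation formula\<close> (\<open>interpolation_formula\<close>) only has to be checked for the kernel functions
  \<open>exp (\<pi> \<alpha> z)\<close>, because the reproducing formula writes every \<open>F\<close> in \<open>F\<^sup>1\<close> as an absolutely convergent
  superposition of them. For a kernel function the terms factor over the coordinates. The sum over the
  smallest index runs over a translate of \<open>\<gamma>\<^sub>1 \<int>[i]\<close>, which depends on the other coordinates. But this
  one-dimensional sum does not depend on the translate: by the reproducing formula the Fourier coefficients
  of the periodized term are multiples of values of \<open>\<tau>\<^sub>1\<close> on the adjoint lattice, so all of them but one
  vanish, and a continuous periodic function with this property is constant (\<open>poisson_square\<close>). Hence the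
  lattice sum is a product of one-dimensional sums, as for a product lattice. Integrating against a test
  function gives the weak formula (\<open>weak_interpolation\<close>), and the set of uniqueness is immediate.

  \<^bold>\<open>The Gabor expansion\<close> (\<open>gabor_expansion\<close>) is the same formula seen through the Bargmann transform: for
  \<open>f\<close> in \<open>M\<^sup>1\<close>, the numbers \<open>\<langle>f, \<pi>\<^sub>\<lambda> g\<rangle>\<close> are, up to conjugation and an explicit factor, the values of the
  Bargmann transform of \<open>f\<close>, which satisfies the reproducing formula; and the Bargmann transform of \<open>\<pi>\<^sub>\<lambda> \<gamma>\<close>,
  for \<open>\<gamma>\<close> the product of Bastiaans' windows, is a multiple of the function attached to \<open>\<lambda>\<close> in the Lagrange
  formula. As \<open>\<gamma>\<close> is a bounded function, its pairing with \<open>M\<^sup>1\<close>, defined by extension from the Schwartz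
  space, is an integral (\<open>mod_pair_bounded\<close>); this needs the inversion formula for the short-time Fourier
  transform and the density of the finite superpositions of shifted Gaussians in \<open>M\<^sup>1\<close>.\<close>

section \<open>Lebesgue measure and Gaussian integrals\<close>

lemma nn_integral_lborel_translation:
  fixes f :: "'a::euclidean_space \<Rightarrow> ennreal"
  assumes "f \<in> borel_measurable borel"
  shows "(\<integral>\<^sup>+x. f (x + c) \<partial>lborel) = (\<integral>\<^sup>+x. f x \<partial>lborel)"
proof -
  have "(\<integral>\<^sup>+x. f x \<partial>lborel) = (\<integral>\<^sup>+x. f x \<partial>distr lborel borel ((+) c))"
    by (simp add: lborel_distr_plus)
  also have "\<dots> = (\<integral>\<^sup>+x. f (c + x) \<partial>lborel)"
    using assms by (subst nn_integral_distr) auto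
  finally show ?thesis by (simp add: add.commute)
qed

lemma integral_lborel_translation:
  fixes f :: "'a::euclidean_space \<Rightarrow> 'b::{banach,second_countable_topology}"
  assumes "f \<in> borel_measurable borel"
  shows "(\<integral>x. f (x + c) \<partial>lborel) = (\<integral>x. f x \<partial>lborel)"
    and "integrable lborel (\<lambda>x. f (x + c)) \<longleftrightarrow> integrable lborel f"
proof -
  have "(\<integral>x. f x \<partial>lborel) = (\<integral>x. f x \<partial>distr lborel borel ((+) c))"
    by (simp add: lborel_distr_plus)
  also have "\<dots> = (\<integral>x. f (c + x) \<partial>lborel)"
    using assms by (subst integral_distr) auto
  finally show "(\<integral>x. f (x + c) \<partial>lborel) = (\<integral>x. f x \<partial>lborel)" by (simp add: add.commute)
  have "integrable lborel f \<longleftrightarrow> integrable (distr lborel borel ((+) c)) f"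
    by (simp add: lborel_distr_plus)
  also have "\<dots> \<longleftrightarrow> integrable lborel (\<lambda>x. f (c + x))"
    using assms by (subst integrable_distr_eq) auto
  finally show "integrable lborel (\<lambda>x. f (x + c)) \<longleftrightarrow> integrable lborel f"
    by (simp add: add.commute)
qed

text \<open>Uniqueness of Haar measure, in the form of a Fubini computation: if \<open>\<mu>\<close> is Lebesgue measure and \<open>\<nu>\<close>
  its image under \<open>T\<close>, both translation invariant, then \<open>\<integral>f d\<mu> * \<integral>g d\<nu> = \<integral>f d\<nu> * \<integral>g(-x) d\<mu>(x)\<close>.  For \<open>g\<close>
  the indicator of the unit ball, which \<open>T\<close> preserves, the two factors with \<open>g\<close> agree.\<close>

lemma lborel_distr_isometry:
  fixes T :: "'a::euclidean_space \<Rightarrow> 'b::euclidean_space"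
  assumes lin: "linear T" and iso: "\<And>x. norm (T x) = norm x" and dim: "DIM('a) = DIM('b)"
  shows "distr lborel borel T = lborel"
proof -
  have cont: "continuous_on A T" for A
    using lin by (simp add: linear_continuous_on linear_conv_bounded_linear)
  have [measurable]: "T \<in> borel_measurable borel"
    by (intro borel_measurable_continuous_onI cont)
  have inj: "inj T"
    unfolding linear_injective_0[OF lin] using iso by (metis norm_eq_zero)
  have "dim (range T) = DIM('b)"
    using dim_image_eq[OF lin, of UNIV] inj dim by (simp add: dim_UNIV)
  then have "span (range T) = UNIV" by (simp add: dim_eq_full)
  then have surj: "surj T"
    using lin by (metis linear_span_image span_UNIV)
  define Ti where "Ti = inv T"
  have TTi: "T (Ti y) = y" for y using surj by (simp add: Ti_def surj_f_inv_f)
  define g :: "'b \<Rightarrow> ennreal" where "g = indicator (ball 0 1)"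
  have [measurable]: "g \<in> borel_measurable borel"
    unfolding g_def by (intro borel_measurable_indicator) auto
  have g_symm: "g (- x) = g x" for x by (simp add: g_def indicator_def)
  have key: "(\<integral>\<^sup>+x. f x \<partial>lborel) = (\<integral>\<^sup>+y. f (T y) \<partial>lborel)"
    if [measurable]: "f \<in> borel_measurable borel" for f :: "'b \<Rightarrow> ennreal"
  proof -
    have gball: "(\<integral>\<^sup>+y. g (T y) \<partial>lborel) = (\<integral>\<^sup>+x. g x \<partial>lborel)"
    proof -
      have "(\<integral>\<^sup>+y. g (T y) \<partial>lborel) = (\<integral>\<^sup>+y. indicator (ball (0::'a) 1) y \<partial>lborel)"
        by (intro nn_integral_cong) (simp add: g_def indicator_def iso)
      then show ?thesis by (simp add: g_def emeasure_ball dim)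
    qed
    have pos: "(\<integral>\<^sup>+x. g x \<partial>lborel) = ennreal (unit_ball_vol DIM('b))"
      by (simp add: g_def emeasure_ball)
    have "(\<integral>\<^sup>+x. f x \<partial>lborel) * (\<integral>\<^sup>+y. g (T y) \<partial>lborel)
        = (\<integral>\<^sup>+x. \<integral>\<^sup>+y. f x * g (T y) \<partial>lborel \<partial>lborel)"
      by (simp add: nn_integral_cmult nn_integral_multc)
    also have "\<dots> = (\<integral>\<^sup>+x. \<integral>\<^sup>+y. f x * g (T y - x) \<partial>lborel \<partial>lborel)"
    proof (rule nn_integral_cong)
      fix x
      have "(\<integral>\<^sup>+y. f x * g (T (y + Ti (- x))) \<partial>lborel) = (\<integral>\<^sup>+y. f x * g (T y) \<partial>lborel)"
        by (rule nn_integral_lborel_translation) measurable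
      then show "(\<integral>\<^sup>+y. f x * g (T y) \<partial>lborel) = (\<integral>\<^sup>+y. f x * g (T y - x) \<partial>lborel)"
        by (simp add: linear_add[OF lin] TTi)
    qed
    also have "\<dots> = (\<integral>\<^sup>+y. \<integral>\<^sup>+x. f x * g (T y - x) \<partial>lborel \<partial>lborel)"
      by (rule lborel_pair.Fubini'[symmetric]) measurable
    also have "\<dots> = (\<integral>\<^sup>+y. \<integral>\<^sup>+x. f (x + T y) * g x \<partial>lborel \<partial>lborel)"
    proof (rule nn_integral_cong)
      fix y
      have "(\<integral>\<^sup>+x. f (x + T y) * g (T y - (x + T y)) \<partial>lborel) = (\<integral>\<^sup>+x. f x * g (T y - x) \<partial>lborel)"
        by (rule nn_integral_lborel_translation) measurable
      then show "(\<integral>\<^sup>+x. f x * g (T y - x) \<partial>lborel) = (\<integral>\<^sup>+x. f (x + T y) * g x \<partial>lborel)"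
        by (simp add: g_symm)
    qed
    also have "\<dots> = (\<integral>\<^sup>+x. \<integral>\<^sup>+y. f (x + T y) * g x \<partial>lborel \<partial>lborel)"
      by (rule lborel_pair.Fubini') measurable
    also have "\<dots> = (\<integral>\<^sup>+x. (\<integral>\<^sup>+y. f (T y) \<partial>lborel) * g x \<partial>lborel)"
    proof (rule nn_integral_cong)
      fix x
      have "(\<integral>\<^sup>+y. f (T (y + Ti x)) * g x \<partial>lborel) = (\<integral>\<^sup>+y. f (T y) * g x \<partial>lborel)"
        by (rule nn_integral_lborel_translation) measurable
      then show "(\<integral>\<^sup>+y. f (x + T y) * g x \<partial>lborel) = (\<integral>\<^sup>+y. f (T y) \<partial>lborel) * g x"
        by (simp add: linear_add[OF lin] TTi nn_integral_multc add.commute)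
    qed
    also have "\<dots> = (\<integral>\<^sup>+y. f (T y) \<partial>lborel) * (\<integral>\<^sup>+x. g x \<partial>lborel)"
      by (simp add: nn_integral_cmult)
    finally show ?thesis
      unfolding gball pos
      by (metis (no_types, lifting) ennreal_mult_cancel_left ennreal_neq_top ennreal_eq_0_iff
          mult.commute not_less of_nat_0_le_iff unit_ball_vol_pos)
  qed
  show ?thesis
  proof (rule measure_eqI)
    fix A assume "A \<in> sets (distr lborel borel T)"
    then have [measurable]: "A \<in> sets borel" by simp
    have "emeasure (distr lborel borel T) A = (\<integral>\<^sup>+x. indicator A x \<partial>distr lborel borel T)"
      by simp
    also have "\<dots> = (\<integral>\<^sup>+y. indicator A (T y) \<partial>lborel)"
      by (subst nn_integral_distr) auto
    also have "\<dots> = (\<integral>\<^sup>+x. indicator A x \<partial>lborel)"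
      by (rule key[symmetric]) measurable
    finally show "emeasure (distr lborel borel T) A = emeasure lborel A" by simp
  qed simp
qed

lemma integral_lborel_isometry:
  fixes T :: "'a::euclidean_space \<Rightarrow> 'b::euclidean_space"
    and f :: "'b \<Rightarrow> 'c::{banach,second_countable_topology}"
  assumes "linear T" "\<And>x. norm (T x) = norm x" "DIM('a) = DIM('b)"
    and f: "f \<in> borel_measurable borel"
  shows "(\<integral>x. f (T x) \<partial>lborel) = (\<integral>x. f x \<partial>lborel)"
    and "integrable lborel (\<lambda>x. f (T x)) \<longleftrightarrow> integrable lborel f"
proof -
  note D = lborel_distr_isometry[OF assms(1-3)]
  have [measurable]: "T \<in> borel_measurable borel"
    using assms(1) by (intro borel_measurable_continuous_onI)
      (simp add: linear_continuous_on linear_conv_bounded_linear)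
  show "(\<integral>x. f (T x) \<partial>lborel) = (\<integral>x. f x \<partial>lborel)"
    by (subst D[symmetric], subst integral_distr) (use f in auto)
  show "integrable lborel (\<lambda>x. f (T x)) \<longleftrightarrow> integrable lborel f"
    using integrable_distr_eq[of T lborel borel f] f by (simp add: D)
qed

lemma integrable_dominated:
  fixes f :: "'a \<Rightarrow> 'b::{banach,second_countable_topology}" and g :: "'a \<Rightarrow> real"
  assumes "integrable M g" "f \<in> borel_measurable M" "\<And>x. x \<in> space M \<Longrightarrow> norm (f x) \<le> g x"
  shows "integrable M f"
  by (rule Bochner_Integration.integrable_bound[OF assms(1,2)])
     (use assms(3) in \<open>auto intro!: AE_I2 intro: order_trans[OF _ abs_ge_self]\<close>)

lemma norm_integral_le:
  fixes f :: "'a \<Rightarrow> 'b::{banach,second_countable_topology}" and g :: "'a \<Rightarrow> real"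
  assumes "integrable M f" "integrable M g" "\<And>x. x \<in> space M \<Longrightarrow> norm (f x) \<le> g x"
  shows "norm (\<integral>x. f x \<partial>M) \<le> (\<integral>x. g x \<partial>M)"
  by (rule order_trans[OF integral_norm_bound integral_mono]) (use assms in auto)

text \<open>Dominated convergence along an enumeration of the index set.\<close>

lemma has_sum_integral_dominated:
  fixes f :: "'i \<Rightarrow> 'a \<Rightarrow> 'b::{banach,second_countable_topology}"
  assumes I: "countable I"
    and meas: "\<And>i. i \<in> I \<Longrightarrow> f i \<in> borel_measurable M"
    and bound: "\<And>x J. x \<in> space M \<Longrightarrow> finite J \<Longrightarrow> J \<subseteq> I \<Longrightarrow> (\<Sum>i\<in>J. norm (f i x)) \<le> G x"
    and G: "integrable M G"
    and sums: "\<And>x. x \<in> space M \<Longrightarrow> ((\<lambda>i. f i x) has_sum g x) I"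
  shows "(\<lambda>i. norm (\<integral>x. f i x \<partial>M)) summable_on I"
    and "((\<lambda>i. \<integral>x. f i x \<partial>M) has_sum (\<integral>x. g x \<partial>M)) I"
proof -
  have int: "integrable M (f i)" if "i \<in> I" for i
    by (rule integrable_dominated[OF G meas[OF that]]) (use bound[of _ "{i}"] that in auto)
  have fin: "(\<Sum>i\<in>J. \<integral>x. norm (f i x) \<partial>M) \<le> (\<integral>x. G x \<partial>M)" if "finite J" "J \<subseteq> I" for J
  proof -
    have "(\<Sum>i\<in>J. \<integral>x. norm (f i x) \<partial>M) = (\<integral>x. (\<Sum>i\<in>J. norm (f i x)) \<partial>M)"
      using that int by (subst Bochner_Integration.integral_sum) auto
    also have "\<dots> \<le> (\<integral>x. G x \<partial>M)"
      using that int bound by (intro integral_mono G Bochner_Integration.integrable_sum) auto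
    finally show ?thesis .
  qed
  show abs: "(\<lambda>i. norm (\<integral>x. f i x \<partial>M)) summable_on I"
  proof (rule nonneg_bdd_above_summable_on)
    show "bdd_above (sum (\<lambda>i. norm (\<integral>x. f i x \<partial>M)) ` {F. F \<subseteq> I \<and> finite F})"
    proof (rule bdd_aboveI2[where M="\<integral>x. G x \<partial>M"])
      fix J assume J: "J \<in> {F. F \<subseteq> I \<and> finite F}"
      have "(\<Sum>i\<in>J. norm (\<integral>x. f i x \<partial>M)) \<le> (\<Sum>i\<in>J. \<integral>x. norm (f i x) \<partial>M)"
        by (intro sum_mono integral_norm_bound)
      also have "\<dots> \<le> (\<integral>x. G x \<partial>M)" using J by (intro fin) auto
      finally show "(\<Sum>i\<in>J. norm (\<integral>x. f i x \<partial>M)) \<le> (\<integral>x. G x \<partial>M)" .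
    qed
  qed simp
  show "((\<lambda>i. \<integral>x. f i x \<partial>M) has_sum (\<integral>x. g x \<partial>M)) I"
  proof (cases "finite I")
    case True
    have "(\<integral>x. g x \<partial>M) = (\<integral>x. (\<Sum>i\<in>I. f i x) \<partial>M)"
      using sums True by (intro Bochner_Integration.integral_cong) (auto simp: has_sum_finite_iff)
    also have "\<dots> = (\<Sum>i\<in>I. \<integral>x. f i x \<partial>M)"
      by (rule Bochner_Integration.integral_sum[OF int])
    finally show ?thesis using True by (simp add: has_sum_finite_iff)
  next
    case False
    define e where "e = from_nat_into I"
    have e: "bij_betw e UNIV I" unfolding e_def by (rule bij_betw_from_nat_into[OF I False])
    have eI: "e n \<in> I" for n using e by (auto simp: bij_betw_def)
    have g: "(\<lambda>n. f (e n) x) sums g x" if "x \<in> space M" for x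
      using sums[OF that] has_sum_reindex_bij_betw[OF e, of "\<lambda>i. f i x"] has_sum_imp_sums by blast
    have gM: "g \<in> borel_measurable M"
      by (rule borel_measurable_LIMSEQ_metric[of "\<lambda>n x. \<Sum>k<n. f (e k) x"])
         (use g meas eI in \<open>auto simp: sums_def\<close>)
    have "(\<lambda>n. \<integral>x. (\<Sum>k<n. f (e k) x) \<partial>M) \<longlonglongrightarrow> (\<integral>x. g x \<partial>M)"
    proof (rule integral_dominated_convergence[where w=G])
      fix n
      show "AE x in M. norm (\<Sum>k<n. f (e k) x) \<le> G x"
      proof (rule AE_I2)
        fix x assume x: "x \<in> space M"
        have "norm (\<Sum>k<n. f (e k) x) \<le> (\<Sum>k<n. norm (f (e k) x))" by (rule norm_sum)
        also have "\<dots> = (\<Sum>i\<in>e ` {..<n}. norm (f i x))"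
          using e by (subst sum.reindex) (auto simp: bij_betw_def inj_on_def)
        also have "\<dots> \<le> G x" using eI by (intro bound x) auto
        finally show "norm (\<Sum>k<n. f (e k) x) \<le> G x" .
      qed
    qed (use g meas eI gM G in \<open>auto simp: sums_def\<close>)
    then have 1: "(\<lambda>n. \<integral>x. f (e n) x \<partial>M) sums (\<integral>x. g x \<partial>M)"
      unfolding sums_def using eI int by (subst (asm) Bochner_Integration.integral_sum) auto
    obtain s where s: "((\<lambda>i. \<integral>x. f i x \<partial>M) has_sum s) I"
      using abs_summable_summable[OF abs] by (auto simp: summable_on_def)
    then have "(\<lambda>n. \<integral>x. f (e n) x \<partial>M) sums s"
      using has_sum_reindex_bij_betw[OF e, of "\<lambda>i. \<integral>x. f i x \<partial>M"] has_sum_imp_sums by blast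
    with 1 s show ?thesis using sums_unique2 by blast
  qed
qed

lemma Basis_real_vec: "(Basis :: (real^'d) set) = range (\<lambda>j. axis j 1)"
  by (auto simp: Basis_vec_def)

lemma integral_lborel_prod_vec:
  fixes f :: "'d::finite \<Rightarrow> real \<Rightarrow> complex"
  assumes f: "\<And>j. integrable lborel (f j)"
  shows "integrable lborel (\<lambda>x::real^'d. \<Prod>j\<in>UNIV. f j (x $ j))" (is ?A)
    and "(\<integral>x. (\<Prod>j\<in>UNIV. f j (x $ j)) \<partial>(lborel :: (real^'d) measure)) = (\<Prod>j\<in>UNIV. \<integral>t. f j t \<partial>lborel)" (is ?B)
proof -
  interpret product_sigma_finite "\<lambda>_::real^'d. lborel :: real measure"
    by (intro product_sigma_finite.intro sigma_finite_lborel)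
  define ax where "ax = (\<lambda>j::'d. axis j (1::real))"
  have inj: "inj ax" by (auto simp: ax_def inj_def axis_eq_axis)
  define F where "F b = f (inv ax b)" for b
  define E where "E = (\<lambda>g::real^'d \<Rightarrow> real. \<Sum>b\<in>Basis. g b *\<^sub>R b)"
  have B: "(Basis :: (real^'d) set) = range ax" by (simp add: Basis_real_vec ax_def)
  have nth: "E g $ j = g (ax j)" for g j
  proof -
    have "E g $ j = (\<Sum>k\<in>UNIV. (g (ax k) *\<^sub>R ax k) $ j)"
      unfolding E_def B by (subst sum.reindex[OF inj]) (simp add: sum_component)
    also have "\<dots> = (\<Sum>k\<in>UNIV. if k = j then g (ax k) else 0)"
      by (intro sum.cong) (auto simp: ax_def axis_def)
    finally show ?thesis by simp
  qed
  have eq: "(\<Prod>j\<in>UNIV. f j (E g $ j)) = (\<Prod>b\<in>Basis. F b (g b))" for g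
    unfolding B by (subst prod.reindex[OF inj]) (simp add: nth F_def inv_f_f[OF inj])
  have Em[measurable]: "E \<in> (\<Pi>\<^sub>M b\<in>Basis. lborel) \<rightarrow>\<^sub>M borel"
    unfolding E_def by measurable
  have [measurable]: "f j \<in> borel_measurable borel" for j
    using borel_measurable_integrable[OF f[of j]] by simp
  have [measurable]: "(\<lambda>x::real^'d. x $ j) \<in> borel_measurable borel" for j
    by (intro borel_measurable_continuous_onI continuous_intros)
  have M: "(\<lambda>x::real^'d. \<Prod>j\<in>UNIV. f j (x $ j)) \<in> borel_measurable borel"
    by measurable
  have L: "(lborel :: (real^'d) measure) = distr (\<Pi>\<^sub>M b\<in>Basis. lborel) borel E"
    unfolding E_def by (rule lborel_eq)
  have Fi: "integrable lborel (F b)" for b using f by (simp add: F_def)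
  show ?A
    unfolding L by (subst integrable_distr_eq[OF Em M]) (simp add: eq product_integrable_prod Fi)
  have "(\<integral>x. (\<Prod>j\<in>UNIV. f j (x $ j)) \<partial>(lborel :: (real^'d) measure)) = (\<integral>g. (\<Prod>b\<in>Basis. F b (g b)) \<partial>(\<Pi>\<^sub>M b\<in>Basis. lborel))"
    unfolding L by (subst integral_distr[OF Em M]) (simp add: eq)
  also have "\<dots> = (\<Prod>b\<in>Basis. \<integral>t. F b t \<partial>lborel)"
    by (intro product_integral_prod Fi) simp
  also have "\<dots> = (\<Prod>j\<in>UNIV. \<integral>t. f j t \<partial>lborel)"
    unfolding B by (subst prod.reindex[OF inj]) (simp add: F_def inv_f_f[OF inj])
  finally show ?B .
qed

text \<open>Completing the square for the real part of \<open>\<zeta>\<close> reduces this to the characteristic function of the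
  normal distribution.\<close>

lemma complex_gaussian_integral_1:
  fixes \<zeta> :: complex
  assumes c: "c > 0"
  shows "integrable lborel (\<lambda>x::real. exp (of_real (- pi * c * x\<^sup>2) + of_real (2 * pi * x) * \<zeta>))" (is ?A)
    and "(\<integral>x. exp (of_real (- pi * c * x\<^sup>2) + of_real (2 * pi * x) * \<zeta>) \<partial>(lborel :: real measure))
      = exp (pi * \<zeta>\<^sup>2 / c) / sqrt c" (is ?B)
proof -
  define s where "s = sqrt (2 * pi * c)"
  define a b where "a = Re \<zeta>" and "b = Im \<zeta>"
  have s: "s > 0" "s\<^sup>2 = 2 * pi * c" using c by (auto simp: s_def)
  define t where "t = 2 * pi * b / s"
  define \<phi> where "\<phi> = (\<lambda>x. std_normal_density x *\<^sub>R iexp (t * x))"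
  let ?f = "\<lambda>x::real. exp (of_real (- pi * c * x\<^sup>2) + of_real (2 * pi * x) * \<zeta>)"
  have z: "\<zeta> = a + \<i> * b" by (simp add: a_def b_def complex_eq)
  have int\<phi>: "integrable lborel \<phi>"
    unfolding \<phi>_def
    by (rule integrable_dominated[of lborel std_normal_density])
       (auto simp: norm_exp_eq_Re integrable_normal_density)
  have char: "(\<integral>x. \<phi> x \<partial>lborel) = exp (- t\<^sup>2 / 2)"
  proof -
    have "exp (- t\<^sup>2 / 2) = (\<integral>x. iexp (t * x) \<partial>std_normal_distribution)"
      using fun_cong[OF char_std_normal_distribution, of t] by (simp add: char_def exp_of_real)
    also have "\<dots> = (\<integral>x. \<phi> x \<partial>lborel)"
      unfolding \<phi>_def by (subst integral_density) auto
    finally show ?thesis by simp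
  qed
  define K where "K = complex_of_real (1 / sqrt (2 * pi)) * exp (- pi * a\<^sup>2 / c - 2 * pi * \<i> * a * b / c)"
  have K0: "K \<noteq> 0" by (simp add: K_def)
  have sub: "\<phi> (- s * a / c + s * y) = K * ?f y" for y
  proof -
    have e1: "(- s * a / c + s * y)\<^sup>2 / 2 = pi * c * y\<^sup>2 - 2 * pi * a * y + pi * a\<^sup>2 / c"
    proof -
      have "(- s * a / c + s * y)\<^sup>2 / 2 = s\<^sup>2 * (y - a / c)\<^sup>2 / 2"
        by (simp add: power2_eq_square algebra_simps)
      also have "\<dots> = pi * c * (y - a / c)\<^sup>2" unfolding s(2) by simp
      also have "\<dots> = pi * c * y\<^sup>2 - 2 * pi * a * y + pi * a\<^sup>2 / c"
        using c by (simp add: power2_eq_square field_simps)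
      finally show ?thesis .
    qed
    have e2: "t * (- s * a / c + s * y) = 2 * pi * b * y - 2 * pi * a * b / c"
      using s(1) c by (simp add: t_def field_simps)
    have "\<phi> (- s * a / c + s * y) = (1 / sqrt (2 * pi)) *
       (exp (of_real (- (pi * c * y\<^sup>2 - 2 * pi * a * y + pi * a\<^sup>2 / c))) *
         exp (\<i> * of_real (2 * pi * b * y - 2 * pi * a * b / c)))"
    proof -
      have "std_normal_density (- s * a / c + s * y) = 1 / sqrt (2 * pi) *
          exp (- ((- s * a / c + s * y)\<^sup>2 / 2))"
        by (simp add: std_normal_density_def)
      then show ?thesis
        unfolding \<phi>_def e2 e1 by (simp add: scaleR_conv_of_real flip: exp_of_real)
    qed
    also have "\<dots> = (1 / sqrt (2 * pi)) * exp ((- pi * a\<^sup>2 / c - 2 * pi * \<i> * a * b / c) +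
         (of_real (- pi * c * y\<^sup>2) + of_real (2 * pi * y) * \<zeta>))"
      unfolding z by (simp add: algebra_simps flip: exp_add)
    also have "\<dots> = K * ?f y" unfolding K_def exp_add by simp
    finally show ?thesis .
  qed
  have "integrable lborel (\<lambda>y. \<phi> (- s * a / c + s * y))"
    using int\<phi> s by (intro lborel_integrable_real_affine) auto
  then have "integrable lborel (\<lambda>y. K * ?f y)" by (simp only: sub)
  from integrable_mult_right[OF this, of "inverse K"] show ?A
    using K0 by (simp add: mult.assoc[symmetric] del: of_real_power)
  have "exp (- t\<^sup>2 / 2) = \<bar>s\<bar> *\<^sub>R (\<integral>y. \<phi> (- s * a / c + s * y) \<partial>lborel)"
    unfolding char[symmetric] using s by (intro lborel_integral_real_affine) auto
  also have "\<dots> = s * (K * (\<integral>y. ?f y \<partial>lborel))"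
    using s by (simp only: sub integral_mult_right_zero) (simp add: scaleR_conv_of_real)
  finally have "(\<integral>y. ?f y \<partial>lborel) = exp (- t\<^sup>2 / 2) / (s * K)"
    using s K0 by (simp add: field_simps)
  also have "s * K = sqrt c * exp (- pi * a\<^sup>2 / c - 2 * pi * \<i> * a * b / c)"
    unfolding K_def s_def by (simp add: real_sqrt_mult)
  also have "- t\<^sup>2 / 2 = - pi * b\<^sup>2 / c"
    using s c by (simp add: t_def power_divide power_mult_distrib) (simp add: power2_eq_square)
  also have "complex_of_real (exp (- pi * b\<^sup>2 / c)) / (sqrt c * exp (- pi * a\<^sup>2 / c - 2 * pi * \<i> * a * b / c))
      = exp (of_real (- pi * b\<^sup>2 / c) - (- pi * a\<^sup>2 / c - 2 * pi * \<i> * a * b / c)) / sqrt c"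
    unfolding exp_diff exp_of_real by simp
  also have "of_real (- pi * b\<^sup>2 / c) - (- pi * a\<^sup>2 / c - 2 * pi * \<i> * a * b / c) = pi * \<zeta>\<^sup>2 / c"
    unfolding z using c by (simp add: field_simps power2_eq_square)
  finally show ?B by simp
qed

definition cvec :: "real^'d \<Rightarrow> complex^'d" where
  "cvec x = (\<chi> j. of_real (x $ j))"

lemma norm_vec_power2: "(norm (x :: 'a::real_normed_vector^'d))\<^sup>2 = (\<Sum>j\<in>UNIV. (norm (x $ j))\<^sup>2)"
  by (simp add: norm_vec_def L2_set_def sum_nonneg)

lemma complex_gaussian_integral:
  fixes \<zeta> :: "complex^'d"
  assumes c: "c > 0"
  shows "(\<integral>x. exp (of_real (- pi * c * (norm x)\<^sup>2) + 2 * pi * cdot (cvec x) \<zeta>) \<partial>(lborel :: (real^'d) measure))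
      = exp (pi * cdot \<zeta> \<zeta> / c) / (sqrt c) ^ CARD('d)"
proof -
  let ?f = "\<lambda>j t. exp (of_real (- pi * c * t\<^sup>2) + of_real (2 * pi * t) * \<zeta> $ j)"
  have eq: "exp (of_real (- pi * c * (norm x)\<^sup>2) + 2 * pi * cdot (cvec x) \<zeta>) = (\<Prod>j\<in>UNIV. ?f j (x $ j))"
    for x :: "real^'d"
  proof -
    have "of_real (- pi * c * (norm x)\<^sup>2) + 2 * pi * cdot (cvec x) \<zeta>
        = (\<Sum>j\<in>UNIV. of_real (- pi * c * (x $ j)\<^sup>2) + of_real (2 * pi * x $ j) * \<zeta> $ j)"
      by (simp add: norm_vec_power2 cdot_def cvec_def sum_distrib_left sum_subtractf sum_negf mult.assoc)
    then show ?thesis by (simp add: exp_sum)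
  qed
  have "(\<integral>x. exp (of_real (- pi * c * (norm x)\<^sup>2) + 2 * pi * cdot (cvec x) \<zeta>) \<partial>(lborel :: (real^'d) measure))
      = (\<Prod>j\<in>UNIV. \<integral>t. ?f j t \<partial>lborel)"
    unfolding eq by (rule integral_lborel_prod_vec(2)) (rule complex_gaussian_integral_1(1)[OF c])
  also have "\<dots> = (\<Prod>j\<in>UNIV. exp (pi * (\<zeta> $ j)\<^sup>2 / c) / sqrt c)"
    by (simp only: complex_gaussian_integral_1(2)[OF c])
  also have "\<dots> = exp (pi * cdot \<zeta> \<zeta> / c) / (sqrt c) ^ CARD('d)"
    by (simp add: prod_dividef cdot_def sum_distrib_left sum_divide_distrib power2_eq_square flip: exp_sum)
  finally show ?thesis .
qed

lemma gaussian_integral: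
  assumes c: "c > 0"
  shows "integrable lborel (\<lambda>x::'a::euclidean_space. exp (- pi * c * (norm x)\<^sup>2))" (is ?A)
    and "(\<integral>x. exp (- pi * c * (norm (x::'a))\<^sup>2) \<partial>lborel) = (1 / sqrt c) ^ DIM('a)" (is ?B)
proof -
  have r: "integrable lborel (\<lambda>t::real. exp (- pi * c * t\<^sup>2))" "(\<integral>t. exp (- pi * c * t\<^sup>2) \<partial>(lborel::real measure)) = 1 / sqrt c"
  proof -
    have "integrable lborel (\<lambda>t::real. Re (exp (of_real (- pi * c * t\<^sup>2) + of_real (2 * pi * t) * 0)))"
      by (intro integrable_Re complex_gaussian_integral_1 c)
    then show "integrable lborel (\<lambda>t::real. exp (- pi * c * t\<^sup>2))" by (simp add: Re_exp)
    have "Re (\<integral>t. exp (of_real (- pi * c * t\<^sup>2) + of_real (2 * pi * t) * 0) \<partial>(lborel::real measure)) = 1 / sqrt c"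
      by (subst complex_gaussian_integral_1(2)[OF c]) simp
    also have "Re (\<integral>t. exp (of_real (- pi * c * t\<^sup>2) + of_real (2 * pi * t) * 0) \<partial>(lborel::real measure))
      = (\<integral>t. Re (exp (of_real (- pi * c * t\<^sup>2) + of_real (2 * pi * t) * 0)) \<partial>(lborel::real measure))"
      by (rule integral_Re[symmetric]) (rule complex_gaussian_integral_1(1)[OF c])
    finally show "(\<integral>t. exp (- pi * c * t\<^sup>2) \<partial>(lborel::real measure)) = 1 / sqrt c" by (simp add: Re_exp)
  qed
  have eq: "exp (- pi * c * (norm x)\<^sup>2) = (\<Prod>b\<in>Basis. exp (- pi * c * (x \<bullet> b)\<^sup>2))" for x :: 'a
  proof -
    have "(norm x)\<^sup>2 = (\<Sum>b\<in>Basis. (x \<bullet> b)\<^sup>2)"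
      unfolding power2_norm_eq_inner by (subst euclidean_inner) (simp add: power2_eq_square)
    then show ?thesis by (simp add: sum_distrib_left flip: exp_sum sum_negf)
  qed
  have "(\<integral>\<^sup>+x. ennreal (exp (- pi * c * (norm (x::'a))\<^sup>2)) \<partial>lborel)
      = (\<integral>\<^sup>+x. (\<Prod>b\<in>Basis. ennreal (exp (- pi * c * (x \<bullet> b)\<^sup>2))) \<partial>(lborel :: 'a measure))"
    unfolding eq by (simp add: prod_ennreal)
  also have "\<dots> = (\<Prod>b\<in>(Basis::'a set). \<integral>\<^sup>+t. ennreal (exp (- pi * c * t\<^sup>2)) \<partial>lborel)"
    by (rule nn_integral_lborel_prod) auto
  also have "\<dots> = (\<Prod>b\<in>(Basis::'a set). ennreal (1 / sqrt c))"
    using nn_integral_eq_integral[OF r(1)] r(2) by simp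
  also have "\<dots> = ennreal ((1 / sqrt c) ^ DIM('a))"
    using c by (simp add: ennreal_power)
  finally have nn: "(\<integral>\<^sup>+x. ennreal (exp (- pi * c * (norm (x::'a))\<^sup>2)) \<partial>lborel) = ennreal ((1 / sqrt c) ^ DIM('a))" .
  show ?A
    by (rule integrableI_nonneg) (use nn in auto)
  show ?B
    by (rule integral_eq_nn_integral[THEN trans]) (use c nn in auto)
qed

section \<open>The reproducing formula for entire functions\<close>

lemma entireE:
  assumes "entire F"
  obtains D where "(F has_derivative D) (at z)" "\<And>c v. D (c *s v) = c * D v"
  using assms unfolding entire_def by blast

lemma entireI:
  assumes "\<And>z. (F has_derivative D z) (at z)" "\<And>z c v. D z (c *s v) = c * D z v"
  shows "entire F"
  using assms unfolding entire_def by blast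

lemma entire_continuous: "entire F \<Longrightarrow> continuous_on A F"
  unfolding entire_def by (meson continuous_at_imp_continuous_on has_derivative_continuous)

lemma entire_measurable [measurable_dest]: "entire F \<Longrightarrow> F \<in> borel_measurable borel"
  by (intro borel_measurable_continuous_onI entire_continuous)

lemma entire_const: "entire (\<lambda>_. c)"
  by (rule entireI[where D="\<lambda>_ _. 0"]) auto

lemma entire_nth: "entire (\<lambda>z. z $ j)"
  by (rule entireI[where D="\<lambda>_ h. h $ j"])
     (auto intro: bounded_linear_imp_has_derivative bounded_linear_vec_nth)

lemma entire_add:
  assumes "entire F" "entire G"
  shows "entire (\<lambda>z. F z + G z)"
  unfolding entire_def
proof
  fix z
  obtain D E where "(F has_derivative D) (at z)" "\<And>c v. D (c *s v) = c * D v"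
    "(G has_derivative E) (at z)" "\<And>c v. E (c *s v) = c * E v"
    using assms entireE by metis
  then show "\<exists>D. ((\<lambda>z. F z + G z) has_derivative D) (at z) \<and> (\<forall>c v. D (c *s v) = c * D v)"
    by (intro exI[of _ "\<lambda>h. D h + E h"]) (auto intro!: has_derivative_add simp: algebra_simps)
qed

lemma entire_mult:
  assumes "entire F" "entire G"
  shows "entire (\<lambda>z. F z * G z)"
  unfolding entire_def
proof
  fix z
  obtain D E where "(F has_derivative D) (at z)" "\<And>c v. D (c *s v) = c * D v"
    "(G has_derivative E) (at z)" "\<And>c v. E (c *s v) = c * E v"
    using assms entireE by metis
  then show "\<exists>D. ((\<lambda>z. F z * G z) has_derivative D) (at z) \<and> (\<forall>c v. D (c *s v) = c * D v)"
    by (intro exI[of _ "\<lambda>h. F z * E h + D h * G z"])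
       (auto intro!: has_derivative_mult simp: distrib_left mult.assoc mult.left_commute)
qed

lemma entire_compose:
  assumes "g holomorphic_on UNIV" "entire F"
  shows "entire (\<lambda>z. g (F z))"
  unfolding entire_def
proof
  fix z
  obtain D where D: "(F has_derivative D) (at z)" "\<And>c v. D (c *s v) = c * D v"
    using assms entireE by metis
  have "(g has_field_derivative deriv g (F z)) (at (F z))"
    using assms(1) holomorphic_derivI open_UNIV by blast
  then have "(g has_derivative (*) (deriv g (F z))) (at (F z))"
    by (simp add: has_field_derivative_def)
  from has_derivative_compose[OF D(1) this]
  show "\<exists>D. ((\<lambda>z. g (F z)) has_derivative D) (at z) \<and> (\<forall>c v. D (c *s v) = c * D v)"
    by (intro exI[of _ "\<lambda>h. deriv g (F z) * D h"]) (auto simp: D(2) algebra_simps)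
qed

lemma entire_exp: "entire F \<Longrightarrow> entire (\<lambda>z. exp (F z))"
  using entire_compose[of exp F] by (simp add: holomorphic_on_exp)

lemma entire_sum:
  assumes "\<And>j. j \<in> J \<Longrightarrow> entire (F j)"
  shows "entire (\<lambda>z. \<Sum>j\<in>J. F j z)"
proof (cases "finite J")
  case True
  then show ?thesis using assms by (induction J) (auto intro: entire_const entire_add)
qed (simp add: entire_const)

lemma entire_prod:
  assumes "\<And>j. j \<in> J \<Longrightarrow> entire (F j)"
  shows "entire (\<lambda>z. \<Prod>j\<in>J. F j z)"
proof (cases "finite J")
  case True
  then show ?thesis using assms by (induction J) (auto intro: entire_const entire_mult)
qed (simp add: entire_const)

lemma entire_cdot: "entire (\<lambda>z. cdot w z)"
  unfolding cdot_def by (intro entire_sum entire_mult entire_const entire_nth)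

lemma entire_shift:
  assumes "entire F"
  shows "entire (\<lambda>z. F (z + w))"
  unfolding entire_def
proof
  fix z
  obtain D where D: "(F has_derivative D) (at (z + w))" "\<And>c v. D (c *s v) = c * D v"
    using assms entireE by metis
  have "((\<lambda>z. z + w) has_derivative (\<lambda>h. h)) (at z)" by (auto intro!: derivative_eq_intros)
  from has_derivative_compose[OF this D(1)]
  show "\<exists>D. ((\<lambda>z. F (z + w)) has_derivative D) (at z) \<and> (\<forall>c v. D (c *s v) = c * D v)"
    using D(2) by blast
qed

lemma entire_slice:
  assumes "entire F"
  shows "(\<lambda>\<zeta>. F (\<zeta> *s z)) holomorphic_on A"
proof -
  have "(\<lambda>\<zeta>. F (\<zeta> *s z)) field_differentiable at \<zeta>" for \<zeta>
  proof -
    obtain D where D: "(F has_derivative D) (at (\<zeta> *s z))" "\<And>c v. D (c *s v) = c * D v"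
      using assms entireE by metis
    have "((\<lambda>\<zeta>. \<zeta> *s z) has_derivative (\<lambda>h. h *s z)) (at \<zeta>)"
      by (intro bounded_linear_imp_has_derivative)
         (auto simp: linear_conv_bounded_linear[symmetric] vec_eq_iff algebra_simps intro!: linearI)
    from has_derivative_compose[OF this D(1)]
    have "((\<lambda>\<zeta>. F (\<zeta> *s z)) has_field_derivative D z) (at \<zeta>)"
      by (simp add: has_field_derivative_def D(2) mult.commute[of _ "D z"])
    then show ?thesis using field_differentiable_def by blast
  qed
  then show ?thesis
    by (simp add: field_differentiable_at_within holomorphic_on_def)
qed

lemma cdot_add_left: "cdot (z + w) v = cdot z v + cdot w v"
  and cdot_add_right: "cdot v (z + w) = cdot v z + cdot v w"
  and cdot_minus_left: "cdot (z - w) v = cdot z v - cdot w v"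
  and cdot_minus_right: "cdot v (z - w) = cdot v z - cdot v w"
  and cdot_commute: "cdot z w = cdot w z"
  by (simp_all add: cdot_def algebra_simps sum.distrib sum_subtractf)

lemma cnj_vec_add: "cnj_vec (z + w) = cnj_vec z + cnj_vec w"
  and cnj_vec_minus: "cnj_vec (z - w) = cnj_vec z - cnj_vec w"
  and cnj_cdot: "cnj (cdot z w) = cdot (cnj_vec z) (cnj_vec w)"
  and cnj_vec_cnj_vec [simp]: "cnj_vec (cnj_vec z) = z"
  and cnj_vec_nth [simp]: "cnj_vec z $ j = cnj (z $ j)"
  and norm_cnj_vec [simp]: "norm (cnj_vec z) = norm z"
  by (simp_all add: cnj_vec_def vec_eq_iff cdot_def norm_vec_def L2_set_def)

lemma cdot_cnj_self: "cdot (cnj_vec z) z = of_real ((norm z)\<^sup>2)"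
  by (simp only: cdot_def cnj_vec_nth norm_vec_power2 of_real_sum complex_norm_square mult.commute)

lemma norm_diff_power2_cdot:
  "(norm (z - w))\<^sup>2 = (norm z)\<^sup>2 + (norm w)\<^sup>2 - 2 * Re (cdot (cnj_vec z) w)"
proof -
  have "complex_of_real ((norm (z - w))\<^sup>2) = cdot (cnj_vec (z - w)) (z - w)"
    by (simp only: cdot_cnj_self)
  also have "\<dots> = of_real ((norm z)\<^sup>2) + of_real ((norm w)\<^sup>2) - (cdot (cnj_vec z) w + cnj (cdot (cnj_vec z) w))"
    unfolding cdot_cnj_self[symmetric]
    by (simp add: cnj_vec_minus cdot_minus_left cdot_minus_right cnj_cdot)
       (metis cdot_commute)
  also have "\<dots> = of_real ((norm z)\<^sup>2 + (norm w)\<^sup>2 - 2 * Re (cdot (cnj_vec z) w))"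
    by (simp add: complex_add_cnj)
  finally show ?thesis by (simp only: of_real_eq_iff)
qed

lemma continuous_on_cnj_vec [continuous_intros]:
  "continuous_on A f \<Longrightarrow> continuous_on A (\<lambda>x. cnj_vec (f x))"
  unfolding cnj_vec_def by (intro continuous_intros)

lemma continuous_on_cdot [continuous_intros]:
  "continuous_on A f \<Longrightarrow> continuous_on A g \<Longrightarrow> continuous_on A (\<lambda>x. cdot (f x) (g x))"
  unfolding cdot_def by (intro continuous_intros)

lemma circle_mean_value:
  assumes "f holomorphic_on UNIV"
  shows "((\<lambda>t. f (exp (2 * pi * \<i> * of_real t))) has_integral f 0) {0..1}"
proof -
  have "((\<lambda>u. f u / (u - 0)) has_contour_integral (2 * of_real pi * \<i> * f 0)) (circlepath 0 1)"
    by (rule Cauchy_integral_circlepath) (use assms in \<open>auto intro: holomorphic_on_subset holomorphic_on_imp_continuous_on\<close>)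
  then have "((\<lambda>t. (2 * of_real pi * \<i>) * f (exp (2 * of_real pi * \<i> * of_real t))) has_integral
      (2 * of_real pi * \<i>) * f 0) {0..1}"
    unfolding has_contour_integral_def
    by (rule has_integral_eq[rotated])
       (simp add: vector_derivative_circlepath01, simp add: circlepath)
  then have "((\<lambda>t. inverse (2 * of_real pi * \<i>) * ((2 * of_real pi * \<i>) * f (exp (2 * of_real pi * \<i> * of_real t)))) has_integral
      inverse (2 * of_real pi * \<i>) * ((2 * of_real pi * \<i>) * f 0)) {0..1}"
    by (rule has_integral_mult_right)
  then show ?thesis by (simp add: field_simps)
qed

text \<open>Lebesgue measure and \<open>|z|\<close> are invariant under \<open>z \<mapsto> exp(i t) z\<close>, so the integral of \<open>F\<close> against the
  Gaussian equals that of the circular means of \<open>F\<close>, and these are constant by the one-variable Cauchy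
  formula on complex lines.\<close>

lemma entire_gaussian_mean:
  fixes F :: "complex^'d \<Rightarrow> complex"
  assumes F: "entire F" and int: "integrable lborel (\<lambda>z. F z * of_real (exp (- pi * (norm z)\<^sup>2)))"
  shows "(\<integral>z. F z * of_real (exp (- pi * (norm z)\<^sup>2)) \<partial>lborel) = F 0"
proof -
  define G where "G z = F z * of_real (exp (- pi * (norm z)\<^sup>2))" for z
  define R where "R t z = exp (2 * pi * \<i> * of_real t) *s z" for t :: real and z :: "complex^'d"
  have normR: "norm (R t z) = norm z" for t z
    by (simp add: R_def norm_vec_def norm_mult)
  have GR: "G (R t z) = F (R t z) * of_real (exp (- pi * (norm z)\<^sup>2))" for t z
    by (simp add: G_def normR)
  have linR: "linear (R t)" for t
    by (rule linearI) (auto simp: R_def vec_eq_iff algebra_simps)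
  have contR: "continuous_on UNIV (\<lambda>p. R (fst p) (snd p))"
    unfolding R_def vector_scalar_mult_def by (intro continuous_intros)
  have contG: "continuous_on UNIV G"
    unfolding G_def by (intro continuous_intros entire_continuous F)
  have [measurable]: "G \<in> borel_measurable borel"
    using contG by (rule borel_measurable_continuous_onI)
  have contGR: "continuous_on UNIV (\<lambda>p. G (R (fst p) (snd p)))"
    using continuous_on_compose2[OF contG contR] by simp
  have [measurable]: "(\<lambda>p. G (R (fst p) (snd p))) \<in> borel_measurable (borel \<Otimes>\<^sub>M borel)"
    unfolding borel_prod using contGR by (rule borel_measurable_continuous_onI)
  have rot: "(\<integral>z. g (R t z) \<partial>lborel) = (\<integral>z. g z \<partial>lborel)" "integrable lborel (\<lambda>z. g (R t z)) \<longleftrightarrow> integrable lborel g"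
    if "g \<in> borel_measurable borel" for t and g :: "complex^'d \<Rightarrow> 'x::{banach,second_countable_topology}"
    using integral_lborel_isometry[OF linR normR refl that] by auto
  have intG: "integrable lborel G" using int by (simp add: G_def[abs_def])
  define H where "H = (\<lambda>(t, z). indicator {0..1} t *\<^sub>R G (R t z))"
  have [measurable]: "H \<in> borel_measurable (borel \<Otimes>\<^sub>M borel)"
    unfolding H_def by measurable
  have HM: "H \<in> borel_measurable (lborel \<Otimes>\<^sub>M lborel)" by simp
  have intH: "integrable (lborel \<Otimes>\<^sub>M lborel) H"
  proof (rule lborel_pair.Fubini_integrable[OF HM])
    have "(\<integral>z. norm (H (t, z)) \<partial>lborel) = indicator {0..1} t *\<^sub>R (\<integral>z. norm (G z) \<partial>lborel)" for t
      using rot(1)[of "\<lambda>z. norm (G z)" t] by (simp add: H_def)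
    then show "integrable lborel (\<lambda>t. \<integral>z. norm (H (t, z)) \<partial>lborel)"
      by (simp add: integrable_real_indicator)
    show "AE t in lborel. integrable lborel (\<lambda>z. H (t, z))"
      using rot(2)[of G] intG by (simp add: H_def)
  qed
  have "(\<integral>z. \<integral>t. H (t, z) \<partial>lborel \<partial>lborel) = (\<integral>t. \<integral>z. H (t, z) \<partial>lborel \<partial>lborel)"
    using lborel_pair.Fubini_integral[of "\<lambda>t z. H (t, z)"] intH by simp
  also have "\<dots> = (\<integral>z. G z \<partial>lborel)"
    using rot(1)[of G] by (simp add: H_def)
  also have "(\<lambda>z. \<integral>t. H (t, z) \<partial>lborel) = (\<lambda>z. F 0 * of_real (exp (- pi * (norm z)\<^sup>2)))"
  proof
    fix z
    have c: "continuous_on {0..1} (\<lambda>t. F (R t z))"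
      unfolding R_def vector_scalar_mult_def
      by (intro continuous_on_compose2[OF entire_continuous[OF F, of UNIV]] continuous_intros) auto
    have hi: "((\<lambda>t. F (R t z)) has_integral F 0) {0..1}"
      using circle_mean_value[OF entire_slice[OF F, of z]] by (simp add: R_def)
    have si: "set_integrable lborel {0..1} (\<lambda>t. F (R t z))"
      unfolding set_integrable_def using borel_integrable_compact[OF _ c] by (simp add: scaleR_conv_of_real indicator_def if_distrib cong: if_cong)
    have "(\<integral>t. H (t, z) \<partial>lborel) = (\<integral>t. (indicator {0..1} t *\<^sub>R F (R t z)) * of_real (exp (- pi * (norm z)\<^sup>2)) \<partial>lborel)"
      by (simp add: H_def GR)
    also have "\<dots> = (LINT t:{0..1}|lborel. F (R t z)) * of_real (exp (- pi * (norm z)\<^sup>2))"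
      unfolding set_lebesgue_integral_def by (rule integral_mult_left_zero)
    also have "(LINT t:{0..1}|lborel. F (R t z)) = F 0"
      using set_borel_integral_eq_integral(2)[OF si] hi by (simp add: integral_unique)
    finally show "(\<integral>t. H (t, z) \<partial>lborel) = F 0 * of_real (exp (- pi * (norm z)\<^sup>2))" .
  qed
  also have "(\<integral>z. F 0 * of_real (exp (- pi * (norm (z::complex^'d))\<^sup>2)) \<partial>lborel) = F 0"
    using gaussian_integral(2)[of 1, where 'a="complex^'d"]
    by (subst integral_mult_right_zero, subst integral_complex_of_real) simp
  finally show ?thesis by (simp add: G_def)
qed

lemma exp_minus_of_real:
  "exp (a - of_real p * of_real x) = exp a * complex_of_real (exp (- p * x))"
proof -
  have "exp (a - of_real p * of_real x) = exp a * exp (complex_of_real (- p * x))"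
    by (simp add: exp_diff exp_minus divide_inverse)
  then show ?thesis by (simp only: exp_of_real)
qed

definition gauss_kernel :: "complex^'d \<Rightarrow> complex^'d \<Rightarrow> complex" where
  "gauss_kernel w z = exp (pi * cdot (cnj_vec z) w) * of_real (exp (- pi * (norm z)\<^sup>2))"

text \<open>Translation by \<open>w\<close> and multiplication by \<open>exp (- \<pi> w\<^sup>* z)\<close> (with \<open>w\<^sup>*\<close> the conjugate of \<open>w\<close>) turn
  \<open>gauss_kernel w\<close> into the Gaussian centred at \<open>0\<close>, where the mean value formula applies.\<close>

theorem fock_reproducing:
  fixes F :: "complex^'d \<Rightarrow> complex"
  assumes F: "entire F" and int: "integrable lborel (\<lambda>z. F z * gauss_kernel w z)"
  shows "(\<integral>z. F z * gauss_kernel w z \<partial>lborel) = F w"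
proof -
  define F' where "F' z = F (z + w) * exp (- pi * cdot (cnj_vec w) z)" for z
  have "entire (\<lambda>z. exp (complex_of_real (- pi) * cdot (cnj_vec w) z))"
    by (intro entire_exp entire_mult entire_const entire_cdot)
  then have F': "entire F'" unfolding F'_def
    by (intro entire_mult entire_shift F) simp
  have eq: "F' z * of_real (exp (- pi * (norm z)\<^sup>2)) = F (z + w) * gauss_kernel w (z + w)" for z
  proof -
    have "gauss_kernel w (z + w) = exp (pi * cdot (cnj_vec (z + w)) w - pi * cdot (cnj_vec (z + w)) (z + w))"
      by (simp only: gauss_kernel_def cdot_cnj_self exp_minus_of_real)
    also have "\<dots> = exp (- pi * cdot (cnj_vec w) z - pi * cdot (cnj_vec z) z)"
      by (simp add: cnj_vec_add cdot_add_left cdot_add_right algebra_simps)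
    also have "\<dots> = exp (- pi * cdot (cnj_vec w) z) * of_real (exp (- pi * (norm z)\<^sup>2))"
      by (simp only: cdot_cnj_self exp_minus_of_real)
    finally show ?thesis by (simp add: F'_def)
  qed
  have m: "(\<lambda>z. F z * gauss_kernel w z) \<in> borel_measurable borel"
    using int by simp
  have "(\<integral>z. F z * gauss_kernel w z \<partial>lborel) = (\<integral>z. F' z * of_real (exp (- pi * (norm z)\<^sup>2)) \<partial>lborel)"
    unfolding eq by (rule integral_lborel_translation(1)[OF m, symmetric])
  also have "\<dots> = F' 0"
    using int integral_lborel_translation(2)[OF m, of w]
    by (intro entire_gaussian_mean F') (simp only: eq)
  finally show ?thesis by (simp add: F'_def cdot_def)
qed

text \<open>The complex line is isometric to \<open>complex^1\<close>.\<close>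

theorem fock_reproducing_1:
  fixes F :: "complex \<Rightarrow> complex"
  assumes F: "F holomorphic_on UNIV"
    and int: "integrable lborel (\<lambda>z. F z * (exp (pi * cnj z * w) * of_real (exp (- pi * (cmod z)\<^sup>2))))"
  shows "(\<integral>z. F z * (exp (pi * cnj z * w) * of_real (exp (- pi * (cmod z)\<^sup>2))) \<partial>lborel) = F w"
proof -
  define T where "T = (\<lambda>z::complex^1. z $ 1)"
  have T: "linear T" "norm (T z) = norm z" for z
    by (auto simp: T_def linearI norm_vec_def)
  have D: "DIM(complex^1) = DIM(complex)" by simp
  let ?f = "\<lambda>z. F z * (exp (pi * cnj z * w) * of_real (exp (- pi * (cmod z)\<^sup>2)))"
  have m: "?f \<in> borel_measurable borel" using int by simp
  have eq: "?f (T z) = F (T z) * gauss_kernel (\<chi> i. w) z" for z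
    by (simp add: T_def gauss_kernel_def cdot_def norm_vec_def mult.assoc)
  have e: "entire (\<lambda>z. F (T z))"
    unfolding T_def by (rule entire_compose[OF F entire_nth])
  have "integrable lborel (\<lambda>z. ?f (T z))"
    using integral_lborel_isometry(2)[OF T D m] int by simp
  then have "(\<integral>z. F (T z) * gauss_kernel (\<chi> i. w) z \<partial>lborel) = F (T (\<chi> i. w))"
    unfolding eq by (rule fock_reproducing[OF e])
  then show ?thesis
    using integral_lborel_isometry(1)[OF T D m] unfolding eq by (simp add: T_def)
qed

section \<open>Triangular lattices\<close>

lemma gauss_int_image: "gauss_int = (\<lambda>(a, b). Complex (of_int a) (of_int b)) ` (UNIV :: (int \<times> int) set)"
  unfolding gauss_int_def by (auto simp: complex_eq_iff image_iff)

lemma inj_gauss_int: "inj (\<lambda>(a, b). Complex (of_int a) (of_int b))"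
  by (auto simp: inj_def)

lemma countable_gauss_int: "countable gauss_int"
  unfolding gauss_int_image by simp

lemma mem_gauss_int_iff: "z \<in> gauss_int \<longleftrightarrow> Re z \<in> \<int> \<and> Im z \<in> \<int>"
  by (auto simp: gauss_int_image image_iff complex_eq_iff elim!: Ints_cases)

lemma gauss_int_closed [simp]:
  "a \<in> gauss_int \<Longrightarrow> b \<in> gauss_int \<Longrightarrow> a + b \<in> gauss_int"
  "a \<in> gauss_int \<Longrightarrow> b \<in> gauss_int \<Longrightarrow> a - b \<in> gauss_int"
  by (auto simp: mem_gauss_int_iff)

locale triangular_lattice =
  fixes S :: "complex ^ ('d :: {finite, linorder}) ^ ('d :: {finite, linorder})"
    and gam :: "'d \<Rightarrow> real"
  assumes upper: "upper_triangular S"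
    and diag: "S $ j $ j = of_real (gam j)"
    and pos: "gam j > 0"
    and le1: "gam j \<le> 1"
begin

text \<open>Coefficient vectors supported in \<open>A\<close>.  Statements about the lattice are proved by induction on \<open>A\<close>, adding
  smaller and smaller indices, because the coordinate \<open>j\<close> of \<open>S k\<close> involves only the entries of \<open>k\<close> at
  indices \<open>\<ge> j\<close>.\<close>

definition coeffs :: "'d set \<Rightarrow> (complex, 'd) vec set" where
  "coeffs A = {k. (\<forall>j\<in>A. k $ j \<in> gauss_int) \<and> (\<forall>j. j \<notin> A \<longrightarrow> k $ j = 0)}"

lemma upper_zero: "j < i \<Longrightarrow> S $ i $ j = 0"
  using upper by (simp add: upper_triangular_def)

lemma matrix_lattice_coeffs: "matrix_lattice S = (*v) S ` coeffs UNIV"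
  by (auto simp: matrix_lattice_def coeffs_def)

lemma mult_add_axis: "(S *v (k + axis b m)) $ j = (S *v k) $ j + S $ j $ b * m"
proof -
  have "(S *v axis b m) $ j = S $ j $ b * m"
    by (simp add: matrix_vector_mult_def axis_def if_distrib cong: if_cong)
  then show ?thesis by (simp add: matrix_vector_right_distrib)
qed

text \<open>Changing the entry of \<open>k\<close> at a minimal new index \<open>b\<close> does not affect the entries of \<open>S k\<close> at larger
  indices.\<close>

lemma coeffs_insert:
  assumes "finite A" "\<forall>a\<in>A. b < a"
  shows "coeffs (insert b A) = (\<lambda>(k, m). k + axis b m) ` (coeffs A \<times> gauss_int)"
    and "inj_on (\<lambda>(k, m). k + axis b m) (coeffs A \<times> gauss_int)"
    and "\<And>k m j. j \<in> A \<Longrightarrow> (S *v (k + axis b m)) $ j = (S *v k) $ j"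
    and "\<And>k m. (S *v (k + axis b m)) $ b = of_real (gam b) * m + (S *v k) $ b"
proof -
  have b: "b \<notin> A" using assms(2) by auto
  show "coeffs (insert b A) = (\<lambda>(k, m). k + axis b m) ` (coeffs A \<times> gauss_int)"
  proof safe
    fix k assume k: "k \<in> coeffs (insert b A)"
    have "k = (\<lambda>(k, m). k + axis b m) (k - axis b (k $ b), k $ b)" by simp
    moreover have "(k - axis b (k $ b), k $ b) \<in> coeffs A \<times> gauss_int"
      using k b by (auto simp: coeffs_def axis_def)
    ultimately show "k \<in> (\<lambda>(k, m). k + axis b m) ` (coeffs A \<times> gauss_int)" by blast
  next
    fix k m assume "k \<in> coeffs A" "m \<in> gauss_int"
    then show "k + axis b m \<in> coeffs (insert b A)"
      using b by (auto simp: coeffs_def axis_def)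
  qed
  show "inj_on (\<lambda>(k, m). k + axis b m) (coeffs A \<times> gauss_int)"
  proof (rule inj_onI, clarify)
    fix k m k' m' assume k: "k \<in> coeffs A" "k' \<in> coeffs A" and eq: "k + axis b m = k' + axis b m'"
    have "(k + axis b m) $ b = (k' + axis b m') $ b" using eq by simp
    then have "m = m'" using k b by (simp add: coeffs_def)
    with eq show "k = k' \<and> m = m'" by simp
  qed
  show "(S *v (k + axis b m)) $ j = (S *v k) $ j" if "j \<in> A" for k m j
    using assms(2) that by (simp add: mult_add_axis upper_zero)
  show "(S *v (k + axis b m)) $ b = of_real (gam b) * m + (S *v k) $ b" for k m
    by (simp add: mult_add_axis diag)
qed

text \<open>At the largest index \<open>j\<close> of a nonzero entry of \<open>k\<close>, row \<open>j\<close> of \<open>S\<close> contributes only its diagonal entry.\<close>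

lemma mult_last_nonzero:
  fixes k :: "(complex, 'd) vec"
  assumes "k \<noteq> 0"
  shows "\<exists>j. k $ j \<noteq> 0 \<and> (S *v k) $ j = of_real (gam j) * k $ j"
proof -
  have ne: "{j. k $ j \<noteq> 0} \<noteq> {}" using assms by (auto simp: vec_eq_iff)
  define j where "j = Max {j. k $ j \<noteq> 0}"
  have j: "k $ j \<noteq> 0" using Max_in[OF _ ne] by (simp add: j_def)
  have gt: "k $ i = 0" if "j < i" for i
  proof (rule ccontr)
    assume "k $ i \<noteq> 0"
    then have "i \<le> j" unfolding j_def by (intro Max_ge) auto
    with that show False by simp
  qed
  have "S $ j $ i * k $ i = (if i = j then of_real (gam j) * k $ j else 0)" for i
    using gt[of i] upper_zero[of i j] diag[of j] by (cases i j rule: linorder_cases) auto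
  then have "(S *v k) $ j = of_real (gam j) * k $ j" by (simp add: matrix_vector_mult_def)
  with j show ?thesis by blast
qed

lemma mult_eq_zero:
  assumes "S *v k = 0"
  shows "k = 0"
proof (rule ccontr)
  assume "k \<noteq> 0"
  then obtain j where "k $ j \<noteq> 0" "(S *v k) $ j = of_real (gam j) * k $ j" using mult_last_nonzero by blast
  then show False using assms pos[of j] by simp
qed

lemma inj_mult: "inj_on ((*v) S) A"
  using mult_eq_zero
  by (intro inj_onI) (metis eq_iff_diff_eq_0 matrix_vector_mult_diff_distrib)

lemma countable_lattice: "countable (matrix_lattice S)"
proof -
  have "countable (coeffs A)" if "finite A" for A
    using that
  proof (induction A rule: finite_linorder_min_induct)
    case empty
    have "coeffs {} = {0}" by (auto simp: coeffs_def vec_eq_iff)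
    then show ?case by simp
  next
    case (insert b A)
    then show ?case
      by (simp add: coeffs_insert(1) countable_gauss_int)
  qed
  then show ?thesis unfolding matrix_lattice_coeffs by simp
qed

lemma coeffs_sum_bound:
  fixes u :: "'d \<Rightarrow> complex \<Rightarrow> real"
  assumes nn: "\<And>j w. 0 \<le> u j w"
    and sm: "\<And>j c. (\<lambda>m. u j (of_real (gam j) * m + c)) summable_on gauss_int"
    and le: "\<And>j c. infsum (\<lambda>m. u j (of_real (gam j) * m + c)) gauss_int \<le> M j"
    and A: "finite A"
  shows "(\<lambda>k. \<Prod>j\<in>A. u j ((S *v k) $ j)) summable_on coeffs A \<and>
    infsum (\<lambda>k. \<Prod>j\<in>A. u j ((S *v k) $ j)) (coeffs A) \<le> (\<Prod>j\<in>A. M j)"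
  using A
proof (induction A rule: finite_linorder_min_induct)
  case empty
  have "coeffs {} = {0}" by (auto simp: coeffs_def vec_eq_iff)
  then show ?case by simp
next
  case (insert b A)
  note I = coeffs_insert[OF insert(1,2)]
  have b: "b \<notin> A" using insert(2) by auto
  define P where "P = (\<lambda>k. \<Prod>j\<in>A. u j ((S *v k) $ j))"
  define f where "f = (\<lambda>(k, m). P k * u b (of_real (gam b) * m + (S *v k) $ b))"
  define g where "g k = P k * infsum (\<lambda>m. u b (of_real (gam b) * m + (S *v k) $ b)) gauss_int" for k
  have P: "P k \<ge> 0" for k by (simp add: P_def nn prod_nonneg)
  have PA: "P summable_on coeffs A" "infsum P (coeffs A) \<le> (\<Prod>j\<in>A. M j)"
    using insert(3) by (simp_all add: P_def)
  have M: "M j \<ge> 0" for j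
    by (rule order_trans[OF infsum_nonneg le[of j 0]]) (simp add: nn)
  have fs: "((\<lambda>m. f (k, m)) has_sum g k) gauss_int" for k
    unfolding f_def g_def by (simp add: has_sum_cmult_right has_sum_infsum sm)
  have gle: "g k \<le> M b * P k" for k
    unfolding g_def using mult_left_mono[OF le[of b "(S *v k) $ b"] P[of k]] by (simp add: mult.commute)
  have g0: "0 \<le> g k" for k
    unfolding g_def by (intro mult_nonneg_nonneg P infsum_nonneg nn)
  have gs: "g summable_on coeffs A"
    by (rule summable_on_comparison_test[OF summable_on_cmult_right[OF PA(1)]]) (use gle g0 in auto)
  have fsm: "f summable_on coeffs A \<times> gauss_int"
    by (rule summable_on_SigmaI[OF fs gs]) (auto simp: f_def P nn)
  have fsum: "(f has_sum infsum g (coeffs A)) (coeffs A \<times> gauss_int)"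
    by (rule has_sum_SigmaI[OF fs _ fsm]) (use gs in auto)
  have eq: "(\<Prod>j\<in>insert b A. u j ((S *v (case p of (k, m) \<Rightarrow> k + axis b m)) $ j)) = f p" for p
  proof (cases p)
    case (Pair k m)
    have "(\<Prod>j\<in>A. u j ((S *v (k + axis b m)) $ j)) = P k"
      unfolding P_def by (intro prod.cong) (auto simp: I(3))
    then show ?thesis using b insert(1) by (simp add: Pair f_def I(4))
  qed
  have "((\<lambda>k. \<Prod>j\<in>insert b A. u j ((S *v k) $ j)) has_sum infsum g (coeffs A)) (coeffs (insert b A))"
    unfolding I(1) using fsum by (subst has_sum_reindex[OF I(2)]) (simp add: o_def eq)
  moreover have "infsum g (coeffs A) \<le> M b * infsum P (coeffs A)"
    using gle gs PA(1) by (subst infsum_cmult_right[symmetric]) (auto intro!: infsum_mono summable_on_cmult_right)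
  moreover have "\<dots> \<le> M b * (\<Prod>j\<in>A. M j)"
    using PA(2) M by (intro mult_left_mono) auto
  ultimately show ?case using b insert(1)
    by (auto simp: has_sum_iff)
qed

lemma coeffs_sum_value:
  fixes u :: "'d \<Rightarrow> complex \<Rightarrow> complex"
  assumes sm: "\<And>j c. (\<lambda>m. norm (u j (of_real (gam j) * m + c))) summable_on gauss_int"
    and le: "\<And>j c. infsum (\<lambda>m. norm (u j (of_real (gam j) * m + c))) gauss_int \<le> M j"
    and val: "\<And>j c. ((\<lambda>m. u j (of_real (gam j) * m + c)) has_sum V j) gauss_int"
    and A: "finite A"
  shows "((\<lambda>k. \<Prod>j\<in>A. u j ((S *v k) $ j)) has_sum (\<Prod>j\<in>A. V j)) (coeffs A)"
  using A
proof (induction A rule: finite_linorder_min_induct)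
  case empty
  have "coeffs {} = {0}" by (auto simp: coeffs_def vec_eq_iff)
  then show ?case by (simp add: has_sum_finiteI)
next
  case (insert b A)
  note I = coeffs_insert[OF insert(1,2)]
  have b: "b \<notin> A" using insert(2) by auto
  define P where "P = (\<lambda>k. \<Prod>j\<in>A. u j ((S *v k) $ j))"
  define f where "f = (\<lambda>(k, m). P k * u b (of_real (gam b) * m + (S *v k) $ b))"
  have eq: "(\<Prod>j\<in>insert b A. u j ((S *v (case p of (k, m) \<Rightarrow> k + axis b m)) $ j)) = f p" for p
  proof (cases p)
    case (Pair k m)
    have "(\<Prod>j\<in>A. u j ((S *v (k + axis b m)) $ j)) = P k"
      unfolding P_def by (intro prod.cong) (auto simp: I(3))
    then show ?thesis using b insert(1) by (simp add: Pair f_def I(4))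
  qed
  have fs: "((\<lambda>m. f (k, m)) has_sum (P k * V b)) gauss_int" for k
    unfolding f_def by (simp add: has_sum_cmult_right val)
  have gs: "((\<lambda>k. P k * V b) has_sum ((\<Prod>j\<in>A. V j) * V b)) (coeffs A)"
    using insert(3) by (intro has_sum_cmult_left) (simp add: P_def)
  have "(\<lambda>k. \<Prod>j\<in>insert b A. norm (u j ((S *v k) $ j))) summable_on coeffs (insert b A)"
    using coeffs_sum_bound[of "\<lambda>j w. norm (u j w)" M "insert b A"] sm le insert(1) by simp
  then have "(\<lambda>p. norm (f p)) summable_on coeffs A \<times> gauss_int"
    unfolding I(1) prod_norm by (subst (asm) summable_on_reindex[OF I(2)]) (simp add: o_def eq)
  then have "f summable_on coeffs A \<times> gauss_int" by (rule abs_summable_summable)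
  from has_sum_SigmaI[OF fs gs this]
  have "(f has_sum ((\<Prod>j\<in>A. V j) * V b)) (coeffs A \<times> gauss_int)" by simp
  then have "((\<lambda>k. \<Prod>j\<in>insert b A. u j ((S *v k) $ j)) has_sum ((\<Prod>j\<in>A. V j) * V b)) (coeffs (insert b A))"
    unfolding I(1) by (subst has_sum_reindex[OF I(2)]) (simp add: o_def eq)
  then show ?case using b insert(1) by (simp add: mult.commute)
qed

text \<open>Summing a product \<open>\<Prod>u\<^sub>j(l\<^sub>j)\<close> over the lattice: the innermost sum runs over the smallest index, where
  it meets a translate of \<open>gam j * \<int>[i]\<close> that depends on the other coordinates.  If the one-dimensional
  sums do not depend on the translate, the whole sum is their product, although the lattice itself is not a
  product.\<close>

lemma lattice_sum_bound:
  fixes u :: "'d \<Rightarrow> complex \<Rightarrow> real"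
  assumes "\<And>j w. 0 \<le> u j w"
    and "\<And>j c. (\<lambda>m. u j (of_real (gam j) * m + c)) summable_on gauss_int"
    and "\<And>j c. infsum (\<lambda>m. u j (of_real (gam j) * m + c)) gauss_int \<le> M j"
  shows "(\<lambda>l. \<Prod>j\<in>UNIV. u j (l $ j)) summable_on matrix_lattice S"
    and "infsum (\<lambda>l. \<Prod>j\<in>UNIV. u j (l $ j)) (matrix_lattice S) \<le> (\<Prod>j\<in>UNIV. M j)"
  unfolding matrix_lattice_coeffs
  using coeffs_sum_bound[OF assms finite]
  by (simp_all add: summable_on_reindex[OF inj_mult] infsum_reindex[OF inj_mult] o_def)

lemma lattice_sum_value:
  fixes u :: "'d \<Rightarrow> complex \<Rightarrow> complex"
  assumes "\<And>j c. (\<lambda>m. norm (u j (of_real (gam j) * m + c))) summable_on gauss_int"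
    and "\<And>j c. infsum (\<lambda>m. norm (u j (of_real (gam j) * m + c))) gauss_int \<le> M j"
    and "\<And>j c. ((\<lambda>m. u j (of_real (gam j) * m + c)) has_sum V j) gauss_int"
  shows "((\<lambda>l. \<Prod>j\<in>UNIV. u j (l $ j)) has_sum (\<Prod>j\<in>UNIV. V j)) (matrix_lattice S)"
  unfolding matrix_lattice_coeffs
  using coeffs_sum_value[OF assms finite]
  by (simp add: has_sum_reindex[OF inj_mult] o_def)

lemma uminus_lattice:
  assumes "l \<in> matrix_lattice S"
  shows "- l \<in> matrix_lattice S"
proof -
  obtain k :: "(complex, 'd) vec" where "l = S *v k" "\<forall>j. k $ j \<in> gauss_int" using assms by (auto simp: matrix_lattice_def)
  then have "- l = S *v (- k)" "\<forall>j. (- k) $ j \<in> gauss_int"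
    using matrix_vector_mult_diff_distrib[of S 0 k] by (simp_all add: mem_gauss_int_iff)
  then show ?thesis unfolding matrix_lattice_def by blast
qed

definition cell :: "(complex, 'd) vec set" where
  "cell = {z. \<forall>j. 0 \<le> Re (z $ j) \<and> Re (z $ j) < gam j \<and> 0 \<le> Im (z $ j) \<and> Im (z $ j) < gam j}"

text \<open>Back substitution: the entries of \<open>k\<close> are found one after the other, the one with the largest index
  first, as integer parts.\<close>

lemma cell_cover: "\<exists>l\<in>matrix_lattice S. z - l \<in> cell"
proof -
  define B where "B j w \<longleftrightarrow> 0 \<le> Re w \<and> Re w < gam j \<and> 0 \<le> Im w \<and> Im w < gam j" for j w
  have "\<exists>k\<in>coeffs A. \<forall>j\<in>A. B j ((z - S *v k) $ j)" if "finite A" for A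
    using that
  proof (induction A rule: finite_linorder_min_induct)
    case empty
    show ?case by (rule bexI[of _ 0]) (auto simp: coeffs_def)
  next
    case (insert b A)
    note I = coeffs_insert[OF insert(1,2)]
    obtain k where k: "k \<in> coeffs A" "\<forall>j\<in>A. B j ((z - S *v k) $ j)"
      using insert(3) by blast
    define r where "r = (z - S *v k) $ b"
    define m where "m = Complex (of_int \<lfloor>Re r / gam b\<rfloor>) (of_int \<lfloor>Im r / gam b\<rfloor>)"
    have "m \<in> gauss_int" by (simp add: m_def mem_gauss_int_iff)
    then have 1: "k + axis b m \<in> coeffs (insert b A)" using k(1) unfolding I(1) by force
    have fl: "0 \<le> t - gam b * of_int \<lfloor>t / gam b\<rfloor>" "t - gam b * of_int \<lfloor>t / gam b\<rfloor> < gam b" for t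
    proof -
      have "of_int \<lfloor>t / gam b\<rfloor> \<le> t / gam b" "t / gam b < of_int \<lfloor>t / gam b\<rfloor> + 1" by linarith+
      moreover from this have "gam b * of_int \<lfloor>t / gam b\<rfloor> \<le> gam b * (t / gam b)"
        using pos[of b] by (intro mult_left_mono) auto
      ultimately show "0 \<le> t - gam b * of_int \<lfloor>t / gam b\<rfloor>" "t - gam b * of_int \<lfloor>t / gam b\<rfloor> < gam b"
        using pos[of b] by (simp_all add: field_simps)
    qed
    have "(z - S *v (k + axis b m)) $ b = r - of_real (gam b) * m"
      by (simp add: I(4) r_def)
    then have 2: "B b ((z - S *v (k + axis b m)) $ b)"
      using fl[of "Re r"] fl[of "Im r"] by (simp add: B_def m_def)
    have "(z - S *v (k + axis b m)) $ j = (z - S *v k) $ j" if "j \<in> A" for j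
      using I(3)[OF that] by simp
    with k(2) have "B j ((z - S *v (k + axis b m)) $ j)" if "j \<in> A" for j
      using that by simp
    with 1 2 show ?case by blast
  qed
  from this[of UNIV] obtain k where "k \<in> coeffs UNIV" "\<forall>j. B j ((z - S *v k) $ j)" by auto
  then show ?thesis
    by (intro bexI[of _ "S *v k"]) (auto simp: cell_def matrix_lattice_coeffs B_def)
qed

lemma cell_unique:
  assumes "l \<in> matrix_lattice S" "z - l \<in> cell" "l' \<in> matrix_lattice S" "z - l' \<in> cell"
  shows "l = l'"
proof (rule ccontr)
  assume ne: "l \<noteq> l'"
  obtain k k' :: "(complex, 'd) vec" where k: "l = S *v k" "l' = S *v k'" "\<And>j. k $ j \<in> gauss_int" "\<And>j. k' $ j \<in> gauss_int"
    using assms by (auto simp: matrix_lattice_def)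
  define d where "d = k' - k"
  have d: "S *v d = (z - l) - (z - l')" unfolding d_def k by (simp add: matrix_vector_mult_diff_distrib)
  have di: "d $ j \<in> gauss_int" for j using k by (simp add: d_def)
  have "d \<noteq> 0" using ne k by (auto simp: d_def)
  then obtain j where j: "d $ j \<noteq> 0" and "(S *v d) $ j = of_real (gam j) * d $ j"
    using mult_last_nonzero by blast
  then have eq: "of_real (gam j) * d $ j = (z - l) $ j - (z - l') $ j" using d by simp
  have small: "x = 0" if "x \<in> \<int>" "\<bar>gam j * x\<bar> < gam j" for x
  proof -
    have "gam j * \<bar>x\<bar> < gam j * 1" using that pos[of j] by (simp add: abs_mult)
    then have "\<bar>x\<bar> < 1" using pos[of j] by (simp only: mult_less_cancel_left_pos)
    with that show "x = 0" using Ints_nonzero_abs_less1 by blast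
  qed
  have "Re (d $ j) = 0"
  proof (rule small)
    have "gam j * Re (d $ j) = Re ((z - l) $ j) - Re ((z - l') $ j)" using arg_cong[OF eq, of Re] by simp
    moreover have "0 \<le> Re ((z - l) $ j)" "Re ((z - l) $ j) < gam j" "0 \<le> Re ((z - l') $ j)" "Re ((z - l') $ j) < gam j"
      using assms by (auto simp: cell_def)
    ultimately show "\<bar>gam j * Re (d $ j)\<bar> < gam j" by linarith
  qed (use di[of j] in \<open>simp add: mem_gauss_int_iff\<close>)
  moreover have "Im (d $ j) = 0"
  proof (rule small)
    have "gam j * Im (d $ j) = Im ((z - l) $ j) - Im ((z - l') $ j)" using arg_cong[OF eq, of Im] by simp
    moreover have "0 \<le> Im ((z - l) $ j)" "Im ((z - l) $ j) < gam j" "0 \<le> Im ((z - l') $ j)" "Im ((z - l') $ j) < gam j"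
      using assms by (auto simp: cell_def)
    ultimately show "\<bar>gam j * Im (d $ j)\<bar> < gam j" by linarith
  qed (use di[of j] in \<open>simp add: mem_gauss_int_iff\<close>)
  ultimately show False using j by (simp add: complex_eq_iff)
qed

lemma cell_measure: "cell \<in> sets borel" "measure lebesgue cell = (\<Prod>j\<in>UNIV. (gam j)\<^sup>2)"
proof -
  define b :: "(complex, 'd) vec" where "b = (\<chi> j. Complex (gam j) (gam j))"
  have [measurable]: "(\<lambda>z::(complex, 'd) vec. Re (z $ j)) \<in> borel_measurable borel"
    "(\<lambda>z::(complex, 'd) vec. Im (z $ j)) \<in> borel_measurable borel" for j
    by (intro borel_measurable_continuous_onI continuous_intros)+
  show c: "cell \<in> sets borel" unfolding cell_def by measurable
  have Basis: "(Basis :: (complex, 'd) vec set) = (\<lambda>(j, u). axis j u) ` (UNIV \<times> {1, \<i>})"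
    by (auto simp: Basis_vec_def Basis_complex_def)
  have injB: "inj_on (\<lambda>(j::'d, u). axis j u) (UNIV \<times> {1, \<i>})"
    by (auto simp: inj_on_def axis_eq_axis)
  have inner: "x \<bullet> axis j u = x $ j \<bullet> u" for x :: "(complex, 'd) vec" and j u
    by (simp add: inner_axis)
  have sub: "box 0 b \<subseteq> cell" "cell \<subseteq> cbox 0 b"
    unfolding cell_def mem_box box_def cbox_def Basis
    by (auto simp: inner b_def inner_complex_def less_imp_le)
  have pb: "(\<Prod>x\<in>Basis. b \<bullet> x) = (\<Prod>j\<in>UNIV. (gam j)\<^sup>2)"
  proof -
    have "(\<Prod>x\<in>Basis. b \<bullet> x) = (\<Prod>p\<in>UNIV \<times> {1, \<i>}. b $ fst p \<bullet> snd p)"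
      unfolding Basis by (subst prod.reindex[OF injB]) (auto intro!: prod.cong simp: inner)
    also have "\<dots> = (\<Prod>j\<in>UNIV. \<Prod>u\<in>{1, \<i>}. b $ j \<bullet> u)"
      by (subst prod.cartesian_product) (simp add: case_prod_unfold)
    also have "\<dots> = (\<Prod>j\<in>UNIV. (gam j)\<^sup>2)"
      by (intro prod.cong refl) (simp add: b_def inner_complex_def power2_eq_square)
    finally show ?thesis .
  qed
  have bb: "0 \<bullet> x \<le> b \<bullet> x" if "x \<in> Basis" for x
    using that pos unfolding Basis by (auto simp: inner b_def inner_complex_def less_imp_le)
  have "emeasure lborel cell = ennreal (\<Prod>j\<in>UNIV. (gam j)\<^sup>2)"
  proof (rule antisym)
    have "emeasure lborel cell \<le> emeasure lborel (cbox 0 b)" using sub by (intro emeasure_mono) auto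
    also have "\<dots> = ennreal (\<Prod>j\<in>UNIV. (gam j)\<^sup>2)" using bb pb by (subst emeasure_lborel_cbox) auto
    finally show "emeasure lborel cell \<le> ennreal (\<Prod>j\<in>UNIV. (gam j)\<^sup>2)" .
    have "ennreal (\<Prod>j\<in>UNIV. (gam j)\<^sup>2) = emeasure lborel (box 0 b)" using bb pb by (subst emeasure_lborel_box) auto
    also have "\<dots> \<le> emeasure lborel cell" using sub c by (intro emeasure_mono) auto
    finally show "ennreal (\<Prod>j\<in>UNIV. (gam j)\<^sup>2) \<le> emeasure lborel cell" .
  qed
  then show "measure lebesgue cell = (\<Prod>j\<in>UNIV. (gam j)\<^sup>2)"
    using c by (simp add: measure_def prod_nonneg)
qed

lemma fundamental_domain_cell: "fundamental_domain (matrix_lattice S) cell"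
proof -
  have "cell \<in> sets lebesgue" using cell_measure(1) by simp
  then show ?thesis
    unfolding fundamental_domain_def using cell_cover cell_unique by (metis (no_types, lifting))
qed

end

text \<open>Both sets are cut along the translates of the other one; the pieces correspond by translation.\<close>

lemma fundamental_domain_emeasure:
  fixes L :: "(complex^'d) set"
  assumes D: "fundamental_domain L D" and D': "fundamental_domain L D'"
    and L: "countable L" "\<And>l. l \<in> L \<Longrightarrow> - l \<in> L"
  shows "emeasure lebesgue D = emeasure lebesgue D'"
proof -
  have [measurable]: "D \<in> sets lebesgue" "D' \<in> sets lebesgue"
    using D D' by (auto simp: fundamental_domain_def)
  have trans: "emeasure lebesgue ((\<lambda>x. x + l) ` B) = emeasure lebesgue B" for B and l :: "complex^'d"
    using emeasure_lebesgue_affine[of 1 l B] by simp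
  have transs: "(\<lambda>x. x + l) ` B \<in> sets lebesgue" if "B \<in> sets lebesgue" for B and l :: "complex^'d"
    using lebesgue_sets_translation[OF that, of l] by (simp add: add.commute)
  define X where "X l = D \<inter> (\<lambda>x. x + l) ` D'" for l
  define Y where "Y l = D' \<inter> (\<lambda>x. x + (- l)) ` D" for l
  have mem: "x \<in> (\<lambda>x. x + l) ` B \<longleftrightarrow> x - l \<in> B" for x l and B :: "(complex^'d) set"
    by (auto simp: image_iff intro: bexI[of _ "x - l"])
  have XY: "X l = (\<lambda>x. x + l) ` Y l" for l
    unfolding X_def Y_def by (auto simp: mem set_eq_iff)
  have "emeasure lebesgue (\<Union>l\<in>L. X l) = (\<integral>\<^sup>+l. emeasure lebesgue (X l) \<partial>count_space L)"
  proof (rule emeasure_UN_countable[OF _ L(1)])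
    show "disjoint_family_on X L"
      unfolding disjoint_family_on_def X_def
    proof (intro ballI impI)
      fix m n assume mn: "m \<in> L" "n \<in> L" "m \<noteq> n"
      have "m = n" if "x - m \<in> D'" "x - n \<in> D'" for x
        using D' mn that unfolding fundamental_domain_def by blast
      then show "(D \<inter> (\<lambda>x. x + m) ` D') \<inter> (D \<inter> (\<lambda>x. x + n) ` D') = {}"
        using mn(3) unfolding disjoint_iff by (simp add: mem) blast
    qed
    show "X l \<in> sets lebesgue" if "l \<in> L" for l unfolding X_def by (intro sets.Int transs) auto
  qed
  moreover have "(\<Union>l\<in>L. X l) = D"
  proof -
    have "\<exists>l\<in>L. x - l \<in> D'" for x using D' unfolding fundamental_domain_def by blast
    then show ?thesis unfolding X_def by (auto simp: mem)
  qed
  moreover have "emeasure lebesgue (\<Union>l\<in>L. Y l) = (\<integral>\<^sup>+l. emeasure lebesgue (Y l) \<partial>count_space L)"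
  proof (rule emeasure_UN_countable[OF _ L(1)])
    show "disjoint_family_on Y L"
      unfolding disjoint_family_on_def Y_def
    proof (intro ballI impI)
      fix m n assume "m \<in> L" "n \<in> L" "m \<noteq> n"
      then have "- m = - n" if "x - (- m) \<in> D" "x - (- n) \<in> D" for x
        using D L(2) that unfolding fundamental_domain_def by blast
      then have "x - (- m) \<notin> D \<or> x - (- n) \<notin> D" for x
        using \<open>m \<noteq> n\<close> by (metis neg_equal_iff_equal)
      then show "(D' \<inter> (\<lambda>x. x + - m) ` D) \<inter> (D' \<inter> (\<lambda>x. x + - n) ` D) = {}"
        unfolding disjoint_iff Int_iff mem by metis
    qed
    show "Y l \<in> sets lebesgue" if "l \<in> L" for l unfolding Y_def by (intro sets.Int transs) auto
  qed
  moreover have "(\<Union>l\<in>L. Y l) = D'"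
  proof -
    have "\<exists>l\<in>L. x - (- l) \<in> D" for x
      using D L(2) unfolding fundamental_domain_def by (metis minus_minus)
    then show ?thesis unfolding Y_def by (auto simp: mem simp del: add_uminus_conv_diff)
  qed
  moreover have "emeasure lebesgue (X l) = emeasure lebesgue (Y l)" for l
    unfolding XY by (rule trans)
  ultimately show ?thesis by simp
qed

lemma (in triangular_lattice) lattice_vol_eq: "lattice_vol (matrix_lattice S) = (\<Prod>j\<in>UNIV. (gam j)\<^sup>2)"
  unfolding lattice_vol_def
proof (rule the_equality)
  show "\<exists>D. fundamental_domain (matrix_lattice S) D \<and> (\<Prod>j\<in>UNIV. (gam j)\<^sup>2) = measure lebesgue D"
    using fundamental_domain_cell cell_measure by metis
  fix v assume "\<exists>D. fundamental_domain (matrix_lattice S) D \<and> v = measure lebesgue D"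
  then show "v = (\<Prod>j\<in>UNIV. (gam j)\<^sup>2)"
    using fundamental_domain_emeasure[OF _ fundamental_domain_cell countable_lattice uminus_lattice]
    by (auto simp: measure_def cell_measure(2)[unfolded measure_def])
qed

section \<open>The dual window in one dimension\<close>

lemma has_sum_geometric_int:
  fixes x :: real
  assumes x: "0 \<le> x" "x < 1"
  shows "((\<lambda>k::int. x ^ nat \<bar>k\<bar>) has_sum ((1 + x) / (1 - x))) UNIV"
proof -
  have "(\<lambda>n. x ^ n) sums (1 / (1 - x))" using x by (intro geometric_sums) auto
  then have g: "((\<lambda>n. x ^ n) has_sum (1 / (1 - x))) UNIV"
    using x by (intro sums_nonneg_imp_has_sum) auto
  have b1: "bij_betw int UNIV {0..}"
    by (rule bij_betwI[of _ _ _ nat]) auto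
  have b2: "bij_betw (\<lambda>n. - int (Suc n)) UNIV {..<0}"
    by (rule bij_betwI[of _ _ _ "\<lambda>k. nat (- k - 1)"]) auto
  have 1: "((\<lambda>k::int. x ^ nat \<bar>k\<bar>) has_sum (1 / (1 - x))) {0..}"
    using g has_sum_reindex_bij_betw[OF b1, of "\<lambda>k. x ^ nat \<bar>k\<bar>"] by simp
  have A: "((\<lambda>n. x * x ^ n) has_sum (x * (1 / (1 - x)))) UNIV"
    by (intro has_sum_cmult_right g)
  have e: "x ^ nat \<bar>- int (Suc n)\<bar> = x * x ^ n" for n
    by (simp add: nat_add_distrib)
  have 2: "((\<lambda>k::int. x ^ nat \<bar>k\<bar>) has_sum (x * (1 / (1 - x)))) {..<0}"
    unfolding has_sum_reindex_bij_betw[OF b2, of "\<lambda>k. x ^ nat \<bar>k\<bar>", symmetric] e by (rule A)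
  have "{0..} \<union> {..<0} = (UNIV :: int set)" "{0..} \<inter> {..<0} = ({} :: int set)" by auto
  then have "((\<lambda>k::int. x ^ nat \<bar>k\<bar>) has_sum (1 / (1 - x) + x * (1 / (1 - x)))) UNIV"
    using has_sum_Un_disjoint[OF 1 2] by auto
  then show ?thesis using x by (simp add: field_simps)
qed

lemma quadratic_le:
  fixes a b t :: real
  assumes "a > 0"
  shows "b * t \<le> a * t\<^sup>2 + b\<^sup>2 / (4 * a)"
proof -
  have "0 \<le> (2 * a * t - b)\<^sup>2 / (4 * a)" using assms by simp
  also have "\<dots> = a * t\<^sup>2 + b\<^sup>2 / (4 * a) - b * t"
    using assms by (simp add: power2_eq_square field_simps)
  finally show ?thesis by simp
qed

lemma summable_gauss_int:
  fixes a b :: real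
  assumes a: "a > 0"
  shows "(\<lambda>k::int. exp (- a * (of_int k)\<^sup>2 + b * \<bar>of_int k\<bar>)) summable_on UNIV"
proof -
  have "exp (-1) < (1::real)" by simp
  then have s: "(\<lambda>k::int. exp ((b + 1)\<^sup>2 / (4 * a)) * exp (-1) ^ nat \<bar>k\<bar>) summable_on UNIV"
    by (intro summable_on_cmult_right has_sum_imp_summable[OF has_sum_geometric_int]) auto
  show ?thesis
  proof (rule summable_on_comparison_test[OF s])
    fix k :: int
    have "(b + 1) * \<bar>of_int k\<bar> \<le> a * (of_int k)\<^sup>2 + (b + 1)\<^sup>2 / (4 * a)"
      using quadratic_le[OF a, of "b + 1" "\<bar>of_int k\<bar>"] by simp
    then have "exp (- a * (of_int k)\<^sup>2 + b * \<bar>of_int k\<bar>) \<le> exp ((b + 1)\<^sup>2 / (4 * a) - \<bar>of_int k\<bar>)"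
      by (simp add: algebra_simps)
    also have "\<dots> = exp ((b + 1)\<^sup>2 / (4 * a)) * exp (-1) ^ nat \<bar>k\<bar>"
    proof -
      have "exp (-1) ^ nat \<bar>k\<bar> = exp (real (nat \<bar>k\<bar>) * (-1))" by (rule exp_of_nat_mult[symmetric])
      also have "real (nat \<bar>k\<bar>) * (-1) = - \<bar>of_int k\<bar>" by simp
      finally show ?thesis by (simp only: diff_conv_add_uminus exp_add)
    qed
    finally show "exp (- a * (of_int k)\<^sup>2 + b * \<bar>of_int k\<bar>) \<le> exp ((b + 1)\<^sup>2 / (4 * a)) * exp (-1) ^ nat \<bar>k\<bar>" .
  qed simp
qed

definition theta_coeff :: "nat \<Rightarrow> real" where
  "theta_coeff n = (-1) ^ n * exp (- pi * (real n + 1 / 2)\<^sup>2)"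

definition theta_tail :: "nat \<Rightarrow> real" where
  "theta_tail i = (\<Sum>n. theta_coeff (n + i))"

text \<open>These are the Laurent coefficients of \<open>\<theta>(s) / (1 - 1/s)\<close>, where \<open>\<theta>\<close> is the theta series with
  coefficients \<open>(-1)^k exp (- \<pi> (k + 1/2)\<^sup>2)\<close> for integers \<open>k\<close>: it vanishes at the points \<open>exp (2 \<pi> m)\<close>
  for integers \<open>m\<close>, and the division removes the simple zero at \<open>s = 1\<close>.\<close>

definition window_coeff :: "int \<Rightarrow> real" where
  "window_coeff k = theta_tail (nat \<bar>k\<bar>)"

lemma exp_minus_pi: "exp (- pi) < 1 / 4" "exp (- 2 * pi) < 1 / 16"
proof -
  have "4 < 1 + pi" using pi_gt3 by simp
  also have "\<dots> \<le> exp pi" by (rule exp_ge_add_one_self)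
  finally have 4: "4 < exp pi" .
  then show "exp (- pi) < 1 / 4" by (simp add: exp_minus field_simps)
  have "(4::real)^2 < exp pi ^ 2" using 4 by (intro power_strict_mono) auto
  then have "16 < exp (2 * pi)" by (simp add: exp_double)
  then show "exp (- 2 * pi) < 1 / 16" by (simp add: exp_minus field_simps)
qed

lemma theta_coeff_bound: "\<bar>theta_coeff (n + i)\<bar> \<le> exp (- pi * (real i + 1 / 2)\<^sup>2) * exp (- pi) ^ n"
proof -
  have "(real i + 1 / 2)\<^sup>2 + real n \<le> (real (n + i) + 1 / 2)\<^sup>2"
  proof -
    have "(real (n + i) + 1 / 2)\<^sup>2 = (real i + 1 / 2)\<^sup>2 + real n + (2 * real n * real i + (real n)\<^sup>2)"
      by (simp add: power2_eq_square algebra_simps)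
    moreover have "0 \<le> 2 * real n * real i + (real n)\<^sup>2" by simp
    ultimately show ?thesis by linarith
  qed
  then have "pi * ((real i + 1 / 2)\<^sup>2 + real n) \<le> pi * (real (n + i) + 1 / 2)\<^sup>2"
    by (intro mult_left_mono) auto
  then have "exp (- pi * (real (n + i) + 1 / 2)\<^sup>2) \<le> exp (- pi * (real i + 1 / 2)\<^sup>2 + real n * (- pi))"
    by (simp add: algebra_simps)
  also have "\<dots> = exp (- pi * (real i + 1 / 2)\<^sup>2) * exp (- pi) ^ n"
    by (simp only: exp_add exp_of_nat_mult)
  finally show ?thesis by (simp add: theta_coeff_def abs_mult)
qed

lemma summable_theta_coeff: "summable (\<lambda>n. theta_coeff (n + i))"
  by (rule summable_comparison_test'[where g="\<lambda>n. exp (- pi * (real i + 1 / 2)\<^sup>2) * exp (- pi) ^ n"])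
     (use theta_coeff_bound in \<open>auto intro!: summable_mult summable_geometric\<close>)

lemma theta_tail_bound: "\<bar>theta_tail i\<bar> \<le> 4 / 3 * exp (- pi * (real i + 1 / 2)\<^sup>2)"
proof -
  have g: "(\<lambda>n. exp (- pi * (real i + 1 / 2)\<^sup>2) * exp (- pi) ^ n) sums (exp (- pi * (real i + 1 / 2)\<^sup>2) * (1 / (1 - exp (- pi))))"
    by (intro sums_mult geometric_sums) simp
  have "\<bar>theta_tail i\<bar> \<le> (\<Sum>n. exp (- pi * (real i + 1 / 2)\<^sup>2) * exp (- pi) ^ n)"
  proof -
    have sm: "summable (\<lambda>n. \<bar>theta_coeff (n + i)\<bar>)"
      by (rule summable_comparison_test'[OF sums_summable[OF g], of 0]) (use theta_coeff_bound[of _ i] in simp)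
    have "\<bar>theta_tail i\<bar> \<le> (\<Sum>n. \<bar>theta_coeff (n + i)\<bar>)"
      unfolding theta_tail_def by (rule summable_rabs[OF sm])
    also have "\<dots> \<le> (\<Sum>n. exp (- pi * (real i + 1 / 2)\<^sup>2) * exp (- pi) ^ n)"
      by (rule suminf_le[OF theta_coeff_bound sm sums_summable[OF g]])
    finally show ?thesis .
  qed
  also have "\<dots> = exp (- pi * (real i + 1 / 2)\<^sup>2) * (1 / (1 - exp (- pi)))"
    using g by (rule sums_unique[symmetric])
  also have "\<dots> \<le> exp (- pi * (real i + 1 / 2)\<^sup>2) * (4 / 3)"
    using exp_minus_pi(1) by (intro mult_left_mono) (auto simp: field_simps)
  finally show ?thesis by simp
qed

lemma theta_tail_diff: "theta_tail i - theta_tail (Suc i) = theta_coeff i"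
  using suminf_split_head[OF summable_theta_coeff[of i]] by (simp add: theta_tail_def)

lemma window_coeff_diff:
  "window_coeff k - window_coeff (k + 1) = (if even k then 1 else -1) * exp (- pi * (of_int k + 1 / 2)\<^sup>2)"
proof (cases "k \<ge> 0")
  case True
  then obtain n where n: "k = int n" by (metis nonneg_int_cases)
  have "nat \<bar>int n + 1\<bar> = Suc n" by simp
  then show ?thesis using theta_tail_diff[of n]
    by (simp add: n window_coeff_def theta_coeff_def uminus_power_if)
next
  case False
  define n where "n = nat (- k - 1)"
  have n: "k = - int n - 1" using False by (simp add: n_def)
  have "nat \<bar>k\<bar> = Suc n" "nat \<bar>k + 1\<bar> = n" using n by auto
  moreover have "(- real n - 1 + 1 / 2)\<^sup>2 = (real n + 1 / 2)\<^sup>2" by (simp add: power2_eq_square algebra_simps)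
  moreover have "even k \<longleftrightarrow> odd n" using n by simp
  ultimately show ?thesis using theta_tail_diff[of n]
    by (simp add: window_coeff_def theta_coeff_def uminus_power_if n algebra_simps)
qed

lemma window_coeff_bound: "\<bar>window_coeff k\<bar> \<le> 4 / 3 * exp (- pi * (\<bar>of_int k\<bar> + 1 / 2)\<^sup>2)"
  using theta_tail_bound[of "nat \<bar>k\<bar>"] by (simp add: window_coeff_def)

lemma window_coeff_summable: "(\<lambda>k. \<bar>window_coeff k * exp (2 * pi * of_int k * t)\<bar>) summable_on UNIV"
proof (rule summable_on_comparison_test[OF summable_on_cmult_right[OF summable_gauss_int[of pi "2 * pi * \<bar>t\<bar>"], of "4 / 3"]])
  fix k :: int
  have "(of_int k)\<^sup>2 \<le> (\<bar>of_int k\<bar> + 1 / 2 :: real)\<^sup>2"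
    unfolding abs_le_square_iff[symmetric] by linarith
  then have 1: "exp (- pi * (\<bar>of_int k\<bar> + 1 / 2)\<^sup>2) \<le> exp (- pi * (of_int k)\<^sup>2)" by simp
  have "of_int k * t \<le> \<bar>of_int k\<bar> * \<bar>t\<bar>" by (metis abs_ge_self abs_mult)
  then have 2: "exp (2 * pi * of_int k * t) \<le> exp (2 * pi * \<bar>t\<bar> * \<bar>of_int k\<bar>)"
    by (simp add: mult_ac)
  have "\<bar>window_coeff k\<bar> * exp (2 * pi * of_int k * t) \<le>
      (4 / 3 * exp (- pi * (of_int k)\<^sup>2)) * exp (2 * pi * \<bar>t\<bar> * \<bar>of_int k\<bar>)"
    using 1 window_coeff_bound[of k] by (intro mult_mono 2) (linarith | simp)+
  also have "\<dots> = 4 / 3 * exp (- pi * (of_int k)\<^sup>2 + 2 * pi * \<bar>t\<bar> * \<bar>of_int k\<bar>)"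
    by (simp only: exp_add mult.assoc)
  finally show "\<bar>window_coeff k * exp (2 * pi * of_int k * t)\<bar> \<le> \<dots>"
    by (simp add: abs_mult)
qed auto

text \<open>The reflection \<open>k \<mapsto> 2 m - 1 - k\<close> changes the sign of every term of the theta series at
  \<open>s = exp (2 \<pi> m)\<close>; so \<open>(1 - 1/s)\<close> times the sum vanishes, and \<open>s \<noteq> 1\<close>.\<close>

lemma window_series_zero:
  fixes m :: int
  assumes m: "m \<noteq> 0"
  shows "((\<lambda>k. window_coeff k * exp (2 * pi * of_int k * of_int m)) has_sum 0) UNIV"
proof -
  define s where "s = exp (2 * pi * of_int m)"
  have s: "s \<noteq> 1" "s > 0" using m by (auto simp: s_def)
  define f where "f k = window_coeff k * exp (2 * pi * of_int k * of_int m)" for k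
  define r where "r k = (window_coeff k - window_coeff (k + 1)) * exp (2 * pi * of_int k * of_int m)" for k
  have "(\<lambda>k. f k) summable_on UNIV"
  proof (rule abs_summable_summable)
    show "(\<lambda>k. norm (f k)) summable_on UNIV"
      using window_coeff_summable[of "of_int m"] by (simp add: f_def)
  qed
  then obtain A where A: "(f has_sum A) UNIV" by (auto simp: summable_on_def)
  have bij: "bij_betw (\<lambda>k::int. k + 1) UNIV UNIV"
    by (rule bij_betwI[of _ _ _ "\<lambda>k. k - 1"]) auto
  have "((\<lambda>k. f (k + 1)) has_sum A) UNIV"
    using A has_sum_reindex_bij_betw[OF bij, of f] by simp
  then have "((\<lambda>k. f (k + 1) * (1 / s)) has_sum (A * (1 / s))) UNIV"
    by (rule has_sum_cmult_left)
  then have "((\<lambda>k. f k + - (f (k + 1) * (1 / s))) has_sum (A + - (A * (1 / s)))) UNIV"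
    by (intro has_sum_add A has_sum_uminusI)
  also have "(\<lambda>k. f k + - (f (k + 1) * (1 / s))) = r"
    by (rule ext) (simp add: f_def r_def s_def algebra_simps exp_add)
  finally have rA: "(r has_sum (A + - (A * (1 / s)))) UNIV" .
  have refl: "r (2 * m - 1 - k) = - r k" for k
  proof -
    have rr: "r k = (if even k then 1 else -1) * exp (- pi * (of_int k + 1 / 2 - of_int m)\<^sup>2 + pi * ((of_int m)\<^sup>2 - of_int m))" for k
      unfolding r_def window_coeff_diff
      by (simp add: mult.assoc flip: exp_add) (simp add: power2_eq_square algebra_simps)
    have "(of_int (2 * m - 1 - k) + 1 / 2 - of_int m)\<^sup>2 = (of_int k + 1 / 2 - of_int m :: real)\<^sup>2"
      by (simp add: power2_eq_square algebra_simps)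
    then show ?thesis unfolding rr by simp
  qed
  have bij2: "bij_betw (\<lambda>k. 2 * m - 1 - k) UNIV UNIV"
    by (rule bij_betwI[of _ _ _ "\<lambda>k. 2 * m - 1 - k"]) auto
  have "((\<lambda>k. - r k) has_sum (A + - (A * (1 / s)))) UNIV"
    using rA has_sum_reindex_bij_betw[OF bij2, of r] by (simp add: refl)
  then have "A + - (A * (1 / s)) = - (A + - (A * (1 / s)))"
    using has_sum_uminusI[OF rA] has_sum_unique by blast
  then have "2 * (A * (1 - 1 / s)) = 0" by (simp add: algebra_simps)
  then have "A * (1 - 1 / s) = 0" by (simp only: mult_eq_0_iff) simp
  then have "A = 0" using s by simp
  with A show ?thesis by (simp add: f_def[abs_def])
qed

definition window_total :: real where
  "window_total = infsum window_coeff UNIV"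

text \<open>Positivity holds because the coefficients decay so fast that the term \<open>k = 0\<close> outweighs all the others.\<close>

lemma window_total: "(window_coeff has_sum window_total) UNIV" "window_total > 0"
proof -
  have sm: "window_coeff summable_on UNIV"
    by (rule abs_summable_summable) (use window_coeff_summable[of 0] in simp)
  then show ws: "(window_coeff has_sum window_total) UNIV"
    unfolding window_total_def by (rule has_sum_infsum)
  \<comment> \<open>\<open>(t + 1/2)\<^sup>2 \<ge> 1/4 + 2 t\<close> for \<open>t = \<bar>k\<bar>\<close>, so the coefficients are bounded by a geometric sequence of ratio \<open>x\<close>.\<close>
  define x where "x = exp (- 2 * pi)"
  have x: "0 \<le> x" "x < 1 / 16" using exp_minus_pi(2) by (auto simp: x_def)
  define s where "s = exp (- pi / 4)"
  have s: "s > 0" by (simp add: s_def)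
  have b: "\<bar>window_coeff k\<bar> \<le> 4 / 3 * s * x ^ nat \<bar>k\<bar>" for k
  proof -
    have "2 * \<bar>of_int k\<bar> \<le> (\<bar>of_int k\<bar>\<^sup>2 + \<bar>of_int k\<bar> :: real)"
    proof -
      have "\<bar>k\<bar> \<le> \<bar>k\<bar>\<^sup>2" using self_le_power[of "\<bar>k\<bar>" 2] by (cases "k = 0") auto
      then have "of_int \<bar>k\<bar> \<le> (of_int (\<bar>k\<bar>\<^sup>2) :: real)" by (simp only: of_int_le_iff)
      then show ?thesis by simp
    qed
    then have "1 / 4 + 2 * \<bar>of_int k\<bar> \<le> (\<bar>of_int k\<bar> + 1 / 2 :: real)\<^sup>2"
      by (simp add: power2_eq_square algebra_simps)
    then have "pi * (1 / 4 + 2 * \<bar>of_int k\<bar>) \<le> pi * (\<bar>of_int k\<bar> + 1 / 2)\<^sup>2"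
      by (intro mult_left_mono) auto
    then have "exp (- pi * (\<bar>of_int k\<bar> + 1 / 2)\<^sup>2) \<le> exp (- pi / 4 + real (nat \<bar>k\<bar>) * (- 2 * pi))"
      by (simp add: algebra_simps)
    also have "\<dots> = s * x ^ nat \<bar>k\<bar>" unfolding s_def x_def exp_add exp_of_nat_mult ..
    finally show ?thesis using window_coeff_bound[of k] by linarith
  qed
  have "((\<lambda>k. window_coeff k - (if k = 0 then window_coeff 0 else 0)) has_sum (window_total - window_coeff 0)) UNIV"
  proof -
    have "((\<lambda>k. if k = 0 then window_coeff 0 else 0) has_sum window_coeff 0) (UNIV::int set)"
      by (rule has_sum_finite_neutralI[of "{0}"]) auto
    from has_sum_add[OF ws has_sum_uminusI[OF this]] show ?thesis by simp
  qed
  moreover have "((\<lambda>k::int. 4 / 3 * s * (x ^ nat \<bar>k\<bar> - (if k = 0 then 1 else 0))) has_sum (4 / 3 * s * ((1 + x) / (1 - x) - 1))) UNIV"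
  proof -
    have "((\<lambda>k. if k = 0 then 1 else 0) has_sum (1::real)) (UNIV::int set)"
      by (rule has_sum_finite_neutralI[of "{0}"]) auto
    moreover have "((\<lambda>k::int. x ^ nat \<bar>k\<bar>) has_sum ((1 + x) / (1 - x))) UNIV"
      using x by (intro has_sum_geometric_int) auto
    ultimately have "((\<lambda>k::int. x ^ nat \<bar>k\<bar> + - (if k = 0 then 1 else 0)) has_sum ((1 + x) / (1 - x) + - 1)) UNIV"
      by (intro has_sum_add has_sum_uminusI)
    then show ?thesis by (intro has_sum_cmult_right) simp
  qed
  ultimately have "norm (window_total - window_coeff 0) \<le> 4 / 3 * s * ((1 + x) / (1 - x) - 1)"
    by (rule norm_infsum_le) (use b in auto)
  also have "\<dots> \<le> 4 / 3 * s * (2 / 15)"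
    using x s by (intro mult_left_mono) (auto simp: field_simps)
  finally have 1: "\<bar>window_total - window_coeff 0\<bar> \<le> 8 / 45 * s" by simp
  have "window_coeff 0 - window_coeff 1 = s"
    using window_coeff_diff[of 0] by (simp add: s_def power2_eq_square)
  moreover have "\<bar>window_coeff 1\<bar> \<le> 4 / 3 * s * (1 / 16)"
  proof -
    have "4 / 3 * s * x \<le> 4 / 3 * s * (1 / 16)" using x s by (intro mult_left_mono) auto
    moreover have "\<bar>window_coeff 1\<bar> \<le> 4 / 3 * s * x" using b[of 1] by simp
    ultimately show ?thesis by (rule order_trans[rotated])
  qed
  ultimately show "window_total > 0" using 1 s by linarith
qed

definition step_fun :: "real \<Rightarrow> real \<Rightarrow> real" where
  "step_fun g x = window_coeff \<lfloor>x / g + 1 / 2\<rfloor>"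

text \<open>Bastiaans' dual window of the Gaussian, for the lattice \<open>g \<int>[i]\<close>: the Gaussian divided out of a step
  function whose steps have length \<open>g\<close>.\<close>

definition dual_window :: "real \<Rightarrow> real \<Rightarrow> real" where
  "dual_window g x = g / (2 powr (1 / 4) * window_total) * (exp (pi * x\<^sup>2) * step_fun g x)"

lemma step_fun_measurable [measurable]: "step_fun g \<in> borel_measurable borel"
  unfolding step_fun_def by measurable

lemma dual_window_measurable [measurable]: "dual_window g \<in> borel_measurable borel"
  unfolding dual_window_def by measurable

text \<open>On the step number \<open>k\<close> one has \<open>\<bar>x\<bar> \<le> g (\<bar>k\<bar> + 1/2) \<le> \<bar>k\<bar> + 1/2\<close>.  For \<open>g = 1\<close> both inequalities are
  equalities at the outer end of a step, so the dual window is then bounded but does not decay: at the critical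
  density the expansion has to be understood weakly.\<close>

lemma step_fun_bound:
  assumes g: "0 < g" "g \<le> 1"
  shows "\<bar>step_fun g x\<bar> \<le> 4 / 3 * exp (- pi * x\<^sup>2)"
proof -
  define k where "k = \<lfloor>x / g + 1 / 2\<rfloor>"
  have "of_int k \<le> x / g + 1 / 2" "x / g + 1 / 2 < of_int k + 1" unfolding k_def by linarith+
  then have "\<bar>x / g\<bar> \<le> \<bar>of_int k\<bar> + 1 / 2" by linarith
  then have "\<bar>x\<bar> \<le> g * (\<bar>of_int k\<bar> + 1 / 2)" using g by (simp add: field_simps)
  also have "\<dots> \<le> 1 * (\<bar>of_int k\<bar> + 1 / 2)" using g by (intro mult_right_mono) auto
  finally have "\<bar>x\<bar>\<^sup>2 \<le> (\<bar>of_int k\<bar> + 1 / 2)\<^sup>2" by (intro power_mono) auto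
  then have "exp (- pi * (\<bar>of_int k\<bar> + 1 / 2)\<^sup>2) \<le> exp (- pi * x\<^sup>2)" by simp
  then show ?thesis using window_coeff_bound[of k] by (simp only: step_fun_def k_def[symmetric])
qed

lemma dual_window_bound:
  assumes g: "0 < g" "g \<le> 1"
  shows "\<exists>C. \<forall>x. \<bar>dual_window g x\<bar> \<le> C"
proof -
  have "exp (pi * x\<^sup>2) * \<bar>step_fun g x\<bar> \<le> 4 / 3" for x
  proof -
    have "exp (pi * x\<^sup>2) * \<bar>step_fun g x\<bar> \<le> exp (pi * x\<^sup>2) * (4 / 3 * exp (- pi * x\<^sup>2))"
      by (intro mult_left_mono step_fun_bound g) simp
    also have "\<dots> = 4 / 3" by (simp add: exp_minus)
    finally show ?thesis .
  qed
  then have "\<bar>dual_window g x\<bar> \<le> \<bar>g / (2 powr (1 / 4) * window_total)\<bar> * (4 / 3)" for x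
    unfolding dual_window_def abs_mult[of "g / _"] by (intro mult_left_mono) (auto simp: abs_mult)
  then show ?thesis by blast
qed

lemma exp_quadratic_integrable:
  fixes b :: real
  assumes "a > 0"
  shows "integrable lborel (\<lambda>x::real. exp (- a * x\<^sup>2 + b * \<bar>x\<bar>))"
proof (rule integrable_dominated)
  have "integrable lborel (\<lambda>x::real. exp (- pi * (a / (2 * pi)) * (norm x)\<^sup>2))"
    using assms by (intro gaussian_integral) simp
  then show "integrable lborel (\<lambda>x::real. exp (b\<^sup>2 / (2 * a)) * exp (- pi * (a / (2 * pi)) * (norm x)\<^sup>2))"
    by (rule integrable_mult_right)
  fix x :: real
  have "b * \<bar>x\<bar> \<le> a / 2 * \<bar>x\<bar>\<^sup>2 + b\<^sup>2 / (4 * (a / 2))"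
    using assms by (intro quadratic_le) simp
  then have "- a * x\<^sup>2 + b * \<bar>x\<bar> \<le> b\<^sup>2 / (2 * a) + (- pi * (a / (2 * pi)) * (norm x)\<^sup>2)"
    by (simp add: algebra_simps)
  then show "norm (exp (- a * x\<^sup>2 + b * \<bar>x\<bar>)) \<le> exp (b\<^sup>2 / (2 * a)) * exp (- pi * (a / (2 * pi)) * (norm x)\<^sup>2)"
    by (simp add: exp_add[symmetric])
qed simp

lemma gaussian_laplace_integrable:
  fixes \<psi> :: "real \<Rightarrow> complex"
  assumes [measurable]: "\<psi> \<in> borel_measurable borel" and b: "\<And>x. cmod (\<psi> x) \<le> C * exp (- pi * x\<^sup>2)"
  shows "integrable lborel (\<lambda>x. \<psi> x * exp (complex_of_real (2 * pi * x) * z))"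
proof (rule integrable_dominated)
  show "integrable lborel (\<lambda>x. C * exp (- pi * x\<^sup>2 + 2 * pi * cmod z * \<bar>x\<bar>))"
    by (intro integrable_mult_right exp_quadratic_integrable) simp
  fix x :: real
  have C: "0 \<le> C" using order_trans[OF norm_ge_zero b[of 0]] by simp
  have "x * Re z \<le> \<bar>x\<bar> * cmod z"
    by (rule order_trans[OF abs_ge_self]) (simp add: abs_mult mult_left_mono abs_Re_le_cmod)
  then have "exp (2 * pi * x * Re z) \<le> exp (2 * pi * cmod z * \<bar>x\<bar>)" by (simp add: mult_ac)
  then have "cmod (\<psi> x) * exp (2 * pi * x * Re z) \<le> (C * exp (- pi * x\<^sup>2)) * exp (2 * pi * cmod z * \<bar>x\<bar>)"
    using C by (intro mult_mono b) auto
  then show "norm (\<psi> x * exp (complex_of_real (2 * pi * x) * z)) \<le> C * exp (- pi * x\<^sup>2 + 2 * pi * cmod z * \<bar>x\<bar>)"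
    by (simp only: norm_mult norm_exp_eq_Re exp_add mult.assoc) (simp add: mult.assoc)
qed simp

text \<open>Differentiation under the integral sign, with the remainder of \<open>exp\<close> bounded quadratically.\<close>

lemma gaussian_laplace_holomorphic:
  fixes \<psi> :: "real \<Rightarrow> complex"
  assumes m [measurable]: "\<psi> \<in> borel_measurable borel" and b: "\<And>x. cmod (\<psi> x) \<le> C * exp (- pi * x\<^sup>2)"
  shows "(\<lambda>z. \<integral>x. \<psi> x * exp (complex_of_real (2 * pi * x) * z) \<partial>lborel) holomorphic_on UNIV"
proof -
  have C: "0 \<le> C" using order_trans[OF norm_ge_zero b[of 0]] by simp
  define f where "f z = (\<integral>x. \<psi> x * exp (complex_of_real (2 * pi * x) * z) \<partial>lborel)" for z
  note int = gaussian_laplace_integrable[OF m b]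
  have "\<exists>D. (f has_field_derivative D) (at z)" for z
  proof -
    define K where "K x = C * 4 * pi\<^sup>2 * (2 * exp (- pi * x\<^sup>2 + (2 * pi * (cmod z + 1) + 1) * \<bar>x\<bar>))" for x :: real
    have K: "integrable lborel K"
      unfolding K_def by (intro integrable_mult_right exp_quadratic_integrable) simp
    define d where "d x = \<psi> x * exp (complex_of_real (2 * pi * x) * z) * complex_of_real (2 * pi * x)" for x
    have sq: "x\<^sup>2 \<le> 2 * exp \<bar>x\<bar>" for x :: real
      using exp_lower_Taylor_quadratic[of "\<bar>x\<bar>"] by (simp add: power2_eq_square)
    have main: "norm (\<psi> x * exp (complex_of_real (2 * pi * x) * (z + h)) - \<psi> x * exp (complex_of_real (2 * pi * x) * z) - d x * h)
        \<le> K x * (cmod h)\<^sup>2" if h: "cmod h \<le> 1" for x h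
    proof -
      define u where "u = complex_of_real (2 * pi * x) * h"
      have nu: "cmod u = 2 * pi * \<bar>x\<bar> * cmod h" by (simp add: u_def norm_mult)
      have e: "norm (exp u - 1 - u) \<le> exp (cmod u) * (cmod u)\<^sup>2"
        using Taylor_exp_field[of u 1] by (simp add: power2_eq_square algebra_simps)
      have eu: "exp (cmod u) \<le> exp (2 * pi * \<bar>x\<bar>)"
        using h by (simp add: nu mult_left_le)
      have "x * Re z \<le> \<bar>x\<bar> * cmod z"
        by (rule order_trans[OF abs_ge_self]) (simp add: abs_mult mult_left_mono abs_Re_le_cmod)
      then have ez: "exp (2 * pi * x * Re z) \<le> exp (2 * pi * \<bar>x\<bar> * cmod z)" by (simp add: mult_ac)
      have "\<psi> x * exp (complex_of_real (2 * pi * x) * (z + h)) - \<psi> x * exp (complex_of_real (2 * pi * x) * z) - d x * h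
          = \<psi> x * exp (complex_of_real (2 * pi * x) * z) * (exp u - 1 - u)"
        by (simp add: d_def u_def exp_add ring_distribs)
      also have "norm \<dots> = cmod (\<psi> x) * exp (2 * pi * x * Re z) * norm (exp u - 1 - u)"
        by (simp add: norm_mult)
      also have "\<dots> \<le> (C * exp (- pi * x\<^sup>2)) * exp (2 * pi * \<bar>x\<bar> * cmod z) * (exp (2 * pi * \<bar>x\<bar>) * (cmod u)\<^sup>2)"
        using C eu by (intro mult_mono b ez order_trans[OF e]) auto
      also have "(cmod u)\<^sup>2 = 4 * pi\<^sup>2 * x\<^sup>2 * (cmod h)\<^sup>2" by (simp add: nu power_mult_distrib)
      also have "(C * exp (- pi * x\<^sup>2)) * exp (2 * pi * \<bar>x\<bar> * cmod z) * (exp (2 * pi * \<bar>x\<bar>) * (4 * pi\<^sup>2 * x\<^sup>2 * (cmod h)\<^sup>2))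
          = (C * 4 * pi\<^sup>2 * exp (- pi * x\<^sup>2) * exp (2 * pi * \<bar>x\<bar> * cmod z) * exp (2 * pi * \<bar>x\<bar>) * (cmod h)\<^sup>2) * x\<^sup>2"
        by (simp add: mult_ac)
      also have "\<dots> \<le> (C * 4 * pi\<^sup>2 * exp (- pi * x\<^sup>2) * exp (2 * pi * \<bar>x\<bar> * cmod z) * exp (2 * pi * \<bar>x\<bar>) * (cmod h)\<^sup>2) * (2 * exp \<bar>x\<bar>)"
        using C by (intro mult_left_mono sq) auto
      also have "\<dots> = K x * (cmod h)\<^sup>2"
        by (simp add: K_def exp_add exp_diff exp_minus ring_distribs mult_ac divide_inverse)
      finally show ?thesis .
    qed
    have dint: "integrable lborel d"
    proof -
      define R where "R x = \<psi> x * exp (complex_of_real (2 * pi * x) * (z + 1)) - \<psi> x * exp (complex_of_real (2 * pi * x) * z) - d x * 1" for x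
      have R: "integrable lborel R"
      proof (rule integrable_dominated[OF K])
        show "R \<in> borel_measurable lborel" unfolding R_def[abs_def] d_def[abs_def] by measurable
        show "norm (R x) \<le> K x" for x using main[of 1 x] by (simp add: R_def)
      qed
      have "integrable lborel (\<lambda>x. (\<psi> x * exp (complex_of_real (2 * pi * x) * (z + 1)) - \<psi> x * exp (complex_of_real (2 * pi * x) * z)) - R x)"
        by (intro Bochner_Integration.integrable_diff int R)
      then show ?thesis by (simp add: R_def)
    qed
    have est: "norm ((f (z + h) - f z) / h - (\<integral>x. d x \<partial>lborel)) \<le> (\<integral>x. K x \<partial>lborel) * cmod h"
      if h: "h \<noteq> 0" "cmod h \<le> 1" for h
    proof -
      have "f (z + h) - f z - (\<integral>x. d x \<partial>lborel) * h
          = (\<integral>x. \<psi> x * exp (complex_of_real (2 * pi * x) * (z + h)) - \<psi> x * exp (complex_of_real (2 * pi * x) * z) - d x * h \<partial>lborel)"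
        using int dint unfolding f_def by simp
      also have "norm \<dots> \<le> (\<integral>x. K x * (cmod h)\<^sup>2 \<partial>lborel)"
        by (rule norm_integral_le) (use int dint K main[OF h(2)] in auto)
      also have "\<dots> = (\<integral>x. K x \<partial>lborel) * (cmod h)\<^sup>2" by simp
      finally have "norm (f (z + h) - f z - (\<integral>x. d x \<partial>lborel) * h) / cmod h \<le> (\<integral>x. K x \<partial>lborel) * (cmod h)\<^sup>2 / cmod h"
        by (intro divide_right_mono) auto
      moreover have "norm ((f (z + h) - f z) / h - (\<integral>x. d x \<partial>lborel)) = norm (f (z + h) - f z - (\<integral>x. d x \<partial>lborel) * h) / cmod h"
        using h by (simp add: norm_divide[symmetric] diff_divide_distrib)
      ultimately show ?thesis using h by (simp add: power2_eq_square)
    qed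
    have "((\<lambda>h. (f (z + h) - f z) / h - (\<integral>x. d x \<partial>lborel)) \<longlongrightarrow> 0) (at 0)"
    proof (rule Lim_null_comparison)
      show "\<forall>\<^sub>F h in at 0. norm ((f (z + h) - f z) / h - (\<integral>x. d x \<partial>lborel)) \<le> (\<integral>x. K x \<partial>lborel) * cmod h"
        unfolding eventually_at using est by (intro exI[of _ 1]) (auto simp: dist_norm)
      show "((\<lambda>h. (\<integral>x. K x \<partial>lborel) * cmod h) \<longlongrightarrow> 0) (at 0)"
        by (auto intro!: tendsto_eq_intros)
    qed
    then have "(f has_field_derivative (\<integral>x. d x \<partial>lborel)) (at z)"
      unfolding DERIV_def by (rule LIM_zero_cancel)
    then show ?thesis by blast
  qed
  then have "f holomorphic_on UNIV" by (simp add: holomorphic_on_open)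
  then show ?thesis by (simp add: f_def[abs_def])
qed

definition bargmann_kernel_1 :: "real \<Rightarrow> complex \<Rightarrow> complex" where
  "bargmann_kernel_1 x z = complex_of_real (2 powr (1 / 4)) *
    exp (complex_of_real (2 * pi * x) * z - complex_of_real (pi * x\<^sup>2) - complex_of_real pi * z\<^sup>2 / 2)"

text \<open>The Bargmann transform of the dual window; \<open>g\<^sup>2\<close> is the area of the fundamental square of \<open>g \<int>[i]\<close>.\<close>

definition interp_1 :: "real \<Rightarrow> complex \<Rightarrow> complex" where
  "interp_1 g z = (\<integral>x. complex_of_real (dual_window g x) * bargmann_kernel_1 x z \<partial>lborel) / complex_of_real (g\<^sup>2)"

lemma dual_window_bargmann:
  assumes g: "0 < g" "g \<le> 1"
  shows "complex_of_real (dual_window g x) * bargmann_kernel_1 x z = complex_of_real (g / window_total) * exp (- complex_of_real pi * z\<^sup>2 / 2) *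
      (complex_of_real (step_fun g x) * exp (complex_of_real (2 * pi * x) * z))"
proof -
  have "bargmann_kernel_1 x z = complex_of_real (2 powr (1 / 4)) * (exp (complex_of_real (2 * pi * x) * z) * complex_of_real (exp (- (pi * x\<^sup>2))) * exp (- complex_of_real pi * z\<^sup>2 / 2))"
  proof -
    have "complex_of_real (2 * pi * x) * z - complex_of_real (pi * x\<^sup>2) - complex_of_real pi * z\<^sup>2 / 2
        = complex_of_real (2 * pi * x) * z + complex_of_real (- (pi * x\<^sup>2)) + - complex_of_real pi * z\<^sup>2 / 2"
      by simp
    then show ?thesis unfolding bargmann_kernel_1_def by (simp only: exp_add exp_of_real)
  qed
  moreover have "complex_of_real (exp (- (pi * x\<^sup>2))) = 1 / complex_of_real (exp (pi * x\<^sup>2))"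
    by (simp add: exp_minus divide_inverse)
  ultimately show ?thesis by (simp add: dual_window_def)
qed

lemma interp_1_eq:
  assumes g: "0 < g" "g \<le> 1"
  shows "interp_1 g z = complex_of_real (1 / (g * window_total)) * exp (- complex_of_real pi * z\<^sup>2 / 2) *
      (\<integral>x. complex_of_real (step_fun g x) * exp (complex_of_real (2 * pi * x) * z) \<partial>lborel)"
  unfolding interp_1_def dual_window_bargmann[OF g]
  using g by (simp add: power2_eq_square)

lemma interp_1_integrable:
  assumes g: "0 < g" "g \<le> 1"
  shows "integrable lborel (\<lambda>x. complex_of_real (dual_window g x) * bargmann_kernel_1 x z)"
proof -
  have m: "(\<lambda>x. complex_of_real (step_fun g x)) \<in> borel_measurable borel" by measurable
  show ?thesis unfolding dual_window_bargmann[OF g]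
    using step_fun_bound[OF g] by (intro integrable_mult_right gaussian_laplace_integrable[OF m, of "4/3"]) simp
qed

lemma interp_1_holomorphic:
  assumes g: "0 < g" "g \<le> 1"
  shows "interp_1 g holomorphic_on A"
proof -
  have m: "(\<lambda>x. complex_of_real (step_fun g x)) \<in> borel_measurable borel" by measurable
  have "(\<lambda>z. \<integral>x. complex_of_real (step_fun g x) * exp (complex_of_real (2 * pi * x) * z) \<partial>lborel) holomorphic_on UNIV"
    by (rule gaussian_laplace_holomorphic[OF m, of "4/3"]) (use step_fun_bound[OF g] in simp)
  then have "interp_1 g holomorphic_on UNIV"
    unfolding interp_1_eq[OF g, abs_def] by (intro holomorphic_intros) auto
  then show ?thesis by (rule holomorphic_on_subset) simp
qed

text \<open>The dual window is bounded, and the absolute value of \<open>bargmann_kernel_1 x z\<close>, integrated over \<open>x\<close>, is a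
  multiple of \<open>exp (\<pi> \<bar>z\<bar>\<^sup>2 / 2)\<close>.\<close>

lemma interp_1_bound:
  assumes g: "0 < g" "g \<le> 1"
  shows "\<exists>C. \<forall>z. cmod (interp_1 g z) \<le> C * exp (pi * (cmod z)\<^sup>2 / 2)"
proof (intro exI allI)
  fix z
  define c where "c = 1 / (g * window_total)"
  have c: "c > 0" using g window_total(2) by (simp add: c_def)
  have m: "(\<lambda>x. complex_of_real (step_fun g x)) \<in> borel_measurable borel" by measurable
  have i: "integrable lborel (\<lambda>x. complex_of_real (step_fun g x) * exp (complex_of_real (2 * pi * x) * z))"
    by (rule gaussian_laplace_integrable[OF m, of "4/3"]) (use step_fun_bound[OF g] in simp)
  have cg: "integrable lborel (\<lambda>x::real. exp (complex_of_real (- pi * 1 * x\<^sup>2) + complex_of_real (2 * pi * x) * complex_of_real (Re z)))"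
      "(\<integral>x. exp (complex_of_real (- pi * 1 * x\<^sup>2) + complex_of_real (2 * pi * x) * complex_of_real (Re z)) \<partial>(lborel::real measure))
        = exp (pi * (complex_of_real (Re z))\<^sup>2 / complex_of_real 1) / sqrt 1"
    by (rule complex_gaussian_integral_1, simp)+
  have eqr: "exp (complex_of_real (- pi * 1 * x\<^sup>2) + complex_of_real (2 * pi * x) * complex_of_real (Re z)) = complex_of_real (exp (- pi * x\<^sup>2 + 2 * pi * x * Re z))" for x :: real
    by (simp flip: exp_of_real)
  have r: "integrable lborel (\<lambda>x::real. exp (- pi * x\<^sup>2 + 2 * pi * x * Re z))"
      "(\<integral>x. exp (- pi * x\<^sup>2 + 2 * pi * x * Re z) \<partial>(lborel::real measure)) = exp (pi * (Re z)\<^sup>2)"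
  proof -
    show i: "integrable lborel (\<lambda>x::real. exp (- pi * x\<^sup>2 + 2 * pi * x * Re z))"
      using cg(1) unfolding eqr by (simp only: complex_of_real_integrable_eq)
    have "complex_of_real (\<integral>x. exp (- pi * x\<^sup>2 + 2 * pi * x * Re z) \<partial>(lborel::real measure)) = complex_of_real (exp (pi * (Re z)\<^sup>2))"
    proof -
      have "complex_of_real (\<integral>x. exp (- pi * x\<^sup>2 + 2 * pi * x * Re z) \<partial>(lborel::real measure))
          = (\<integral>x. complex_of_real (exp (- pi * x\<^sup>2 + 2 * pi * x * Re z)) \<partial>(lborel::real measure))"
        by (rule integral_complex_of_real[symmetric])
      also have "\<dots> = exp (pi * (complex_of_real (Re z))\<^sup>2)"
        using cg(2) unfolding eqr by simp
      also have "\<dots> = exp (complex_of_real (pi * (Re z)\<^sup>2))" by simp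
      finally show ?thesis by (simp only: exp_of_real)
    qed
    then show "(\<integral>x. exp (- pi * x\<^sup>2 + 2 * pi * x * Re z) \<partial>(lborel::real measure)) = exp (pi * (Re z)\<^sup>2)"
      by (simp only: of_real_eq_iff)
  qed
  have "cmod (\<integral>x. complex_of_real (step_fun g x) * exp (complex_of_real (2 * pi * x) * z) \<partial>lborel)
      \<le> (\<integral>x. 4 / 3 * exp (- pi * x\<^sup>2 + 2 * pi * x * Re z) \<partial>lborel)"
  proof (rule norm_integral_le[OF i integrable_mult_right[OF r(1)]])
    fix x
    have "\<bar>step_fun g x\<bar> * exp (2 * pi * x * Re z) \<le> 4 / 3 * exp (- pi * x\<^sup>2) * exp (2 * pi * x * Re z)"
      by (intro mult_right_mono step_fun_bound g) simp
    moreover have "4 / 3 * exp (- pi * x\<^sup>2) * exp (2 * pi * x * Re z) = 4 / 3 * exp (- pi * x\<^sup>2 + 2 * pi * x * Re z)"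
      unfolding exp_add by (rule mult.assoc)
    moreover have "norm (complex_of_real (step_fun g x) * exp (complex_of_real (2 * pi * x) * z)) = \<bar>step_fun g x\<bar> * exp (2 * pi * x * Re z)"
      by (simp add: norm_mult)
    ultimately show "norm (complex_of_real (step_fun g x) * exp (complex_of_real (2 * pi * x) * z)) \<le> 4 / 3 * exp (- pi * x\<^sup>2 + 2 * pi * x * Re z)"
      by (simp only:)
  qed
  also have "\<dots> = 4 / 3 * exp (pi * (Re z)\<^sup>2)" using r(2) by simp
  finally have b: "cmod (\<integral>x. complex_of_real (step_fun g x) * exp (complex_of_real (2 * pi * x) * z) \<partial>lborel) \<le> 4 / 3 * exp (pi * (Re z)\<^sup>2)" .
  have "cmod (interp_1 g z) = c * exp (Re (- complex_of_real pi * z\<^sup>2 / 2)) * cmod (\<integral>x. complex_of_real (step_fun g x) * exp (complex_of_real (2 * pi * x) * z) \<partial>lborel)"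
    unfolding interp_1_eq[OF g] c_def[symmetric] using c by (simp add: norm_mult)
  also have "\<dots> \<le> c * exp (Re (- complex_of_real pi * z\<^sup>2 / 2)) * (4 / 3 * exp (pi * (Re z)\<^sup>2))"
    using c b by (intro mult_left_mono) auto
  also have "\<dots> = (c * (4 / 3)) * exp (Re (- complex_of_real pi * z\<^sup>2 / 2) + pi * (Re z)\<^sup>2)"
    unfolding exp_add by (simp only: mult_ac)
  also have "Re (- complex_of_real pi * z\<^sup>2 / 2) + pi * (Re z)\<^sup>2 = pi * (cmod z)\<^sup>2 / 2"
    unfolding cmod_power2 by (simp add: power2_eq_square field_simps)
  finally show "cmod (interp_1 g z) \<le> (1 / (g * window_total) * (4 / 3)) * exp (pi * (cmod z)\<^sup>2 / 2)"
    by (simp only: c_def)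
qed

text \<open>Cutting the line at the jumps of the step function leaves the Laurent series with coefficients
  \<open>window_coeff\<close> at \<open>exp (2 \<pi> g z)\<close>, times the integral of \<open>exp (2 \<pi> z x)\<close> over a single step.\<close>

lemma step_fun_series:
  assumes g: "0 < g" "g \<le> 1"
  shows "((\<lambda>k. window_coeff k * exp (complex_of_real (2 * pi * g * of_int k) * z) *
      (\<integral>x. indicator {- g / 2..<g / 2} x * exp (complex_of_real (2 * pi * x) * z) \<partial>lborel)) has_sum
      (\<integral>x. complex_of_real (step_fun g x) * exp (complex_of_real (2 * pi * x) * z) \<partial>lborel)) UNIV"
proof -
  define F where "F x = complex_of_real (step_fun g x) * exp (complex_of_real (2 * pi * x) * z)" for x
  define f where "f k x = of_bool (\<lfloor>x / g + 1 / 2\<rfloor> = k) * F x" for k x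
  have m: "(\<lambda>x. complex_of_real (step_fun g x)) \<in> borel_measurable borel" by measurable
  have Fi: "integrable lborel F" unfolding F_def
    by (rule gaussian_laplace_integrable[OF m, of "4/3"]) (use step_fun_bound[OF g] in simp)
  have "((\<lambda>k. \<integral>x. f k x \<partial>lborel) has_sum (\<integral>x. F x \<partial>lborel)) UNIV"
  proof (rule has_sum_integral_dominated(2)[where G="\<lambda>x. norm (F x)"])
    show "f k \<in> borel_measurable lborel" for k
      unfolding f_def F_def by measurable
    show "(\<Sum>i\<in>J. norm (f i x)) \<le> norm (F x)" if "finite J" for J x
    proof -
      have "(\<Sum>i\<in>J. norm (f i x)) = (\<Sum>i\<in>J. if i = \<lfloor>x / g + 1 / 2\<rfloor> then norm (F x) else 0)"
        by (intro sum.cong) (auto simp: f_def)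
      then show ?thesis using that by simp
    qed
    show "((\<lambda>k. f k x) has_sum F x) UNIV" for x
      by (rule has_sum_finite_neutralI[of "{\<lfloor>x / g + 1 / 2\<rfloor>}"]) (auto simp: f_def)
  qed (use Fi in auto)
  moreover have "(\<integral>x. f k x \<partial>lborel) = window_coeff k * exp (complex_of_real (2 * pi * g * of_int k) * z) *
      (\<integral>x. indicator {- g / 2..<g / 2} x * exp (complex_of_real (2 * pi * x) * z) \<partial>lborel)" for k
  proof -
    have mf: "f k \<in> borel_measurable borel" unfolding f_def F_def by measurable
    have "(\<integral>x. f k x \<partial>lborel) = (\<integral>x. f k (x + g * of_int k) \<partial>lborel)"
      by (rule integral_lborel_translation(1)[OF mf, symmetric])
    also have "(\<lambda>x. f k (x + g * of_int k)) = (\<lambda>x. (window_coeff k * exp (complex_of_real (2 * pi * g * of_int k) * z)) *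
        (indicator {- g / 2..<g / 2} x * exp (complex_of_real (2 * pi * x) * z)))"
    proof
      fix x
      have "(x + g * of_int k) / g + 1 / 2 = x / g + 1 / 2 + of_int k"
        using g by (simp add: add_divide_distrib)
      then have fl: "\<lfloor>(x + g * of_int k) / g + 1 / 2\<rfloor> = \<lfloor>x / g + 1 / 2\<rfloor> + k"
        by (simp only: floor_add_int)
      have "\<lfloor>x / g + 1 / 2\<rfloor> = 0 \<longleftrightarrow> x \<in> {- g / 2..<g / 2}"
        using g by (auto simp: floor_eq_iff field_simps)
      then show "f k (x + g * of_int k) = (window_coeff k * exp (complex_of_real (2 * pi * g * of_int k) * z)) *
        (indicator {- g / 2..<g / 2} x * exp (complex_of_real (2 * pi * x) * z))"
        unfolding f_def F_def step_fun_def fl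
        by (auto simp: indicator_def exp_add[symmetric] algebra_simps)
    qed
    also have "(\<integral>x. (window_coeff k * exp (complex_of_real (2 * pi * g * of_int k) * z)) *
        (indicator {- g / 2..<g / 2} x * exp (complex_of_real (2 * pi * x) * z)) \<partial>lborel) = (window_coeff k * exp (complex_of_real (2 * pi * g * of_int k) * z)) *
        (\<integral>x. indicator {- g / 2..<g / 2} x * exp (complex_of_real (2 * pi * x) * z) \<partial>lborel)"
      by (rule integral_mult_right_zero)
    finally show ?thesis .
  qed
  ultimately show ?thesis by (simp add: F_def)
qed

lemma integral_exp_period:
  fixes n :: int
  assumes g: "0 < g" and n: "n \<noteq> 0"
  shows "(\<integral>x. indicator {- g / 2..<g / 2} x * exp (complex_of_real (2 * pi * x) * (\<i> * of_int n / complex_of_real g)) \<partial>lborel) = 0"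
proof -
  define c where "c = 2 * pi * \<i> * of_int n / complex_of_real g"
  have c0: "c \<noteq> 0" using g n by (simp add: c_def)
  define G where "G x = exp (complex_of_real x * c) / c" for x
  have "(\<integral>x. indicator {- g / 2..<g / 2} x * exp (complex_of_real (2 * pi * x) * (\<i> * of_int n / complex_of_real g)) \<partial>lborel)
      = (\<integral>x. indicator {- g / 2..g / 2} x *\<^sub>R exp (complex_of_real x * c) \<partial>lborel)"
  proof (rule integral_cong_AE)
    show "AE x in lborel. indicator {- g / 2..<g / 2} x * exp (complex_of_real (2 * pi * x) * (\<i> * of_int n / complex_of_real g))
      = indicator {- g / 2..g / 2} x *\<^sub>R exp (complex_of_real x * c)"
      using AE_lborel_singleton[of "g / 2"]
      by eventually_elim (auto simp: indicator_def c_def mult_ac)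
  qed measurable
  also have "\<dots> = G (g / 2) - G (- g / 2)"
  proof (rule integral_FTC_Icc)
    show "- g / 2 \<le> g / 2" using g by simp
    show "(G has_vector_derivative exp (complex_of_real x * c)) (at x within {- g / 2..g / 2})" for x
    proof -
      have "((\<lambda>w. exp (w * c) / c) has_field_derivative exp (complex_of_real x * c)) (at (complex_of_real x))"
        using c0 by (auto intro!: derivative_eq_intros)
      then show ?thesis unfolding G_def
        using has_vector_derivative_real_field has_vector_derivative_at_within by blast
    qed
    show "continuous_on {- g / 2..g / 2} (\<lambda>x. exp (complex_of_real x * c))"
      by (intro continuous_intros)
  qed
  also have "\<dots> = 0"
  proof -
    have "complex_of_real (g / 2) * c = complex_of_real (- g / 2) * c + (of_int (2 * n) * pi) * \<i>"
      using g by (simp add: c_def field_simps)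
    then have "exp (complex_of_real (g / 2) * c) = exp (complex_of_real (- g / 2) * c)"
      unfolding exp_eq by blast
    then show ?thesis by (simp add: G_def)
  qed
  finally show ?thesis .
qed

text \<open>At \<open>z = (m + i n) / g\<close> the Laurent series is evaluated at \<open>exp (2 \<pi> m)\<close>, and this vanishes unless
  \<open>m = 0\<close>.  If \<open>m = 0\<close>, the integral over a step is that of \<open>exp (2 \<pi> i n x / g)\<close> over a full period, and it
  vanishes unless \<open>n = 0\<close>.\<close>

theorem interp_1_lattice:
  assumes g: "0 < g" "g \<le> 1" and k: "k \<in> gauss_int"
  shows "interp_1 g (k / complex_of_real g) = (if k = 0 then 1 else 0)"
proof -
  obtain m n where mn: "k = of_int m + \<i> * of_int n" using k by (auto simp: gauss_int_def)
  define z where "z = k / complex_of_real g"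
  define J where "J = (\<integral>x. indicator {- g / 2..<g / 2} x * exp (complex_of_real (2 * pi * x) * z) \<partial>lborel)"
  define I where "I = (\<integral>x. complex_of_real (step_fun g x) * exp (complex_of_real (2 * pi * x) * z) \<partial>lborel)"
  have ser: "((\<lambda>k. window_coeff k * exp (complex_of_real (2 * pi * g * of_int k) * z) * J) has_sum I) UNIV"
    unfolding I_def J_def by (rule step_fun_series[OF g])
  have per: "exp (complex_of_real (2 * pi * g * of_int k) * z) = complex_of_real (exp (2 * pi * of_int k * of_int m))" for k :: int
  proof -
    have "complex_of_real (2 * pi * g * of_int k) * z = complex_of_real (2 * pi * of_int k * of_int m) + (of_int (2 * (k * n)) * pi) * \<i>"
      using g by (simp add: z_def mn field_simps)
    then have "exp (complex_of_real (2 * pi * g * of_int k) * z) = exp (complex_of_real (2 * pi * of_int k * of_int m))"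
      unfolding exp_eq by blast
    then show ?thesis by (simp only: exp_of_real)
  qed
  have ws: "((\<lambda>k. complex_of_real (window_coeff k * exp (2 * pi * of_int k * of_int m)) * J) has_sum
      (complex_of_real (if m = 0 then window_total else 0) * J)) UNIV"
    using window_series_zero[of m] window_total(1)
    by (intro has_sum_cmult_left has_sum_of_real) auto
  have I: "I = complex_of_real (if m = 0 then window_total else 0) * J"
    using ser ws unfolding per by (simp add: has_sum_unique)
  show ?thesis
  proof (cases "k = 0")
    case True
    then have z0: "z = 0" by (simp add: z_def)
    have "J = (\<integral>x. complex_of_real (indicator {- g / 2..<g / 2} x) \<partial>lborel)"
      unfolding J_def z0 by (intro Bochner_Integration.integral_cong) (auto simp: indicator_def)
    also have "\<dots> = complex_of_real (\<integral>x. indicator {- g / 2..<g / 2} x \<partial>lborel)"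
      by (rule integral_complex_of_real)
    also have "\<dots> = complex_of_real g" using g by simp
    finally have "I = complex_of_real window_total * complex_of_real g" using True mn I by (simp add: complex_eq_iff)
    then show ?thesis
      using True g window_total(2) unfolding interp_1_eq[OF g] z_def[symmetric] I_def[symmetric]
      by (simp add: z0)
  next
    case False
    have "I = 0"
    proof (cases "m = 0")
      case True
      then have n: "n \<noteq> 0" using False mn by simp
      have "z = \<i> * of_int n / complex_of_real g" by (simp add: z_def mn True)
      then have "J = 0" unfolding J_def using integral_exp_period[OF g(1) n] by simp
      then show ?thesis by (simp add: I)
    qed (simp add: I)
    then show ?thesis
      using False unfolding interp_1_eq[OF g] z_def[symmetric] I_def[symmetric] by simp
  qed
qed

section \<open>A Poisson summation formula in the plane\<close>

lemma norm_sum_square_lower: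
  fixes x y :: "'a::real_normed_vector"
  shows "(norm x)\<^sup>2 / 2 - (norm y)\<^sup>2 \<le> (norm (x + y))\<^sup>2"
proof -
  have "norm x \<le> norm (x + y) + norm y" by (metis add_diff_cancel_right' norm_triangle_ineq4)
  then have "(norm x)\<^sup>2 \<le> (norm (x + y) + norm y)\<^sup>2" by (intro power_mono) auto
  also have "\<dots> \<le> 2 * (norm (x + y))\<^sup>2 + 2 * (norm y)\<^sup>2"
    using sum_squares_bound[of "norm (x + y)" "norm y"] by (simp add: power2_sum)
  finally show ?thesis by simp
qed

lemma summable_gauss_norm:
  fixes b :: real
  assumes "b > 0"
  shows "(\<lambda>k. exp (- b * (cmod k)\<^sup>2)) summable_on gauss_int"
proof -
  define e where "e k = exp (- b * (of_int k)\<^sup>2)" for k :: int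
  have e: "e summable_on UNIV" using summable_gauss_int[OF assms, of 0] by (simp add: e_def[abs_def])
  have "(\<lambda>p. e (fst p) * e (snd p)) summable_on UNIV \<times> UNIV"
  proof (rule summable_on_SigmaI[where g="\<lambda>x. e x * infsum e UNIV"])
    show "((\<lambda>y. e (fst (x, y)) * e (snd (x, y))) has_sum e x * infsum e UNIV) UNIV" for x
      using has_sum_cmult_right[OF has_sum_infsum[OF e], of "e x"] by simp
    show "(\<lambda>x. e x * infsum e UNIV) summable_on UNIV" by (rule summable_on_cmult_left[OF e])
  qed (simp add: e_def)
  also have "(\<lambda>p. e (fst p) * e (snd p)) = (\<lambda>k. exp (- b * (cmod k)\<^sup>2)) \<circ> (\<lambda>(a, b). Complex (of_int a) (of_int b))"
    by (auto simp: fun_eq_iff e_def cmod_power2 algebra_simps simp flip: exp_add)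
  finally show ?thesis
    by (simp only: gauss_int_image summable_on_reindex[OF inj_gauss_int] UNIV_Times_UNIV)
qed

text \<open>The bound is uniform in the translate, because \<open>c\<close> may be reduced modulo the lattice.\<close>

lemma gauss_sum_uniform:
  assumes a: "a > 0" and g: "g > 0"
  shows "\<exists>M. \<forall>c. (\<lambda>m. exp (- a * (cmod (of_real g * m + c))\<^sup>2)) summable_on gauss_int \<and>
    infsum (\<lambda>m. exp (- a * (cmod (of_real g * m + c))\<^sup>2)) gauss_int \<le> M"
proof (intro exI allI)
  fix c :: complex
  define h where "h m = exp (a * (4 * g\<^sup>2)) * exp (- (a * g\<^sup>2 / 2) * (cmod m)\<^sup>2)" for m :: complex
  have h: "h summable_on gauss_int"
    unfolding h_def using a g by (intro summable_on_cmult_right summable_gauss_norm) simp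
  define m0 where "m0 = Complex (of_int \<lfloor>Re c / g\<rfloor>) (of_int \<lfloor>Im c / g\<rfloor>)"
  have m0: "m0 \<in> gauss_int" by (simp add: m0_def mem_gauss_int_iff)
  define r where "r = c - of_real g * m0"
  have r: "cmod r \<le> 2 * g"
  proof -
    have fl: "\<bar>t - g * of_int \<lfloor>t / g\<rfloor>\<bar> \<le> g" for t
    proof -
      have "of_int \<lfloor>t / g\<rfloor> \<le> t / g" "t / g \<le> of_int \<lfloor>t / g\<rfloor> + 1" by linarith+
      then have "g * of_int \<lfloor>t / g\<rfloor> \<le> g * (t / g)" "g * (t / g) \<le> g * (of_int \<lfloor>t / g\<rfloor> + 1)"
        using g by (intro mult_left_mono; simp)+
      then show ?thesis using g by (simp add: algebra_simps abs_le_iff)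
    qed
    have "cmod r \<le> \<bar>Re r\<bar> + \<bar>Im r\<bar>" by (rule cmod_le)
    also have "\<dots> \<le> g + g" using fl[of "Re c"] fl[of "Im c"] by (intro add_mono) (simp_all add: r_def m0_def)
    finally show ?thesis by simp
  qed
  define f where "f m = exp (- a * (cmod (of_real g * m + r))\<^sup>2)" for m
  have fh: "f m \<le> h m" for m
  proof -
    have "(cmod r)\<^sup>2 \<le> (2 * g)\<^sup>2" using r by (intro power_mono) auto
    then have "g\<^sup>2 * (cmod m)\<^sup>2 / 2 - 4 * g\<^sup>2 \<le> (cmod (of_real g * m + r))\<^sup>2"
      using norm_sum_square_lower[of "of_real g * m" r] by (simp add: norm_mult power_mult_distrib)
    then have "a * (g\<^sup>2 * (cmod m)\<^sup>2 / 2 - 4 * g\<^sup>2) \<le> a * (cmod (of_real g * m + r))\<^sup>2"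
      using a by (intro mult_left_mono) auto
    then have "f m \<le> exp (a * (4 * g\<^sup>2) + - (a * g\<^sup>2 / 2) * (cmod m)\<^sup>2)"
      by (simp add: f_def algebra_simps)
    then show ?thesis by (simp only: h_def exp_add)
  qed
  have fs: "f summable_on gauss_int"
    by (rule summable_on_comparison_test[OF h fh]) (simp add: f_def)
  have bij: "bij_betw (\<lambda>m. m + m0) gauss_int gauss_int"
    using m0 by (intro bij_betwI[of _ _ _ "\<lambda>m. m - m0"]) auto
  have eq: "f (m + m0) = exp (- a * (cmod (of_real g * m + c))\<^sup>2)" for m
    by (simp add: f_def r_def algebra_simps)
  have "(f has_sum infsum f gauss_int) gauss_int" by (rule has_sum_infsum[OF fs])
  then have s: "((\<lambda>m. exp (- a * (cmod (of_real g * m + c))\<^sup>2)) has_sum infsum f gauss_int) gauss_int"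
    using has_sum_reindex_bij_betw[OF bij, of f] by (simp add: eq)
  have "infsum f gauss_int \<le> infsum h gauss_int" by (rule infsum_mono[OF fs h fh])
  with s show "(\<lambda>m. exp (- a * (cmod (of_real g * m + c))\<^sup>2)) summable_on gauss_int \<and>
    infsum (\<lambda>m. exp (- a * (cmod (of_real g * m + c))\<^sup>2)) gauss_int \<le>
      infsum (\<lambda>m. exp (a * (4 * g\<^sup>2)) * exp (- (a * g\<^sup>2 / 2) * (cmod m)\<^sup>2)) gauss_int"
    by (simp add: has_sum_iff h_def[abs_def])
qed

lemma integrable_half_open: "integrable lborel (indicator {a..<b::real} :: real \<Rightarrow> real)"
  by (rule integrable_real_indicator) (cases "a \<le> b"; simp)+

text \<open>The Fourier coefficient of \<open>cos (\<pi> x) ^ (2 * N)\<close> at the frequency \<open>j - N\<close>.\<close>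

definition cos_power_coeff :: "nat \<Rightarrow> nat \<Rightarrow> real" where
  "cos_power_coeff N j = real ((2 * N) choose j) / 4 ^ N"

lemma cos_power_expansion:
  "complex_of_real (cos (pi * x) ^ (2 * N)) =
    (\<Sum>j\<le>2 * N. cos_power_coeff N j * exp (2 * pi * \<i> * of_int (int j - int N) * of_real x))"
proof -
  define e where "e = exp (pi * \<i> * of_real x)"
  have e0: "e \<noteq> 0" by (simp add: e_def)
  have "complex_of_real (cos (pi * x)) = (e + inverse e) / 2"
    by (simp add: e_def cos_exp_eq exp_minus[symmetric] mult_ac flip: cos_of_real)
  then have "complex_of_real (cos (pi * x) ^ (2 * N)) = (e + inverse e) ^ (2 * N) / 2 ^ (2 * N)"
    by (simp only: of_real_power power_divide)
  also have "(e + inverse e) ^ (2 * N) = (\<Sum>j\<le>2 * N. of_nat ((2 * N) choose j) * e ^ j * inverse e ^ (2 * N - j))"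
    by (rule binomial_ring)
  also have "\<dots> / 2 ^ (2 * N) = (\<Sum>j\<le>2 * N. of_nat ((2 * N) choose j) * e ^ j * inverse e ^ (2 * N - j) / 2 ^ (2 * N))"
    by (rule sum_divide_distrib)
  also have "\<dots> = (\<Sum>j\<le>2 * N. cos_power_coeff N j * exp (2 * pi * \<i> * of_int (int j - int N) * of_real x))"
  proof (rule sum.cong[OF refl])
    fix j assume "j \<in> {..2 * N}"
    then have j: "real (2 * N - j) = 2 * real N - real j" by simp
    have "e ^ j * inverse e ^ (2 * N - j) = exp (of_nat j * (pi * \<i> * of_real x) + of_nat (2 * N - j) * - (pi * \<i> * of_real x))"
      unfolding e_def exp_minus[symmetric] exp_of_nat_mult[symmetric] by (rule exp_add[symmetric])
    also have "of_nat j * (pi * \<i> * of_real x) + of_nat (2 * N - j) * - (pi * \<i> * of_real x)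
        = 2 * pi * \<i> * of_int (int j - int N) * of_real x"
    proof -
      have "complex_of_nat (2 * N - j) = 2 * of_nat N - of_nat j"
        using j by (metis of_real_diff of_real_mult of_real_numeral of_real_of_nat_eq)
      then show ?thesis unfolding \<open>complex_of_nat (2 * N - j) = _\<close> by (simp add: algebra_simps)
    qed
    finally have "e ^ j * inverse e ^ (2 * N - j) = exp (2 * pi * \<i> * of_int (int j - int N) * of_real x)" .
    moreover have "(2::complex) ^ (2 * N) = 4 ^ N" by (simp add: power_mult)
    ultimately show "of_nat ((2 * N) choose j) * e ^ j * inverse e ^ (2 * N - j) / 2 ^ (2 * N)
        = cos_power_coeff N j * exp (2 * pi * \<i> * of_int (int j - int N) * of_real x)"
      by (simp add: cos_power_coeff_def mult.assoc)
  qed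
  finally show ?thesis .
qed

lemma cos_power_mean:
  assumes g: "g > 0"
  shows "(\<integral>x. indicator {- g / 2..<g / 2} x * cos (pi * (x / g)) ^ (2 * N) \<partial>lborel) = g * cos_power_coeff N N"
proof -
  have ind: "integrable lborel (\<lambda>x::real. indicator {- g / 2..<g / 2} x * exp (2 * pi * \<i> * of_int n * of_real (x / g)))" for n :: int
    by (rule integrable_dominated[OF integrable_half_open[of "- g / 2" "g / 2"]])
       (auto simp: norm_mult norm_exp_eq_Re indicator_def)
  have "complex_of_real (\<integral>x. indicator {- g / 2..<g / 2} x * cos (pi * (x / g)) ^ (2 * N) \<partial>lborel)
      = (\<integral>x. complex_of_real (indicator {- g / 2..<g / 2} x * cos (pi * (x / g)) ^ (2 * N)) \<partial>lborel)"
    by (rule integral_complex_of_real[symmetric])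
  also have "\<dots> = (\<integral>x. (\<Sum>j\<le>2 * N. cos_power_coeff N j * (indicator {- g / 2..<g / 2} x * exp (2 * pi * \<i> * of_int (int j - int N) * of_real (x / g)))) \<partial>lborel)"
  proof (rule Bochner_Integration.integral_cong[OF refl])
    fix x
    have "complex_of_real (indicator {- g / 2..<g / 2} x * cos (pi * (x / g)) ^ (2 * N))
        = indicator {- g / 2..<g / 2} x * complex_of_real (cos (pi * (x / g)) ^ (2 * N))"
      by (simp add: indicator_def)
    then show "complex_of_real (indicator {- g / 2..<g / 2} x * cos (pi * (x / g)) ^ (2 * N))
       = (\<Sum>j\<le>2 * N. cos_power_coeff N j * (indicator {- g / 2..<g / 2} x * exp (2 * pi * \<i> * of_int (int j - int N) * of_real (x / g))))"
      unfolding cos_power_expansion by (simp only: sum_distrib_left mult.left_commute)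
  qed
  also have "\<dots> = (\<Sum>j\<le>2 * N. cos_power_coeff N j * (\<integral>x. indicator {- g / 2..<g / 2} x * exp (2 * pi * \<i> * of_int (int j - int N) * of_real (x / g)) \<partial>lborel))"
    by (subst Bochner_Integration.integral_sum) (simp_all only: integrable_mult_right[OF ind] integral_mult_right_zero)
  also have "\<dots> = (\<Sum>j\<le>2 * N. if j = N then complex_of_real (cos_power_coeff N N) * complex_of_real g else 0)"
  proof (rule sum.cong[OF refl])
    fix j
    show "cos_power_coeff N j * (\<integral>x. indicator {- g / 2..<g / 2} x * exp (2 * pi * \<i> * of_int (int j - int N) * of_real (x / g)) \<partial>lborel)
       = (if j = N then complex_of_real (cos_power_coeff N N) * complex_of_real g else 0)"
    proof (cases "j = N")
      case True
      have "(\<integral>x. indicator {- g / 2..<g / 2} x * exp (2 * pi * \<i> * of_int (int j - int N) * of_real (x / g)) \<partial>lborel)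
        = (\<integral>x. complex_of_real (indicator {- g / 2..<g / 2} x) \<partial>lborel)"
        unfolding True by (intro Bochner_Integration.integral_cong) (auto simp: indicator_def)
      also have "\<dots> = of_real g" using g by (subst integral_complex_of_real) simp
      finally show ?thesis using True by simp
    next
      case False
      have "(\<integral>x. indicator {- g / 2..<g / 2} x * exp (2 * pi * \<i> * of_int (int j - int N) * of_real (x / g)) \<partial>lborel)
        = (\<integral>x. indicator {- g / 2..<g / 2} x * exp (complex_of_real (2 * pi * x) * (\<i> * of_int (int j - int N) / complex_of_real g)) \<partial>lborel)"
        by (intro Bochner_Integration.integral_cong) (auto simp: mult_ac)
      also have "\<dots> = 0" using False by (intro integral_exp_period g) simp
      finally show ?thesis using False by simp
    qed
  qed
  also have "\<dots> = complex_of_real (g * cos_power_coeff N N)" by simp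
  finally show ?thesis by (simp only: of_real_eq_iff)
qed

definition cos_kernel :: "real \<Rightarrow> nat \<Rightarrow> complex \<Rightarrow> real" where
  "cos_kernel g N w = cos (pi * (Re w / g)) ^ (2 * N) * cos (pi * (Im w / g)) ^ (2 * N)"

definition centred_square :: "real \<Rightarrow> complex set" where
  "centred_square g = {w. Re w \<in> {- g / 2..<g / 2} \<and> Im w \<in> {- g / 2..<g / 2}}"

lemma centred_square_measurable [measurable]: "centred_square g \<in> sets borel"
  unfolding centred_square_def by measurable

lemma cos_kernel_measurable [measurable]: "cos_kernel g N \<in> borel_measurable borel"
  unfolding cos_kernel_def by measurable

lemma cos_kernel_bounds: "0 \<le> cos_kernel g N w" "cos_kernel g N w \<le> 1"
proof -
  have "0 \<le> cos t ^ (2 * N)" "cos t ^ (2 * N) \<le> 1" for t :: real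
    using power_mono[of "\<bar>cos t\<bar>" 1 "2 * N"] by (simp_all add: power_mult)
  then show "0 \<le> cos_kernel g N w" "cos_kernel g N w \<le> 1"
    unfolding cos_kernel_def by (auto intro: mult_le_one)
qed

lemma integral_cos_kernel:
  assumes g: "g > 0"
  shows "(\<integral>w. indicator (centred_square g) w * cos_kernel g N w \<partial>lborel) = (g * cos_power_coeff N N)\<^sup>2"
    and "integrable lborel (\<lambda>w. indicator (centred_square g) w * cos_kernel g N w)"
proof -
  define T where "T = (\<lambda>x::real^2. Complex (x $ 1) (x $ 2))"
  have T: "linear T" "norm (T x) = norm x" for x
  proof -
    show "linear T" by (rule linearI) (auto simp: T_def complex_eq_iff)
    show "norm (T x) = norm x" by (simp add: T_def cmod_def norm_vec_def L2_set_def sum_2)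
  qed
  have D: "DIM(real^2) = DIM(complex)" by simp
  define q where "q x = complex_of_real (indicator {- g / 2..<g / 2} x * cos (pi * (x / g)) ^ (2 * N))" for x
  have qi: "integrable lborel q"
  proof (rule integrable_dominated[OF integrable_half_open[of "- g / 2" "g / 2"]])
    show "q \<in> borel_measurable lborel" unfolding q_def by measurable
    show "norm (q x) \<le> indicator {- g / 2..<g / 2} x" for x
      using power_mono[of "\<bar>cos (pi * (x / g))\<bar>" 1 "2 * N"] by (simp add: q_def indicator_def norm_power power_abs)
  qed
  let ?f = "\<lambda>w. indicator (centred_square g) w * cos_kernel g N w"
  have fT: "complex_of_real (?f (T x)) = (\<Prod>j\<in>UNIV. q (x $ j))" for x
    by (simp add: T_def q_def UNIV_2 centred_square_def cos_kernel_def indicator_def)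
  have m: "(\<lambda>w. complex_of_real (?f w)) \<in> borel_measurable borel" by measurable
  have "integrable lborel (\<lambda>x. complex_of_real (?f (T x)))"
    unfolding fT by (rule integral_lborel_prod_vec(1)[OF qi])
  then have i: "integrable lborel (\<lambda>w. complex_of_real (?f w))"
    using integral_lborel_isometry(2)[OF T D m] by simp
  then show "integrable lborel ?f" by (simp only: complex_of_real_integrable_eq)
  have "complex_of_real (\<integral>w. ?f w \<partial>lborel) = (\<integral>w. complex_of_real (?f w) \<partial>lborel)"
    by (rule integral_complex_of_real[symmetric])
  also have "\<dots> = (\<integral>x. complex_of_real (?f (T x)) \<partial>lborel)"
    by (rule integral_lborel_isometry(1)[OF T D m, symmetric])
  also have "\<dots> = (\<Prod>j\<in>(UNIV::2 set). \<integral>t. q t \<partial>lborel)"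
    unfolding fT by (rule integral_lborel_prod_vec(2)[OF qi])
  also have "(\<integral>t. q t \<partial>lborel) = complex_of_real (g * cos_power_coeff N N)"
    unfolding q_def integral_complex_of_real cos_power_mean[OF g] ..
  finally show "(\<integral>w. ?f w \<partial>lborel) = (g * cos_power_coeff N N)\<^sup>2"
    by (simp add: power2_eq_square flip: of_real_mult of_real_power)
qed

lemma mem_centred_square_shift:
  assumes g: "g > 0" and k: "k \<in> gauss_int"
  shows "w - of_real g * k \<in> centred_square g \<longleftrightarrow>
    k = Complex (of_int \<lfloor>Re w / g + 1 / 2\<rfloor>) (of_int \<lfloor>Im w / g + 1 / 2\<rfloor>)"
proof -
  obtain m n :: int where mn: "k = Complex (of_int m) (of_int n)"
    using k by (auto simp: gauss_int_image)
  have *: "t - g * of_int m \<in> {- g / 2..<g / 2} \<longleftrightarrow> \<lfloor>t / g + 1 / 2\<rfloor> = m" for t m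
    using g by (auto simp: floor_eq_iff field_simps)
  have "w - of_real g * k \<in> centred_square g \<longleftrightarrow>
      Re w - g * of_int m \<in> {- g / 2..<g / 2} \<and> Im w - g * of_int n \<in> {- g / 2..<g / 2}"
    by (simp add: centred_square_def mn)
  then show ?thesis unfolding * mn by auto
qed

lemma cos_kernel_periodic:
  assumes g: "g > 0" and k: "k \<in> gauss_int"
  shows "cos_kernel g N (w + of_real g * k) = cos_kernel g N w"
proof -
  obtain m n :: int where mn: "k = Complex (of_int m) (of_int n)"
    using k by (auto simp: gauss_int_image)
  have "cos (pi * ((t + g * of_int m) / g)) ^ (2 * N) = cos (pi * (t / g)) ^ (2 * N)" for t :: real and m :: int
  proof -
    have "pi * ((t + g * of_int m) / g) = pi * (t / g) + of_int m * pi"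
      using g by (simp add: field_simps)
    moreover have s: "sin (of_int m * pi) = 0" by (auto simp: sin_zero_iff_int2)
    moreover have "(cos (of_int m * pi))\<^sup>2 = 1" using sin_cos_squared_add[of "of_int m * pi"] s by simp
    ultimately have "(cos (pi * ((t + g * of_int m) / g)))\<^sup>2 = (cos (pi * (t / g)))\<^sup>2"
      by (simp only: cos_add power_mult_distrib) (simp add: power_mult_distrib)
    then show ?thesis by (simp add: power_mult)
  qed
  then show ?thesis by (simp add: cos_kernel_def mn)
qed

text \<open>The plane is cut into the translates of the square, and the kernel is periodic.\<close>

lemma integral_unfold_square:
  fixes v :: "complex \<Rightarrow> complex"
  assumes g: "g > 0" and v: "integrable lborel v"
  shows "((\<lambda>k. \<integral>w. indicator (centred_square g) w * (v (w + of_real g * k) * of_real (cos_kernel g N w)) \<partial>lborel)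
    has_sum (\<integral>w. v w * of_real (cos_kernel g N w) \<partial>lborel)) gauss_int"
proof -
  have [measurable]: "v \<in> borel_measurable borel" using v by simp
  define F where "F w = v w * of_real (cos_kernel g N w)" for w
  define k0 where "k0 w = Complex (of_int \<lfloor>Re w / g + 1 / 2\<rfloor>) (of_int \<lfloor>Im w / g + 1 / 2\<rfloor>)" for w
  have k0: "k0 w \<in> gauss_int" for w by (simp add: k0_def mem_gauss_int_iff)
  have mem: "w - of_real g * k \<in> centred_square g \<longleftrightarrow> k = k0 w" if "k \<in> gauss_int" for w k
    using mem_centred_square_shift[OF g that] by (simp add: k0_def)
  define f where "f k w = indicator (centred_square g) (w - of_real g * k) * F w" for k w
  have mf[measurable]: "f k \<in> borel_measurable borel" for k
    unfolding f_def F_def by measurable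
  have fk: "f k w = (if k = k0 w then F w else 0)" if "k \<in> gauss_int" for k w
    using mem[OF that] by (simp add: f_def indicator_def)
  have Fv: "norm (F w) \<le> norm (v w)" for w
    using cos_kernel_bounds[of g N w] by (simp add: F_def norm_mult mult_left_le)
  have "((\<lambda>k. \<integral>w. f k w \<partial>lborel) has_sum (\<integral>w. F w \<partial>lborel)) gauss_int"
  proof (rule has_sum_integral_dominated(2)[where G="\<lambda>w. norm (v w)", OF countable_gauss_int])
    show "(\<Sum>k\<in>J. norm (f k w)) \<le> norm (v w)" if "finite J" "J \<subseteq> gauss_int" for J w
    proof -
      have "(\<Sum>k\<in>J. norm (f k w)) = (\<Sum>k\<in>J. if k = k0 w then norm (F w) else 0)"
        using that(2) by (intro sum.cong) (auto simp: fk)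
      also have "\<dots> \<le> norm (F w)" using that(1) by simp
      finally show ?thesis using Fv[of w] by linarith
    qed
    show "((\<lambda>k. f k w) has_sum F w) gauss_int" for w
      by (rule has_sum_finite_neutralI[of "{k0 w}"]) (use k0[of w] in \<open>auto simp: fk\<close>)
  qed (use v in auto)
  moreover have "(\<integral>w. f k w \<partial>lborel) = (\<integral>w. indicator (centred_square g) w * (v (w + of_real g * k) * of_real (cos_kernel g N w)) \<partial>lborel)"
    if "k \<in> gauss_int" for k
  proof -
    have "(\<integral>w. f k w \<partial>lborel) = (\<integral>w. f k (w + of_real g * k) \<partial>lborel)"
      by (rule integral_lborel_translation(1)[OF mf, symmetric])
    then show ?thesis by (simp add: f_def F_def cos_kernel_periodic[OF g that])
  qed
  ultimately show ?thesis unfolding F_def by (simp cong: has_sum_cong)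
qed

text \<open>Expanding the trigonometric polynomial, only its constant term contributes.\<close>

lemma integral_against_cos_kernel:
  fixes v :: "complex \<Rightarrow> complex"
  assumes g: "g > 0" and v: "integrable lborel v"
    and zero: "\<And>m n :: int. (m, n) \<noteq> (0, 0) \<Longrightarrow>
      (\<integral>w. v w * exp (2 * pi * \<i> * of_real ((of_int m * Re w + of_int n * Im w) / g)) \<partial>lborel) = 0"
  shows "(\<integral>w. v w * of_real (cos_kernel g N w) \<partial>lborel) = of_real ((cos_power_coeff N N)\<^sup>2) * (\<integral>w. v w \<partial>lborel)"
proof -
  have [measurable]: "v \<in> borel_measurable borel" using v by simp
  define e where "e m n w = exp (2 * pi * \<i> * of_real ((of_int m * Re w + of_int n * Im w) / g))" for m n :: int and w
  have [measurable]: "e m n \<in> borel_measurable borel" for m n unfolding e_def by measurable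
  have vi: "integrable lborel (\<lambda>w. v w * e m n w)" for m n
    by (rule integrable_dominated[OF integrable_norm[OF v]]) (auto simp: norm_mult e_def)
  define c where "c j = complex_of_real (cos_power_coeff N j)" for j
  have K: "complex_of_real (cos_kernel g N w) = (\<Sum>j\<le>2 * N. \<Sum>l\<le>2 * N. c j * c l * e (int j - int N) (int l - int N) w)" for w
  proof -
    have E: "exp (2 * pi * \<i> * of_int m * of_real (Re w / g)) * exp (2 * pi * \<i> * of_int n * of_real (Im w / g)) = e m n w" for m n
      unfolding e_def exp_add[symmetric] by (simp add: algebra_simps add_divide_distrib)
    have "complex_of_real (cos_kernel g N w)
        = complex_of_real (cos (pi * (Re w / g)) ^ (2 * N)) * complex_of_real (cos (pi * (Im w / g)) ^ (2 * N))"
      by (simp add: cos_kernel_def)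
    also have "\<dots> = (\<Sum>j\<le>2 * N. \<Sum>l\<le>2 * N. (c j * exp (2 * pi * \<i> * of_int (int j - int N) * of_real (Re w / g))) *
        (c l * exp (2 * pi * \<i> * of_int (int l - int N) * of_real (Im w / g))))"
      unfolding cos_power_expansion c_def by (rule sum_product)
    also have "\<dots> = (\<Sum>j\<le>2 * N. \<Sum>l\<le>2 * N. c j * c l * e (int j - int N) (int l - int N) w)"
      unfolding E[symmetric] by (intro sum.cong refl) (simp only: mult_ac)
    finally show ?thesis .
  qed
  have "(\<integral>w. v w * of_real (cos_kernel g N w) \<partial>lborel)
      = (\<integral>w. (\<Sum>j\<le>2 * N. \<Sum>l\<le>2 * N. c j * c l * (v w * e (int j - int N) (int l - int N) w)) \<partial>lborel)"
    unfolding K sum_distrib_left by (simp only: mult_ac)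
  also have "\<dots> = (\<Sum>j\<le>2 * N. \<Sum>l\<le>2 * N. c j * c l * (\<integral>w. v w * e (int j - int N) (int l - int N) w \<partial>lborel))"
    by (simp only: Bochner_Integration.integral_sum Bochner_Integration.integrable_sum integrable_mult_right vi
        integral_mult_right_zero)
  also have "\<dots> = (\<Sum>j\<le>2 * N. \<Sum>l\<le>2 * N. if j = N \<and> l = N then c N * c N * (\<integral>w. v w \<partial>lborel) else 0)"
  proof (intro sum.cong refl)
    fix j l
    show "c j * c l * (\<integral>w. v w * e (int j - int N) (int l - int N) w \<partial>lborel)
      = (if j = N \<and> l = N then c N * c N * (\<integral>w. v w \<partial>lborel) else 0)"
      using zero[of "int j - int N" "int l - int N"] by (auto simp: e_def)
  qed
  also have "\<dots> = (\<Sum>j\<le>2 * N. if j = N then (\<Sum>l\<le>2 * N. if l = N then c N * c N * (\<integral>w. v w \<partial>lborel) else 0) else 0)"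
    by (intro sum.cong refl) auto
  also have "\<dots> = c N * c N * (\<integral>w. v w \<partial>lborel)" by simp
  finally show ?thesis by (simp add: c_def power2_eq_square)
qed

text \<open>The Weierstrass test, with a Gaussian majorant on the disc of radius \<open>g\<close>, which contains the centred square.\<close>

lemma periodization_continuous:
  fixes v :: "complex \<Rightarrow> complex"
  assumes g: "g > 0" and a: "a > 0" and cont: "continuous_on UNIV v"
    and bound: "\<And>w. cmod (v w) \<le> C * exp (- a * (cmod w)\<^sup>2)"
  shows "\<exists>P M. continuous_on (cball 0 g) P \<and>
    (\<forall>w\<in>cball 0 g. ((\<lambda>k. v (w + of_real g * k)) has_sum P w) gauss_int) \<and>
    (\<forall>w\<in>cball 0 g. \<forall>J. finite J \<and> J \<subseteq> gauss_int \<longrightarrow> (\<Sum>k\<in>J. cmod (v (w + of_real g * k))) \<le> M)"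
proof -
  have C: "0 \<le> C" using order_trans[OF norm_ge_zero bound[of 0]] by simp
  define h where "h k = C * (exp (a * g\<^sup>2) * exp (- (a * g\<^sup>2 / 2) * (cmod k)\<^sup>2))" for k :: complex
  have h: "h summable_on gauss_int"
    unfolding h_def using a g by (intro summable_on_cmult_right summable_gauss_norm) simp
  have vh: "cmod (v (w + of_real g * k)) \<le> h k" if w: "w \<in> cball 0 g" for w k
  proof -
    have "(cmod w)\<^sup>2 \<le> g\<^sup>2" using w by (intro power_mono) auto
    then have "g\<^sup>2 * (cmod k)\<^sup>2 / 2 - g\<^sup>2 \<le> (cmod (w + of_real g * k))\<^sup>2"
      using norm_sum_square_lower[of "of_real g * k" w]
      by (simp add: norm_mult power_mult_distrib add.commute)
    then have "a * (g\<^sup>2 * (cmod k)\<^sup>2 / 2 - g\<^sup>2) \<le> a * (cmod (w + of_real g * k))\<^sup>2"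
      using a by (intro mult_left_mono) auto
    then have "exp (- a * (cmod (w + of_real g * k))\<^sup>2) \<le> exp (a * g\<^sup>2 + - (a * g\<^sup>2 / 2) * (cmod k)\<^sup>2)"
      by (simp add: algebra_simps)
    then have "exp (- a * (cmod (w + of_real g * k))\<^sup>2) \<le> exp (a * g\<^sup>2) * exp (- (a * g\<^sup>2 / 2) * (cmod k)\<^sup>2)"
      by (simp only: exp_add)
    then show ?thesis unfolding h_def using bound C by (meson mult_left_mono order_trans)
  qed
  define P where "P w = infsum (\<lambda>k. v (w + of_real g * k)) gauss_int" for w
  have abs: "(\<lambda>k. cmod (v (w + of_real g * k))) summable_on gauss_int" if "w \<in> cball 0 g" for w
    by (rule summable_on_comparison_test[OF h vh[OF that]]) simp
  have P: "((\<lambda>k. v (w + of_real g * k)) has_sum P w) gauss_int" if "w \<in> cball 0 g" for w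
    unfolding P_def by (rule has_sum_infsum[OF abs_summable_summable[OF abs[OF that]]])
  have "uniform_limit (cball 0 g) (\<lambda>X w. \<Sum>k\<in>X. v (w + of_real g * k)) P (finite_subsets_at_top gauss_int)"
    by (rule Weierstrass_m_test_general'[OF vh P h])
  then have "continuous_on (cball 0 g) P"
    by (rule uniform_limit_theorem[rotated])
       (auto intro!: always_eventually continuous_intros continuous_on_compose2[OF cont])
  moreover have "(\<Sum>k\<in>J. cmod (v (w + of_real g * k))) \<le> infsum h gauss_int"
    if "w \<in> cball 0 g" "finite J" "J \<subseteq> gauss_int" for w J
  proof -
    have "h k \<ge> 0" for k using C by (simp add: h_def)
    then have "(\<Sum>k\<in>J. h k) \<le> infsum h gauss_int"
      using that h by (intro finite_sum_le_infsum) auto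
    moreover have "(\<Sum>k\<in>J. cmod (v (w + of_real g * k))) \<le> (\<Sum>k\<in>J. h k)"
      by (intro sum_mono vh that)
    ultimately show ?thesis by linarith
  qed
  ultimately show ?thesis using P by blast
qed

lemma centred_square_subset: "g > 0 \<Longrightarrow> centred_square g \<subseteq> cball 0 g"
proof
  fix w assume g: "g > 0" and w: "w \<in> centred_square g"
  have "cmod w \<le> \<bar>Re w\<bar> + \<bar>Im w\<bar>" by (rule cmod_le)
  also have "\<dots> \<le> g" using w by (auto simp: centred_square_def)
  finally show "w \<in> cball 0 g" by simp
qed

lemma cos_power_coeff_lower:
  assumes "N > 0"
  shows "1 / (2 * real N) \<le> cos_power_coeff N N"
  using central_binomial_lower_bound[OF assms] by (simp add: cos_power_coeff_def field_simps)

text \<open>If all Fourier coefficients of the periodization \<open>P\<close> of \<open>v\<close>, except the constant one, vanish, then \<open>P\<close>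
  is constant.  The kernels \<open>(cos (\<pi> x / g) cos (\<pi> y / g))^(2N)\<close>, normalized, are trigonometric
  polynomials that concentrate at the lattice points; integrated against them, \<open>P\<close> gives its mean on the
  one hand and, in the limit, \<open>P(0)\<close> on the other.\<close>

theorem poisson_square:
  fixes v :: "complex \<Rightarrow> complex"
  assumes g: "g > 0" and a: "a > 0" and cont: "continuous_on UNIV v"
    and bound: "\<And>w. cmod (v w) \<le> C * exp (- a * (cmod w)\<^sup>2)"
    and zero: "\<And>m n :: int. (m, n) \<noteq> (0, 0) \<Longrightarrow>
      (\<integral>w. v w * exp (2 * pi * \<i> * of_real ((of_int m * Re w + of_int n * Im w) / g)) \<partial>lborel) = 0"
  shows "((\<lambda>k. v (of_real g * k)) has_sum ((\<integral>w. v w \<partial>lborel) / of_real (g\<^sup>2))) gauss_int"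
proof -
  have vm[measurable]: "v \<in> borel_measurable borel" by (rule borel_measurable_continuous_onI[OF cont])
  have vi: "integrable lborel v"
  proof (rule integrable_dominated[of lborel "\<lambda>w. C * exp (- pi * (a / pi) * (norm w)\<^sup>2)"])
    show "integrable lborel (\<lambda>w. C * exp (- pi * (a / pi) * (norm w)\<^sup>2))"
      using a by (intro integrable_mult_right gaussian_integral) simp
  qed (use bound in auto)
  obtain P M where Pc: "continuous_on (cball 0 g) P"
    and P: "\<And>w. w \<in> cball 0 g \<Longrightarrow> ((\<lambda>k. v (w + of_real g * k)) has_sum P w) gauss_int"
    and PM: "\<And>w J. w \<in> cball 0 g \<Longrightarrow> finite J \<Longrightarrow> J \<subseteq> gauss_int \<Longrightarrow> (\<Sum>k\<in>J. cmod (v (w + of_real g * k))) \<le> M"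
    using periodization_continuous[OF g a cont bound] by metis
  define Q where "Q = centred_square g"
  have Q: "Q \<subseteq> cball 0 g" unfolding Q_def by (rule centred_square_subset[OF g])
  have [measurable]: "Q \<in> sets borel" by (simp add: Q_def)
  have PMn: "cmod (P w) \<le> M" if "w \<in> cball 0 g" for w
  proof -
    have b: "(\<lambda>k. cmod (v (w + of_real g * k))) summable_on gauss_int"
      by (rule nonneg_bdd_above_summable_on) (use PM[OF that] in \<open>auto intro!: bdd_aboveI2[where M=M]\<close>)
    have "cmod (P w) \<le> infsum (\<lambda>k. cmod (v (w + of_real g * k))) gauss_int"
      by (rule norm_infsum_le[OF P[OF that] has_sum_infsum[OF b]]) simp
    also have "\<dots> \<le> M"
      by (rule infsum_le_finite_sums[OF b]) (use PM[OF that] in auto)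
    finally show ?thesis .
  qed
  define I where "I = (\<integral>w. v w \<partial>lborel) / of_real (g\<^sup>2)"
  define K where "K N w = indicator Q w * cos_kernel g N w" for N w
  have K0: "0 \<le> K N w" for N w using cos_kernel_bounds by (simp add: K_def)
  have Ki: "integrable lborel (K N)" and KI: "(\<integral>w. K N w \<partial>lborel) = (g * cos_power_coeff N N)\<^sup>2" for N
    using integral_cos_kernel[OF g, of N] by (simp_all add: K_def[abs_def] Q_def)
  have KP: "K N w * x = K N w * (indicator Q w * x)" for N w and x :: real
    by (simp add: K_def indicator_def)
  have PK: "(\<integral>w. indicator Q w * (P w * of_real (cos_kernel g N w)) \<partial>lborel) = of_real ((cos_power_coeff N N)\<^sup>2) * (\<integral>w. v w \<partial>lborel)" for N
  proof -
    have M0: "0 \<le> M" using order_trans[OF norm_ge_zero PMn[of 0]] g by simp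
    have "((\<lambda>k. \<integral>w. indicator Q w * (v (w + of_real g * k) * of_real (cos_kernel g N w)) \<partial>lborel) has_sum
        (\<integral>w. indicator Q w * (P w * of_real (cos_kernel g N w)) \<partial>lborel)) gauss_int"
    proof (rule has_sum_integral_dominated(2)[where G="\<lambda>w. M * K N w", OF countable_gauss_int])
      show "(\<lambda>w. indicator Q w * (v (w + of_real g * k) * of_real (cos_kernel g N w))) \<in> borel_measurable lborel" for k
        by measurable
      show "integrable lborel (\<lambda>w. M * K N w)" by (intro integrable_mult_right Ki)
      fix w :: complex
      show "(\<Sum>k\<in>J. norm (indicator Q w * (v (w + of_real g * k) * of_real (cos_kernel g N w)))) \<le> M * K N w"
        if "finite J" "J \<subseteq> gauss_int" for J
      proof (cases "w \<in> Q")
        case True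
        have "(\<Sum>k\<in>J. norm (indicator Q w * (v (w + of_real g * k) * of_real (cos_kernel g N w))))
            = (\<Sum>k\<in>J. cmod (v (w + of_real g * k))) * K N w"
          using cos_kernel_bounds(1)[of g N w] True by (simp add: K_def norm_mult sum_distrib_right)
        also have "\<dots> \<le> M * K N w"
          using True Q that by (intro mult_right_mono PM K0) auto
        finally show ?thesis .
      qed (simp add: K_def)
      show "((\<lambda>k. indicator Q w * (v (w + of_real g * k) * of_real (cos_kernel g N w))) has_sum
          indicator Q w * (P w * of_real (cos_kernel g N w))) gauss_int"
      proof (cases "w \<in> Q")
        case True
        then show ?thesis using Q by (auto intro!: has_sum_cmult_left P)
      qed simp
    qed
    then have "(\<integral>w. indicator Q w * (P w * of_real (cos_kernel g N w)) \<partial>lborel) = (\<integral>w. v w * of_real (cos_kernel g N w) \<partial>lborel)"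
      using integral_unfold_square[OF g vi, of N] has_sum_unique unfolding Q_def by blast
    then show ?thesis using integral_against_cos_kernel[OF g vi zero] by simp
  qed
  have PQm[measurable]: "(\<lambda>w. indicator Q w *\<^sub>R P w) \<in> borel_measurable borel"
    by (rule borel_measurable_continuous_on_indicator) (use Q Pc continuous_on_subset in auto)
  have PKi: "integrable lborel (\<lambda>w. of_real (K N w) * P w)" for N
  proof (rule integrable_dominated[of lborel "\<lambda>w. M * K N w"])
    have "(\<lambda>w. of_real (K N w) * (indicator Q w *\<^sub>R P w)) \<in> borel_measurable lborel"
      unfolding K_def by measurable
    also have "(\<lambda>w. of_real (K N w) * (indicator Q w *\<^sub>R P w)) = (\<lambda>w. of_real (K N w) * P w)"
      by (auto simp: K_def indicator_def fun_eq_iff)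
    finally show "(\<lambda>w. of_real (K N w) * P w) \<in> borel_measurable lborel" .
    show "norm (of_real (K N w) * P w) \<le> M * K N w" for w
    proof (cases "w \<in> Q")
      case True
      then have "K N w * cmod (P w) \<le> K N w * M" using Q by (intro mult_left_mono PMn K0) auto
      then show ?thesis using K0[of N w] by (simp add: norm_mult mult.commute)
    qed (simp add: K_def)
  qed (intro integrable_mult_right Ki)
  have PKint: "(\<integral>w. of_real (K N w) * P w \<partial>lborel) = of_real ((g * cos_power_coeff N N)\<^sup>2) * I" for N
  proof -
    have "(\<integral>w. of_real (K N w) * P w \<partial>lborel) = (\<integral>w. indicator Q w * (P w * of_real (cos_kernel g N w)) \<partial>lborel)"
      by (intro Bochner_Integration.integral_cong) (auto simp: K_def indicator_def)
    then show ?thesis unfolding PK I_def using g by (simp add: power_mult_distrib)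
  qed
  have KiC: "integrable lborel (\<lambda>w. complex_of_real (K N w))" for N
    using Ki[of N] by (simp only: complex_of_real_integrable_eq)
  have small: "cmod (P 0 - I) \<le> e" if e: "e > 0" for e
  proof -
    have "0 \<in> cball (0::complex) g" using g by simp
    then obtain d where d: "d > 0" "\<And>w. w \<in> cball 0 g \<Longrightarrow> dist w 0 < d \<Longrightarrow> dist (P w) (P 0) < e"
      using Pc e unfolding continuous_on_iff by meson
    \<comment> \<open>The square \<open>\<bar>Re w\<bar>, \<bar>Im w\<bar> < r\<close> lies in the disc of radius \<open>d\<close>, and outside it one of the two cosines is at
      most \<open>q < 1\<close>.\<close>
    define r where "r = min (d / 3) (g / 3)"
    have r: "r > 0" "2 * r < d" "2 * r < g" using d g by (auto simp: r_def)
    define q where "q = cos (pi * (r / g))"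
    have rg: "0 < pi * (r / g)" "pi * (r / g) < pi / 2" using r g by (simp_all add: field_simps)
    have q: "0 \<le> q" "q < 1"
    proof -
      show "0 \<le> q" unfolding q_def using rg by (intro cos_ge_zero) auto
      have "cos (pi * (r / g)) < cos 0" using rg pi_gt_zero by (intro cos_monotone_0_pi) linarith+
      then show "q < 1" by (simp add: q_def)
    qed
    have far: "K N w \<le> q ^ (2 * N) * indicator Q w" if "\<not> (\<bar>Re w\<bar> < r \<and> \<bar>Im w\<bar> < r)" for N w
    proof (cases "w \<in> Q")
      case True
      have c1: "cos (pi * (t / g)) ^ (2 * N) \<le> 1" "0 \<le> cos (pi * (t / g)) ^ (2 * N)" for t
        using power_mono[of "\<bar>cos (pi * (t / g))\<bar>" 1 "2 * N"] by (simp_all add: power_mult)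
      have c2: "cos (pi * (t / g)) ^ (2 * N) \<le> q ^ (2 * N)" if "r \<le> \<bar>t\<bar>" "t \<in> {- g / 2..<g / 2}" for t
      proof -
        have t: "\<bar>t\<bar> \<le> g / 2" using that(2) by auto
        have "cos (pi * (\<bar>t\<bar> / g)) \<le> q" unfolding q_def
        proof (intro cos_monotone_0_pi_le)
          have "pi * \<bar>t\<bar> \<le> pi * g" using t g by (intro mult_left_mono) auto
          then show "pi * (\<bar>t\<bar> / g) \<le> pi" using g by (simp add: divide_le_eq)
          show "pi * (r / g) \<le> pi * (\<bar>t\<bar> / g)" using that g by (intro mult_left_mono divide_right_mono) auto
        qed (use rg in simp)
        moreover have "0 \<le> cos (pi * (\<bar>t\<bar> / g))"
        proof (rule cos_ge_zero)
          have "pi * \<bar>t\<bar> \<le> pi * (g / 2)" using t by (intro mult_left_mono) auto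
          then show "pi * (\<bar>t\<bar> / g) \<le> pi / 2" using g by (simp add: field_simps)
          have "0 \<le> pi * (\<bar>t\<bar> / g)" using g by simp
          then show "- (pi / 2) \<le> pi * (\<bar>t\<bar> / g)" using pi_ge_zero by linarith
        qed
        moreover have "cos (pi * (\<bar>t\<bar> / g)) = cos (pi * (t / g))" by (cases "t \<ge> 0") auto
        ultimately show ?thesis by (intro power_mono) auto
      qed
      have "cos_kernel g N w \<le> q ^ (2 * N)"
      proof (cases "r \<le> \<bar>Re w\<bar>")
        case R: True
        have "cos_kernel g N w \<le> q ^ (2 * N) * 1"
          unfolding cos_kernel_def using True R q(1)
          by (intro mult_mono c1 c2) (auto simp: Q_def centred_square_def)
        then show ?thesis by simp
      next
        case False
        then have "r \<le> \<bar>Im w\<bar>" using that by auto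
        then have "cos_kernel g N w \<le> 1 * q ^ (2 * N)"
          unfolding cos_kernel_def using True q(1)
          by (intro mult_mono c1 c2) (auto simp: Q_def centred_square_def)
        then show ?thesis by simp
      qed
      then show ?thesis using True by (simp add: K_def)
    qed (simp add: K_def)
    have near: "cmod (P w - P 0) \<le> e" if "\<bar>Re w\<bar> < r" "\<bar>Im w\<bar> < r" for w
    proof -
      have "cmod w \<le> \<bar>Re w\<bar> + \<bar>Im w\<bar>" by (rule cmod_le)
      then have "cmod w < 2 * r" using that by linarith
      then show ?thesis using d(2)[of w] r by (auto simp: dist_norm less_imp_le)
    qed
    have M0: "0 \<le> M" using order_trans[OF norm_ge_zero PMn[of 0]] g by simp
    have Qi: "integrable lborel (indicator Q :: complex \<Rightarrow> real)"
    proof (rule integrable_real_indicator)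
      have "emeasure lborel Q \<le> emeasure lborel (cball (0::complex) g)" using Q by (intro emeasure_mono) auto
      also have "\<dots> < \<infinity>" by (rule emeasure_lborel_cball_finite)
      finally show "emeasure lborel Q < \<infinity>" .
    qed simp
    define V :: real where "V = (\<integral>w. indicator Q w \<partial>lborel)"
    have main: "cmod (P 0 - I) * (g * cos_power_coeff N N)\<^sup>2 \<le> e * (g * cos_power_coeff N N)\<^sup>2 + 2 * M * (q ^ (2 * N) * V)" for N
    proof -
      have "(I - P 0) * of_real ((g * cos_power_coeff N N)\<^sup>2) = (\<integral>w. of_real (K N w) * P w - of_real (K N w) * P 0 \<partial>lborel)"
      proof -
        have A: "(\<integral>w. of_real (K N w) * P 0 \<partial>lborel) = of_real ((g * cos_power_coeff N N)\<^sup>2) * P 0"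
          unfolding KI[symmetric] integral_mult_left_zero integral_complex_of_real ..
        have B: "integrable lborel (\<lambda>w. of_real (K N w) * P 0)"
          by (intro integrable_mult_left KiC)
        show ?thesis
          unfolding Bochner_Integration.integral_diff[OF PKi B] A PKint by (simp only: left_diff_distrib mult.commute)
      qed
      also have "norm \<dots> \<le> (\<integral>w. e * K N w + 2 * M * (q ^ (2 * N) * indicator Q w) \<partial>lborel)"
      proof (rule norm_integral_le)
        fix w
        have "norm (of_real (K N w) * P w - of_real (K N w) * P 0) = K N w * cmod (P w - P 0)"
          using K0[of N w] by (simp add: norm_mult flip: right_diff_distrib)
        also have "\<dots> \<le> e * K N w + 2 * M * (q ^ (2 * N) * indicator Q w)"
        proof (cases "w \<in> Q")
          case True
          show ?thesis
          proof (cases "\<bar>Re w\<bar> < r \<and> \<bar>Im w\<bar> < r")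
            case T: True
            have "K N w * cmod (P w - P 0) \<le> K N w * e" using T near K0 by (intro mult_left_mono) auto
            moreover have "0 \<le> 2 * M * (q ^ (2 * N) * indicator Q w)" using M0 q by simp
            ultimately show ?thesis by (simp add: mult.commute)
          next
            case F: False
            have "cmod (P w - P 0) \<le> cmod (P w) + cmod (P 0)" by (rule norm_triangle_ineq4)
            also have "\<dots> \<le> 2 * M" using PMn[of w] PMn[of 0] True Q g by auto
            finally have "K N w * cmod (P w - P 0) \<le> (q ^ (2 * N) * indicator Q w) * (2 * M)"
              using far[OF F] K0 M0 by (intro mult_mono) auto
            moreover have "0 \<le> e * K N w" using e K0 by simp
            ultimately show ?thesis by (simp add: mult.commute)
          qed
        qed (simp add: K_def)
        finally show "norm (of_real (K N w) * P w - of_real (K N w) * P 0) \<le> e * K N w + 2 * M * (q ^ (2 * N) * indicator Q w)" .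
      qed (use PKi KiC Ki Qi in auto)
      also have "\<dots> = e * (g * cos_power_coeff N N)\<^sup>2 + 2 * M * (q ^ (2 * N) * V)"
        using Ki Qi by (simp add: KI V_def)
      finally have "norm ((I - P 0) * of_real ((g * cos_power_coeff N N)\<^sup>2)) \<le> e * (g * cos_power_coeff N N)\<^sup>2 + 2 * M * (q ^ (2 * N) * V)" .
      moreover have "norm ((I - P 0) * of_real ((g * cos_power_coeff N N)\<^sup>2)) = cmod (P 0 - I) * (g * cos_power_coeff N N)\<^sup>2"
        by (simp only: norm_mult norm_of_real norm_minus_commute) simp
      ultimately show ?thesis by simp
    qed
    have V0: "0 \<le> V" unfolding V_def by (intro integral_nonneg_AE) auto
    \<comment> \<open>The mass of the kernel decreases only like \<open>1 / N\<^sup>2\<close>, its values away from the lattice exponentially.\<close>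
    have est: "cmod (P 0 - I) \<le> e + (8 * M * V / g\<^sup>2) * (real N * q ^ N)\<^sup>2" if N: "N > 0" for N
    proof -
      define A where "A = (g * cos_power_coeff N N)\<^sup>2"
      have lo: "g / (2 * real N) \<le> g * cos_power_coeff N N"
        using mult_left_mono[OF cos_power_coeff_lower[OF N], of g] g by simp
      have 1: "(g / (2 * real N))\<^sup>2 \<le> A" unfolding A_def using lo g by (intro power_mono) auto
      have 2: "0 < (g / (2 * real N))\<^sup>2" using g N by simp
      have "1 / A \<le> 1 / (g / (2 * real N))\<^sup>2" using 1 2 by (intro frac_le) auto
      also have "\<dots> = 4 * (real N)\<^sup>2 / g\<^sup>2" by (simp add: power_divide power_mult_distrib)
      finally have A: "0 < A" "1 / A \<le> 4 * (real N)\<^sup>2 / g\<^sup>2"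
        using 1 2 by linarith+
      have "cmod (P 0 - I) = (cmod (P 0 - I) * A) / A" using A by simp
      also have "\<dots> \<le> (e * A + 2 * M * (q ^ (2 * N) * V)) / A"
        using main[of N] A unfolding A_def by (intro divide_right_mono) auto
      also have "\<dots> = e + 2 * M * (q ^ (2 * N) * V) * (1 / A)" using A by (simp add: add_divide_distrib)
      also have "\<dots> \<le> e + 2 * M * (q ^ (2 * N) * V) * (4 * (real N)\<^sup>2 / g\<^sup>2)"
        using A M0 V0 q by (intro add_left_mono mult_left_mono) auto
      also have "\<dots> = e + (8 * M * V / g\<^sup>2) * (real N * q ^ N)\<^sup>2"
        by (simp add: power_mult_distrib power_mult[symmetric] mult.commute[of 2 N])
      finally show ?thesis .
    qed
    have "(\<lambda>N. e + (8 * M * V / g\<^sup>2) * (real N * q ^ N)\<^sup>2) \<longlonglongrightarrow> e + (8 * M * V / g\<^sup>2) * 0\<^sup>2"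
      using q by (intro tendsto_intros powser_times_n_limit_0) simp
    then have "cmod (P 0 - I) \<le> e + (8 * M * V / g\<^sup>2) * 0\<^sup>2"
      by (rule tendsto_lowerbound) (use est in \<open>auto intro!: eventually_sequentiallyI[of 1]\<close>)
    then show ?thesis by simp
  qed
  have "P 0 = I"
  proof -
    have "cmod (P 0 - I) \<le> 0" by (rule field_le_epsilon) (use small in simp)
    then show ?thesis by simp
  qed
  then show ?thesis using P[of 0] g by (simp add: I_def)
qed

section \<open>Interpolation of the reproducing kernels\<close>

text \<open>One coordinate of the term \<open>exp (\<pi> \<alpha> l) * atom l b\<close> of the interpolation series of the kernel function
  \<open>exp (\<pi> \<alpha> z)\<close>, as a function of the coordinate \<open>w\<close> of \<open>l\<close>.\<close>

definition interp_term :: "real \<Rightarrow> complex \<Rightarrow> complex \<Rightarrow> complex \<Rightarrow> complex" where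
  "interp_term g \<alpha> b w = exp (complex_of_real pi * \<alpha> * w + complex_of_real pi * cnj w * b) *
    complex_of_real (exp (- pi * (cmod w)\<^sup>2)) * interp_1 g (b - w)"

lemma interp_term_bound:
  assumes g: "0 < g" "g \<le> 1"
  shows "\<exists>C\<ge>0. \<forall>w. cmod (interp_term g \<alpha> b w) \<le> C * exp (- (pi / 4) * (cmod w)\<^sup>2)"
proof -
  obtain C where C: "\<And>z. cmod (interp_1 g z) \<le> C * exp (pi * (cmod z)\<^sup>2 / 2)"
    using interp_1_bound[OF g] by blast
  have C0: "0 \<le> C" using order_trans[OF norm_ge_zero C[of 0]] by simp
  define D where "D = C * exp (pi * (cmod \<alpha>)\<^sup>2 + pi * (cmod b)\<^sup>2 / 2)"
  have "cmod (interp_term g \<alpha> b w) \<le> D * exp (- (pi / 4) * (cmod w)\<^sup>2)" for w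
  proof -
    have bw: "(cmod (b - w))\<^sup>2 = (cmod b)\<^sup>2 + (cmod w)\<^sup>2 - 2 * Re (cnj w * b)"
      unfolding cmod_power2 by (simp add: power2_eq_square algebra_simps)
    have "Re (\<alpha> * w) \<le> cmod \<alpha> * cmod w" by (metis complex_Re_le_cmod norm_mult)
    also have "\<dots> \<le> 1 / 4 * (cmod w)\<^sup>2 + (cmod \<alpha>)\<^sup>2 / (4 * (1 / 4))" by (rule quadratic_le) simp
    finally have "pi * Re (\<alpha> * w) \<le> pi * ((cmod w)\<^sup>2 / 4 + (cmod \<alpha>)\<^sup>2)" by (intro mult_left_mono) auto
    then have e: "pi * Re (\<alpha> * w) + pi * Re (cnj w * b) + - pi * (cmod w)\<^sup>2 + pi * (cmod (b - w))\<^sup>2 / 2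
        \<le> (pi * (cmod \<alpha>)\<^sup>2 + pi * (cmod b)\<^sup>2 / 2) + - (pi / 4) * (cmod w)\<^sup>2"
      unfolding bw by (simp add: field_simps)
    have "cmod (interp_term g \<alpha> b w) = exp (pi * Re (\<alpha> * w) + pi * Re (cnj w * b)) * exp (- pi * (cmod w)\<^sup>2) * cmod (interp_1 g (b - w))"
      by (simp add: interp_term_def norm_mult mult.assoc)
    also have "\<dots> \<le> exp (pi * Re (\<alpha> * w) + pi * Re (cnj w * b)) * exp (- pi * (cmod w)\<^sup>2) * (C * exp (pi * (cmod (b - w))\<^sup>2 / 2))"
      by (intro mult_left_mono C) auto
    also have "\<dots> = C * exp (pi * Re (\<alpha> * w) + pi * Re (cnj w * b) + - pi * (cmod w)\<^sup>2 + pi * (cmod (b - w))\<^sup>2 / 2)"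
      by (simp only: exp_add mult_ac)
    also have "\<dots> \<le> C * exp ((pi * (cmod \<alpha>)\<^sup>2 + pi * (cmod b)\<^sup>2 / 2) + - (pi / 4) * (cmod w)\<^sup>2)"
      using C0 e by (intro mult_left_mono) auto
    also have "\<dots> = D * exp (- (pi / 4) * (cmod w)\<^sup>2)" unfolding D_def exp_add by (simp only: mult_ac)
    finally show ?thesis .
  qed
  moreover have "0 \<le> D" using C0 by (simp add: D_def)
  ultimately show ?thesis by blast
qed

lemma interp_term_continuous:
  assumes g: "0 < g" "g \<le> 1"
  shows "continuous_on A (interp_term g \<alpha> b)"
proof -
  have "continuous_on UNIV (interp_1 g)"
    by (rule holomorphic_on_imp_continuous_on[OF interp_1_holomorphic[OF g]])
  then have "continuous_on A (\<lambda>w. interp_1 g (b - w))"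
    by (rule continuous_on_compose2) (auto intro!: continuous_intros)
  then show ?thesis unfolding interp_term_def by (intro continuous_intros)
qed

text \<open>The character belongs to \<open>\<mu> = (- n + i m) / g\<close> in the adjoint lattice, and the reproducing formula
  evaluates the Fourier coefficient as a multiple of \<open>interp_1 g (- \<mu>)\<close>.\<close>

lemma interp_term_fourier:
  fixes m n :: int
  assumes g: "0 < g" "g \<le> 1"
  shows "(\<integral>w. interp_term g \<alpha> b w * exp (2 * pi * \<i> * of_real ((of_int m * Re w + of_int n * Im w) / g)) \<partial>lborel)
    = (if m = 0 \<and> n = 0 then exp (complex_of_real pi * \<alpha> * b) else 0)"
proof -
  define \<mu> where "\<mu> = Complex (- of_int n) (of_int m) / complex_of_real g"
  define F where "F w = exp (complex_of_real pi * (\<alpha> - cnj \<mu>) * w) * interp_1 g (b - w)" for w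
  have "(interp_1 g \<circ> (\<lambda>w. b - w)) holomorphic_on UNIV"
    by (rule holomorphic_on_compose) (auto intro!: holomorphic_intros interp_1_holomorphic g)
  then have F: "F holomorphic_on UNIV"
    unfolding F_def by (intro holomorphic_intros) (simp add: o_def)
  let ?K = "\<lambda>w. exp (complex_of_real pi * cnj w * (b + \<mu>)) * of_real (exp (- pi * (cmod w)\<^sup>2))"
  have eq: "interp_term g \<alpha> b w * exp (2 * pi * \<i> * of_real ((of_int m * Re w + of_int n * Im w) / g)) = F w * ?K w" for w
  proof -
    have "2 * complex_of_real pi * \<i> * of_real ((of_int m * Re w + of_int n * Im w) / g) = complex_of_real pi * (cnj w * \<mu> - w * cnj \<mu>)"
      using g by (simp add: \<mu>_def complex_eq_iff field_simps)
    then have "interp_term g \<alpha> b w * exp (2 * pi * \<i> * of_real ((of_int m * Re w + of_int n * Im w) / g))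
       = exp (complex_of_real pi * \<alpha> * w + complex_of_real pi * cnj w * b + complex_of_real pi * (cnj w * \<mu> - w * cnj \<mu>)) *
        complex_of_real (exp (- pi * (cmod w)\<^sup>2)) * interp_1 g (b - w)"
      unfolding interp_term_def exp_add by simp
    also have "complex_of_real pi * \<alpha> * w + complex_of_real pi * cnj w * b + complex_of_real pi * (cnj w * \<mu> - w * cnj \<mu>)
        = complex_of_real pi * (\<alpha> - cnj \<mu>) * w + complex_of_real pi * cnj w * (b + \<mu>)"
      by (simp add: algebra_simps)
    finally show ?thesis unfolding F_def exp_add by simp
  qed
  have int: "integrable lborel (\<lambda>w. F w * ?K w)"
  proof -
    obtain C where C: "\<And>w. cmod (interp_term g \<alpha> b w) \<le> C * exp (- (pi / 4) * (cmod w)\<^sup>2)"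
      using interp_term_bound[OF g] by blast
    have m: "interp_term g \<alpha> b \<in> borel_measurable borel"
      by (intro borel_measurable_continuous_onI interp_term_continuous g)
    have "integrable lborel (\<lambda>w::complex. C * exp (- pi * (1 / 4) * (norm w)\<^sup>2))"
      by (intro integrable_mult_right gaussian_integral) simp
    then show ?thesis unfolding eq[symmetric]
      by (rule integrable_dominated) (use m C in \<open>auto simp: norm_mult\<close>)
  qed
  have "(\<integral>w. interp_term g \<alpha> b w * exp (2 * pi * \<i> * of_real ((of_int m * Re w + of_int n * Im w) / g)) \<partial>lborel) = F (b + \<mu>)"
    unfolding eq by (rule fock_reproducing_1[OF F int])
  also have "\<dots> = exp (complex_of_real pi * (\<alpha> - cnj \<mu>) * (b + \<mu>)) * interp_1 g (Complex (of_int n) (- of_int m) / of_real g)"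
  proof -
    have "- \<mu> = Complex (of_int n) (- of_int m) / complex_of_real g"
      by (simp add: \<mu>_def complex_eq_iff)
    then show ?thesis by (simp add: F_def)
  qed
  also have "interp_1 g (Complex (of_int n) (- of_int m) / of_real g) = (if m = 0 \<and> n = 0 then 1 else 0)"
    by (subst interp_1_lattice[OF g]) (auto simp: mem_gauss_int_iff complex_eq_iff)
  finally show ?thesis by (simp add: \<mu>_def zero_complex.code[symmetric])
qed

text \<open>The nonconstant Fourier coefficients vanish, and so do those of a translate; hence the Poisson formula gives
  a sum that does not depend on \<open>c\<close>.\<close>

theorem interp_term_sum:
  assumes g: "0 < g" "g \<le> 1"
  shows "((\<lambda>m. interp_term g \<alpha> b (of_real g * m + c)) has_sum (exp (complex_of_real pi * \<alpha> * b) / of_real (g\<^sup>2))) gauss_int"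
proof -
  define v where "v w = interp_term g \<alpha> b (w + c)" for w
  have cont: "continuous_on UNIV v"
    unfolding v_def by (rule continuous_on_compose2[OF interp_term_continuous[OF g, of UNIV]]) (auto intro!: continuous_intros)
  obtain C where C: "C \<ge> 0" "\<And>w. cmod (interp_term g \<alpha> b w) \<le> C * exp (- (pi / 4) * (cmod w)\<^sup>2)"
    using interp_term_bound[OF g] by blast
  have bound: "cmod (v w) \<le> (C * exp (pi / 4 * (cmod c)\<^sup>2)) * exp (- (pi / 8) * (cmod w)\<^sup>2)" for w
  proof -
    have "pi / 4 * ((cmod w)\<^sup>2 / 2 - (cmod c)\<^sup>2) \<le> pi / 4 * (cmod (w + c))\<^sup>2"
      by (intro mult_left_mono norm_sum_square_lower) simp
    then have "exp (- (pi / 4) * (cmod (w + c))\<^sup>2) \<le> exp (pi / 4 * (cmod c)\<^sup>2 + - (pi / 8) * (cmod w)\<^sup>2)"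
      by (simp add: algebra_simps)
    then have "C * exp (- (pi / 4) * (cmod (w + c))\<^sup>2) \<le> C * (exp (pi / 4 * (cmod c)\<^sup>2) * exp (- (pi / 8) * (cmod w)\<^sup>2))"
      unfolding exp_add using C(1) by (rule mult_left_mono)
    then show ?thesis using C(2)[of "w + c"] by (simp add: v_def mult.assoc)
  qed
  have coef: "(\<integral>w. v w * exp (2 * pi * \<i> * of_real ((of_int m * Re w + of_int n * Im w) / g)) \<partial>lborel)
      = exp (- (2 * pi * \<i> * of_real ((of_int m * Re c + of_int n * Im c) / g))) *
        (if m = 0 \<and> n = 0 then exp (complex_of_real pi * \<alpha> * b) else 0)" for m n :: int
  proof -
    let ?e = "\<lambda>w. exp (2 * pi * \<i> * of_real ((of_int m * Re w + of_int n * Im w) / g))"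
    have [measurable]: "interp_term g \<alpha> b \<in> borel_measurable borel"
      by (intro borel_measurable_continuous_onI interp_term_continuous g)
    have "v w * ?e w = inverse (?e c) * (interp_term g \<alpha> b (w + c) * ?e (w + c))" for w
    proof -
      have "?e (w + c) = ?e w * ?e c"
        unfolding exp_add[symmetric] by (simp add: algebra_simps add_divide_distrib)
      then show ?thesis by (simp add: v_def)
    qed
    then have "(\<integral>w. v w * ?e w \<partial>lborel) = inverse (?e c) * (\<integral>w. interp_term g \<alpha> b (w + c) * ?e (w + c) \<partial>lborel)"
      by simp
    also have "(\<integral>w. interp_term g \<alpha> b (w + c) * ?e (w + c) \<partial>lborel) = (\<integral>w. interp_term g \<alpha> b w * ?e w \<partial>lborel)"
      by (rule integral_lborel_translation(1)) measurable
    finally show ?thesis unfolding interp_term_fourier[OF g] by (simp only: exp_minus)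
  qed
  have "(\<integral>w. v w \<partial>lborel) = exp (complex_of_real pi * \<alpha> * b)"
    using coef[of 0 0] by simp
  moreover have "((\<lambda>k. v (of_real g * k)) has_sum ((\<integral>w. v w \<partial>lborel) / of_real (g\<^sup>2))) gauss_int"
    by (rule poisson_square[OF g(1) _ cont bound]) (use coef in auto)
  ultimately show ?thesis by (simp add: v_def)
qed

definition (in triangular_lattice) interp :: "(complex, 'd) vec \<Rightarrow> complex" where
  "interp z = (\<Prod>j\<in>UNIV. interp_1 (gam j) (z $ j))"

definition (in triangular_lattice) vol :: real where
  "vol = (\<Prod>j\<in>UNIV. (gam j)\<^sup>2)"

definition (in triangular_lattice) atom :: "(complex, 'd) vec \<Rightarrow> (complex, 'd) vec \<Rightarrow> complex" where
  "atom l z = exp (complex_of_real pi * cdot (cnj_vec l) z) * complex_of_real (exp (- pi * (norm l)\<^sup>2)) * interp (z - l)"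

text \<open>Shared by the entire functions in \<open>fock1\<close> and by the Bargmann transforms of functions in \<open>M\<^sup>1\<close>, so that both
  can be interpolated at once.\<close>

definition reproduced :: "(complex^'d \<Rightarrow> complex) \<Rightarrow> bool" where
  "reproduced F \<longleftrightarrow> F \<in> borel_measurable borel \<and>
    integrable lborel (\<lambda>z. cmod (F z) * exp (- pi * (norm z)\<^sup>2 / 2)) \<and>
    (\<forall>w. F w = (\<integral>z. F z * gauss_kernel w z \<partial>lborel))"

lemma norm_gauss_kernel:
  "cmod (gauss_kernel w z) = exp (- pi * (norm z)\<^sup>2 / 2) * exp (- pi / 2 * (norm (z - w))\<^sup>2) * exp (pi * (norm w)\<^sup>2 / 2)"
proof -
  have "cmod (gauss_kernel w z) = exp (pi * Re (cdot (cnj_vec z) w) + - pi * (norm z)\<^sup>2)"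
    unfolding gauss_kernel_def norm_mult exp_add by simp
  also have "pi * Re (cdot (cnj_vec z) w) + - pi * (norm z)\<^sup>2 = - pi * (norm z)\<^sup>2 / 2 + - pi / 2 * (norm (z - w))\<^sup>2 + pi * (norm w)\<^sup>2 / 2"
    unfolding norm_diff_power2_cdot by (simp add: field_simps)
  finally show ?thesis by (simp only: exp_add)
qed

lemma gauss_kernel_measurable [measurable]: "gauss_kernel w \<in> borel_measurable borel"
  unfolding gauss_kernel_def by (intro borel_measurable_continuous_onI continuous_intros)

lemma fock1_reproduced:
  assumes "F \<in> fock1"
  shows "reproduced F"
proof -
  have F: "entire F" and i: "integrable lebesgue (\<lambda>z. cmod (F z) * exp (- pi * (norm z)\<^sup>2 / 2))"
    using assms by (auto simp: fock1_def)
  have [measurable]: "F \<in> borel_measurable borel" by (rule entire_measurable[OF F])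
  have i': "integrable lborel (\<lambda>z. cmod (F z) * exp (- pi * (norm z)\<^sup>2 / 2))"
    using i by (subst (asm) integrable_completion) auto
  moreover have "F w = (\<integral>z. F z * gauss_kernel w z \<partial>lborel)" for w
  proof (rule fock_reproducing[OF F, symmetric])
    show "integrable lborel (\<lambda>z. F z * gauss_kernel w z)"
    proof (rule integrable_dominated[OF integrable_mult_right[OF i', of "exp (pi * (norm w)\<^sup>2 / 2)"]])
      fix z
      have "exp (- pi / 2 * (norm (z - w))\<^sup>2) \<le> 1" by simp
      then have "cmod (F z) * (exp (- pi * (norm z)\<^sup>2 / 2) * exp (- pi / 2 * (norm (z - w))\<^sup>2) * exp (pi * (norm w)\<^sup>2 / 2))
        \<le> cmod (F z) * (exp (- pi * (norm z)\<^sup>2 / 2) * 1 * exp (pi * (norm w)\<^sup>2 / 2))"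
        by (intro mult_left_mono mult_right_mono) auto
      then show "norm (F z * gauss_kernel w z) \<le> exp (pi * (norm w)\<^sup>2 / 2) * (cmod (F z) * exp (- pi * (norm z)\<^sup>2 / 2))"
        by (simp only: norm_mult norm_gauss_kernel mult_1_right mult_ac)
    qed simp
  qed
  moreover have "F \<in> borel_measurable borel" by measurable
  ultimately show ?thesis unfolding reproduced_def by blast
qed

context triangular_lattice
begin

lemma vol_pos: "vol > 0"
  unfolding vol_def by (intro prod_pos zero_less_power pos)

lemma interp_entire: "entire interp"
  unfolding interp_def by (intro entire_prod entire_compose[OF interp_1_holomorphic entire_nth] pos le1)

lemma interp_bound: "\<exists>C\<ge>0. \<forall>z. cmod (interp z) \<le> C * exp (pi * (norm z)\<^sup>2 / 2)"
proof -
  have "\<forall>j. \<exists>C. \<forall>z. cmod (interp_1 (gam j) z) \<le> C * exp (pi * (cmod z)\<^sup>2 / 2)"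
    using interp_1_bound[OF pos le1] by blast
  then obtain C where C: "\<And>j z. cmod (interp_1 (gam j) z) \<le> C j * exp (pi * (cmod z)\<^sup>2 / 2)"
    by metis
  have C0: "0 \<le> C j" for j using order_trans[OF norm_ge_zero C[of j 0]] by simp
  have "cmod (interp z) \<le> (\<Prod>j\<in>UNIV. C j) * exp (pi * (norm z)\<^sup>2 / 2)" for z
  proof -
    have "cmod (interp z) = (\<Prod>j\<in>UNIV. cmod (interp_1 (gam j) (z $ j)))"
      by (simp add: interp_def prod_norm)
    also have "\<dots> \<le> (\<Prod>j\<in>UNIV. C j * exp (pi * (cmod (z $ j))\<^sup>2 / 2))"
      by (intro prod_mono conjI norm_ge_zero C)
    also have "\<dots> = (\<Prod>j\<in>UNIV. C j) * exp (pi * (norm z)\<^sup>2 / 2)"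
      by (simp add: prod.distrib norm_vec_power2 sum_distrib_left sum_divide_distrib exp_sum)
    finally show ?thesis .
  qed
  moreover have "0 \<le> (\<Prod>j\<in>UNIV. C j)" by (intro prod_nonneg) (simp add: C0)
  ultimately show ?thesis by blast
qed

lemma atom_continuous: "continuous_on A (atom l)"
proof -
  have "continuous_on A (\<lambda>z. interp (z - l))"
    by (rule continuous_on_compose2[OF entire_continuous[OF interp_entire, of UNIV]]) (auto intro!: continuous_intros)
  then show ?thesis unfolding atom_def by (intro continuous_intros)
qed

lemma atom_measurable [measurable]: "atom l \<in> borel_measurable borel"
  by (intro borel_measurable_continuous_onI atom_continuous)

lemma atom_bound: "\<exists>C\<ge>0. \<forall>l z. cmod (atom l z) \<le> C * exp (- pi * (norm l)\<^sup>2 / 2) * exp (pi * (norm z)\<^sup>2 / 2)"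
proof -
  obtain C where C: "C \<ge> 0" "\<And>z. cmod (interp z) \<le> C * exp (pi * (norm z)\<^sup>2 / 2)"
    using interp_bound by blast
  have "cmod (atom l z) \<le> C * exp (- pi * (norm l)\<^sup>2 / 2) * exp (pi * (norm z)\<^sup>2 / 2)" for l z
  proof -
    have "(norm (z - l))\<^sup>2 = (norm l)\<^sup>2 + (norm z)\<^sup>2 - 2 * Re (cdot (cnj_vec l) z)"
      unfolding norm_minus_commute[of z l] by (rule norm_diff_power2_cdot)
    then have e: "pi * Re (cdot (cnj_vec l) z) + - pi * (norm l)\<^sup>2 + pi * (norm (z - l))\<^sup>2 / 2
        = - pi * (norm l)\<^sup>2 / 2 + pi * (norm z)\<^sup>2 / 2"
      by (simp only:) (simp add: field_simps)
    have "cmod (atom l z) = exp (pi * Re (cdot (cnj_vec l) z)) * exp (- pi * (norm l)\<^sup>2) * cmod (interp (z - l))"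
      by (simp add: atom_def norm_mult)
    also have "\<dots> \<le> exp (pi * Re (cdot (cnj_vec l) z)) * exp (- pi * (norm l)\<^sup>2) * (C * exp (pi * (norm (z - l))\<^sup>2 / 2))"
      by (intro mult_left_mono C) auto
    also have "\<dots> = C * exp (pi * Re (cdot (cnj_vec l) z) + - pi * (norm l)\<^sup>2 + pi * (norm (z - l))\<^sup>2 / 2)"
      by (simp only: exp_add mult_ac)
    finally show ?thesis unfolding e by (simp only: exp_add mult_ac)
  qed
  with C(1) show ?thesis by blast
qed

text \<open>The terms factor over the coordinates, and the one-dimensional sums are the same for all translates; so the
  sum over the lattice is a product, although the lattice is not.\<close>

lemma kernel_interpolation:
  "((\<lambda>l. exp (complex_of_real pi * cdot \<alpha> l) * atom l b) has_sum (exp (complex_of_real pi * cdot \<alpha> b) / of_real vol)) (matrix_lattice S)"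
proof -
  define u where "u j w = interp_term (gam j) (\<alpha> $ j) (b $ j) w" for j w
  have "\<forall>j. \<exists>C\<ge>0. \<forall>w. cmod (u j w) \<le> C * exp (- (pi / 4) * (cmod w)\<^sup>2)"
    unfolding u_def using interp_term_bound[OF pos le1] by blast
  then obtain C where C: "\<And>j. C j \<ge> 0" "\<And>j w. cmod (u j w) \<le> C j * exp (- (pi / 4) * (cmod w)\<^sup>2)" by metis
  have "\<forall>j. \<exists>M. \<forall>c. (\<lambda>m. exp (- (pi / 4) * (cmod (of_real (gam j) * m + c))\<^sup>2)) summable_on gauss_int \<and>
    infsum (\<lambda>m. exp (- (pi / 4) * (cmod (of_real (gam j) * m + c))\<^sup>2)) gauss_int \<le> M"
    by (intro allI gauss_sum_uniform pos) simp
  then obtain M where M: "\<And>j c. (\<lambda>m. exp (- (pi / 4) * (cmod (of_real (gam j) * m + c))\<^sup>2)) summable_on gauss_int"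
    "\<And>j c. infsum (\<lambda>m. exp (- (pi / 4) * (cmod (of_real (gam j) * m + c))\<^sup>2)) gauss_int \<le> M j" by metis
  have s: "(\<lambda>m. norm (u j (of_real (gam j) * m + c))) summable_on gauss_int" for j c
    by (rule summable_on_comparison_test[OF summable_on_cmult_right[OF M(1)[of j c], of "C j"] C(2)]) simp
  have le: "infsum (\<lambda>m. norm (u j (of_real (gam j) * m + c))) gauss_int \<le> C j * M j" for j c
  proof -
    have "infsum (\<lambda>m. norm (u j (of_real (gam j) * m + c))) gauss_int
        \<le> infsum (\<lambda>m. C j * exp (- (pi / 4) * (cmod (of_real (gam j) * m + c))\<^sup>2)) gauss_int"
      by (rule infsum_mono[OF s summable_on_cmult_right[OF M(1)] C(2)])
    also have "\<dots> = C j * infsum (\<lambda>m. exp (- (pi / 4) * (cmod (of_real (gam j) * m + c))\<^sup>2)) gauss_int"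
      by (rule infsum_cmult_right[OF M(1)])
    also have "\<dots> \<le> C j * M j" by (intro mult_left_mono M C)
    finally show ?thesis .
  qed
  have "((\<lambda>l. \<Prod>j\<in>UNIV. u j (l $ j)) has_sum (\<Prod>j\<in>UNIV. exp (complex_of_real pi * \<alpha> $ j * b $ j) / of_real ((gam j)\<^sup>2))) (matrix_lattice S)"
    by (rule lattice_sum_value[OF s le]) (unfold u_def, rule interp_term_sum[OF pos le1])
  moreover have "(\<Prod>j\<in>UNIV. exp (complex_of_real pi * \<alpha> $ j * b $ j) / of_real ((gam j)\<^sup>2)) = exp (complex_of_real pi * cdot \<alpha> b) / of_real vol"
    by (simp add: prod_dividef vol_def cdot_def sum_distrib_left exp_sum mult.assoc)
  moreover have "(\<Prod>j\<in>UNIV. u j (l $ j)) = exp (complex_of_real pi * cdot \<alpha> l) * atom l b" for l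
  proof -
    have "(\<Prod>j\<in>UNIV. u j (l $ j)) = (\<Prod>j\<in>UNIV. exp (complex_of_real pi * (\<alpha> $ j * l $ j) + complex_of_real pi * (cnj (l $ j) * b $ j))) *
       complex_of_real (\<Prod>j\<in>UNIV. exp (- pi * (cmod (l $ j))\<^sup>2)) * interp (b - l)"
      by (simp add: u_def interp_term_def prod.distrib interp_def mult.assoc)
    also have "(\<Prod>j\<in>UNIV. exp (complex_of_real pi * (\<alpha> $ j * l $ j) + complex_of_real pi * (cnj (l $ j) * b $ j)))
        = exp (complex_of_real pi * cdot \<alpha> l + complex_of_real pi * cdot (cnj_vec l) b)"
      unfolding exp_sum[OF finite, symmetric] by (simp add: cdot_def sum_distrib_left sum.distrib)
    also have "(\<Prod>j\<in>UNIV. exp (- pi * (cmod (l $ j))\<^sup>2)) = exp (- pi * (norm l)\<^sup>2)"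
      unfolding exp_sum[OF finite, symmetric] by (simp add: norm_vec_power2 sum_distrib_left sum_negf)
    finally show ?thesis by (simp add: atom_def exp_add mult.assoc)
  qed
  ultimately show ?thesis by simp
qed

lemma lattice_gauss_bound:
  "\<exists>M. \<forall>a J. finite J \<and> J \<subseteq> matrix_lattice S \<longrightarrow> (\<Sum>l\<in>J. exp (- pi / 2 * (norm (a - l))\<^sup>2)) \<le> M"
proof -
  have "\<forall>j. \<exists>M. \<forall>c. (\<lambda>m. exp (- (pi / 2) * (cmod (of_real (gam j) * m + c))\<^sup>2)) summable_on gauss_int \<and>
    infsum (\<lambda>m. exp (- (pi / 2) * (cmod (of_real (gam j) * m + c))\<^sup>2)) gauss_int \<le> M"
    by (intro allI gauss_sum_uniform pos) simp
  then obtain M where M: "\<And>j c. (\<lambda>m. exp (- (pi / 2) * (cmod (of_real (gam j) * m + c))\<^sup>2)) summable_on gauss_int"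
    "\<And>j c. infsum (\<lambda>m. exp (- (pi / 2) * (cmod (of_real (gam j) * m + c))\<^sup>2)) gauss_int \<le> M j" by metis
  have "(\<Sum>l\<in>J. exp (- pi / 2 * (norm (a - l))\<^sup>2)) \<le> (\<Prod>j\<in>UNIV. M j)"
    if J: "finite J" "J \<subseteq> matrix_lattice S" for a J
  proof -
    define u where "u j w = exp (- (pi / 2) * (cmod (w - a $ j))\<^sup>2)" for j w
    have eq: "u j (of_real (gam j) * m + c) = exp (- (pi / 2) * (cmod (of_real (gam j) * m + (c - a $ j)))\<^sup>2)" for j m c
      by (simp add: u_def add_diff_eq)
    have U: "(\<lambda>l. \<Prod>j\<in>UNIV. u j (l $ j)) summable_on matrix_lattice S"
      "infsum (\<lambda>l. \<Prod>j\<in>UNIV. u j (l $ j)) (matrix_lattice S) \<le> (\<Prod>j\<in>UNIV. M j)"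
      by (rule lattice_sum_bound[of u M]; (unfold eq)?; (rule M)?; simp add: u_def)+
    have "(\<Prod>j\<in>UNIV. u j (l $ j)) = exp (- pi / 2 * (norm (a - l))\<^sup>2)" for l
      unfolding u_def exp_sum[OF finite, symmetric]
      by (simp add: norm_minus_commute[of a] norm_vec_power2 sum_distrib_left sum_negf)
    then have "(\<Sum>l\<in>J. exp (- pi / 2 * (norm (a - l))\<^sup>2)) = (\<Sum>l\<in>J. \<Prod>j\<in>UNIV. u j (l $ j))" by simp
    also have "\<dots> \<le> infsum (\<lambda>l. \<Prod>j\<in>UNIV. u j (l $ j)) (matrix_lattice S)"
      by (rule finite_sum_le_infsum[OF U(1) J]) (simp add: u_def prod_nonneg)
    finally show ?thesis using U(2) by linarith
  qed
  then show ?thesis by blast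
qed

text \<open>The reproducing formula writes \<open>F\<close> as a superposition of kernel functions \<open>exp (\<pi> \<alpha> z)\<close>, which are
  interpolated exactly; the Gaussian sums over the lattice are bounded, so sum and integral may be
  interchanged.\<close>

theorem interpolation_formula:
  assumes F: "reproduced F"
  shows "((\<lambda>l. of_real vol * (F l * atom l b)) has_sum F b) (matrix_lattice S)"
proof -
  have Fm[measurable]: "F \<in> borel_measurable borel" and Fi: "integrable lborel (\<lambda>z. cmod (F z) * exp (- pi * (norm z)\<^sup>2 / 2))"
    and Fr: "\<And>w. F w = (\<integral>z. F z * gauss_kernel w z \<partial>lborel)"
    using F unfolding reproduced_def by blast+
  obtain C where C: "C \<ge> 0" "\<And>l z. cmod (atom l z) \<le> C * exp (- pi * (norm l)\<^sup>2 / 2) * exp (pi * (norm z)\<^sup>2 / 2)"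
    using atom_bound by blast
  obtain M where M: "\<And>a J. finite J \<Longrightarrow> J \<subseteq> matrix_lattice S \<Longrightarrow> (\<Sum>l\<in>J. exp (- pi / 2 * (norm (a - l))\<^sup>2)) \<le> M"
    using lattice_gauss_bound by blast
  define D where "D = C * exp (pi * (norm b)\<^sup>2 / 2)"
  have D: "D \<ge> 0" using C by (simp add: D_def)
  have "((\<lambda>l. \<integral>a. F a * gauss_kernel l a * atom l b \<partial>lborel) has_sum (\<integral>a. F a * gauss_kernel b a / of_real vol \<partial>lborel)) (matrix_lattice S)"
  proof (rule has_sum_integral_dominated(2)[where G="\<lambda>a. (D * M) * (cmod (F a) * exp (- pi * (norm a)\<^sup>2 / 2))", OF countable_lattice])
    show "(\<lambda>a. F a * gauss_kernel l a * atom l b) \<in> borel_measurable lborel" for l by measurable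
    show "integrable lborel (\<lambda>a. (D * M) * (cmod (F a) * exp (- pi * (norm a)\<^sup>2 / 2)))"
      by (rule integrable_mult_right[OF Fi])
    show "(\<Sum>l\<in>J. norm (F a * gauss_kernel l a * atom l b)) \<le> (D * M) * (cmod (F a) * exp (- pi * (norm a)\<^sup>2 / 2))"
      if J: "finite J" "J \<subseteq> matrix_lattice S" for a J
    proof -
      have "norm (F a * gauss_kernel l a * atom l b) \<le> (cmod (F a) * exp (- pi * (norm a)\<^sup>2 / 2) * D) * exp (- pi / 2 * (norm (a - l))\<^sup>2)" for l
      proof -
        have "norm (F a * gauss_kernel l a * atom l b) \<le> cmod (F a) * cmod (gauss_kernel l a) * (C * exp (- pi * (norm l)\<^sup>2 / 2) * exp (pi * (norm b)\<^sup>2 / 2))"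
          unfolding norm_mult by (intro mult_left_mono C) auto
        also have "\<dots> = (cmod (F a) * exp (- pi * (norm a)\<^sup>2 / 2) * D) * exp (- pi / 2 * (norm (a - l))\<^sup>2) * (exp (pi * (norm l)\<^sup>2 / 2) * exp (- pi * (norm l)\<^sup>2 / 2))"
          unfolding norm_gauss_kernel D_def by (simp only: mult_ac)
        also have "exp (pi * (norm l)\<^sup>2 / 2) * exp (- pi * (norm l)\<^sup>2 / 2) = 1"
          by (simp flip: exp_add)
        finally show ?thesis by simp
      qed
      then have "(\<Sum>l\<in>J. norm (F a * gauss_kernel l a * atom l b)) \<le> (cmod (F a) * exp (- pi * (norm a)\<^sup>2 / 2) * D) * (\<Sum>l\<in>J. exp (- pi / 2 * (norm (a - l))\<^sup>2))"
        unfolding sum_distrib_left by (rule sum_mono)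
      also have "\<dots> \<le> (cmod (F a) * exp (- pi * (norm a)\<^sup>2 / 2) * D) * M"
        using D by (intro mult_left_mono M J) auto
      finally show ?thesis by (simp only: mult_ac)
    qed
    show "((\<lambda>l. F a * gauss_kernel l a * atom l b) has_sum F a * gauss_kernel b a / of_real vol) (matrix_lattice S)" for a
    proof -
      have "((\<lambda>l. (F a * of_real (exp (- pi * (norm a)\<^sup>2))) * (exp (complex_of_real pi * cdot (cnj_vec a) l) * atom l b)) has_sum
        (F a * of_real (exp (- pi * (norm a)\<^sup>2))) * (exp (complex_of_real pi * cdot (cnj_vec a) b) / of_real vol)) (matrix_lattice S)"
        by (rule has_sum_cmult_right[OF kernel_interpolation])
      then show ?thesis unfolding gauss_kernel_def by (simp only: mult_ac times_divide_eq_right)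
    qed
  qed
  moreover have "(\<integral>a. F a * gauss_kernel l a * atom l b \<partial>lborel) = F l * atom l b" for l
    unfolding integral_mult_left_zero Fr[symmetric] ..
  moreover have "(\<integral>a. F a * gauss_kernel b a / of_real vol \<partial>lborel) = F b / of_real vol"
    unfolding integral_divide_zero Fr[symmetric] ..
  ultimately have "((\<lambda>l. F l * atom l b) has_sum F b / of_real vol) (matrix_lattice S)" by (simp only:)
  then have "((\<lambda>l. of_real vol * (F l * atom l b)) has_sum of_real vol * (F b / of_real vol)) (matrix_lattice S)"
    by (rule has_sum_cmult_right)
  then show ?thesis using vol_pos by simp
qed

text \<open>By the reproducing formula, the weighted value of \<open>\<bar>F\<bar>\<close> at \<open>l\<close> is at most the integral of the weighted
  \<open>\<bar>F\<bar>\<close> against a Gaussian centred at \<open>l\<close>.\<close>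

lemma samples_bounded:
  assumes F: "reproduced F"
  shows "\<exists>B. \<forall>J. finite J \<and> J \<subseteq> matrix_lattice S \<longrightarrow> (\<Sum>l\<in>J. cmod (F l) * exp (- pi * (norm l)\<^sup>2 / 2)) \<le> B"
proof -
  have Fm[measurable]: "F \<in> borel_measurable borel" and Fi: "integrable lborel (\<lambda>z. cmod (F z) * exp (- pi * (norm z)\<^sup>2 / 2))"
    and Fr: "\<And>w. F w = (\<integral>z. F z * gauss_kernel w z \<partial>lborel)"
    using F unfolding reproduced_def by blast+
  obtain M where M: "\<And>a J. finite J \<Longrightarrow> J \<subseteq> matrix_lattice S \<Longrightarrow> (\<Sum>l\<in>J. exp (- pi / 2 * (norm (a - l))\<^sup>2)) \<le> M"
    using lattice_gauss_bound by blast
  define f where "f l a = cmod (F a) * exp (- pi * (norm a)\<^sup>2 / 2) * exp (- pi / 2 * (norm (a - l))\<^sup>2)" for l a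
  have fi: "integrable lborel (f l)" for l
    by (rule integrable_dominated[OF Fi]) (auto simp: f_def[abs_def] mult_left_le)
  have Fl: "cmod (F l) * exp (- pi * (norm l)\<^sup>2 / 2) \<le> (\<integral>a. f l a \<partial>lborel)" for l
  proof -
    have "cmod (F l) \<le> (\<integral>a. norm (F a * gauss_kernel l a) \<partial>lborel)"
      by (subst Fr) (rule integral_norm_bound)
    also have "\<dots> = (\<integral>a. f l a * exp (pi * (norm l)\<^sup>2 / 2) \<partial>lborel)"
      by (simp only: norm_mult norm_gauss_kernel f_def mult.assoc)
    also have "\<dots> = (\<integral>a. f l a \<partial>lborel) * exp (pi * (norm l)\<^sup>2 / 2)" by (rule integral_mult_left_zero)
    finally have "cmod (F l) * exp (- pi * (norm l)\<^sup>2 / 2) \<le> (\<integral>a. f l a \<partial>lborel) * exp (pi * (norm l)\<^sup>2 / 2) * exp (- pi * (norm l)\<^sup>2 / 2)"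
      by (intro mult_right_mono) auto
    also have "\<dots> = (\<integral>a. f l a \<partial>lborel)" unfolding mult.assoc by (simp flip: exp_add)
    finally show ?thesis .
  qed
  have "(\<Sum>l\<in>J. cmod (F l) * exp (- pi * (norm l)\<^sup>2 / 2)) \<le> (\<integral>a. M * (cmod (F a) * exp (- pi * (norm a)\<^sup>2 / 2)) \<partial>lborel)"
    if J: "finite J" "J \<subseteq> matrix_lattice S" for J
  proof -
    have "(\<Sum>l\<in>J. cmod (F l) * exp (- pi * (norm l)\<^sup>2 / 2)) \<le> (\<Sum>l\<in>J. \<integral>a. f l a \<partial>lborel)"
      by (intro sum_mono Fl)
    also have "\<dots> = (\<integral>a. (\<Sum>l\<in>J. f l a) \<partial>lborel)"
      by (rule Bochner_Integration.integral_sum[symmetric]) (rule fi)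
    also have "\<dots> \<le> (\<integral>a. M * (cmod (F a) * exp (- pi * (norm a)\<^sup>2 / 2)) \<partial>lborel)"
    proof (rule integral_mono)
      fix a
      show "(\<Sum>l\<in>J. f l a) \<le> M * (cmod (F a) * exp (- pi * (norm a)\<^sup>2 / 2))"
        unfolding f_def sum_distrib_left[symmetric] mult.commute[of M]
        by (intro mult_left_mono M J) auto
    qed (intro Bochner_Integration.integrable_sum fi integrable_mult_right Fi)+
    finally show ?thesis .
  qed
  then show ?thesis by blast
qed

text \<open>The interpolation formula is integrated against \<open>K\<close> term by term; the weighted samples are summable, and the
  atoms grow at most like \<open>exp (\<pi> \<bar>z\<bar>\<^sup>2 / 2)\<close>.\<close>

theorem weak_interpolation:
  assumes F: "reproduced F" and K[measurable]: "K \<in> borel_measurable borel"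
    and Ki: "integrable lborel (\<lambda>z. cmod (K z) * exp (pi * (norm z)\<^sup>2 / 2))"
  shows "(\<lambda>l. norm (of_real vol * (F l * (\<integral>z. atom l z * K z \<partial>lborel)))) summable_on matrix_lattice S"
    and "((\<lambda>l. of_real vol * (F l * (\<integral>z. atom l z * K z \<partial>lborel))) has_sum (\<integral>z. F z * K z \<partial>lborel)) (matrix_lattice S)"
proof -
  have Fm[measurable]: "F \<in> borel_measurable borel" using F unfolding reproduced_def by blast+
  obtain C where C: "C \<ge> 0" "\<And>l z. cmod (atom l z) \<le> C * exp (- pi * (norm l)\<^sup>2 / 2) * exp (pi * (norm z)\<^sup>2 / 2)"
    using atom_bound by blast
  obtain B where B: "\<And>J. finite J \<Longrightarrow> J \<subseteq> matrix_lattice S \<Longrightarrow> (\<Sum>l\<in>J. cmod (F l) * exp (- pi * (norm l)\<^sup>2 / 2)) \<le> B"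
    using samples_bounded[OF F] by blast
  define f where "f l z = of_real vol * (F l * atom l z) * K z" for l z
  have meas: "f l \<in> borel_measurable lborel" for l unfolding f_def[abs_def] by measurable
  have bound: "(\<Sum>l\<in>J. norm (f l z)) \<le> (vol * C * B) * (cmod (K z) * exp (pi * (norm z)\<^sup>2 / 2))"
    if J: "finite J" "J \<subseteq> matrix_lattice S" for z J
  proof -
    have "norm (f l z) \<le> (vol * C * (cmod (K z) * exp (pi * (norm z)\<^sup>2 / 2))) * (cmod (F l) * exp (- pi * (norm l)\<^sup>2 / 2))" for l
    proof -
      have "norm (f l z) = (vol * cmod (F l) * cmod (K z)) * cmod (atom l z)"
        using vol_pos by (simp add: f_def norm_mult)
      also have "\<dots> \<le> (vol * cmod (F l) * cmod (K z)) * (C * exp (- pi * (norm l)\<^sup>2 / 2) * exp (pi * (norm z)\<^sup>2 / 2))"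
        using vol_pos by (intro mult_left_mono C) auto
      finally show ?thesis by (simp only: mult_ac)
    qed
    then have "(\<Sum>l\<in>J. norm (f l z)) \<le> (vol * C * (cmod (K z) * exp (pi * (norm z)\<^sup>2 / 2))) * (\<Sum>l\<in>J. cmod (F l) * exp (- pi * (norm l)\<^sup>2 / 2))"
      unfolding sum_distrib_left by (rule sum_mono)
    also have "\<dots> \<le> (vol * C * (cmod (K z) * exp (pi * (norm z)\<^sup>2 / 2))) * B"
      using vol_pos C(1) by (intro mult_left_mono B J) auto
    finally show ?thesis by (simp only: mult_ac)
  qed
  have Gi: "integrable lborel (\<lambda>z. (vol * C * B) * (cmod (K z) * exp (pi * (norm z)\<^sup>2 / 2)))"
    by (rule integrable_mult_right[OF Ki])
  have sums: "((\<lambda>l. f l z) has_sum F z * K z) (matrix_lattice S)" for z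
    unfolding f_def by (rule has_sum_cmult_left[OF interpolation_formula[OF F]])
  have eq: "(\<integral>z. f l z \<partial>lborel) = of_real vol * (F l * (\<integral>z. atom l z * K z \<partial>lborel))" for l
    unfolding f_def by (simp only: mult.assoc integral_mult_right_zero)
  show "(\<lambda>l. norm (of_real vol * (F l * (\<integral>z. atom l z * K z \<partial>lborel)))) summable_on matrix_lattice S"
    using has_sum_integral_dominated(1)[OF countable_lattice meas bound Gi sums] unfolding eq .
  show "((\<lambda>l. of_real vol * (F l * (\<integral>z. atom l z * K z \<partial>lborel))) has_sum (\<integral>z. F z * K z \<partial>lborel)) (matrix_lattice S)"
    using has_sum_integral_dominated(2)[OF countable_lattice meas bound Gi sums] unfolding eq .
qed

end

section \<open>The short-time Fourier transform with Gaussian window\<close>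

definition bargmann_kernel :: "real^'d \<Rightarrow> complex^'d \<Rightarrow> complex" where
  "bargmann_kernel x z = complex_of_real (2 powr (real CARD('d) / 4)) *
    exp (complex_of_real (2 * pi) * cdot (cvec x) z - complex_of_real (pi * (norm x)\<^sup>2) - complex_of_real pi * cdot z z / 2)"

text \<open>The nonholomorphic factor of \<open>tf_shift z gaussian\<close>, as a function of \<open>z\<close>.\<close>

definition phase :: "complex^'d \<Rightarrow> complex" where
  "phase z = exp (\<i> * complex_of_real (pi * (Re_vec z \<bullet> Im_vec z))) * complex_of_real (exp (- pi * (norm z)\<^sup>2 / 2))"

lemma norm_phase: "cmod (phase z) = exp (- pi * (norm z)\<^sup>2 / 2)"
  by (simp add: phase_def norm_mult)

lemma continuous_on_Re_vec [continuous_intros]: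
  "continuous_on A f \<Longrightarrow> continuous_on A (\<lambda>x. Re_vec (f x))"
  unfolding Re_vec_def by (intro continuous_intros)

lemma continuous_on_Im_vec [continuous_intros]:
  "continuous_on A f \<Longrightarrow> continuous_on A (\<lambda>x. Im_vec (f x))"
  unfolding Im_vec_def by (intro continuous_intros)

lemma continuous_on_cvec [continuous_intros]:
  "continuous_on A f \<Longrightarrow> continuous_on A (\<lambda>x. cvec (f x))"
  unfolding cvec_def by (intro continuous_intros)

lemma phase_measurable [measurable]: "phase \<in> borel_measurable borel"
  unfolding phase_def by (intro borel_measurable_continuous_onI continuous_intros) auto

lemma borel_measurable_cnj [measurable (raw)]:
  "f \<in> borel_measurable M \<Longrightarrow> (\<lambda>x. cnj (f x)) \<in> borel_measurable M"
  by (rule measurable_compose[where N=borel]) (auto intro!: borel_measurable_continuous_onI continuous_intros)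

lemma cnj_vec_cvec [simp]: "cnj_vec (cvec x) = cvec x"
  by (simp add: cvec_def cnj_vec_def vec_eq_iff)

lemma cdot_cvec: "cdot (cvec x) z = of_real (x \<bullet> Re_vec z) + \<i> * of_real (x \<bullet> Im_vec z)"
  by (simp add: cdot_def cvec_def Re_vec_def Im_vec_def inner_vec_def complex_eq_iff)

lemma cdot_self: "cdot z z = of_real ((norm (Re_vec z))\<^sup>2 - (norm (Im_vec z))\<^sup>2) + 2 * \<i> * of_real (Re_vec z \<bullet> Im_vec z)"
  unfolding cdot_def norm_vec_power2
  by (simp add: Re_vec_def Im_vec_def inner_vec_def complex_eq_iff
      power2_eq_square sum_subtractf sum.distrib[symmetric] sum_distrib_left mult.commute)

lemma norm_power2_Re_Im: "(norm z)\<^sup>2 = (norm (Re_vec z))\<^sup>2 + (norm (Im_vec z))\<^sup>2"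
  by (simp add: norm_vec_power2 Re_vec_def Im_vec_def cmod_power2 sum.distrib)

lemma tf_gaussian:
  fixes x :: "real^'d"
  shows "tf_shift z gaussian x = phase z * bargmann_kernel x z"
proof -
  define r i where "r = x \<bullet> Re_vec z" and "i = x \<bullet> Im_vec z"
  define a b c where "a = (norm (Re_vec z))\<^sup>2" and "b = (norm (Im_vec z))\<^sup>2" and "c = Re_vec z \<bullet> Im_vec z"
  have n: "(norm (x - Re_vec z))\<^sup>2 = (norm x)\<^sup>2 + a - 2 * r"
    by (simp add: a_def r_def power2_norm_eq_inner inner_diff_left inner_diff_right inner_commute algebra_simps)
  have "tf_shift z gaussian x = complex_of_real (2 powr (real CARD('d) / 4)) *
     (exp (2 * pi * \<i> * complex_of_real i) * exp (complex_of_real (- pi * ((norm x)\<^sup>2 + a - 2 * r))))"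
    unfolding tf_shift_def gaussian_def n i_def inner_commute[of "Im_vec z"] by (simp add: exp_of_real[symmetric] mult_ac)
  also have "exp (2 * pi * \<i> * complex_of_real i) * exp (complex_of_real (- pi * ((norm x)\<^sup>2 + a - 2 * r)))
      = exp (\<i> * complex_of_real (pi * c)) * exp (complex_of_real (- pi * (a + b) / 2)) *
        exp (complex_of_real (2 * pi) * (of_real r + \<i> * of_real i) - complex_of_real (pi * (norm x)\<^sup>2) -
          complex_of_real pi * (of_real (a - b) + 2 * \<i> * of_real c) / 2)"
    unfolding exp_add[symmetric] by (rule arg_cong[of _ _ exp]) (simp add: field_simps)
  finally show ?thesis
    unfolding phase_def bargmann_kernel_def cdot_cvec cdot_self norm_power2_Re_Im[of z] exp_of_real[symmetric]
    by (simp add: a_def b_def c_def r_def i_def mult_ac)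
qed

lemma norm_tf_gaussian:
  fixes x :: "real^'d"
  shows "cmod (tf_shift z gaussian x) = 2 powr (real CARD('d) / 4) * exp (- pi * (norm (x - Re_vec z))\<^sup>2)"
  by (simp add: tf_shift_def gaussian_def norm_mult)

lemma continuous_on_tf_gaussian:
  "continuous_on A (\<lambda>p. tf_shift (fst p) gaussian (snd p :: real^'d))"
  unfolding tf_shift_def gaussian_def by (intro continuous_intros)

lemma tf_gaussian_measurable [measurable]:
  "(\<lambda>p. tf_shift (fst p) gaussian (snd p :: real^'d)) \<in> borel_measurable (borel \<Otimes>\<^sub>M borel)"
  unfolding borel_prod by (intro borel_measurable_continuous_onI continuous_on_tf_gaussian)

lemma tf_gaussian_measurable_1 [measurable]:
  "tf_shift z gaussian \<in> borel_measurable (borel :: (real^'d) measure)"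
  unfolding tf_shift_def gaussian_def by (intro borel_measurable_continuous_onI continuous_intros)

lemma tf_gaussian_measurable_2 [measurable]:
  "(\<lambda>z. tf_shift z gaussian (x :: real^'d)) \<in> borel_measurable borel"
  unfolding tf_shift_def gaussian_def by (intro borel_measurable_continuous_onI continuous_intros)

lemma gaussian_integral_shift:
  fixes a :: "'a::euclidean_space"
  assumes "c > 0"
  shows "integrable lborel (\<lambda>x. exp (- pi * c * (norm (x - a))\<^sup>2))"
    and "(\<integral>x. exp (- pi * c * (norm (x - a))\<^sup>2) \<partial>lborel) = (1 / sqrt c) ^ DIM('a)"
proof -
  have m: "(\<lambda>x::'a. exp (- pi * c * (norm x)\<^sup>2)) \<in> borel_measurable borel" by measurable
  show "integrable lborel (\<lambda>x. exp (- pi * c * (norm (x - a))\<^sup>2))"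
    using integral_lborel_translation(2)[OF m, of "- a"] gaussian_integral(1)[OF assms] by simp
  show "(\<integral>x. exp (- pi * c * (norm (x - a))\<^sup>2) \<partial>lborel) = (1 / sqrt c) ^ DIM('a)"
    using integral_lborel_translation(1)[OF m, of "- a"] gaussian_integral(2)[OF assms, where 'a='a] by simp
qed

lemma tf_gaussian_L1:
  "integrable lborel (\<lambda>x::real^'d. cmod (tf_shift z gaussian x))"
  "(\<integral>x. cmod (tf_shift z gaussian x) \<partial>(lborel :: (real^'d) measure)) = 2 powr (real CARD('d) / 4)"
proof -
  show "integrable lborel (\<lambda>x::real^'d. cmod (tf_shift z gaussian x))"
    unfolding norm_tf_gaussian using gaussian_integral_shift(1)[of 1 "Re_vec z"]
    by (intro integrable_mult_right) simp
  show "(\<integral>x. cmod (tf_shift z gaussian x) \<partial>(lborel :: (real^'d) measure)) = 2 powr (real CARD('d) / 4)"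
    unfolding norm_tf_gaussian using gaussian_integral_shift(2)[of 1 "Re_vec z"] by simp
qed

lemma tf_gaussian_L2:
  "integrable lborel (\<lambda>x::real^'d. (cmod (tf_shift z gaussian x))\<^sup>2)"
  "(\<integral>x. (cmod (tf_shift z gaussian x))\<^sup>2 \<partial>(lborel :: (real^'d) measure)) = 1"
proof -
  have eq: "(cmod (tf_shift z gaussian x))\<^sup>2 = 2 powr (real CARD('d) / 2) * exp (- pi * 2 * (norm (x - Re_vec z))\<^sup>2)"
    for x :: "real^'d"
    unfolding norm_tf_gaussian by (simp add: power_mult_distrib exp_double[symmetric] powr_power mult_ac)
  show "integrable lborel (\<lambda>x::real^'d. (cmod (tf_shift z gaussian x))\<^sup>2)"
    unfolding eq using gaussian_integral_shift(1)[of 2 "Re_vec z"] by (intro integrable_mult_right) simp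
  have "(\<integral>x. (cmod (tf_shift z gaussian x))\<^sup>2 \<partial>(lborel :: (real^'d) measure)) = 2 powr (real CARD('d) / 2) * (1 / sqrt 2) ^ CARD('d)"
    unfolding eq using gaussian_integral_shift(2)[of 2 "Re_vec z"] by simp
  also have "2 powr (real CARD('d) / 2) = sqrt 2 ^ CARD('d)"
    by (simp add: powr_half_sqrt[symmetric] powr_power)
  also have "sqrt 2 ^ CARD('d) * (1 / sqrt 2) ^ CARD('d) = 1"
    by (simp flip: power_mult_distrib)
  finally show "(\<integral>x. (cmod (tf_shift z gaussian x))\<^sup>2 \<partial>(lborel :: (real^'d) measure)) = 1" .
qed

text \<open>The Bargmann transform of a shifted Gaussian is, up to a factor, a reproducing kernel of the Fock space.\<close>

lemma bargmann_kernel_gram: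
  fixes z w :: "complex^'d"
  shows "(\<integral>x. cnj (bargmann_kernel x z) * bargmann_kernel x w \<partial>lborel) = exp (complex_of_real pi * cdot (cnj_vec z) w)"
proof -
  define c where "c = complex_of_real (2 powr (real CARD('d) / 2)) *
    exp (- (complex_of_real pi * (cdot (cnj_vec z) (cnj_vec z) + cdot w w) / 2))"
  have eq: "cnj (bargmann_kernel x z) * bargmann_kernel x w =
      c * exp (of_real (- pi * 2 * (norm x)\<^sup>2) + of_real (2 * pi) * cdot (cvec x) (cnj_vec z + w))" for x :: "real^'d"
  proof -
    have "complex_of_real (2 powr (real CARD('d) / 4)) * complex_of_real (2 powr (real CARD('d) / 4)) = complex_of_real (2 powr (real CARD('d) / 2))"
      by (simp flip: of_real_mult powr_add)
    moreover have "cnj (cdot (cvec x) z) = cdot (cvec x) (cnj_vec z)"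
      unfolding cnj_cdot by simp
    ultimately have "cnj (bargmann_kernel x z) * bargmann_kernel x w = complex_of_real (2 powr (real CARD('d) / 2)) *
       (exp (complex_of_real (2 * pi) * cdot (cvec x) (cnj_vec z) - complex_of_real (pi * (norm x)\<^sup>2) - complex_of_real pi * cdot (cnj_vec z) (cnj_vec z) / 2) *
        exp (complex_of_real (2 * pi) * cdot (cvec x) w - complex_of_real (pi * (norm x)\<^sup>2) - complex_of_real pi * cdot w w / 2))"
      by (simp add: bargmann_kernel_def exp_cnj cnj_cdot mult_ac)
    then show ?thesis
      unfolding c_def exp_add[symmetric] mult.assoc
      by (simp only: exp_add[symmetric]) (simp add: cdot_add_right algebra_simps add_divide_distrib)
  qed
  have "(\<integral>x. cnj (bargmann_kernel x z) * bargmann_kernel x w \<partial>lborel)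
      = c * (exp (pi * cdot (cnj_vec z + w) (cnj_vec z + w) / 2) / (sqrt 2) ^ CARD('d))"
    unfolding eq integral_mult_right_zero by (subst complex_gaussian_integral) auto
  also have "cdot (cnj_vec z + w) (cnj_vec z + w) = cdot (cnj_vec z) (cnj_vec z) + cdot w w + 2 * cdot (cnj_vec z) w"
    by (simp add: cdot_add_left cdot_add_right cdot_commute[of w "cnj_vec z"])
  also have "c * (exp (pi * (cdot (cnj_vec z) (cnj_vec z) + cdot w w + 2 * cdot (cnj_vec z) w) / 2) / (sqrt 2) ^ CARD('d))
     = complex_of_real (2 powr (real CARD('d) / 2) / (sqrt 2) ^ CARD('d)) * exp (complex_of_real pi * cdot (cnj_vec z) w)"
    unfolding c_def by (simp add: exp_minus field_simps flip: exp_add)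
  also have "2 powr (real CARD('d) / 2) / (sqrt 2) ^ CARD('d) = 1"
    by (simp add: powr_half_sqrt[symmetric] powr_power)
  finally show ?thesis by simp
qed

lemma bargmann_kernel_entire: "entire (bargmann_kernel x)"
proof -
  have c: "entire (\<lambda>z. cdot z z)" unfolding cdot_def by (intro entire_sum entire_mult entire_nth)
  have "entire (\<lambda>z. complex_of_real (2 powr (real CARD('a) / 4)) *
    exp (complex_of_real (2 * pi) * cdot (cvec x) z + - complex_of_real (pi * (norm x)\<^sup>2) + (- complex_of_real pi / 2) * cdot z z))"
    by (intro entire_mult entire_const entire_exp entire_add entire_cdot c)
  then show ?thesis by (simp add: bargmann_kernel_def[abs_def])
qed

lemma norm_bargmann_kernel: "cmod (bargmann_kernel x z) = cmod (tf_shift z gaussian x) * exp (pi * (norm z)\<^sup>2 / 2)"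
  unfolding tf_gaussian norm_mult norm_phase by (simp add: exp_minus field_simps)

lemma bargmann_kernel_reproducing:
  fixes x :: "real^'d"
  shows "(\<integral>z. bargmann_kernel x z * gauss_kernel w z \<partial>lborel) = bargmann_kernel x w"
proof (rule fock_reproducing[OF bargmann_kernel_entire])
  have m: "bargmann_kernel x \<in> borel_measurable borel" by (rule entire_measurable[OF bargmann_kernel_entire])
  define C where "C = 2 powr (real CARD('d) / 4) * exp (pi * (norm w)\<^sup>2 / 2)"
  have i: "integrable lborel (\<lambda>z. C * exp (- pi * (1 / 2) * (norm (z - w))\<^sup>2))"
    by (intro integrable_mult_right gaussian_integral_shift) simp
  show "integrable lborel (\<lambda>z. bargmann_kernel x z * gauss_kernel w z)"
  proof (rule integrable_dominated[OF i])
    show "(\<lambda>z. bargmann_kernel x z * gauss_kernel w z) \<in> borel_measurable lborel" using m by measurable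
    fix z
    have "exp (- pi * (norm (x - Re_vec z))\<^sup>2) \<le> 1" by simp
    then have t: "cmod (tf_shift z gaussian x) \<le> 2 powr (real CARD('d) / 4)"
      unfolding norm_tf_gaussian by (intro mult_left_le) auto
    have "norm (bargmann_kernel x z * gauss_kernel w z) = cmod (tf_shift z gaussian x) * (exp (pi * (norm w)\<^sup>2 / 2) * exp (- pi / 2 * (norm (z - w))\<^sup>2)) *
      (exp (pi * (norm z)\<^sup>2 / 2) * exp (- pi * (norm z)\<^sup>2 / 2))"
      unfolding norm_mult norm_bargmann_kernel norm_gauss_kernel by (simp only: mult_ac)
    also have "exp (pi * (norm z)\<^sup>2 / 2) * exp (- pi * (norm z)\<^sup>2 / 2) = 1" by (simp flip: exp_add)
    also have "cmod (tf_shift z gaussian x) * (exp (pi * (norm w)\<^sup>2 / 2) * exp (- pi / 2 * (norm (z - w))\<^sup>2)) * 1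
       \<le> 2 powr (real CARD('d) / 4) * (exp (pi * (norm w)\<^sup>2 / 2) * exp (- pi / 2 * (norm (z - w))\<^sup>2)) * 1"
      by (intro mult_right_mono t) auto
    finally show "norm (bargmann_kernel x z * gauss_kernel w z) \<le> C * exp (- pi * (1 / 2) * (norm (z - w))\<^sup>2)"
      by (simp add: C_def)
  qed
qed

definition square_integrable :: "(real^'d \<Rightarrow> complex) \<Rightarrow> bool" where
  "square_integrable f \<longleftrightarrow> f \<in> borel_measurable borel \<and> integrable lborel (\<lambda>x. (cmod (f x))\<^sup>2)"

definition stft :: "(real^'d \<Rightarrow> complex) \<Rightarrow> complex^'d \<Rightarrow> complex" where
  "stft f z = (\<integral>x. f x * cnj (tf_shift z gaussian x) \<partial>lborel)"

text \<open>The Bargmann transform of the complex conjugate of \<open>f\<close>: the inner product with \<open>f\<close> in the second place is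
  the one that is holomorphic in \<open>z\<close>.\<close>

definition bargmann :: "(real^'d \<Rightarrow> complex) \<Rightarrow> complex^'d \<Rightarrow> complex" where
  "bargmann f z = (\<integral>x. cnj (f x) * bargmann_kernel x z \<partial>lborel)"

lemma cnj_stft: "cnj (stft f z) = phase z * bargmann f z"
proof -
  have "cnj (stft f z) = (\<integral>x. cnj (f x * cnj (tf_shift z gaussian x)) \<partial>lborel)"
    unfolding stft_def by (rule Bochner_Integration.integral_cnj[symmetric])
  also have "\<dots> = (\<integral>x. phase z * (cnj (f x) * bargmann_kernel x z) \<partial>lborel)"
    by (simp add: tf_gaussian mult_ac)
  finally have "cnj (stft f z) = (\<integral>x. phase z * (cnj (f x) * bargmann_kernel x z) \<partial>lborel)" .
  then show ?thesis by (simp add: bargmann_def)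
qed

lemma square_integrable_product:
  assumes f: "square_integrable f"
  shows "integrable lborel (\<lambda>x. cmod (f x) * cmod (tf_shift z gaussian x))"
    and "(\<integral>x. cmod (f x) * cmod (tf_shift z gaussian x) \<partial>lborel) \<le> ((\<integral>x. (cmod (f x))\<^sup>2 \<partial>lborel) + 1) / 2"
proof -
  have [measurable]: "f \<in> borel_measurable borel" and i: "integrable lborel (\<lambda>x. (cmod (f x))\<^sup>2)"
    using f by (auto simp: square_integrable_def)
  define G where "G x = ((cmod (f x))\<^sup>2 + (cmod (tf_shift z gaussian x))\<^sup>2) / 2" for x
  have G: "integrable lborel G" "(\<integral>x. G x \<partial>lborel) = ((\<integral>x. (cmod (f x))\<^sup>2 \<partial>lborel) + 1) / 2"
    unfolding G_def using i tf_gaussian_L2[of z] by simp_all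
  have le: "cmod (f x) * cmod (tf_shift z gaussian x) \<le> G x" for x
    using sum_squares_bound[of "cmod (f x)" "cmod (tf_shift z gaussian x)"] by (simp add: G_def)
  show 1: "integrable lborel (\<lambda>x. cmod (f x) * cmod (tf_shift z gaussian x))"
    by (rule integrable_dominated[OF G(1)]) (use le in auto)
  show "(\<integral>x. cmod (f x) * cmod (tf_shift z gaussian x) \<partial>lborel) \<le> ((\<integral>x. (cmod (f x))\<^sup>2 \<partial>lborel) + 1) / 2"
    unfolding G(2)[symmetric] by (rule integral_mono[OF 1 G(1) le])
qed

text \<open>The form of Fubini's theorem used throughout: \<open>k\<close> has uniformly bounded \<open>L\<^sup>1\<close> norms in \<open>x\<close>, weighted
  by an integrable function of \<open>z\<close>.\<close>

lemma fubini_weighted: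
  fixes a :: "'a::euclidean_space \<Rightarrow> complex" and k :: "'a \<Rightarrow> 'b::euclidean_space \<Rightarrow> complex"
  assumes am: "a \<in> borel_measurable borel" and ai: "integrable lborel (\<lambda>z. cmod (a z))"
    and km: "(\<lambda>p. k (fst p) (snd p)) \<in> borel_measurable (borel \<Otimes>\<^sub>M borel)"
    and ki: "\<And>z. integrable lborel (\<lambda>x. cmod (k z x))"
    and kb: "\<And>z. (\<integral>x. cmod (k z x) \<partial>lborel) \<le> C"
  shows "(\<integral>x. (\<integral>z. a z * k z x \<partial>lborel) \<partial>lborel) = (\<integral>z. a z * (\<integral>x. k z x \<partial>lborel) \<partial>lborel)"
    and "integrable lborel (\<lambda>x. \<integral>z. cmod (a z * k z x) \<partial>lborel)"
    and "(\<integral>x. (\<integral>z. cmod (a z * k z x) \<partial>lborel) \<partial>lborel) \<le> (\<integral>z. cmod (a z) \<partial>lborel) * C"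
    and "(\<integral>x. (\<integral>z. cmod (a z * k z x) \<partial>lborel) \<partial>lborel) = (\<integral>z. cmod (a z) * (\<integral>x. cmod (k z x) \<partial>lborel) \<partial>lborel)"
proof -
  note [measurable] = am km
  define H where "H p = a (fst p) * k (fst p) (snd p)" for p
  have Hm: "H \<in> borel_measurable (lborel \<Otimes>\<^sub>M lborel)"
    unfolding H_def by measurable
  have cm: "(\<lambda>z. \<integral>x. cmod (k z x) \<partial>lborel) \<in> borel_measurable borel"
  proof -
    have "(\<lambda>p. cmod (k (fst p) (snd p))) \<in> borel_measurable (lborel \<Otimes>\<^sub>M lborel)" by measurable
    then have "(\<lambda>z. \<integral>x. cmod (k z x) \<partial>lborel) \<in> borel_measurable lborel"
      by (intro lborel.borel_measurable_lebesgue_integral) (simp add: case_prod_unfold)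
    then show ?thesis by simp
  qed
  have kint: "integrable lborel (k z)" for z
  proof -
    have "(\<lambda>x. k z x) \<in> borel_measurable borel"
      using measurable_compose[OF measurable_Pair1'[of z borel] km] by simp
    then show ?thesis using ki[of z] by (subst (asm) integrable_norm_iff) auto
  qed
  have i1: "integrable lborel (\<lambda>z. cmod (a z) * (\<integral>x. cmod (k z x) \<partial>lborel))"
  proof (rule integrable_dominated[OF integrable_mult_left[OF ai, of C]])
    show "(\<lambda>z. cmod (a z) * (\<integral>x. cmod (k z x) \<partial>lborel)) \<in> borel_measurable lborel"
      using cm by measurable
    show "norm (cmod (a z) * (\<integral>x. cmod (k z x) \<partial>lborel)) \<le> cmod (a z) * C" for z
      using kb[of z] by (simp add: abs_mult mult_left_mono)
  qed
  have Hi: "integrable (lborel \<Otimes>\<^sub>M lborel) H"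
  proof (rule lborel_pair.Fubini_integrable[OF Hm])
    show "integrable lborel (\<lambda>z. \<integral>x. norm (H (z, x)) \<partial>lborel)"
      using i1 by (simp add: H_def norm_mult)
    show "AE z in lborel. integrable lborel (\<lambda>x. H (z, x))"
      using kint by (simp add: H_def)
  qed
  then have H2: "integrable (lborel \<Otimes>\<^sub>M lborel) (\<lambda>(z, x). a z * k z x)"
    by (simp add: H_def[abs_def] case_prod_unfold)
  show "(\<integral>x. (\<integral>z. a z * k z x \<partial>lborel) \<partial>lborel) = (\<integral>z. a z * (\<integral>x. k z x \<partial>lborel) \<partial>lborel)"
    using lborel_pair.Fubini_integral[OF H2] by simp
  have H3: "integrable (lborel \<Otimes>\<^sub>M lborel) (\<lambda>(z, x). cmod (a z * k z x))"
    using integrable_norm[OF Hi] by (simp add: H_def case_prod_unfold)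
  show "integrable lborel (\<lambda>x. \<integral>z. cmod (a z * k z x) \<partial>lborel)"
    using lborel_pair.integrable_snd[OF H3] by simp
  have "(\<integral>x. (\<integral>z. cmod (a z * k z x) \<partial>lborel) \<partial>lborel) = (\<integral>z. (\<integral>x. cmod (a z * k z x) \<partial>lborel) \<partial>lborel)"
    by (rule lborel_pair.Fubini_integral[OF H3])
  also have "\<dots> = (\<integral>z. cmod (a z) * (\<integral>x. cmod (k z x) \<partial>lborel) \<partial>lborel)"
    by (simp add: norm_mult)
  finally show eq: "(\<integral>x. (\<integral>z. cmod (a z * k z x) \<partial>lborel) \<partial>lborel) = (\<integral>z. cmod (a z) * (\<integral>x. cmod (k z x) \<partial>lborel) \<partial>lborel)" .
  note eq
  also have "\<dots> \<le> (\<integral>z. cmod (a z) * C \<partial>lborel)"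
    by (rule integral_mono[OF i1 integrable_mult_left[OF ai]]) (simp add: kb mult_left_mono)
  finally show "(\<integral>x. (\<integral>z. cmod (a z * k z x) \<partial>lborel) \<partial>lborel) \<le> (\<integral>z. cmod (a z) \<partial>lborel) * C" by simp
qed

lemma bargmann_kernel_measurable [measurable]:
  "(\<lambda>p. bargmann_kernel (snd p :: real^'d) (fst p)) \<in> borel_measurable (borel \<Otimes>\<^sub>M borel)"
  unfolding borel_prod bargmann_kernel_def by (intro borel_measurable_continuous_onI continuous_intros) auto

lemma bargmann_measurable:
  assumes [measurable]: "f \<in> borel_measurable borel"
  shows "bargmann f \<in> borel_measurable borel"
proof -
  have "(\<lambda>p. cnj (f (snd p)) * bargmann_kernel (snd p) (fst p)) \<in> borel_measurable (borel \<Otimes>\<^sub>M borel)"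
    by measurable
  then have "(\<lambda>p. cnj (f (snd p)) * bargmann_kernel (snd p) (fst p)) \<in> borel_measurable (lborel \<Otimes>\<^sub>M lborel)"
    by simp
  then have "(\<lambda>z. \<integral>x. cnj (f x) * bargmann_kernel x z \<partial>lborel) \<in> borel_measurable lborel"
    by (intro lborel.borel_measurable_lebesgue_integral) (simp add: case_prod_unfold)
  then show ?thesis by (simp add: bargmann_def[abs_def])
qed

lemma stft_measurable:
  assumes "f \<in> borel_measurable borel"
  shows "stft f \<in> borel_measurable borel"
proof -
  have "stft f = (\<lambda>z. cnj (phase z * bargmann f z))"
    by (simp add: cnj_stft[symmetric] fun_eq_iff)
  then show ?thesis using bargmann_measurable[OF assms] by (simp only:) measurable
qed

text \<open>Every \<open>bargmann_kernel x\<close> is reproduced; the growth of the kernels is shifted to the weights \<open>a\<close> before Fubini.\<close>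

lemma bargmann_reproducing:
  assumes f: "square_integrable f"
  shows "bargmann f w = (\<integral>z. bargmann f z * gauss_kernel w z \<partial>lborel)"
proof -
  have fm[measurable]: "f \<in> borel_measurable borel" using f by (simp add: square_integrable_def)
  define a where "a z = gauss_kernel w z * of_real (exp (pi * (norm z)\<^sup>2 / 2))" for z
  define k where "k z x = (cnj (f x) * bargmann_kernel x z) * of_real (exp (- pi * (norm z)\<^sup>2 / 2))" for z x
  have e1: "complex_of_real (exp (pi * (norm z)\<^sup>2 / 2)) * of_real (exp (- pi * (norm z)\<^sup>2 / 2)) = 1" for z :: "complex^'a"
    by (simp flip: of_real_mult exp_add)
  have am: "a \<in> borel_measurable borel" unfolding a_def by measurable
  have na: "cmod (a z) = exp (pi * (norm w)\<^sup>2 / 2) * exp (- pi * (1 / 2) * (norm (z - w))\<^sup>2)" for z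
    unfolding a_def norm_mult norm_gauss_kernel by (simp add: exp_minus)
  have ai: "integrable lborel (\<lambda>z. cmod (a z))"
    unfolding na by (intro integrable_mult_right gaussian_integral_shift) simp
  have km: "(\<lambda>p. k (fst p) (snd p)) \<in> borel_measurable (borel \<Otimes>\<^sub>M borel)"
  proof -
    have [measurable]: "(\<lambda>z::complex^'a. complex_of_real (exp (- pi * (norm z)\<^sup>2 / 2))) \<in> borel_measurable borel"
      by measurable
    show ?thesis unfolding k_def by measurable
  qed
  have nk: "cmod (k z x) = cmod (f x) * cmod (tf_shift z gaussian x)" for z x
    unfolding k_def norm_mult norm_bargmann_kernel by (simp add: exp_minus norm_inverse)
  have ak: "a z * k z x = cnj (f x) * (bargmann_kernel x z * gauss_kernel w z)" for z x
  proof -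
    have "a z * k z x = cnj (f x) * (bargmann_kernel x z * gauss_kernel w z) *
       (complex_of_real (exp (pi * (norm z)\<^sup>2 / 2)) * of_real (exp (- pi * (norm z)\<^sup>2 / 2)))"
      unfolding a_def k_def by (simp only: mult_ac)
    then show ?thesis unfolding e1 by simp
  qed
  have "(\<integral>x. (\<integral>z. a z * k z x \<partial>lborel) \<partial>lborel) = (\<integral>z. a z * (\<integral>x. k z x \<partial>lborel) \<partial>lborel)"
  proof (rule fubini_weighted(1)[OF am ai km])
    show "integrable lborel (\<lambda>x. cmod (k z x))" for z
      unfolding nk by (rule square_integrable_product(1)[OF f])
    show "(\<integral>x. cmod (k z x) \<partial>lborel) \<le> ((\<integral>x. (cmod (f x))\<^sup>2 \<partial>lborel) + 1) / 2" for z
      unfolding nk by (rule square_integrable_product(2)[OF f])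
  qed
  moreover have "(\<integral>x. (\<integral>z. a z * k z x \<partial>lborel) \<partial>lborel) = bargmann f w"
    unfolding ak integral_mult_right_zero bargmann_kernel_reproducing bargmann_def ..
  moreover have "a z * (\<integral>x. k z x \<partial>lborel) = bargmann f z * gauss_kernel w z" for z
  proof -
    have "a z * (\<integral>x. k z x \<partial>lborel) = bargmann f z * gauss_kernel w z * (complex_of_real (exp (pi * (norm z)\<^sup>2 / 2)) * of_real (exp (- pi * (norm z)\<^sup>2 / 2)))"
      unfolding k_def integral_mult_left_zero a_def bargmann_def[symmetric] by (simp only: mult_ac)
    then show ?thesis unfolding e1 by simp
  qed
  ultimately show ?thesis by simp
qed

section \<open>Injectivity and inversion of the Gaussian transform\<close>

lemma cdot_imaginary: "cdot (\<i> *s cvec y) (\<i> *s cvec y) = - of_real ((norm y)\<^sup>2)"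
proof -
  have "(\<i> * complex_of_real r) * (\<i> * complex_of_real r) = - of_real ((norm r)\<^sup>2)" for r
    by (simp add: complex_eq_iff power2_eq_square)
  then show ?thesis
    by (simp only: cdot_def norm_vec_power2 of_real_sum sum_negf[symmetric] cvec_def vector_smult_component vec_lambda_beta)
qed

text \<open>Superposing the characters with a Gaussian weight turns the hypothesis into \<open>q * G\<^sub>n = 0\<close> for the
  Gaussian approximate identity \<open>G\<^sub>n\<close>; hence the integral of \<open>q\<close> over every box vanishes.\<close>

lemma fourier_transform_zero_imp_AE_zero:
  fixes q :: "real^'d \<Rightarrow> complex"
  assumes qi: "integrable lborel q"
    and zero: "\<And>y. (\<integral>x. q x * exp (2 * pi * \<i> * of_real (x \<bullet> y)) \<partial>lborel) = 0"
  shows "AE x in lborel. q x = 0"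
proof -
  have [measurable]: "q \<in> borel_measurable borel" using qi by simp
  have qn: "integrable lborel (\<lambda>x. cmod (q x))" using qi by simp
  \<comment> \<open>Integrated over \<open>y\<close>, the character \<open>k\<close> with its Gaussian weight becomes a Gaussian centred at \<open>t\<close>.\<close>
  have heat: "(\<integral>x. q x * of_real (exp (- pi * N * (norm (x - t))\<^sup>2)) \<partial>lborel) = 0" if N: "N > 0" for N :: real and t
  proof -
    define k where "k x y = exp (of_real (- pi * (1 / N) * (norm y)\<^sup>2) + of_real (2 * pi) * cdot (cvec y) (\<i> *s cvec (x - t)))"
      for x y :: "real^'d"
    have cd: "cdot (cvec y) (\<i> *s cvec (x - t)) = \<i> * of_real (x \<bullet> y) - \<i> * of_real (t \<bullet> y)" for x y
      by (simp add: cdot_def cvec_def inner_vec_def sum_distrib_left sum_subtractf[symmetric] algebra_simps)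
    have nk: "cmod (k x y) = exp (- pi * (1 / N) * (norm y)\<^sup>2)" for x y
      by (simp add: k_def cd)
    have ki: "integrable lborel (\<lambda>y. cmod (k x y))" "(\<integral>y. cmod (k x y) \<partial>lborel) \<le> (1 / sqrt (1 / N)) ^ CARD('d)" for x
      unfolding nk using gaussian_integral[of "1 / N", where 'a="real^'d"] N by simp_all
    have km: "(\<lambda>p. k (fst p) (snd p)) \<in> borel_measurable (borel \<Otimes>\<^sub>M borel)"
      unfolding borel_prod k_def cd by (intro borel_measurable_continuous_onI continuous_intros)
    have kI: "(\<integral>y. k x y \<partial>lborel) = of_real (exp (- pi * N * (norm (x - t))\<^sup>2)) / of_real (sqrt (1 / N) ^ CARD('d))" for x
    proof -
      have "cdot (\<i> *s cvec (x - t)) (\<i> *s cvec (x - t)) = - of_real ((norm (x - t))\<^sup>2)"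
        by (rule cdot_imaginary)
      then show ?thesis
        unfolding k_def using N by (subst complex_gaussian_integral) (simp_all add: exp_of_real[symmetric] mult_ac)
    qed
    have "(\<integral>y. (\<integral>x. q x * k x y \<partial>lborel) \<partial>lborel) = (\<integral>x. q x * (\<integral>y. k x y \<partial>lborel) \<partial>lborel)"
      by (rule fubini_weighted(1)[OF _ qn km ki]) simp
    moreover have "(\<integral>x. q x * k x y \<partial>lborel) = 0" for y
    proof -
      have "q x * k x y = (q x * exp (2 * pi * \<i> * of_real (x \<bullet> y))) * (exp (of_real (- pi * (1 / N) * (norm y)\<^sup>2)) * exp (- (2 * pi * \<i> * of_real (t \<bullet> y))))" for x
        unfolding k_def cd mult.assoc exp_add[symmetric] by (simp add: algebra_simps)
      then have "(\<integral>x. q x * k x y \<partial>lborel) = (\<integral>x. q x * exp (2 * pi * \<i> * of_real (x \<bullet> y)) \<partial>lborel) *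
         (exp (of_real (- pi * (1 / N) * (norm y)\<^sup>2)) * exp (- (2 * pi * \<i> * of_real (t \<bullet> y))))"
        by (simp only: integral_mult_left_zero)
      then show ?thesis using zero[of y] by simp
    qed
    ultimately have "0 = (\<integral>x. q x * (of_real (exp (- pi * N * (norm (x - t))\<^sup>2)) / of_real (sqrt (1 / N) ^ CARD('d))) \<partial>lborel)"
      unfolding kI by simp
    also have "\<dots> = (\<integral>x. q x * of_real (exp (- pi * N * (norm (x - t))\<^sup>2)) \<partial>lborel) / of_real (sqrt (1 / N) ^ CARD('d))"
      unfolding times_divide_eq_right by (rule integral_divide_zero)
    finally show ?thesis using N by simp
  qed
  have box: "(\<integral>x. indicator (cbox a b) x *\<^sub>R q x \<partial>lborel) = 0" for a b :: "real^'d"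
  proof -
    define A where "A = cbox a b"
    have [measurable]: "A \<in> sets borel" by (simp add: A_def)
    \<comment> \<open>The indicator of the box, convolved with a Gaussian of mass \<open>1\<close>.\<close>
    define h where "h n x = sqrt (real (Suc n)) ^ CARD('d) * (\<integral>t. indicator A t * exp (- pi * real (Suc n) * (norm (x - t))\<^sup>2) \<partial>lborel)"
      for n and x :: "real^'d"
    have gi: "integrable lborel (\<lambda>t. exp (- pi * c * (norm (x - t))\<^sup>2))" "(\<integral>t. exp (- pi * c * (norm (x - t))\<^sup>2) \<partial>lborel) = (1 / sqrt c) ^ CARD('d)"
      if "c > 0" for c and x :: "real^'d"
      using gaussian_integral_shift[OF that, of x] by (simp_all add: norm_minus_commute)
    have Ai: "integrable lborel (\<lambda>t. indicator A t * exp (- pi * c * (norm (x - t))\<^sup>2))" if "c > 0" for c and x :: "real^'d"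
      by (rule integrable_dominated[OF gi(1)[OF that, of x]]) (auto simp: indicator_def)
    have qh: "(\<integral>x. q x * of_real (h n x) \<partial>lborel) = 0" for n
    proof -
      define N where "N = real (Suc n)"
      have N: "N > 0" by (simp add: N_def)
      define k where "k x t = complex_of_real (indicator A t * exp (- pi * N * (norm (x - t))\<^sup>2))" for x t
      have km: "(\<lambda>p. k (fst p) (snd p)) \<in> borel_measurable (borel \<Otimes>\<^sub>M borel)"
      proof -
        have [measurable]: "(\<lambda>p::(real^'d) \<times> (real^'d). exp (- pi * N * (norm (fst p - snd p))\<^sup>2)) \<in> borel_measurable (borel \<Otimes>\<^sub>M borel)"
          unfolding borel_prod by (intro borel_measurable_continuous_onI continuous_intros)
        show ?thesis unfolding k_def by measurable
      qed
      have nk: "cmod (k x t) = indicator A t * exp (- pi * N * (norm (x - t))\<^sup>2)" for x t by (simp add: k_def norm_mult)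
      have kb: "(\<integral>t. cmod (k x t) \<partial>lborel) \<le> (1 / sqrt N) ^ CARD('d)" for x
        unfolding nk gi(2)[OF N, of x, symmetric]
        by (rule integral_mono[OF Ai[OF N] gi(1)[OF N]]) (simp add: indicator_def)
      have "(\<integral>t. (\<integral>x. q x * k x t \<partial>lborel) \<partial>lborel) = (\<integral>x. q x * (\<integral>t. k x t \<partial>lborel) \<partial>lborel)"
        by (rule fubini_weighted(1)[OF _ qn km _ kb]) (use Ai[OF N] in \<open>simp_all add: nk\<close>)
      moreover have "(\<integral>x. q x * k x t \<partial>lborel) = 0" for t
      proof -
        have "(\<integral>x. q x * k x t \<partial>lborel) = (\<integral>x. indicator A t * (q x * of_real (exp (- pi * N * (norm (x - t))\<^sup>2))) \<partial>lborel)"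
          by (intro Bochner_Integration.integral_cong) (auto simp: k_def indicator_def)
        then show ?thesis using heat[OF N, of t] by simp
      qed
      ultimately have 0: "(\<integral>x. q x * (\<integral>t. k x t \<partial>lborel) \<partial>lborel) = 0" by simp
      have kI: "(\<integral>t. k x t \<partial>lborel) = of_real (\<integral>t. indicator A t * exp (- pi * N * (norm (x - t))\<^sup>2) \<partial>lborel)" for x
        unfolding k_def by (rule integral_complex_of_real)
      have hk: "q x * of_real (h n x) = of_real (sqrt N ^ CARD('d)) * (q x * (\<integral>t. k x t \<partial>lborel))" for x
        by (simp only: kI h_def N_def of_real_mult mult_ac)
      show ?thesis unfolding hk integral_mult_right_zero 0 by simp
    qed
    have hm[measurable]: "h n \<in> borel_measurable borel" for n
    proof -
      have "(\<lambda>p::(real^'d) \<times> (real^'d). exp (- pi * real (Suc n) * (norm (fst p - snd p))\<^sup>2)) \<in> borel_measurable (borel \<Otimes>\<^sub>M borel)"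
        unfolding borel_prod by (intro borel_measurable_continuous_onI continuous_intros)
      then have "(\<lambda>p. indicator A (snd p) * exp (- pi * real (Suc n) * (norm (fst p - snd p))\<^sup>2)) \<in> borel_measurable (borel \<Otimes>\<^sub>M borel)"
        by measurable
      then have "(\<lambda>p. indicator A (snd p) * exp (- pi * real (Suc n) * (norm (fst p - snd p))\<^sup>2)) \<in> borel_measurable (lborel \<Otimes>\<^sub>M lborel)"
        by simp
      then have "(\<lambda>x. \<integral>t. indicator A t * exp (- pi * real (Suc n) * (norm (x - t))\<^sup>2) \<partial>lborel) \<in> borel_measurable lborel"
        by (intro lborel.borel_measurable_lebesgue_integral) (simp add: case_prod_unfold)
      then show ?thesis unfolding h_def by simp
    qed
    have c1: "sqrt c ^ CARD('d) * (1 / sqrt c) ^ CARD('d) = 1" if "c > 0" for c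
      using that by (simp flip: power_mult_distrib)
    have hb: "0 \<le> h n x" "h n x \<le> 1" for n x
    proof -
      define N where "N = real (Suc n)"
      have N: "N > 0" by (simp add: N_def)
      show "0 \<le> h n x" unfolding h_def by (intro mult_nonneg_nonneg integral_nonneg_AE) auto
      have "(\<integral>t. indicator A t * exp (- pi * N * (norm (x - t))\<^sup>2) \<partial>lborel) \<le> (1 / sqrt N) ^ CARD('d)"
        unfolding gi(2)[OF N, of x, symmetric]
        by (rule integral_mono[OF Ai[OF N] gi(1)[OF N]]) (simp add: indicator_def)
      then have "h n x \<le> sqrt N ^ CARD('d) * (1 / sqrt N) ^ CARD('d)"
        unfolding h_def N_def[symmetric] by (intro mult_left_mono) (auto simp: N_def)
      then show "h n x \<le> 1" using c1[OF N] by simp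
    qed
    have lim: "(\<lambda>n. h n x) \<longlonglongrightarrow> indicator A x" if x: "x \<notin> cbox a b - box a b" for x
    proof -
      have "\<exists>d>0. \<forall>t\<in>ball x d. indicator A t = (indicator A x :: real)"
      proof (cases "x \<in> box a b")
        case True
        then obtain d where "d > 0" "ball x d \<subseteq> box a b" using open_box open_contains_ball by blast
        then have "\<forall>t\<in>ball x d. indicator A t = (indicator A x :: real)"
          using True box_subset_cbox[of a b] by (auto simp: A_def indicator_def)
        then show ?thesis using \<open>d > 0\<close> by blast
      next
        case False
        then have "x \<in> - cbox a b" using x by auto
        moreover have "open (- cbox a b)" by (simp add: open_Compl closed_cbox)
        ultimately obtain d where "d > 0" "ball x d \<subseteq> - cbox a b" using open_contains_ball by blast
        then have "\<forall>t\<in>ball x d. indicator A t = (indicator A x :: real)"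
          using \<open>x \<in> - cbox a b\<close> by (auto simp: A_def indicator_def)
        then show ?thesis using \<open>d > 0\<close> by blast
      qed
      then obtain d where d: "d > 0" "\<And>t. t \<in> ball x d \<Longrightarrow> indicator A t = (indicator A x :: real)" by blast
      define r where "r = exp (- pi * d\<^sup>2 / 2)"
      have r: "0 \<le> r" "r < 1" using d by (auto simp: r_def)
      have est: "\<bar>h n x - indicator A x\<bar> \<le> sqrt 2 ^ CARD('d) * r ^ Suc n" for n
      proof -
        define N where "N = real (Suc n)"
        have N: "N > 0" "N / 2 > 0" by (auto simp: N_def)
        let ?E = "\<lambda>t. exp (- pi * N * (norm (x - t))\<^sup>2)"
        have "h n x - indicator A x = sqrt N ^ CARD('d) * ((\<integral>t. indicator A t * ?E t \<partial>lborel) - indicator A x * (1 / sqrt N) ^ CARD('d))"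
          unfolding h_def N_def[symmetric] right_diff_distrib mult.left_commute[of "sqrt N ^ CARD('d)" "indicator A x"] c1[OF N(1)] by simp
        also have "(\<integral>t. indicator A t * ?E t \<partial>lborel) - indicator A x * (1 / sqrt N) ^ CARD('d) = (\<integral>t. indicator A t * ?E t - indicator A x * ?E t \<partial>lborel)"
          using Ai[OF N(1), of x] gi[OF N(1), of x] by simp
        finally have eq: "h n x - indicator A x = sqrt N ^ CARD('d) * (\<integral>t. indicator A t * ?E t - indicator A x * ?E t \<partial>lborel)" .
        have "norm (\<integral>t. indicator A t * ?E t - indicator A x * ?E t \<partial>lborel) \<le> (\<integral>t. r ^ Suc n * exp (- pi * (N / 2) * (norm (x - t))\<^sup>2) \<partial>lborel)"
        proof (rule norm_integral_le)
          show "norm (indicator A t * ?E t - indicator A x * ?E t) \<le> r ^ Suc n * exp (- pi * (N / 2) * (norm (x - t))\<^sup>2)" for t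
          proof (cases "t \<in> ball x d")
            case True
            then show ?thesis using d(2)[OF True] r by simp
          next
            case False
            then have "d\<^sup>2 \<le> (norm (x - t))\<^sup>2" using d by (intro power_mono) (auto simp: dist_norm)
            then have "pi * (N / 2) * d\<^sup>2 \<le> pi * (N / 2) * (norm (x - t))\<^sup>2" using N by (intro mult_left_mono) auto
            then have "?E t \<le> exp (real (Suc n) * (- pi * d\<^sup>2 / 2) + - pi * (N / 2) * (norm (x - t))\<^sup>2)"
              by (simp add: N_def field_simps)
            also have "\<dots> = r ^ Suc n * exp (- pi * (N / 2) * (norm (x - t))\<^sup>2)"
              unfolding exp_add r_def exp_of_nat_mult ..
            finally have "?E t \<le> r ^ Suc n * exp (- pi * (N / 2) * (norm (x - t))\<^sup>2)" .
            moreover have "norm (indicator A t * ?E t - indicator A x * ?E t) \<le> ?E t"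
              by (auto simp: indicator_def)
            ultimately show ?thesis by linarith
          qed
        qed (use Ai[OF N(1), of x] gi(1)[OF N(1), of x] gi(1)[OF N(2), of x] in auto)
        also have "\<dots> = r ^ Suc n * (1 / sqrt (N / 2)) ^ CARD('d)"
          using gi(2)[OF N(2), of x] by simp
        finally have "\<bar>h n x - indicator A x\<bar> \<le> sqrt N ^ CARD('d) * (r ^ Suc n * (1 / sqrt (N / 2)) ^ CARD('d))"
          unfolding eq abs_mult using N by (intro mult_mono) auto
        also have "\<dots> = r ^ Suc n * (sqrt N * (1 / sqrt (N / 2))) ^ CARD('d)" by (simp only: power_mult_distrib mult_ac)
        also have "sqrt N * (1 / sqrt (N / 2)) = sqrt 2" using N by (simp add: real_sqrt_divide)
        finally show ?thesis by (simp only: mult.commute)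
      qed
      have "(\<lambda>n. h n x - indicator A x) \<longlonglongrightarrow> 0"
      proof (rule Lim_null_comparison)
        show "\<forall>\<^sub>F n in sequentially. norm (h n x - indicator A x) \<le> sqrt 2 ^ CARD('d) * r ^ Suc n"
          using est by simp
        have "(\<lambda>n. sqrt 2 ^ CARD('d) * r ^ Suc n) \<longlonglongrightarrow> sqrt 2 ^ CARD('d) * 0"
          using r by (intro tendsto_mult tendsto_const LIMSEQ_Suc[OF LIMSEQ_realpow_zero])
        then show "(\<lambda>n. sqrt 2 ^ CARD('d) * r ^ Suc n) \<longlonglongrightarrow> 0" by simp
      qed
      then show ?thesis by (rule LIM_zero_cancel)
    qed
    have "(\<lambda>n. \<integral>x. q x * of_real (h n x) \<partial>lborel) \<longlonglongrightarrow> (\<integral>x. q x * of_real (indicator A x) \<partial>lborel)"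
    proof (rule integral_dominated_convergence[where w="\<lambda>x. cmod (q x)"])
      show "AE x in lborel. (\<lambda>n. q x * of_real (h n x)) \<longlonglongrightarrow> q x * of_real (indicator A x)"
        using AE_not_in[OF null_sets_cbox_Diff_box[of a b]]
        by eventually_elim (intro tendsto_intros lim)
      show "AE x in lborel. norm (q x * of_real (h n x)) \<le> cmod (q x)" for n
        using hb[of n] by (intro AE_I2) (simp add: norm_mult mult_left_le)
    qed (use qn in measurable)
    then have "(\<integral>x. q x * of_real (indicator A x) \<partial>lborel) = 0"
      unfolding qh by (rule LIMSEQ_unique) simp
    moreover have "(\<lambda>x. q x * of_real (indicator A x)) = (\<lambda>x. indicator (cbox a b) x *\<^sub>R q x)"
      by (auto simp: A_def indicator_def fun_eq_iff)
    ultimately show ?thesis by simp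
  qed
  have hk: "q integrable_on cbox a b" "integral (cbox a b) q = 0" for a b
  proof -
    have "set_integrable lborel (cbox a b) q"
      unfolding set_integrable_def by (rule integrable_dominated[OF qn]) (auto simp: indicator_def)
    from set_borel_integral_eq_integral[OF this] box[of a b]
    show "q integrable_on cbox a b" "integral (cbox a b) q = 0"
      by (simp_all add: set_lebesgue_integral_def)
  qed
  obtain N where N: "negligible N" "\<And>x e. x \<notin> N \<Longrightarrow> 0 < e \<Longrightarrow>
      \<exists>d>0. \<forall>h. 0 < h \<and> h < d \<longrightarrow> norm (integral (cbox x (x + h *\<^sub>R One)) q /\<^sub>R h ^ DIM(real^'d) - q x) < e"
    using integrable_ccontinuous_explicit[of q] hk(1) by metis
  have "q x = 0" if xN: "x \<notin> N" for x
  proof (rule ccontr)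
    assume "q x \<noteq> 0"
    then obtain d where d: "d > 0" "\<And>h. 0 < h \<and> h < d \<Longrightarrow> norm (integral (cbox x (x + h *\<^sub>R One)) q /\<^sub>R h ^ DIM(real^'d) - q x) < norm (q x)"
      using N(2)[OF xN, of "norm (q x)"] by auto
    show False using d(2)[of "d / 2"] d(1) by (simp add: hk(2))
  qed
  moreover have "AE x in lebesgue. x \<notin> N"
    using N(1) by (intro AE_not_in) (simp add: negligible_iff_null_sets)
  ultimately have "AE x in lebesgue. q x = 0" by (auto elim: eventually_mono)
  then show ?thesis by (simp add: AE_completion_iff)
qed

lemma bargmann_integrable:
  assumes f: "square_integrable f"
  shows "integrable lborel (\<lambda>x. cnj (f x) * bargmann_kernel x z)"
proof (rule integrable_dominated[OF integrable_mult_left[OF square_integrable_product(1)[OF f, of z], of "exp (pi * (norm z)\<^sup>2 / 2)"]])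
  have [measurable]: "f \<in> borel_measurable borel" using f by (simp add: square_integrable_def)
  have [measurable]: "(\<lambda>x. bargmann_kernel x z) \<in> borel_measurable borel"
    unfolding bargmann_kernel_def by (intro borel_measurable_continuous_onI continuous_intros)
  show "(\<lambda>x. cnj (f x) * bargmann_kernel x z) \<in> borel_measurable lborel" by measurable
qed (simp add: norm_mult norm_bargmann_kernel)

text \<open>On the imaginary subspace the Bargmann transform is the Fourier transform of an integrable function.\<close>

lemma bargmann_zero_imp_AE_zero:
  fixes f :: "real^'d \<Rightarrow> complex"
  assumes f: "square_integrable f" and z: "\<And>z. bargmann f z = 0"
  shows "AE x in lborel. f x = 0"
proof -
  define q where "q x = cnj (f x) * of_real (exp (- pi * (norm x)\<^sup>2))" for x
  define c where "c = complex_of_real (2 powr (real CARD('d) / 4))"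
  have c: "c \<noteq> 0" by (simp add: c_def)
  have eq: "cnj (f x) * bargmann_kernel x (\<i> *s cvec y) = c * exp (complex_of_real (pi * (norm y)\<^sup>2 / 2)) * (q x * exp (2 * pi * \<i> * of_real (x \<bullet> y)))" for x y
  proof -
    have 1: "cdot (cvec x) (\<i> *s cvec y) = \<i> * of_real (x \<bullet> y)"
      by (simp add: cdot_def cvec_def inner_vec_def sum_distrib_left mult_ac)
    have 2: "cdot (\<i> *s cvec y) (\<i> *s cvec y) = - of_real ((norm y)\<^sup>2)"
      by (rule cdot_imaginary)
    have "complex_of_real (2 * pi) * (\<i> * of_real (x \<bullet> y)) - complex_of_real (pi * (norm x)\<^sup>2) - complex_of_real pi * - of_real ((norm y)\<^sup>2) / 2
        = complex_of_real (pi * (norm y)\<^sup>2 / 2) + complex_of_real (- pi * (norm x)\<^sup>2) + 2 * pi * \<i> * of_real (x \<bullet> y)"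
      by simp
    then have "bargmann_kernel x (\<i> *s cvec y) = c * (exp (complex_of_real (pi * (norm y)\<^sup>2 / 2)) * exp (complex_of_real (- pi * (norm x)\<^sup>2)) * exp (2 * pi * \<i> * of_real (x \<bullet> y)))"
      unfolding bargmann_kernel_def 1 2 c_def[symmetric] by (simp only: exp_add)
    then show ?thesis by (simp add: q_def exp_of_real[symmetric] mult_ac)
  qed
  have "integrable lborel q"
  proof -
    have "integrable lborel (\<lambda>x. cnj (f x) * bargmann_kernel x (\<i> *s cvec 0))"
      by (rule bargmann_integrable[OF f])
    then have "integrable lborel (\<lambda>x. c * q x)" unfolding eq by simp
    from integrable_mult_right[OF this, of "inverse c"] show ?thesis
      using c by (simp add: mult.assoc[symmetric])
  qed
  moreover have "(\<integral>x. q x * exp (2 * pi * \<i> * of_real (x \<bullet> y)) \<partial>lborel) = 0" for y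
    using z[of "\<i> *s cvec y"] c unfolding bargmann_def eq integral_mult_right_zero by simp
  ultimately have "AE x in lborel. q x = 0" by (rule fourier_transform_zero_imp_AE_zero)
  then show ?thesis by eventually_elim (simp add: q_def)
qed

definition mod1_borel :: "(real^'d \<Rightarrow> complex) \<Rightarrow> bool" where
  "mod1_borel f \<longleftrightarrow> square_integrable f \<and> integrable lborel (\<lambda>z. cmod (stft f z))"

lemma square_integrable_tf: "square_integrable (tf_shift z gaussian)"
  using tf_gaussian_L2(1)[of z] by (simp add: square_integrable_def)

text \<open>Both sides have the same Bargmann transform, by the reproducing formula.\<close>

theorem stft_inversion:
  fixes f :: "real^'d \<Rightarrow> complex"
  assumes f: "mod1_borel f"
  shows "AE x in lborel. f x = (\<integral>z. stft f z * tf_shift z gaussian x \<partial>lborel)"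
proof -
  have sq: "square_integrable f" and ai: "integrable lborel (\<lambda>z. cmod (stft f z))"
    using f by (auto simp: mod1_borel_def)
  have fm[measurable]: "f \<in> borel_measurable borel" and f2: "integrable lborel (\<lambda>x. (cmod (f x))\<^sup>2)"
    using sq by (auto simp: square_integrable_def)
  have am[measurable]: "stft f \<in> borel_measurable borel" by (rule stft_measurable[OF fm])
  define s where "s x = (\<integral>z. stft f z * tf_shift z gaussian x \<partial>lborel)" for x
  define G where "G x = (\<integral>z. cmod (stft f z * tf_shift z gaussian x) \<partial>lborel)" for x
  define B where "B = 2 powr (real CARD('d) / 4) * (\<integral>z. cmod (stft f z) \<partial>lborel)"
  have kb: "(\<integral>x. cmod (tf_shift z gaussian (x::real^'d)) \<partial>lborel) \<le> 2 powr (real CARD('d) / 4)" for z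
    using tf_gaussian_L1(2)[of z] by simp
  have Gi: "integrable lborel G" unfolding G_def
    by (rule fubini_weighted(2)[OF am ai tf_gaussian_measurable tf_gaussian_L1(1) kb])
  have t1: "cmod (tf_shift z gaussian x) \<le> 2 powr (real CARD('d) / 4)" for z and x :: "real^'d"
    unfolding norm_tf_gaussian by (intro mult_left_le) auto
  have si: "integrable lborel (\<lambda>z. stft f z * tf_shift z gaussian x)" for x
  proof (rule integrable_dominated[OF integrable_mult_left[OF ai, of "2 powr (real CARD('d) / 4)"]])
    show "norm (stft f z * tf_shift z gaussian x) \<le> cmod (stft f z) * 2 powr (real CARD('d) / 4)" for z
      unfolding norm_mult by (intro mult_left_mono t1) simp
  qed measurable
  have sG: "cmod (s x) \<le> G x" for x unfolding s_def G_def by (rule integral_norm_bound)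
  have GB: "G x \<le> B" for x
  proof -
    have "G x \<le> (\<integral>z. cmod (stft f z) * 2 powr (real CARD('d) / 4) \<partial>lborel)"
      unfolding G_def
    proof (rule integral_mono[OF integrable_norm[OF si] integrable_mult_left[OF ai]])
      show "norm (stft f z * tf_shift z gaussian x) \<le> cmod (stft f z) * 2 powr (real CARD('d) / 4)" for z
        unfolding norm_mult by (intro mult_left_mono t1) simp
    qed
    then show ?thesis by (simp add: B_def mult.commute)
  qed
  have sm[measurable]: "s \<in> borel_measurable borel"
  proof -
    have "(\<lambda>p. stft f (snd p) * tf_shift (snd p) gaussian (fst p)) \<in> borel_measurable (borel \<Otimes>\<^sub>M borel)"
    proof -
      have "(\<lambda>p. tf_shift (snd p) gaussian (fst p :: real^'d)) \<in> borel_measurable (borel \<Otimes>\<^sub>M borel)"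
        unfolding borel_prod tf_shift_def gaussian_def by (intro borel_measurable_continuous_onI continuous_intros)
      then show ?thesis by measurable
    qed
    then have "(\<lambda>p. stft f (snd p) * tf_shift (snd p) gaussian (fst p)) \<in> borel_measurable (lborel \<Otimes>\<^sub>M lborel)"
      by simp
    then have "(\<lambda>x. \<integral>z. stft f z * tf_shift z gaussian x \<partial>lborel) \<in> borel_measurable lborel"
      by (intro lborel.borel_measurable_lebesgue_integral) (simp add: case_prod_unfold)
    then show ?thesis by (simp add: s_def[abs_def])
  qed
  have s2: "integrable lborel (\<lambda>x. (cmod (s x))\<^sup>2)"
  proof (rule integrable_dominated[OF integrable_mult_right[OF Gi, of B]])
    show "norm ((cmod (s x))\<^sup>2) \<le> B * G x" for x
    proof -
      have "cmod (s x) * cmod (s x) \<le> B * G x"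
        using sG[of x] GB[of x] order_trans[OF norm_ge_zero sG[of x]] by (intro mult_mono) (linarith | simp)+
      then show ?thesis by (simp add: power2_eq_square)
    qed
  qed measurable
  have sqs: "square_integrable s" using s2 by (simp add: square_integrable_def)
  have bs: "bargmann s w = bargmann f w" for w
  proof -
    define k where "k z x = cnj (tf_shift z gaussian x) * bargmann_kernel x w" for z and x :: "real^'d"
    have nk: "cmod (k z x) = (cmod (tf_shift w gaussian x) * cmod (tf_shift z gaussian x)) * exp (pi * (norm w)\<^sup>2 / 2)" for z x
      by (simp add: k_def norm_mult norm_bargmann_kernel)
    have ki: "integrable lborel (\<lambda>x. cmod (k z x))" for z
      unfolding nk by (intro integrable_mult_left square_integrable_product square_integrable_tf)
    have kb: "(\<integral>x. cmod (k z x) \<partial>lborel) \<le> exp (pi * (norm w)\<^sup>2 / 2)" for z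
    proof -
      have "(\<integral>x. cmod (tf_shift w gaussian (x::real^'d)) * cmod (tf_shift z gaussian x) \<partial>lborel) \<le> 1"
        using square_integrable_product(2)[OF square_integrable_tf[of w], of z] tf_gaussian_L2(2)[of w] by simp
      then have "(\<integral>x. cmod (tf_shift w gaussian (x::real^'d)) * cmod (tf_shift z gaussian x) \<partial>lborel) * exp (pi * (norm w)\<^sup>2 / 2) \<le> 1 * exp (pi * (norm w)\<^sup>2 / 2)"
        by (intro mult_right_mono) auto
      then show ?thesis unfolding nk integral_mult_left_zero by simp
    qed
    have km: "(\<lambda>p. k (fst p) (snd p)) \<in> borel_measurable (borel \<Otimes>\<^sub>M borel)"
      unfolding borel_prod k_def tf_shift_def gaussian_def bargmann_kernel_def
      by (intro borel_measurable_continuous_onI continuous_intros) auto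
    have cm: "(\<lambda>z. cnj (stft f z)) \<in> borel_measurable borel" by measurable
    have ci: "integrable lborel (\<lambda>z. cmod (cnj (stft f z)))" using ai by simp
    have "(\<integral>x. (\<integral>z. cnj (stft f z) * k z x \<partial>lborel) \<partial>lborel) = (\<integral>z. cnj (stft f z) * (\<integral>x. k z x \<partial>lborel) \<partial>lborel)"
      by (rule fubini_weighted(1)[OF cm ci km ki kb])
    moreover have "(\<integral>z. cnj (stft f z) * k z x \<partial>lborel) = cnj (s x) * bargmann_kernel x w" for x
    proof -
      have "cnj (s x) = (\<integral>z. cnj (stft f z * tf_shift z gaussian x) \<partial>lborel)"
        unfolding s_def by (rule Bochner_Integration.integral_cnj[symmetric])
      then have "cnj (s x) * bargmann_kernel x w = (\<integral>z. cnj (stft f z * tf_shift z gaussian x) * bargmann_kernel x w \<partial>lborel)"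
        by simp
      then show ?thesis by (subst eq_commute) (simp only: k_def complex_cnj_mult mult.assoc)
    qed
    moreover have "cnj (stft f z) * (\<integral>x. k z x \<partial>lborel) = bargmann f z * gauss_kernel w z" for z
    proof -
      have "(\<integral>x. k z x \<partial>lborel) = (\<integral>x. cnj (phase z) * (cnj (bargmann_kernel x z) * bargmann_kernel x w) \<partial>lborel)"
        unfolding k_def tf_gaussian by (simp add: mult_ac)
      also have "\<dots> = cnj (phase z) * exp (complex_of_real pi * cdot (cnj_vec z) w)"
        unfolding integral_mult_right_zero bargmann_kernel_gram ..
      finally have "cnj (stft f z) * (\<integral>x. k z x \<partial>lborel) = bargmann f z * exp (complex_of_real pi * cdot (cnj_vec z) w) * (phase z * cnj (phase z))"
        unfolding cnj_stft by (simp only: mult_ac)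
      also have "phase z * cnj (phase z) = of_real (exp (- pi * (norm z)\<^sup>2))"
      proof -
        have "phase z * cnj (phase z) = of_real ((cmod (phase z))\<^sup>2)" by (rule complex_norm_square[symmetric])
        also have "(cmod (phase z))\<^sup>2 = exp (- pi * (norm z)\<^sup>2)" by (simp add: norm_phase exp_double[symmetric])
        finally show ?thesis .
      qed
      finally show ?thesis by (simp only: gauss_kernel_def mult.assoc)
    qed
    ultimately show ?thesis unfolding bargmann_def[of s] bargmann_reproducing[OF sq, of w] by simp
  qed
  define e where "e x = f x - s x" for x
  have e: "square_integrable e"
  proof -
    have "integrable lborel (\<lambda>x. (cmod (e x))\<^sup>2)"
    proof (rule integrable_dominated)
      show "integrable lborel (\<lambda>x. 2 * (cmod (f x))\<^sup>2 + 2 * (cmod (s x))\<^sup>2)" using f2 s2 by simp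
      fix x
      have "(cmod (e x))\<^sup>2 \<le> (cmod (f x) + cmod (s x))\<^sup>2"
        unfolding e_def by (intro power_mono norm_triangle_ineq4) simp
      also have "\<dots> \<le> 2 * (cmod (f x))\<^sup>2 + 2 * (cmod (s x))\<^sup>2"
        using sum_squares_bound[of "cmod (f x)" "cmod (s x)"] by (simp add: power2_sum)
      finally show "norm ((cmod (e x))\<^sup>2) \<le> 2 * (cmod (f x))\<^sup>2 + 2 * (cmod (s x))\<^sup>2" by simp
    qed (simp add: e_def[abs_def])
    then show ?thesis by (simp add: square_integrable_def e_def[abs_def])
  qed
  have "bargmann e z = 0" for z
  proof -
    have "bargmann e z = bargmann f z - bargmann s z"
      unfolding bargmann_def e_def
      by (subst Bochner_Integration.integral_diff[symmetric])
         (auto intro: bargmann_integrable sq sqs simp: algebra_simps)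
    then show ?thesis by (simp add: bs)
  qed
  from bargmann_zero_imp_AE_zero[OF e this] show ?thesis
    by eventually_elim (simp add: e_def s_def)
qed

text \<open>The inversion formula for \<open>h\<close>, inserted into the left-hand side.\<close>

lemma pairing_stft:
  fixes h \<phi> :: "real^'d \<Rightarrow> complex"
  assumes h: "mod1_borel h" and [measurable]: "\<phi> \<in> borel_measurable borel"
    and \<phi>i: "\<And>z. integrable lborel (\<lambda>x. cmod (\<phi> x) * cmod (tf_shift z gaussian x))"
    and \<phi>b: "\<And>z. (\<integral>x. cmod (\<phi> x) * cmod (tf_shift z gaussian x) \<partial>lborel) \<le> C"
  shows "(\<integral>x. \<phi> x * cnj (h x) \<partial>lborel) = (\<integral>z. stft \<phi> z * cnj (stft h z) \<partial>lborel)"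
    and "integrable lborel (\<lambda>x. \<phi> x * cnj (h x))"
    and "(\<integral>x. cmod (\<phi> x * cnj (h x)) \<partial>lborel) \<le> (\<integral>z. cmod (stft h z) \<partial>lborel) * C"
proof -
  have hm[measurable]: "h \<in> borel_measurable borel" and ai: "integrable lborel (\<lambda>z. cmod (cnj (stft h z)))"
    using h by (auto simp: mod1_borel_def square_integrable_def)
  have [measurable]: "stft h \<in> borel_measurable borel" by (rule stft_measurable[OF hm])
  have am: "(\<lambda>z. cnj (stft h z)) \<in> borel_measurable borel" by measurable
  define k where "k z x = \<phi> x * cnj (tf_shift z gaussian x)" for z x
  have nk: "cmod (k z x) = cmod (\<phi> x) * cmod (tf_shift z gaussian x)" for z x by (simp add: k_def norm_mult)
  have km: "(\<lambda>p. k (fst p) (snd p)) \<in> borel_measurable (borel \<Otimes>\<^sub>M borel)"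
    unfolding k_def by measurable
  note F = fubini_weighted[of "\<lambda>z. cnj (stft h z)" k, OF am ai km, unfolded nk, OF \<phi>i \<phi>b]
  have eq: "AE x in lborel. \<phi> x * cnj (h x) = (\<integral>z. cnj (stft h z) * k z x \<partial>lborel)"
    using stft_inversion[OF h]
  proof eventually_elim
    fix x assume hx: "h x = (\<integral>z. stft h z * tf_shift z gaussian x \<partial>lborel)"
    have "cnj (h x) = (\<integral>z. cnj (stft h z * tf_shift z gaussian x) \<partial>lborel)"
      unfolding hx by (rule Bochner_Integration.integral_cnj[symmetric])
    then have "\<phi> x * cnj (h x) = (\<integral>z. \<phi> x * cnj (stft h z * tf_shift z gaussian x) \<partial>lborel)" by simp
    then show "\<phi> x * cnj (h x) = (\<integral>z. cnj (stft h z) * k z x \<partial>lborel)" by (simp add: k_def mult_ac)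
  qed
  have Im[measurable]: "(\<lambda>x. \<integral>z. cnj (stft h z) * k z x \<partial>lborel) \<in> borel_measurable lborel"
  proof -
    have "(\<lambda>p. cnj (stft h (snd p)) * k (snd p) (fst p)) \<in> borel_measurable (borel \<Otimes>\<^sub>M borel)"
    proof -
      have "(\<lambda>p. tf_shift (snd p) gaussian (fst p :: real^'d)) \<in> borel_measurable (borel \<Otimes>\<^sub>M borel)"
        unfolding borel_prod tf_shift_def gaussian_def by (intro borel_measurable_continuous_onI continuous_intros)
      then show ?thesis unfolding k_def by measurable
    qed
    then have "(\<lambda>p. cnj (stft h (snd p)) * k (snd p) (fst p)) \<in> borel_measurable (lborel \<Otimes>\<^sub>M lborel)" by simp
    then show ?thesis by (intro lborel.borel_measurable_lebesgue_integral) (simp add: case_prod_unfold)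
  qed
  have "(\<integral>x. \<phi> x * cnj (h x) \<partial>lborel) = (\<integral>x. (\<integral>z. cnj (stft h z) * k z x \<partial>lborel) \<partial>lborel)"
    by (rule integral_cong_AE[OF _ Im eq]) measurable
  also have "\<dots> = (\<integral>z. cnj (stft h z) * (\<integral>x. k z x \<partial>lborel) \<partial>lborel)" by (rule F(1))
  also have "\<dots> = (\<integral>z. stft \<phi> z * cnj (stft h z) \<partial>lborel)"
    by (simp add: k_def stft_def mult.commute)
  finally show "(\<integral>x. \<phi> x * cnj (h x) \<partial>lborel) = (\<integral>z. stft \<phi> z * cnj (stft h z) \<partial>lborel)" .
  have le: "AE x in lborel. cmod (\<phi> x * cnj (h x)) \<le> (\<integral>z. cmod (cnj (stft h z) * k z x) \<partial>lborel)"
    using eq by eventually_elim (simp only: integral_norm_bound)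
  show i: "integrable lborel (\<lambda>x. \<phi> x * cnj (h x))"
  proof (rule Bochner_Integration.integrable_bound[OF F(2)])
    show "AE x in lborel. norm (\<phi> x * cnj (h x)) \<le> norm (\<integral>z. cmod (cnj (stft h z) * k z x) \<partial>lborel)"
      using le by eventually_elim auto
  qed measurable
  have "(\<integral>x. cmod (\<phi> x * cnj (h x)) \<partial>lborel) \<le> (\<integral>x. (\<integral>z. cmod (cnj (stft h z) * k z x) \<partial>lborel) \<partial>lborel)"
    by (rule integral_mono_AE[OF integrable_norm[OF i] F(2) le])
  also have "\<dots> \<le> (\<integral>z. cmod (stft h z) \<partial>lborel) * C" using F(3) by simp
  finally show "(\<integral>x. cmod (\<phi> x * cnj (h x)) \<partial>lborel) \<le> (\<integral>z. cmod (stft h z) \<partial>lborel) * C" .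
qed

corollary moyal:
  assumes f: "square_integrable f" and h: "mod1_borel h"
  shows "(\<integral>x. f x * cnj (h x) \<partial>lborel) = (\<integral>z. stft f z * cnj (stft h z) \<partial>lborel)"
  by (rule pairing_stft(1)[OF h _ square_integrable_product[OF f]])
     (use f in \<open>simp add: square_integrable_def\<close>)

section \<open>Gaussians are Schwartz functions\<close>

text \<open>Closed under partial derivatives; those of a Gaussian are the Gaussian times such a function.\<close>

inductive polynomial_fun :: "(real^'d \<Rightarrow> complex) \<Rightarrow> bool" where
  const: "polynomial_fun (\<lambda>x. c)"
| coord: "polynomial_fun (\<lambda>x. complex_of_real (x $ j))"
| add: "polynomial_fun p \<Longrightarrow> polynomial_fun q \<Longrightarrow> polynomial_fun (\<lambda>x. p x + q x)"
| mult: "polynomial_fun p \<Longrightarrow> polynomial_fun q \<Longrightarrow> polynomial_fun (\<lambda>x. p x * q x)"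

lemma polynomial_fun_derivative:
  fixes p :: "real^'d \<Rightarrow> complex"
  assumes "polynomial_fun p"
  shows "\<exists>q. polynomial_fun q \<and> (\<forall>x. \<exists>D. (p has_derivative D) (at x) \<and> D (axis j 1) = q x)"
  using assms
proof induction
  case (const c)
  have "((\<lambda>x. c) has_derivative (\<lambda>h. 0)) (at x)" for x :: "real^'d" by simp
  then show ?case by (intro exI[of _ "\<lambda>x. 0"] conjI polynomial_fun.const allI exI[of _ "\<lambda>h. 0"]) auto
next
  case (coord i)
  have "((\<lambda>x. complex_of_real (x $ i)) has_derivative (\<lambda>h. complex_of_real (h $ i))) (at x)" for x :: "real^'d"
    by (intro bounded_linear.has_derivative[OF bounded_linear_of_real] bounded_linear.has_derivative[OF bounded_linear_vec_nth] has_derivative_ident)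
  then show ?case
    by (intro exI[of _ "\<lambda>x. complex_of_real (axis j 1 $ i)"] conjI polynomial_fun.const allI exI[of _ "\<lambda>h. complex_of_real (h $ i)"]) auto
next
  case (add p q)
  then obtain p' q' where p: "polynomial_fun p'" "\<And>x. \<exists>D. (p has_derivative D) (at x) \<and> D (axis j 1) = p' x"
    and q: "polynomial_fun q'" "\<And>x. \<exists>D. (q has_derivative D) (at x) \<and> D (axis j 1) = q' x" by blast
  show ?case
  proof (rule exI[of _ "\<lambda>x. p' x + q' x"], rule conjI[OF polynomial_fun.add[OF p(1) q(1)]], rule allI)
    fix x
    obtain D E where "(p has_derivative D) (at x)" "D (axis j 1) = p' x" "(q has_derivative E) (at x)" "E (axis j 1) = q' x"
      using p(2) q(2) by metis
    then show "\<exists>D. ((\<lambda>x. p x + q x) has_derivative D) (at x) \<and> D (axis j 1) = p' x + q' x"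
      by (intro exI[of _ "\<lambda>h. D h + E h"] conjI has_derivative_add) auto
  qed
next
  case (mult p q)
  then obtain p' q' where p: "polynomial_fun p'" "\<And>x. \<exists>D. (p has_derivative D) (at x) \<and> D (axis j 1) = p' x"
    and q: "polynomial_fun q'" "\<And>x. \<exists>D. (q has_derivative D) (at x) \<and> D (axis j 1) = q' x" by blast
  show ?case
  proof (rule exI[of _ "\<lambda>x. p x * q' x + p' x * q x"],
      rule conjI[OF polynomial_fun.add[OF polynomial_fun.mult[OF mult.hyps(1) q(1)] polynomial_fun.mult[OF p(1) mult.hyps(2)]]], rule allI)
    fix x
    obtain D E where "(p has_derivative D) (at x)" "D (axis j 1) = p' x" "(q has_derivative E) (at x)" "E (axis j 1) = q' x"
      using p(2) q(2) by metis
    then show "\<exists>D. ((\<lambda>x. p x * q x) has_derivative D) (at x) \<and> D (axis j 1) = p x * q' x + p' x * q x"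
      by (intro exI[of _ "\<lambda>h. p x * E h + D h * q x"] conjI has_derivative_mult) auto
  qed
qed

lemma polynomial_fun_bound:
  fixes p :: "real^'d \<Rightarrow> complex"
  assumes "polynomial_fun p"
  shows "\<exists>C n. 0 \<le> C \<and> (\<forall>x. cmod (p x) \<le> C * (1 + norm x) ^ n)"
  using assms
proof induction
  case (const c)
  show ?case by (intro exI[of _ "cmod c"] exI[of _ 0]) auto
next
  case (coord i)
  have "\<bar>x $ i\<bar> \<le> 1 * (1 + norm x) ^ 1" for x :: "real^'d" using component_le_norm_cart[of x i] by simp
  then show ?case by (intro exI[of _ 1] exI[of _ 1]) (simp add: norm_of_real)
next
  case (add p q)
  then obtain C n E m where C: "0 \<le> C" "\<And>x. cmod (p x) \<le> C * (1 + norm x) ^ n"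
    and E: "0 \<le> E" "\<And>x. cmod (q x) \<le> E * (1 + norm x) ^ m" by blast
  show ?case
  proof (intro exI[of _ "C + E"] exI[of _ "n + m"] conjI allI)
    fix x
    have "cmod (p x + q x) \<le> C * (1 + norm x) ^ n + E * (1 + norm x) ^ m"
      by (rule order_trans[OF norm_triangle_ineq add_mono[OF C(2) E(2)]])
    also have "\<dots> \<le> C * (1 + norm x) ^ (n + m) + E * (1 + norm x) ^ (n + m)"
      using C(1) E(1) by (intro add_mono mult_left_mono power_increasing) auto
    finally show "cmod (p x + q x) \<le> (C + E) * (1 + norm x) ^ (n + m)" by (simp add: distrib_right)
  qed (use C E in simp)
next
  case (mult p q)
  then obtain C n E m where C: "0 \<le> C" "\<And>x. cmod (p x) \<le> C * (1 + norm x) ^ n"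
    and E: "0 \<le> E" "\<And>x. cmod (q x) \<le> E * (1 + norm x) ^ m" by blast
  show ?case
  proof (intro exI[of _ "C * E"] exI[of _ "n + m"] conjI allI)
    fix x
    have "cmod (p x * q x) \<le> (C * (1 + norm x) ^ n) * (E * (1 + norm x) ^ m)"
      unfolding norm_mult using C E by (intro mult_mono) auto
    then show "cmod (p x * q x) \<le> C * E * (1 + norm x) ^ (n + m)" by (simp add: power_add mult_ac)
  qed (use C E in simp)
qed

lemma tf_gaussian_derivative:
  fixes x :: "real^'d"
  shows "(tf_shift v gaussian has_derivative
    (\<lambda>h. (complex_of_real (2 * pi) * \<i> * complex_of_real (Im_vec v \<bullet> h) - complex_of_real (2 * pi * ((x - Re_vec v) \<bullet> h))) *
      tf_shift v gaussian x)) (at x)"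
proof -
  define a b where "a = Im_vec v" and "b = Re_vec v"
  define c where "c = complex_of_real (2 powr (real CARD('d) / 4))"
  define e where "e x = complex_of_real (2 * pi) * \<i> * complex_of_real (a \<bullet> x) - complex_of_real (pi * ((x - b) \<bullet> (x - b)))" for x
  have ex: "exp (e x) = exp (complex_of_real (2 * pi) * \<i> * complex_of_real (a \<bullet> x)) * complex_of_real (exp (- pi * (norm (x - b))\<^sup>2))" for x
    unfolding e_def power2_norm_eq_inner of_real_mult[of pi] by (rule exp_minus_of_real)
  have eq: "tf_shift v gaussian = (\<lambda>x. c * exp (e x))"
    unfolding ex c_def a_def b_def by (simp add: fun_eq_iff tf_shift_def gaussian_def)
  have lin: "((\<lambda>x. complex_of_real (2 * pi) * \<i> * complex_of_real (a \<bullet> x)) has_derivative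
      (\<lambda>h. complex_of_real (2 * pi) * \<i> * complex_of_real (a \<bullet> h))) (at x)"
    by (intro has_derivative_mult_right bounded_linear.has_derivative[OF bounded_linear_of_real]
        bounded_linear.has_derivative[OF bounded_linear_inner_right] has_derivative_ident)
  have "((\<lambda>x. (x - b) \<bullet> (x - b)) has_derivative (\<lambda>h. (x - b) \<bullet> (h - 0) + (h - 0) \<bullet> (x - b))) (at x)"
    by (intro has_derivative_inner has_derivative_diff has_derivative_ident has_derivative_const)
  then have "((\<lambda>x. complex_of_real (pi * ((x - b) \<bullet> (x - b)))) has_derivative
      (\<lambda>h. complex_of_real (pi * ((x - b) \<bullet> (h - 0) + (h - 0) \<bullet> (x - b))))) (at x)"
    by (intro bounded_linear.has_derivative[OF bounded_linear_of_real] has_derivative_mult_right)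
  moreover have "pi * ((x - b) \<bullet> (h - 0) + (h - 0) \<bullet> (x - b)) = 2 * pi * ((x - b) \<bullet> h)" for h
    by (simp add: inner_commute[of h])
  ultimately have "((\<lambda>x. complex_of_real (pi * ((x - b) \<bullet> (x - b)))) has_derivative
      (\<lambda>h. complex_of_real (2 * pi * ((x - b) \<bullet> h)))) (at x)"
    by (simp only:)
  from has_derivative_diff[OF lin this]
  have e: "(e has_derivative (\<lambda>h. complex_of_real (2 * pi) * \<i> * complex_of_real (a \<bullet> h) - complex_of_real (2 * pi * ((x - b) \<bullet> h)))) (at x)"
    unfolding e_def .
  from has_derivative_mult_right[OF has_derivative_compose[OF e DERIV_exp[unfolded has_field_derivative_def]], of c]
  have "((\<lambda>x. c * exp (e x)) has_derivative (\<lambda>h. c * (exp (e x) * (complex_of_real (2 * pi) * \<i> * complex_of_real (a \<bullet> h) - complex_of_real (2 * pi * ((x - b) \<bullet> h)))))) (at x)" .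
  then show ?thesis
    unfolding eq a_def[symmetric] b_def[symmetric] by (simp only: mult_ac)
qed

lemma partials_tf_gaussian:
  assumes "polynomial_fun p"
  shows "\<exists>q. polynomial_fun q \<and> partials js (\<lambda>x. p x * tf_shift v gaussian x) = (\<lambda>x. q x * tf_shift v gaussian x)"
proof (induction js)
  case Nil
  then show ?case using assms by auto
next
  case (Cons j js)
  then obtain q where q: "polynomial_fun q" "partials js (\<lambda>x. p x * tf_shift v gaussian x) = (\<lambda>x. q x * tf_shift v gaussian x)"
    by blast
  obtain q' where q': "polynomial_fun q'" "\<And>x. \<exists>D. (q has_derivative D) (at x) \<and> D (axis j 1) = q' x"
    using polynomial_fun_derivative[OF q(1)] by blast
  define m where "m x = complex_of_real (2 * pi) * (\<i> * complex_of_real (Im_vec v $ j) + complex_of_real (Re_vec v $ j)) + complex_of_real (- 2 * pi) * complex_of_real (x $ j)" for x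
  have m: "polynomial_fun m" unfolding m_def by (intro polynomial_fun.intros)
  have "partial j (\<lambda>x. q x * tf_shift v gaussian x) x = (q x * m x + q' x) * tf_shift v gaussian x" for x
  proof -
    obtain D where D: "(q has_derivative D) (at x)" "D (axis j 1) = q' x" using q'(2) by blast
    show ?thesis
      unfolding partial_def frechet_derivative_at[OF has_derivative_mult[OF D(1) tf_gaussian_derivative], symmetric]
      by (simp add: D(2) m_def inner_axis algebra_simps)
  qed
  then show ?case
    unfolding partials.simps q(2)
    using polynomial_fun.add[OF polynomial_fun.mult[OF q(1) m] q'(1)]
    by (intro exI[of _ "\<lambda>x. q x * m x + q' x"]) auto
qed

lemma tf_gaussian_schwartz:
  fixes v :: "complex^'d"
  shows "tf_shift v gaussian \<in> schwartz"
proof -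
  have ex: "\<exists>q. polynomial_fun q \<and> partials js (tf_shift v gaussian) = (\<lambda>x. q x * tf_shift v gaussian x)" for js
    using partials_tf_gaussian[OF polynomial_fun.const[of 1], of js v] by simp
  have "partials js (tf_shift v gaussian) differentiable (at x)" for js and x :: "real^'d"
  proof -
    obtain q where q: "polynomial_fun q" "partials js (tf_shift v gaussian) = (\<lambda>x. q x * tf_shift v gaussian x)" using ex by blast
    obtain D where "(q has_derivative D) (at x)" using polynomial_fun_derivative[OF q(1)] by blast
    then show ?thesis
      unfolding q(2) by (intro differentiable_mult) (auto simp: differentiable_def intro: tf_gaussian_derivative)
  qed
  moreover have "bdd_above (range (\<lambda>x. (1 + norm x) ^ k * cmod (partials js (tf_shift v gaussian) x)))" for k js
  proof -
    obtain q where q: "polynomial_fun q" "partials js (tf_shift v gaussian) = (\<lambda>x. q x * tf_shift v gaussian x)" using ex by blast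
    obtain C n where C: "0 \<le> C" "\<And>x. cmod (q x) \<le> C * (1 + norm x) ^ n" using polynomial_fun_bound[OF q(1)] by blast
    define M where "M = C * 2 powr (real CARD('d) / 4) * exp (real (k + n) * norm (Re_vec v) + (real (k + n))\<^sup>2 / (4 * pi))"
    have "(1 + norm x) ^ k * cmod (q x * tf_shift v gaussian x) \<le> M" for x
    proof -
      define t where "t = norm (x - Re_vec v)"
      have "(1 + norm x) ^ k * cmod (q x * tf_shift v gaussian x) = (1 + norm x) ^ k * cmod (q x) * (2 powr (real CARD('d) / 4) * exp (- pi * t\<^sup>2))"
        unfolding norm_mult norm_tf_gaussian t_def by (simp only: mult.assoc)
      also have "\<dots> \<le> (1 + norm x) ^ k * (C * (1 + norm x) ^ n) * (2 powr (real CARD('d) / 4) * exp (- pi * t\<^sup>2))"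
        by (intro mult_right_mono mult_left_mono C) auto
      also have "\<dots> = C * 2 powr (real CARD('d) / 4) * ((1 + norm x) ^ (k + n) * exp (- pi * t\<^sup>2))"
        by (simp only: power_add mult_ac)
      also have "(1 + norm x) ^ (k + n) * exp (- pi * t\<^sup>2) \<le> exp (real (k + n) * norm (Re_vec v) + (real (k + n))\<^sup>2 / (4 * pi))"
      proof -
        have "(1 + norm x) ^ (k + n) \<le> exp (norm x) ^ (k + n)" by (intro power_mono exp_ge_add_one_self) simp
        then have "(1 + norm x) ^ (k + n) * exp (- pi * t\<^sup>2) \<le> exp (real (k + n) * norm x) * exp (- pi * t\<^sup>2)"
          unfolding exp_of_nat_mult by (rule mult_right_mono) simp
        also have "\<dots> = exp (real (k + n) * norm x - pi * t\<^sup>2)" by (simp flip: exp_add)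
        also have "norm x \<le> norm (Re_vec v) + t" unfolding t_def using norm_triangle_sub[of x "Re_vec v"] by simp
        then have "real (k + n) * norm x \<le> real (k + n) * (norm (Re_vec v) + t)" by (intro mult_left_mono) auto
        then have "real (k + n) * norm x - pi * t\<^sup>2 \<le> real (k + n) * norm (Re_vec v) + (real (k + n))\<^sup>2 / (4 * pi)"
          using quadratic_le[of pi "real (k + n)" t] by (simp add: distrib_left)
        finally show ?thesis by simp
      qed
      finally show ?thesis unfolding M_def using C(1) by (simp add: mult_left_mono)
    qed
    then show ?thesis unfolding q(2) by (intro bdd_aboveI2[where M=M])
  qed
  ultimately show ?thesis by (simp add: schwartz_def smooth_def)
qed

section \<open>Borel representatives\<close>

text \<open>Functions in \<open>mod1\<close> are Lebesgue measurable; Fubini's theorem for Borel product measures is applied to their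
  Borel representatives.\<close>

definition borel_rep :: "(real^'d \<Rightarrow> complex) \<Rightarrow> (real^'d \<Rightarrow> complex) \<Rightarrow> bool" where
  "borel_rep f f' \<longleftrightarrow> f \<in> borel_measurable lebesgue \<and> f' \<in> borel_measurable borel \<and> (AE x in lborel. f x = f' x)"

lemma borel_rep_self: "f \<in> borel_measurable borel \<Longrightarrow> borel_rep f f"
  by (simp add: borel_rep_def measurable_completion)

lemma borel_rep_ex:
  fixes f :: "real^'d \<Rightarrow> complex"
  assumes f: "f \<in> borel_measurable lebesgue"
  shows "\<exists>f'. borel_rep f f'"
proof -
  have "(\<lambda>x. Re (f x)) \<in> borel_measurable lebesgue" "(\<lambda>x. Im (f x)) \<in> borel_measurable lebesgue"
    using f by (auto intro: borel_measurable_Re borel_measurable_Im)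
  from this[THEN completion_ex_borel_measurable_real]
  obtain u v where [measurable]: "u \<in> borel_measurable lborel" "v \<in> borel_measurable lborel"
    and uv: "AE x in lborel. Re (f x) = u x" "AE x in lborel. Im (f x) = v x"
    by blast
  have "(\<lambda>x. Complex (u x) (v x)) \<in> borel_measurable lborel" unfolding Complex_eq by measurable
  moreover have "AE x in lborel. f x = Complex (u x) (v x)" using uv by eventually_elim (simp add: complex_eq_iff)
  ultimately show ?thesis using f by (auto simp: borel_rep_def)
qed

lemma borel_rep_integral:
  assumes "borel_rep f f'"
  shows "(\<integral>x. f x \<partial>lebesgue) = (\<integral>x. f' x \<partial>lborel)" and "integrable lebesgue f \<longleftrightarrow> integrable lborel f'"
proof -
  have f: "f \<in> borel_measurable lebesgue" and f': "f' \<in> borel_measurable lborel"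
    and ae: "AE x in lborel. f x = f' x" using assms by (auto simp: borel_rep_def)
  have f'2: "f' \<in> borel_measurable lebesgue" using f' by (rule measurable_completion)
  have ae2: "AE x in lebesgue. f x = f' x" using ae by (rule AE_completion)
  show "(\<integral>x. f x \<partial>lebesgue) = (\<integral>x. f' x \<partial>lborel)"
    unfolding integral_cong_AE[OF f f'2 ae2] by (rule integral_completion[OF f'])
  show "integrable lebesgue f \<longleftrightarrow> integrable lborel f'"
    unfolding integrable_cong_AE[OF f f'2 ae2] by (rule integrable_completion[OF f'])
qed

lemma borel_rep_map2:
  assumes f: "borel_rep f f'" and g: "borel_rep g g'" and c: "continuous_on UNIV (\<lambda>p. c (fst p) (snd p))"
  shows "borel_rep (\<lambda>x. c (f x) (g x)) (\<lambda>x. c (f' x) (g' x))"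
proof -
  have cm: "(\<lambda>p. c (fst p) (snd p)) \<in> borel_measurable (borel \<Otimes>\<^sub>M borel)"
    unfolding borel_prod by (rule borel_measurable_continuous_onI[OF c])
  have "AE x in lborel. c (f x) (g x) = c (f' x) (g' x)"
    using f g unfolding borel_rep_def by (auto elim: eventually_elim2)
  moreover have "(\<lambda>x. c (a x) (b x)) \<in> borel_measurable M"
    if "a \<in> borel_measurable M" "b \<in> borel_measurable M" for a b :: "real^'a \<Rightarrow> complex" and M
    using measurable_compose[OF measurable_Pair[OF that] cm] by simp
  ultimately show ?thesis using f g by (simp add: borel_rep_def)
qed

lemma borel_rep_add: "borel_rep f f' \<Longrightarrow> borel_rep g g' \<Longrightarrow> borel_rep (\<lambda>x. f x + g x) (\<lambda>x. f' x + g' x)"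
  by (rule borel_rep_map2[where c="\<lambda>a b. a + b"]) (auto intro!: continuous_intros)

lemma borel_rep_cmult: "borel_rep f f' \<Longrightarrow> borel_rep (\<lambda>x. k * f x) (\<lambda>x. k * f' x)"
  by (rule borel_rep_map2[where c="\<lambda>a b. k * a"]) (auto intro!: continuous_intros)

lemma borel_rep_inner: "borel_rep f f' \<Longrightarrow> borel_rep g g' \<Longrightarrow> borel_rep (\<lambda>x. f x * cnj (g x)) (\<lambda>x. f' x * cnj (g' x))"
  by (rule borel_rep_map2[where c="\<lambda>a b. a * cnj b"]) (auto intro!: continuous_intros)

lemma l2_inner_borel_rep:
  assumes "borel_rep f f'" "borel_rep g g'"
  shows "l2_inner f g = (\<integral>x. f' x * cnj (g' x) \<partial>lborel)"
  unfolding l2_inner_def by (rule borel_rep_integral[OF borel_rep_inner[OF assms]])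

lemma l2_inner_tf_gaussian:
  assumes "borel_rep f f'"
  shows "l2_inner f (tf_shift z gaussian) = stft f' z"
  unfolding stft_def by (rule l2_inner_borel_rep[OF assms borel_rep_self]) simp

lemma mod1_borel_rep:
  assumes f: "borel_rep f f'"
  shows "f \<in> mod1 \<longleftrightarrow> mod1_borel f'" and "mod1_norm f = (\<integral>z. cmod (stft f' z) \<partial>lborel)"
proof -
  have m: "f \<in> borel_measurable lebesgue" and [measurable]: "f' \<in> borel_measurable borel"
    using f by (auto simp: borel_rep_def)
  have sm[measurable]: "stft f' \<in> borel_measurable borel" by (rule stft_measurable) simp
  have "borel_rep (\<lambda>x. complex_of_real ((cmod (f x))\<^sup>2)) (\<lambda>x. complex_of_real ((cmod (f' x))\<^sup>2))"
    using borel_rep_inner[OF f f] by (simp only: complex_norm_square)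
  from borel_rep_integral(2)[OF this]
  have "integrable lebesgue (\<lambda>x. (cmod (f x))\<^sup>2) \<longleftrightarrow> integrable lborel (\<lambda>x. (cmod (f' x))\<^sup>2)"
    by (simp only: complex_of_real_integrable_eq)
  moreover have "integrable lebesgue (\<lambda>z. cmod (stft f' z)) \<longleftrightarrow> integrable lborel (\<lambda>z. cmod (stft f' z))"
    by (rule integrable_completion) simp
  ultimately show "f \<in> mod1 \<longleftrightarrow> mod1_borel f'"
    unfolding mod1_def mem_Collect_eq l2_inner_tf_gaussian[OF f] mod1_borel_def square_integrable_def using m by simp
  show "mod1_norm f = (\<integral>z. cmod (stft f' z) \<partial>lborel)"
    unfolding mod1_norm_def l2_inner_tf_gaussian[OF f] by (rule integral_completion) simp
qed

lemma mod1_borel_rep_ex: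
  assumes "f \<in> mod1"
  shows "\<exists>f'. borel_rep f f' \<and> mod1_borel f'"
  using assms borel_rep_ex[of f] mod1_borel_rep(1)[of f] by (auto simp: mod1_def)

section \<open>Density of Gaussian superpositions\<close>

lemma stft_tf_gaussian:
  fixes z w :: "complex^'d"
  shows "stft (tf_shift z gaussian) w = phase z * cnj (phase w) * exp (complex_of_real pi * cdot (cnj_vec w) z)"
proof -
  have "stft (tf_shift z gaussian) w = (\<integral>x. phase z * cnj (phase w) * (cnj (bargmann_kernel x w) * bargmann_kernel x z) \<partial>lborel)"
    unfolding stft_def tf_gaussian by (simp add: mult_ac)
  then show ?thesis by (simp only: integral_mult_right_zero bargmann_kernel_gram)
qed

lemma cnj_stft_tf_gaussian: "cnj (stft (tf_shift z gaussian) w) = stft (tf_shift w gaussian) z"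
  unfolding stft_tf_gaussian by (simp add: exp_cnj cnj_cdot cdot_commute mult_ac)

lemma norm_stft_tf_gaussian:
  fixes z w :: "complex^'d"
  shows "cmod (stft (tf_shift z gaussian) w) = exp (- pi * (1 / 2) * (norm (w - z))\<^sup>2)"
proof -
  have "cmod (stft (tf_shift z gaussian) w) = exp (- pi * (norm z)\<^sup>2 / 2) * exp (- pi * (norm w)\<^sup>2 / 2) * exp (pi * Re (cdot (cnj_vec w) z))"
    unfolding stft_tf_gaussian by (simp add: norm_mult norm_phase)
  also have "\<dots> = exp (- pi * (1 / 2) * (norm (w - z))\<^sup>2)"
    unfolding norm_diff_power2_cdot exp_add[symmetric] by (simp add: field_simps)
  finally show ?thesis .
qed

lemma mod1_borel_tf_gaussian: "mod1_borel (tf_shift z gaussian)"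
  unfolding mod1_borel_def norm_stft_tf_gaussian
  by (intro conjI square_integrable_tf gaussian_integral_shift) simp

lemma stft_tf_gaussian_measurable:
  "(\<lambda>p. stft (tf_shift (fst p) gaussian) (snd p) :: complex) \<in> borel_measurable (borel \<Otimes>\<^sub>M (borel :: (complex^'d) measure))"
  unfolding borel_prod stft_tf_gaussian phase_def cdot_def cnj_vec_def
  by (intro borel_measurable_continuous_onI continuous_intros) auto

lemma stft_tf_gaussian_continuous: "continuous_on UNIV (\<lambda>v. stft (tf_shift v gaussian) w)"
  unfolding stft_tf_gaussian phase_def cdot_def cnj_vec_def
  by (intro continuous_intros) auto

lemma square_integrable_stft_integrable:
  assumes "square_integrable f"
  shows "integrable lborel (\<lambda>x. f x * cnj (tf_shift z gaussian x))"
proof (rule integrable_dominated[OF square_integrable_product(1)[OF assms, of z]])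
  have [measurable]: "f \<in> borel_measurable borel" using assms by (simp add: square_integrable_def)
  show "(\<lambda>x. f x * cnj (tf_shift z gaussian x)) \<in> borel_measurable lborel" by measurable
qed (simp add: norm_mult)

lemma mod1_borel_add:
  assumes f: "mod1_borel f" and g: "mod1_borel g"
  shows "mod1_borel (\<lambda>x. f x + g x)" and "stft (\<lambda>x. f x + g x) z = stft f z + stft g z"
proof -
  have s: "stft (\<lambda>x. f x + g x) z = stft f z + stft g z" for z
    using square_integrable_stft_integrable[of f z] square_integrable_stft_integrable[of g z] f g
    unfolding stft_def mod1_borel_def distrib_right by simp
  show "stft (\<lambda>x. f x + g x) z = stft f z + stft g z" by (rule s)
  have [measurable]: "f \<in> borel_measurable borel" "g \<in> borel_measurable borel"
    and f2: "integrable lborel (\<lambda>x. (cmod (f x))\<^sup>2)" and g2: "integrable lborel (\<lambda>x. (cmod (g x))\<^sup>2)"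
    and f1: "integrable lborel (\<lambda>z. cmod (stft f z))" and g1: "integrable lborel (\<lambda>z. cmod (stft g z))"
    using f g by (auto simp: mod1_borel_def square_integrable_def)
  have [measurable]: "stft f \<in> borel_measurable borel" "stft g \<in> borel_measurable borel"
    by (auto intro!: stft_measurable)
  have "integrable lborel (\<lambda>x. (cmod (f x + g x))\<^sup>2)"
  proof (rule integrable_dominated)
    show "integrable lborel (\<lambda>x. 2 * (cmod (f x))\<^sup>2 + 2 * (cmod (g x))\<^sup>2)" using f2 g2 by simp
    fix x
    have "(cmod (f x + g x))\<^sup>2 \<le> (cmod (f x) + cmod (g x))\<^sup>2" by (intro power_mono norm_triangle_ineq) simp
    also have "\<dots> \<le> 2 * (cmod (f x))\<^sup>2 + 2 * (cmod (g x))\<^sup>2"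
      using sum_squares_bound[of "cmod (f x)" "cmod (g x)"] by (simp add: power2_sum)
    finally show "norm ((cmod (f x + g x))\<^sup>2) \<le> 2 * (cmod (f x))\<^sup>2 + 2 * (cmod (g x))\<^sup>2" by simp
  qed measurable
  moreover have "integrable lborel (\<lambda>z. cmod (stft f z + stft g z))"
    by (rule integrable_dominated[OF Bochner_Integration.integrable_add[OF f1 g1]]) (auto intro: norm_triangle_ineq)
  ultimately show "mod1_borel (\<lambda>x. f x + g x)"
    by (simp add: mod1_borel_def square_integrable_def s)
qed

lemma mod1_borel_cmult:
  assumes f: "mod1_borel f"
  shows "mod1_borel (\<lambda>x. c * f x)" and "stft (\<lambda>x. c * f x) z = c * stft f z"
proof -
  have s: "stft (\<lambda>x. c * f x) z = c * stft f z" for z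
    unfolding stft_def mult.assoc integral_mult_right_zero ..
  show "stft (\<lambda>x. c * f x) z = c * stft f z" by (rule s)
  show "mod1_borel (\<lambda>x. c * f x)"
    using f by (auto simp: mod1_borel_def square_integrable_def s norm_mult power_mult_distrib)
qed

lemma mod1_borel_sum:
  assumes "finite V"
  shows "mod1_borel (\<lambda>x. \<Sum>v\<in>V. c v * tf_shift v gaussian x)"
    and "stft (\<lambda>x. \<Sum>v\<in>V. c v * tf_shift v gaussian x) z = (\<Sum>v\<in>V. c v * stft (tf_shift v gaussian) z)"
proof -
  have "mod1_borel (\<lambda>x. \<Sum>v\<in>V. c v * tf_shift v gaussian x) \<and>
     stft (\<lambda>x. \<Sum>v\<in>V. c v * tf_shift v gaussian x) z = (\<Sum>v\<in>V. c v * stft (tf_shift v gaussian) z)"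
    using assms
  proof induction
    case empty
    have "stft (\<lambda>x. 0) z = 0" for z :: "complex^'a" by (simp add: stft_def)
    then show ?case by (simp add: mod1_borel_def square_integrable_def)
  next
    case (insert v V)
    then show ?case
      using mod1_borel_add[OF mod1_borel_cmult(1)[OF mod1_borel_tf_gaussian[of v], of "c v"], of "\<lambda>x. \<Sum>v\<in>V. c v * tf_shift v gaussian x"]
        mod1_borel_cmult(2)[OF mod1_borel_tf_gaussian[of v], of "c v" z] by simp
  qed
  then show "mod1_borel (\<lambda>x. \<Sum>v\<in>V. c v * tf_shift v gaussian x)"
    and "stft (\<lambda>x. \<Sum>v\<in>V. c v * tf_shift v gaussian x) z = (\<Sum>v\<in>V. c v * stft (tf_shift v gaussian) z)" by auto
qed

lemma stft_reproducing:
  assumes h: "mod1_borel h"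
  shows "stft h w = (\<integral>z. stft h z * stft (tf_shift z gaussian) w \<partial>lborel)"
proof -
  have "stft h w = cnj (\<integral>x. tf_shift w gaussian x * cnj (h x) \<partial>lborel)"
    unfolding stft_def Bochner_Integration.integral_cnj[symmetric] by (simp add: mult.commute)
  also have "\<dots> = cnj (\<integral>z. stft (tf_shift w gaussian) z * cnj (stft h z) \<partial>lborel)"
    by (simp only: moyal[OF square_integrable_tf h])
  also have "\<dots> = (\<integral>z. stft h z * stft (tf_shift z gaussian) w \<partial>lborel)"
    unfolding Bochner_Integration.integral_cnj[symmetric] complex_cnj_mult cnj_stft_tf_gaussian
    by (simp add: mult.commute)
  finally show ?thesis .
qed

text \<open>The inversion formula writes \<open>h\<close> as a superposition of the \<open>\<pi>\<^sub>z g\<close>; replacing \<open>z\<close> by the value at \<open>z\<close>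
  of a simple function close to the identity turns it into a finite one.\<close>

lemma mod1_borel_approx:
  fixes h :: "real^'d \<Rightarrow> complex"
  assumes h: "mod1_borel h" and e: "e > 0"
  shows "\<exists>V c. finite V \<and> (\<integral>w. cmod (stft h w - (\<Sum>v\<in>V. c v * stft (tf_shift v gaussian) w)) \<partial>lborel) < e"
proof -
  define R where "R z w = stft (tf_shift z gaussian :: real^'d \<Rightarrow> complex) w" for z w
  have [measurable]: "h \<in> borel_measurable borel" and ai: "integrable lborel (\<lambda>z. cmod (stft h z))"
    using h by (auto simp: mod1_borel_def square_integrable_def)
  have am[measurable]: "stft h \<in> borel_measurable borel" by (rule stft_measurable) simp
  have Rm: "(\<lambda>p. R (fst p) (snd p)) \<in> borel_measurable (borel \<Otimes>\<^sub>M borel)"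
    unfolding R_def by (rule stft_tf_gaussian_measurable)
  have Rm2[measurable]: "R z \<in> borel_measurable borel" for z
    unfolding R_def by (rule stft_measurable) simp
  have Rm1[measurable]: "(\<lambda>z. R z w) \<in> borel_measurable borel" for w
    unfolding R_def by (rule borel_measurable_continuous_onI[OF stft_tf_gaussian_continuous])
  have nR: "cmod (R z w) = exp (- pi * (1 / 2) * (norm (w - z))\<^sup>2)" for z w
    unfolding R_def by (rule norm_stft_tf_gaussian)
  have R1: "cmod (R z w) \<le> 1" for z w unfolding nR by simp
  define C where "C = (1 / sqrt (1 / 2)) ^ DIM(complex^'d)"
  have Ri: "integrable lborel (\<lambda>w. cmod (R z w))" "(\<integral>w. cmod (R z w) \<partial>lborel) = C" for z
    unfolding nR C_def using gaussian_integral_shift[of "1 / 2" z] by simp_all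
  obtain s where s: "\<And>n. simple_function lborel (s n)" "\<And>z :: complex^'d. (\<lambda>n. s n z) \<longlonglongrightarrow> z" "\<And>n z. norm (s n z) \<le> 2 * norm z"
    using borel_measurable_implies_sequence_metric[of "\<lambda>z :: complex^'d. z" lborel 0] by auto
  have sm[measurable]: "s n \<in> borel_measurable borel" for n
    using borel_measurable_simple_function[OF s(1), of n] by simp
  have fin: "finite (range (s n))" for n using s(1)[of n] by (simp add: simple_function_def)
  define k where "k n z w = R z w - R (s n z) w" for n z w
  have km: "(\<lambda>p. k n (fst p) (snd p)) \<in> borel_measurable (borel \<Otimes>\<^sub>M borel)" for n
  proof -
    have "(\<lambda>p. (s n (fst p), snd p)) \<in> (borel \<Otimes>\<^sub>M borel) \<rightarrow>\<^sub>M (borel \<Otimes>\<^sub>M (borel :: (complex^'d) measure))" by measurable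
    from measurable_compose[OF this Rm] show ?thesis unfolding k_def using Rm by simp
  qed
  have kn: "cmod (k n z w) \<le> cmod (R z w) + cmod (R (s n z) w)" for n z w
    unfolding k_def by (rule norm_triangle_ineq4)
  have kmw[measurable]: "(\<lambda>w. k n z w) \<in> borel_measurable borel" for n z unfolding k_def by measurable
  have ki: "integrable lborel (\<lambda>w. cmod (k n z w))" for n z
    by (rule integrable_dominated[OF Bochner_Integration.integrable_add[OF Ri(1)[of z] Ri(1)[of "s n z"]]]) (use kn in auto)
  \<comment> \<open>The \<open>M\<^sup>1\<close> norm of \<open>\<pi>\<^sub>z g - \<pi>\<^sub>v g\<close> for \<open>v = s n z\<close>.\<close>
  define \<kappa> where "\<kappa> n z = (\<integral>w. cmod (k n z w) \<partial>lborel)" for n z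
  have kb: "\<kappa> n z \<le> 2 * C" for n z
    unfolding \<kappa>_def using integral_mono[OF ki Bochner_Integration.integrable_add[OF Ri(1)[of z] Ri(1)[of "s n z"]], OF kn] Ri by simp
  have \<kappa>0: "0 \<le> \<kappa> n z" for n z unfolding \<kappa>_def by simp
  have \<kappa>m[measurable]: "\<kappa> n \<in> borel_measurable borel" for n
  proof -
    have "(\<lambda>p. cmod (k n (fst p) (snd p))) \<in> borel_measurable (lborel \<Otimes>\<^sub>M lborel)" using km[of n] by simp
    then have "(\<lambda>z. \<integral>w. cmod (k n z w) \<partial>lborel) \<in> borel_measurable lborel"
      by (intro lborel.borel_measurable_lebesgue_integral) (simp add: case_prod_unfold)
    then show ?thesis by (simp add: \<kappa>_def[abs_def])
  qed
  have \<kappa>lim: "(\<lambda>n. \<kappa> n z) \<longlonglongrightarrow> 0" for z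
  proof -
    define M where "M = 2 * exp (2 * pi * (norm z)\<^sup>2)"
    have bnd: "cmod (R v w) \<le> exp (2 * pi * (norm z)\<^sup>2) * exp (- pi * (1 / 4) * (norm w)\<^sup>2)" if "norm v \<le> 2 * norm z" for v w
    proof -
      have "(norm v)\<^sup>2 \<le> (2 * norm z)\<^sup>2" using that by (intro power_mono) auto
      then have "(norm w)\<^sup>2 / 2 - 4 * (norm z)\<^sup>2 \<le> (norm (w - v))\<^sup>2"
        using norm_sum_square_lower[of w "- v"] by (simp add: power_mult_distrib)
      then have "pi / 2 * ((norm w)\<^sup>2 / 2 - 4 * (norm z)\<^sup>2) \<le> pi / 2 * (norm (w - v))\<^sup>2" by (intro mult_left_mono) auto
      then show ?thesis unfolding nR exp_add[symmetric] by (simp add: algebra_simps)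
    qed
    have "(\<lambda>n. \<integral>w. cmod (k n z w) \<partial>lborel) \<longlonglongrightarrow> (\<integral>w. 0 \<partial>(lborel :: (complex^'d) measure))"
    proof (rule integral_dominated_convergence[where w="\<lambda>w. M * exp (- pi * (1 / 4) * (norm w)\<^sup>2)"])
      show "integrable lborel (\<lambda>w :: complex^'d. M * exp (- pi * (1 / 4) * (norm w)\<^sup>2))"
        using gaussian_integral(1)[of "1 / 4", where 'a="complex^'d"] by simp
      show "AE w in lborel. (\<lambda>n. cmod (k n z w)) \<longlonglongrightarrow> 0"
      proof (rule AE_I2)
        fix w
        have "isCont (\<lambda>v. R v w) z"
          using stft_tf_gaussian_continuous[of w] unfolding R_def by (auto simp: continuous_on_eq_continuous_at)
        from isCont_tendsto_compose[OF this s(2)[of z]]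
        have "(\<lambda>n. R (s n z) w) \<longlonglongrightarrow> R z w" .
        from tendsto_norm[OF tendsto_diff[OF tendsto_const[of "R z w"] this]]
        show "(\<lambda>n. cmod (k n z w)) \<longlonglongrightarrow> 0" unfolding k_def by simp
      qed
      show "AE w in lborel. norm (cmod (k n z w)) \<le> M * exp (- pi * (1 / 4) * (norm w)\<^sup>2)" for n
      proof (rule AE_I2)
        fix w
        have "cmod (R z w) + cmod (R (s n z) w) \<le> M * exp (- pi * (1 / 4) * (norm w)\<^sup>2)"
          using bnd[of z w] bnd[OF s(3)[of n z], of w] unfolding M_def by simp
        then show "norm (cmod (k n z w)) \<le> M * exp (- pi * (1 / 4) * (norm w)\<^sup>2)" using kn[of n z w] by simp
      qed
    qed measurable
    then show ?thesis unfolding \<kappa>_def by simp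
  qed
  have "(\<lambda>n. \<integral>z. cmod (stft h z) * \<kappa> n z \<partial>lborel) \<longlonglongrightarrow> (\<integral>z. 0 \<partial>(lborel :: (complex^'d) measure))"
  proof (rule integral_dominated_convergence[where w="\<lambda>z. cmod (stft h z) * (2 * C)"])
    show "AE z in lborel. (\<lambda>n. cmod (stft h z) * \<kappa> n z) \<longlonglongrightarrow> 0"
      using tendsto_mult[OF tendsto_const \<kappa>lim] by (intro AE_I2) fastforce
    show "AE z in lborel. norm (cmod (stft h z) * \<kappa> n z) \<le> cmod (stft h z) * (2 * C)" for n
      using kb[of n] \<kappa>0[of n] by (intro AE_I2) (simp add: mult_left_mono)
  qed (use ai in auto)
  then have "\<forall>\<^sub>F n in sequentially. (\<integral>z. cmod (stft h z) * \<kappa> n z \<partial>lborel) < e"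
    using e by (intro order_tendstoD(2)[of _ 0]) auto
  then obtain n where n: "(\<integral>z. cmod (stft h z) * \<kappa> n z \<partial>lborel) < e"
    by (auto simp: eventually_sequentially)
  define c where "c v = (\<integral>z. stft h z * indicator (s n -` {v}) z \<partial>lborel)" for v
  have [measurable]: "s n -` {v} \<in> sets borel" for v
    using measurable_sets[OF sm, of "{v}" n] by simp
  have R0: "cmod (stft h z * R v w) \<le> cmod (stft h z)" for z v w
    unfolding norm_mult using R1[of v w] by (intro mult_left_le) auto
  have aRi: "integrable lborel (\<lambda>z. stft h z * R z w)" for w
  proof (rule integrable_dominated[OF ai])
    show "(\<lambda>z. stft h z * R z w) \<in> borel_measurable lborel"
      by measurable
  qed (rule R0)
  have aRsi: "integrable lborel (\<lambda>z. stft h z * R (s n z) w)" for w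
  proof (rule integrable_dominated[OF ai])
    show "(\<lambda>z. stft h z * R (s n z) w) \<in> borel_measurable lborel"
      using measurable_compose[OF sm Rm1, of n w] by measurable
  qed (rule R0)
  have sums: "(\<Sum>v\<in>range (s n). c v * R v w) = (\<integral>z. stft h z * R (s n z) w \<partial>lborel)" for w
  proof -
    have ii: "integrable lborel (\<lambda>z. stft h z * indicator (s n -` {v}) z * R v w)" for v
    proof (rule integrable_dominated[OF ai])
      show "norm (stft h z * indicator (s n -` {v}) z * R v w) \<le> cmod (stft h z)" for z
        using R0[of z v w] by (cases "s n z = v") auto
    qed measurable
    have "(\<Sum>v\<in>range (s n). c v * R v w) = (\<Sum>v\<in>range (s n). \<integral>z. stft h z * indicator (s n -` {v}) z * R v w \<partial>lborel)"
      unfolding c_def integral_mult_left_zero ..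
    also have "\<dots> = (\<integral>z. (\<Sum>v\<in>range (s n). stft h z * indicator (s n -` {v}) z * R v w) \<partial>lborel)"
      using ii by (subst Bochner_Integration.integral_sum) auto
    also have "(\<lambda>z. \<Sum>v\<in>range (s n). stft h z * indicator (s n -` {v}) z * R v w) = (\<lambda>z. stft h z * R (s n z) w)"
    proof
      fix z
      have "(\<Sum>v\<in>range (s n). stft h z * indicator (s n -` {v}) z * R v w) = (\<Sum>v\<in>range (s n). if s n z = v then stft h z * R v w else 0)"
        by (intro sum.cong) (auto simp: indicator_def)
      then show "(\<Sum>v\<in>range (s n). stft h z * indicator (s n -` {v}) z * R v w) = stft h z * R (s n z) w"
        using fin[of n] by (simp add: sum.delta)
    qed
    finally show ?thesis .
  qed
  have diff: "stft h w - (\<Sum>v\<in>range (s n). c v * R v w) = (\<integral>z. stft h z * k n z w \<partial>lborel)" for w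
    unfolding sums stft_reproducing[OF h, of w, folded R_def] k_def right_diff_distrib
    by (rule Bochner_Integration.integral_diff[OF aRi aRsi, symmetric])
  note F = fubini_weighted[OF am ai km[of n] ki kb[unfolded \<kappa>_def]]
  have "(\<integral>w. cmod (stft h w - (\<Sum>v\<in>range (s n). c v * R v w)) \<partial>lborel) \<le> (\<integral>w. (\<integral>z. cmod (stft h z * k n z w) \<partial>lborel) \<partial>lborel)"
    unfolding diff by (rule integral_mono'[OF F(2) integral_norm_bound]) simp
  also have "\<dots> = (\<integral>z. cmod (stft h z) * \<kappa> n z \<partial>lborel)" unfolding \<kappa>_def by (rule F(4))
  also have "\<dots> < e" by (rule n)
  finally show ?thesis unfolding R_def using fin[of n] by blast
qed

section \<open>The pairing of \<open>M\<^sup>\<infinity>\<close> with \<open>M\<^sup>1\<close>\<close>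

lemma mod1_borel_in_mod1: "mod1_borel f \<Longrightarrow> f \<in> mod1"
  using mod1_borel_rep(1)[OF borel_rep_self, of f] by (auto simp: mod1_borel_def square_integrable_def)

text \<open>The difference of two extensions vanishes on the finite Gaussian superpositions, which are dense in \<open>M\<^sup>1\<close>.\<close>

lemma mod1_extension_unique:
  fixes h :: "real^'d \<Rightarrow> complex"
  assumes A: "mod1_extension u A" and B: "mod1_extension u B" and h: "h \<in> mod1"
  shows "A h = B h"
proof -
  define D where "D f = A f - B f" for f
  have add: "D (\<lambda>x. f x + g x) = D f + D g" if "f \<in> mod1" "g \<in> mod1" for f g
    using A B that by (simp add: D_def mod1_extension_def)
  have mul: "D (\<lambda>x. c * f x) = cnj c * D f" if "f \<in> mod1" for c f
    using A B that by (simp add: D_def mod1_extension_def right_diff_distrib)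
  have tf: "D (tf_shift v gaussian) = 0" for v
    using A B tf_gaussian_schwartz[of v] by (simp add: D_def mod1_extension_def)
  obtain a where a: "\<forall>f\<in>mod1. cmod (A f) \<le> a * mod1_norm f"
    using A unfolding mod1_extension_def by auto
  obtain b where b: "\<forall>f\<in>mod1. cmod (B f) \<le> b * mod1_norm f"
    using B unfolding mod1_extension_def by auto
  have "cmod (D f) \<le> (a + b) * mod1_norm f" if "f \<in> mod1" for f
    unfolding D_def using norm_triangle_ineq4[of "A f" "B f"] bspec[OF a that] bspec[OF b that] by (simp add: distrib_right)
  moreover have "0 \<le> mod1_norm f" for f :: "real^'d \<Rightarrow> complex" unfolding mod1_norm_def by simp
  ultimately have bound: "cmod (D f) \<le> \<bar>a + b\<bar> * mod1_norm f" if "f \<in> mod1" for f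
    using that mult_right_mono[OF abs_ge_self[of "a + b"]] order_trans by blast
  obtain h' where h': "borel_rep h h'" "mod1_borel h'" using mod1_borel_rep_ex[OF h] by blast
  have small: "cmod (D h) \<le> \<bar>a + b\<bar> * e" if e: "e > 0" for e
  proof -
    obtain V c where V: "finite V" "(\<integral>w. cmod (stft h' w - (\<Sum>v\<in>V. c v * stft (tf_shift v gaussian) w)) \<partial>lborel) < e"
      using mod1_borel_approx[OF h'(2) e] by blast
    define q where "q W x = (\<Sum>v\<in>W. c v * tf_shift v gaussian x)" for W and x :: "real^'d"
    have qm: "mod1_borel (q W)" if "finite W" for W unfolding q_def using mod1_borel_sum(1)[OF that] .
    have qV: "q V = (\<lambda>x. \<Sum>v\<in>V. c v * tf_shift v gaussian x)" by (simp add: q_def fun_eq_iff)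
    have q0: "q {} = (\<lambda>x. 0)" by (simp add: q_def fun_eq_iff)
    have D0: "D (\<lambda>x. 0) = 0"
    proof -
      have "(\<lambda>x::real^'d. 0) \<in> mod1" using mod1_borel_in_mod1[OF qm[of "{}"]] unfolding q0 by simp
      from add[OF this this] show ?thesis by simp
    qed
    have Dq: "D (q W) = 0" if "finite W" for W
      using that
    proof induction
      case empty
      show ?case unfolding q0 by (rule D0)
    next
      case (insert v W)
      have "q (insert v W) = (\<lambda>x. c v * tf_shift v gaussian x + q W x)" using insert.hyps by (simp add: q_def fun_eq_iff)
      then show ?case
        using add[OF mod1_borel_in_mod1[OF mod1_borel_cmult(1)[OF mod1_borel_tf_gaussian]] mod1_borel_in_mod1[OF qm[OF insert.hyps(1)]], of "c v" v]
          mul[OF mod1_borel_in_mod1[OF mod1_borel_tf_gaussian], of "c v" v] insert.IH tf[of v] by simp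
    qed
    define r where "r x = h x + (- 1) * q V x" for x
    have rq: "mod1_borel (\<lambda>x. (- 1) * q V x)" "q V \<in> mod1" using mod1_borel_cmult(1)[OF qm[OF V(1)], of "- 1"] mod1_borel_in_mod1[OF qm[OF V(1)]] by auto
    have qb: "q V \<in> borel_measurable borel" using qm[OF V(1)] by (simp add: mod1_borel_def square_integrable_def)
    have rr: "borel_rep r (\<lambda>x. h' x + (- 1) * q V x)" unfolding r_def
      by (intro borel_rep_add h'(1) borel_rep_cmult borel_rep_self qb)
    have "D r = D h + D (\<lambda>x. (- 1) * q V x)" unfolding r_def by (rule add[OF h mod1_borel_in_mod1[OF rq(1)]])
    then have "D h = D r" using mul[OF rq(2), of "- 1"] Dq[OF V(1)] by simp
    moreover have rn: "mod1_norm r < e"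
    proof -
      have "stft (\<lambda>x. h' x + (- 1) * q V x) w = stft h' w - (\<Sum>v\<in>V. c v * stft (tf_shift v gaussian) w)" for w
        using mod1_borel_add(2)[OF h'(2) rq(1), of w] mod1_borel_cmult(2)[OF qm[OF V(1)], of "- 1" w]
          mod1_borel_sum(2)[OF V(1), of c w, folded qV] by simp
      then show ?thesis using V(2) unfolding mod1_borel_rep(2)[OF rr] by simp
    qed
    moreover have "\<bar>a + b\<bar> * mod1_norm r \<le> \<bar>a + b\<bar> * e" using rn by (intro mult_left_mono) auto
    moreover have "cmod (D r) \<le> \<bar>a + b\<bar> * mod1_norm r"
      by (rule bound) (use mod1_borel_rep(1)[OF rr] mod1_borel_add(1)[OF h'(2) rq(1)] in blast)
    ultimately show ?thesis by (metis order_trans)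
  qed
  have "cmod (D h) \<le> 0"
  proof (rule field_le_epsilon)
    fix e :: real assume e: "0 < e"
    have "\<bar>a + b\<bar> * (e / (\<bar>a + b\<bar> + 1)) \<le> (\<bar>a + b\<bar> + 1) * (e / (\<bar>a + b\<bar> + 1))"
      using e by (intro mult_right_mono) auto
    also have "\<dots> = e" by simp
    finally have "\<bar>a + b\<bar> * (e / (\<bar>a + b\<bar> + 1)) \<le> e" .
    moreover have "cmod (D h) \<le> \<bar>a + b\<bar> * (e / (\<bar>a + b\<bar> + 1))" by (rule small) (use e in \<open>simp add: divide_pos_pos\<close>)
    ultimately show "cmod (D h) \<le> 0 + e" by simp
  qed
  then show ?thesis by (simp add: D_def)
qed

text \<open>Integration against \<open>\<phi>\<close> is bounded on \<open>M\<^sup>1\<close>, so it is the extension that defines the pairing.\<close>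

theorem mod_pair_bounded:
  fixes \<phi> :: "real^'d \<Rightarrow> complex"
  assumes m[measurable]: "\<phi> \<in> borel_measurable borel" and b: "\<And>x. cmod (\<phi> x) \<le> C"
    and u: "\<And>f. f \<in> schwartz \<Longrightarrow> distr_pair u f = (\<integral>x. \<phi> x * cnj (f x) \<partial>lebesgue)"
    and h: "borel_rep h h'" "mod1_borel h'"
  shows "mod_pair u h = (\<integral>x. \<phi> x * cnj (h' x) \<partial>lborel)"
proof -
  define B where "B f = (\<integral>x. \<phi> x * cnj (f x) \<partial>lebesgue)" for f
  define M where "M = C * 2 powr (real CARD('d) / 4)"
  have \<phi>i: "integrable lborel (\<lambda>x. cmod (\<phi> x) * cmod (tf_shift z gaussian x))" for z
    by (rule integrable_dominated[OF integrable_mult_right[OF tf_gaussian_L1(1)[of z], of C]])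
       (use b in \<open>auto intro: mult_right_mono\<close>)
  have \<phi>b: "(\<integral>x. cmod (\<phi> x) * cmod (tf_shift z gaussian x) \<partial>lborel) \<le> M" for z
    using integral_mono[OF \<phi>i integrable_mult_right[OF tf_gaussian_L1(1)[of z], of C]] b
    by (simp add: M_def tf_gaussian_L1(2) mult_right_mono)
  have rep: "borel_rep (\<lambda>x. \<phi> x * cnj (f x)) (\<lambda>x. \<phi> x * cnj (f' x))" if "borel_rep f f'" for f f'
    by (rule borel_rep_inner[OF borel_rep_self[OF m] that])
  have Bi: "integrable lebesgue (\<lambda>x. \<phi> x * cnj (f x))" and Bb: "cmod (B f) \<le> M * mod1_norm f" if f: "f \<in> mod1" for f
  proof -
    obtain f' where f': "borel_rep f f'" "mod1_borel f'" using mod1_borel_rep_ex[OF f] by blast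
    show "integrable lebesgue (\<lambda>x. \<phi> x * cnj (f x))"
      unfolding borel_rep_integral(2)[OF rep[OF f'(1)]] by (rule pairing_stft(2)[OF f'(2) m \<phi>i \<phi>b])
    have "cmod (B f) \<le> (\<integral>x. cmod (\<phi> x * cnj (f' x)) \<partial>lborel)"
      unfolding B_def borel_rep_integral(1)[OF rep[OF f'(1)]] by (rule integral_norm_bound)
    also have "\<dots> \<le> mod1_norm f * M"
      unfolding mod1_borel_rep(2)[OF f'(1)] by (rule pairing_stft(3)[OF f'(2) m \<phi>i \<phi>b])
    finally show "cmod (B f) \<le> M * mod1_norm f" by (simp only: mult.commute)
  qed
  have "mod1_extension u B"
    unfolding mod1_extension_def
  proof (intro conjI ballI allI)
    show "B (\<lambda>x. f x + g x) = B f + B g" if "f \<in> mod1" "g \<in> mod1" for f g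
      unfolding B_def using Bi[OF that(1)] Bi[OF that(2)] by (simp add: distrib_left)
    show "B (\<lambda>x. c * f x) = cnj c * B f" if "f \<in> mod1" for c f
      unfolding B_def integral_mult_right_zero[symmetric] by (simp add: mult_ac)
    show "\<exists>C. \<forall>f\<in>mod1. cmod (B f) \<le> C * mod1_norm f" using Bb by blast
    show "B f = distr_pair u f" if "f \<in> schwartz" for f using u[OF that] by (simp add: B_def)
  qed
  then have "mod_pair u h = B h"
    unfolding mod_pair_def
    using mod1_extension_unique[of u _ B h] mod1_borel_rep(1)[OF h(1)] h(2) by (intro the_equality) blast+
  also have "\<dots> = (\<integral>x. \<phi> x * cnj (h' x) \<partial>lborel)"
    unfolding B_def by (rule borel_rep_integral(1)[OF rep[OF h(1)]])
  finally show ?thesis .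
qed

section \<open>Bounded functions as tempered distributions\<close>

lemma schwartz_measurable: 
  assumes "f \<in> schwartz"
  shows "f \<in> borel_measurable borel"
proof -
  have "partials [] f differentiable (at x)" for x using assms unfolding schwartz_def smooth_def by blast
  then have "continuous_on UNIV f"
    by (auto simp: continuous_on_eq_continuous_at intro: differentiable_imp_continuous_within)
  then show ?thesis by (rule borel_measurable_continuous_onI)
qed

lemma schwartz_seminorm_upper:
  assumes "f \<in> schwartz"
  shows "(1 + norm x) ^ k * cmod (partials js f x) \<le> schwartz_seminorm k js f"
proof -
  have "bdd_above (range (\<lambda>x. (1 + norm x) ^ k * cmod (partials js f x)))"
    using assms by (simp add: schwartz_def)
  then show ?thesis unfolding schwartz_seminorm_def by (rule cSUP_upper[OF UNIV_I])
qed

lemma schwartz_seminorm_nonneg: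
  assumes "f \<in> schwartz"
  shows "0 \<le> schwartz_seminorm k js f"
  by (rule order_trans[OF _ schwartz_seminorm_upper[OF assms, of 0]]) simp

text \<open>The seminorm of order \<open>2d\<close> suffices because \<open>\<Prod>(1 + x\<^sub>j\<^sup>2) \<le> (1 + \<bar>x\<bar>)\<^sup>2\<^sup>d\<close>.\<close>

lemma schwartz_integrable:
  shows "\<exists>M\<ge>0. \<forall>f\<in>(schwartz :: (real^'d \<Rightarrow> complex) set). integrable lborel (\<lambda>x. cmod (f x)) \<and>
    (\<integral>x. cmod (f x) \<partial>lborel) \<le> M * schwartz_seminorm (2 * CARD('d)) [] f"
proof -
  define w where "w x = (\<Prod>j\<in>UNIV. inverse (1 + (x $ j)\<^sup>2))" for x :: "real^'d"
  have "integrable lborel (\<lambda>x :: real. inverse (1 + x\<^sup>2))"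
    using integrable_inverse_1_plus_square by (simp add: set_integrable_def einterval_def)
  then have "integrable lborel (\<lambda>x :: real. complex_of_real (inverse (1 + x\<^sup>2)))"
    by (simp only: complex_of_real_integrable_eq)
  from integral_lborel_prod_vec(1)[OF this, where 'd='d]
  have "integrable lborel (\<lambda>x. complex_of_real (w x))" by (simp add: w_def)
  then have wi: "integrable lborel w" by (simp only: complex_of_real_integrable_eq)
  have w0: "0 \<le> w x" for x unfolding w_def by (intro prod_nonneg) simp
  have bound: "cmod (f x) \<le> schwartz_seminorm (2 * CARD('d)) [] f * w x" if f: "f \<in> schwartz" for f and x :: "real^'d"
  proof -
    have "1 + (x $ j)\<^sup>2 \<le> (1 + norm x)\<^sup>2" for j
    proof -
      have "(x $ j)\<^sup>2 \<le> (norm x)\<^sup>2" using component_le_norm_cart[of x j] by (metis abs_ge_zero power2_abs power_mono)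
      then show ?thesis by (simp add: power2_sum add_increasing2)
    qed
    then have "(\<Prod>j\<in>UNIV. 1 + (x $ j)\<^sup>2) \<le> (\<Prod>j\<in>(UNIV :: 'd set). (1 + norm x)\<^sup>2)"
      by (intro prod_mono) auto
    also have "\<dots> = (1 + norm x) ^ (2 * CARD('d))" by (simp add: power_mult)
    finally have "(\<Prod>j\<in>UNIV. 1 + (x $ j)\<^sup>2) * cmod (f x) \<le> (1 + norm x) ^ (2 * CARD('d)) * cmod (partials [] f x)"
      by (simp add: mult_right_mono)
    also have "\<dots> \<le> schwartz_seminorm (2 * CARD('d)) [] f" by (rule schwartz_seminorm_upper[OF f])
    finally have "((\<Prod>j\<in>UNIV. 1 + (x $ j)\<^sup>2) * cmod (f x)) * w x \<le> schwartz_seminorm (2 * CARD('d)) [] f * w x"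
      by (intro mult_right_mono w0)
    moreover have "(\<Prod>j\<in>UNIV. 1 + (x $ j)\<^sup>2) * w x = 1"
      unfolding w_def prod.distrib[symmetric] by (intro prod.neutral) (simp add: add_nonneg_eq_0_iff)
    moreover have "((\<Prod>j\<in>UNIV. 1 + (x $ j)\<^sup>2) * cmod (f x)) * w x = ((\<Prod>j\<in>UNIV. 1 + (x $ j)\<^sup>2) * w x) * cmod (f x)"
      by (simp only: mult_ac)
    ultimately show ?thesis by simp
  qed
  show ?thesis
  proof (intro exI[of _ "\<integral>x. w x \<partial>lborel"] conjI ballI)
    show "0 \<le> (\<integral>x. w x \<partial>lborel)" using w0 by simp
    fix f :: "real^'d \<Rightarrow> complex" assume f: "f \<in> schwartz"
    note [measurable] = schwartz_measurable[OF f]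
    show i: "integrable lborel (\<lambda>x. cmod (f x))"
      by (rule integrable_dominated[OF integrable_mult_right[OF wi, of "schwartz_seminorm (2 * CARD('d)) [] f"]])
         (use bound[OF f] in auto)
    show "(\<integral>x. cmod (f x) \<partial>lborel) \<le> (\<integral>x. w x \<partial>lborel) * schwartz_seminorm (2 * CARD('d)) [] f"
      using integral_mono[OF i integrable_mult_right[OF wi] bound[OF f]] by (simp add: mult.commute)
  qed
qed

definition fun_distr :: "(real^'d \<Rightarrow> complex) \<Rightarrow> ('d :: finite) distr" where
  "fun_distr \<phi> f = (\<integral>x. \<phi> x * f x \<partial>lebesgue)"

context
  fixes \<phi> :: "real^'d \<Rightarrow> complex" and C :: real
  assumes m[measurable]: "\<phi> \<in> borel_measurable borel" and b: "\<And>x. cmod (\<phi> x) \<le> C"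
begin

lemma fun_distr_lborel:
  assumes [measurable]: "f \<in> borel_measurable borel"
  shows "fun_distr \<phi> f = (\<integral>x. \<phi> x * f x \<partial>lborel)"
  unfolding fun_distr_def by (rule integral_completion) simp

lemma fun_distr_tempered: "tempered (fun_distr \<phi>)"
proof -
  obtain M where M: "M \<ge> 0" "\<And>f :: real^'d \<Rightarrow> complex. f \<in> schwartz \<Longrightarrow> integrable lborel (\<lambda>x. cmod (f x))"
    "\<And>f :: real^'d \<Rightarrow> complex. f \<in> schwartz \<Longrightarrow> (\<integral>x. cmod (f x) \<partial>lborel) \<le> M * schwartz_seminorm (2 * CARD('d)) [] f"
    using schwartz_integrable[where 'd='d] by blast
  define N where "N = 2 * CARD('d)"
  have C: "0 \<le> C" using order_trans[OF norm_ge_zero b[of 0]] .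
  have ci: "integrable lborel (\<lambda>x. C * cmod (f x))" if "f \<in> schwartz" for f :: "real^'d \<Rightarrow> complex" using M(2)[OF that] by simp
  have le: "norm (\<phi> x * f x) \<le> C * cmod (f x)" for f x
    unfolding norm_mult by (intro mult_right_mono b) simp
  have i: "integrable lborel (\<lambda>x. \<phi> x * f x)" if f: "f \<in> schwartz" for f
  proof (rule integrable_dominated[OF ci[OF f]])
    show "(\<lambda>x. \<phi> x * f x) \<in> borel_measurable lborel" using schwartz_measurable[OF f] by simp
  qed (rule le)
  have "fun_distr \<phi> (\<lambda>x. f x + g x) = fun_distr \<phi> f + fun_distr \<phi> g" if "f \<in> schwartz" "g \<in> schwartz" for f g
    using that[THEN i] that[THEN schwartz_measurable] by (simp add: fun_distr_lborel distrib_left)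
  moreover have "fun_distr \<phi> (\<lambda>x. c * f x) = c * fun_distr \<phi> f" for c f
    unfolding fun_distr_def integral_mult_right_zero[symmetric] by (simp add: mult_ac)
  moreover have "cmod (fun_distr \<phi> f) \<le> (C * M) * (\<Sum>js | length js \<le> N. schwartz_seminorm N js f)" if f: "f \<in> schwartz" for f
  proof -
    have "finite {js :: 'd list. length js \<le> N}" using finite_lists_length_le[of "UNIV :: 'd set" N] by simp
    then have "schwartz_seminorm N [] f \<le> (\<Sum>js | length js \<le> N. schwartz_seminorm N js f)"
      by (intro member_le_sum) (auto intro: schwartz_seminorm_nonneg[OF f])
    have "cmod (fun_distr \<phi> f) \<le> (\<integral>x. C * cmod (f x) \<partial>lborel)"
      unfolding fun_distr_lborel[OF schwartz_measurable[OF f]] by (rule norm_integral_le[OF i[OF f] ci[OF f]]) (rule le)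
    also have "\<dots> \<le> C * (M * schwartz_seminorm N [] f)"
      using M(3)[OF f] C by (simp add: N_def mult_left_mono)
    also have "\<dots> \<le> C * (M * (\<Sum>js | length js \<le> N. schwartz_seminorm N js f))"
      by (intro mult_left_mono) fact+
    finally show ?thesis by (simp only: mult.assoc)
  qed
  ultimately show ?thesis unfolding tempered_def by blast
qed

lemma distr_pair_tf_gaussian: "distr_pair (fun_distr \<phi>) (tf_shift z gaussian) = stft \<phi> z"
  unfolding distr_pair_def stft_def by (rule fun_distr_lborel) measurable

lemma fun_distr_mod_inf: "fun_distr \<phi> \<in> mod_inf"
proof -
  have "cmod (stft \<phi> z) \<le> C * 2 powr (real CARD('d) / 4)" for z
  proof -
    have le: "norm (\<phi> x * cnj (tf_shift z gaussian x)) \<le> C * cmod (tf_shift z gaussian x)" for x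
      unfolding norm_mult complex_mod_cnj by (intro mult_right_mono b) simp
    have ci: "integrable lborel (\<lambda>x. C * cmod (tf_shift z gaussian x))" by (intro integrable_mult_right tf_gaussian_L1)
    have "cmod (stft \<phi> z) \<le> (\<integral>x. C * cmod (tf_shift z gaussian x) \<partial>lborel)"
      unfolding stft_def
    proof (rule norm_integral_le[OF _ ci le])
      show "integrable lborel (\<lambda>x. \<phi> x * cnj (tf_shift z gaussian x))"
        by (rule integrable_dominated[OF ci _ le]) measurable
    qed
    then show ?thesis using tf_gaussian_L1(2)[of z] by simp
  qed
  then show ?thesis
    unfolding mod_inf_def mem_Collect_eq distr_pair_tf_gaussian
    by (intro conjI fun_distr_tempered bdd_aboveI2)
qed

lemma tf_shift_measurable: "tf_shift l \<phi> \<in> borel_measurable borel"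
proof -
  have "(\<lambda>x. exp (2 * pi * \<i> * complex_of_real (Im_vec l \<bullet> x))) \<in> borel_measurable (borel :: (real^'d) measure)"
    by (intro borel_measurable_continuous_onI continuous_intros)
  then show ?thesis unfolding tf_shift_def by measurable
qed

lemma norm_tf_shift: "cmod (tf_shift l \<phi> x) \<le> C"
  unfolding tf_shift_def using b by (simp add: norm_mult)

lemma tf_shift_fun_distr:
  assumes f: "f \<in> schwartz"
  shows "distr_pair (tf_shift_distr l (fun_distr \<phi>)) f = (\<integral>x. tf_shift l \<phi> x * cnj (f x) \<partial>lebesgue)"
proof -
  note [measurable] = schwartz_measurable[OF f] tf_shift_measurable
  have "(\<lambda>x. exp (2 * pi * \<i> * complex_of_real (Im_vec l \<bullet> (x + Re_vec l)))) \<in> borel_measurable (borel :: (real^'d) measure)"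
    by (intro borel_measurable_continuous_onI continuous_intros)
  then have "(\<lambda>x. exp (2 * pi * \<i> * complex_of_real (Im_vec l \<bullet> (x + Re_vec l))) * cnj (f (x + Re_vec l))) \<in> borel_measurable borel"
    by measurable
  then have "distr_pair (tf_shift_distr l (fun_distr \<phi>)) f
    = (\<integral>x. \<phi> x * (exp (2 * pi * \<i> * complex_of_real (Im_vec l \<bullet> (x + Re_vec l))) * cnj (f (x + Re_vec l))) \<partial>lborel)"
    unfolding distr_pair_def tf_shift_distr_def by (rule fun_distr_lborel)
  also have "\<dots> = (\<integral>x. tf_shift l \<phi> (x + Re_vec l) * cnj (f (x + Re_vec l)) \<partial>lborel)"
    by (simp add: tf_shift_def mult_ac)
  also have "\<dots> = (\<integral>x. tf_shift l \<phi> x * cnj (f x) \<partial>lborel)"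
    by (rule integral_lborel_translation(1)) measurable
  also have "\<dots> = (\<integral>x. tf_shift l \<phi> x * cnj (f x) \<partial>lebesgue)"
    by (rule integral_completion[symmetric]) simp
  finally show ?thesis .
qed

lemma mod_pair_tf_shift:
  assumes h: "borel_rep h h'" "mod1_borel h'"
  shows "mod_pair (tf_shift_distr l (fun_distr \<phi>)) h = (\<integral>z. stft (tf_shift l \<phi>) z * cnj (stft h' z) \<partial>lborel)"
proof -
  let ?\<psi> = "tf_shift l \<phi>"
  note [measurable] = tf_shift_measurable[of l]
  have "integrable lborel (\<lambda>x. cmod (?\<psi> x) * cmod (tf_shift z gaussian x))" for z
    by (rule integrable_dominated[OF integrable_mult_right[OF tf_gaussian_L1(1)[of z], of C]])
       (auto intro!: mult_right_mono norm_tf_shift)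
  moreover from this have "(\<integral>x. cmod (?\<psi> x) * cmod (tf_shift z gaussian x) \<partial>lborel) \<le> (\<integral>x. C * cmod (tf_shift z gaussian x) \<partial>lborel)" for z
    by (intro integral_mono integrable_mult_right[OF tf_gaussian_L1(1)] mult_right_mono norm_tf_shift) auto
  then have "(\<integral>x. cmod (?\<psi> x) * cmod (tf_shift z gaussian x) \<partial>lborel) \<le> C * 2 powr (real CARD('d) / 4)" for z
    by (simp add: tf_gaussian_L1(2))
  ultimately have "(\<integral>x. ?\<psi> x * cnj (h' x) \<partial>lborel) = (\<integral>z. stft ?\<psi> z * cnj (stft h' z) \<partial>lborel)"
    by (rule pairing_stft(1)[OF h(2) tf_shift_measurable])
  moreover have "mod_pair (tf_shift_distr l (fun_distr \<phi>)) h = (\<integral>x. ?\<psi> x * cnj (h' x) \<partial>lborel)"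
    by (rule mod_pair_bounded[OF tf_shift_measurable norm_tf_shift tf_shift_fun_distr h])
  ultimately show ?thesis by simp
qed

text \<open>Time-frequency shifts become the shifts of the Fock space.\<close>

lemma bargmann_tf_shift:
  "bargmann (tf_shift l \<phi>) z = cnj (phase l) * exp (complex_of_real pi * cdot (cnj_vec l) z) * bargmann \<phi> (z - l)"
proof -
  have key: "exp (- (2 * complex_of_real pi * \<i> * complex_of_real (Im_vec l \<bullet> (x + Re_vec l)))) * bargmann_kernel (x + Re_vec l) z
     = cnj (phase l) * exp (complex_of_real pi * cdot (cnj_vec l) z) * bargmann_kernel x (z - l)" for x
  proof -
    define r i where "r = Re_vec l" and "i = Im_vec l"
    define s where "s = cdot (cvec x) z"
    define t where "t = cdot (cvec r) z"
    define q where "q = cdot (cvec i) z"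
    have l: "cdot l z = t + \<i> * q" "cdot (cnj_vec l) z = t - \<i> * q"
      by (simp_all add: t_def q_def r_def i_def cdot_def cvec_def Re_vec_def Im_vec_def cnj_vec_def
          sum_distrib_left sum.distrib[symmetric] sum_subtractf[symmetric] distrib_right[symmetric] left_diff_distrib[symmetric]
          mult.assoc[symmetric] complex_eq[symmetric])
         (simp add: complex_eq_iff)
    have xl: "cdot (cvec x) l = of_real (x \<bullet> r) + \<i> * of_real (x \<bullet> i)" unfolding r_def i_def by (rule cdot_cvec)
    have ll: "cdot l l = of_real (r \<bullet> r - i \<bullet> i) + 2 * \<i> * of_real (r \<bullet> i)"
      unfolding cdot_self r_def i_def power2_norm_eq_inner ..
    have xr: "cdot (cvec (x + r)) z = s + t"
      by (simp add: s_def t_def cdot_def cvec_def distrib_right sum.distrib)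
    have zl: "cdot (z - l) (z - l) = cdot z z - 2 * (t + \<i> * q) + cdot l l"
      by (simp add: cdot_minus_left cdot_minus_right cdot_commute[of z l] l(1))
    have sl: "cdot (cvec x) (z - l) = s - cdot (cvec x) l" by (simp add: s_def cdot_minus_right)
    have nl: "(norm l)\<^sup>2 = r \<bullet> r + i \<bullet> i" unfolding norm_power2_Re_Im power2_norm_eq_inner r_def i_def ..
    have nx: "(norm (x + r))\<^sup>2 = (norm x)\<^sup>2 + 2 * (x \<bullet> r) + r \<bullet> r"
      by (simp add: power2_norm_eq_inner inner_add_left inner_add_right inner_commute)
    have p: "cnj (phase l) = exp (- (\<i> * complex_of_real (pi * (r \<bullet> i))) + complex_of_real (- pi * (r \<bullet> r + i \<bullet> i) / 2))"
      unfolding phase_def nl exp_add exp_of_real by (simp add: exp_cnj r_def i_def)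
    have e: "- (2 * complex_of_real pi * \<i> * complex_of_real (i \<bullet> (x + r))) +
        (complex_of_real (2 * pi) * (s + t) - complex_of_real (pi * ((norm x)\<^sup>2 + 2 * (x \<bullet> r) + r \<bullet> r)) - complex_of_real pi * cdot z z / 2)
      = (- (\<i> * complex_of_real (pi * (r \<bullet> i))) + complex_of_real (- pi * (r \<bullet> r + i \<bullet> i) / 2)) + complex_of_real pi * (t - \<i> * q) +
        (complex_of_real (2 * pi) * (s - (of_real (x \<bullet> r) + \<i> * of_real (x \<bullet> i))) - complex_of_real (pi * (norm x)\<^sup>2) -
          complex_of_real pi * (cdot z z - 2 * (t + \<i> * q) + (of_real (r \<bullet> r - i \<bullet> i) + 2 * \<i> * of_real (r \<bullet> i))) / 2)"
      by (simp add: field_simps inner_add_right inner_commute)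
    have comb: "exp a * (c * exp b) = c * exp (a + b)" "exp a * exp a' * (c * exp b) = c * exp (a + a' + b)" for a a' b c :: complex
      by (simp_all add: exp_add)
    show ?thesis
      unfolding bargmann_kernel_def r_def[symmetric] i_def[symmetric] xr nx sl zl xl ll l p
        comb e ..
  qed
  note [measurable] = tf_shift_measurable
  have bm: "(\<lambda>x. bargmann_kernel x z) \<in> borel_measurable (borel :: (real^'d) measure)"
    unfolding bargmann_kernel_def by (intro borel_measurable_continuous_onI continuous_intros) auto
  have "bargmann (tf_shift l \<phi>) z = (\<integral>x. cnj (tf_shift l \<phi> (x + Re_vec l)) * bargmann_kernel (x + Re_vec l) z \<partial>lborel)"
    unfolding bargmann_def using bm by (intro integral_lborel_translation(1)[symmetric]) measurable
  also have "\<dots> = (\<integral>x. (cnj (phase l) * exp (complex_of_real pi * cdot (cnj_vec l) z)) * (cnj (\<phi> x) * bargmann_kernel x (z - l)) \<partial>lborel)"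
  proof (rule Bochner_Integration.integral_cong[OF refl])
    fix x
    have "cnj (tf_shift l \<phi> (x + Re_vec l)) * bargmann_kernel (x + Re_vec l) z =
      cnj (\<phi> x) * (exp (- (2 * complex_of_real pi * \<i> * complex_of_real (Im_vec l \<bullet> (x + Re_vec l)))) * bargmann_kernel (x + Re_vec l) z)"
      by (simp add: tf_shift_def exp_cnj mult_ac)
    then show "cnj (tf_shift l \<phi> (x + Re_vec l)) * bargmann_kernel (x + Re_vec l) z
      = (cnj (phase l) * exp (complex_of_real pi * cdot (cnj_vec l) z)) * (cnj (\<phi> x) * bargmann_kernel x (z - l))"
      unfolding key by (simp only: mult_ac)
  qed
  finally show ?thesis unfolding integral_mult_right_zero bargmann_def .
qed

end

section \<open>Gabor expansion and Lagrange interpolation\<close>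

lemma bargmann_kernel_prod:
  fixes x :: "real^'d"
  shows "bargmann_kernel x z = (\<Prod>j\<in>UNIV. bargmann_kernel_1 (x $ j) (z $ j))"
proof -
  have "complex_of_real (2 powr (1 / 4)) ^ CARD('d) = complex_of_real (2 powr (real CARD('d) / 4))"
    by (simp flip: of_real_power add: powr_power)
  moreover have "complex_of_real (2 * pi) * cdot (cvec x) z - complex_of_real (pi * (norm x)\<^sup>2) - complex_of_real pi * cdot z z / 2
     = (\<Sum>j\<in>UNIV. complex_of_real (2 * pi * x $ j) * z $ j - complex_of_real (pi * (x $ j)\<^sup>2) - complex_of_real pi * (z $ j)\<^sup>2 / 2)"
    unfolding cdot_def cvec_def norm_vec_power2
    by (simp add: sum_subtractf sum_distrib_left sum_divide_distrib power2_eq_square mult.assoc)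
  ultimately show ?thesis
    unfolding bargmann_kernel_def bargmann_kernel_1_def prod.distrib by (simp add: exp_sum)
qed

context triangular_lattice
begin

text \<open>A dual window of the \<open>d\<close>-dimensional Gaussian for the lattice: the interpolating function is, up to the factor
  \<open>vol\<close>, its Bargmann transform.\<close>

definition dual_gaussian :: "(real, 'd) vec \<Rightarrow> complex" where
  "dual_gaussian x = (\<Prod>j\<in>UNIV. complex_of_real (dual_window (gam j) (x $ j)))"

lemma dual_gaussian_measurable: "dual_gaussian \<in> borel_measurable borel"
proof -
  have "(\<lambda>x :: (real, 'd) vec. dual_window (gam j) (x $ j)) \<in> borel_measurable borel" for j
    by (rule measurable_compose[OF borel_measurable_continuous_onI dual_window_measurable]) (intro continuous_intros)
  then show ?thesis unfolding dual_gaussian_def by measurable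
qed

lemma dual_gaussian_bound: "\<exists>C. \<forall>x. cmod (dual_gaussian x) \<le> C"
proof -
  obtain C where C: "\<And>j x. \<bar>dual_window (gam j) x\<bar> \<le> C j" using dual_window_bound[OF pos le1] by metis
  have "cmod (dual_gaussian x) \<le> (\<Prod>j\<in>UNIV. C j)" for x
    unfolding dual_gaussian_def prod_norm[symmetric] by (intro prod_mono) (simp add: C)
  then show ?thesis by blast
qed

lemma bargmann_dual_gaussian: "bargmann dual_gaussian z = of_real vol * interp z"
proof -
  have "bargmann dual_gaussian z = (\<integral>x. (\<Prod>j\<in>UNIV. complex_of_real (dual_window (gam j) (x $ j)) * bargmann_kernel_1 (x $ j) (z $ j)) \<partial>lborel)"
    unfolding bargmann_def dual_gaussian_def bargmann_kernel_prod prod.distrib by simp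
  also have "\<dots> = (\<Prod>j\<in>UNIV. \<integral>t. complex_of_real (dual_window (gam j) t) * bargmann_kernel_1 t (z $ j) \<partial>lborel)"
    by (rule integral_lborel_prod_vec(2)) (rule interp_1_integrable[OF pos le1])
  also have "\<dots> = (\<Prod>j\<in>UNIV. of_real ((gam j)\<^sup>2) * interp_1 (gam j) (z $ j))"
  proof (rule prod.cong[OF refl])
    fix j
    show "(\<integral>t. complex_of_real (dual_window (gam j) t) * bargmann_kernel_1 t (z $ j) \<partial>lborel) = of_real ((gam j)\<^sup>2) * interp_1 (gam j) (z $ j)"
      using pos[of j] by (simp add: interp_1_def)
  qed
  finally show ?thesis unfolding prod.distrib vol_def interp_def by simp
qed

lemma phase_bargmann_tf_shift:
  "phase l * bargmann (tf_shift l dual_gaussian) z = of_real vol * atom l z"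
proof -
  obtain C where C: "\<And>x. cmod (dual_gaussian x) \<le> C" using dual_gaussian_bound by blast
  have "phase l * cnj (phase l) = of_real ((cmod (phase l))\<^sup>2)" by (rule complex_norm_square[symmetric])
  also have "(cmod (phase l))\<^sup>2 = exp (- pi * (norm l)\<^sup>2)" by (simp add: norm_phase exp_double[symmetric])
  finally have p: "phase l * cnj (phase l) = of_real (exp (- pi * (norm l)\<^sup>2))" .
  have "phase l * bargmann (tf_shift l dual_gaussian) z
    = (phase l * cnj (phase l)) * (exp (complex_of_real pi * cdot (cnj_vec l) z) * bargmann dual_gaussian (z - l))"
    unfolding bargmann_tf_shift[OF dual_gaussian_measurable C] by (simp only: mult.assoc)
  then show ?thesis unfolding p bargmann_dual_gaussian atom_def by (simp only: mult_ac)
qed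

lemma bargmann_reproduced:
  assumes f: "mod1_borel f"
  shows "reproduced (bargmann f)"
proof -
  have sq: "square_integrable f" and "integrable lborel (\<lambda>z. cmod (stft f z))" using f by (auto simp: mod1_borel_def)
  moreover have "(\<lambda>z. cmod (stft f z)) = (\<lambda>z. cmod (bargmann f z) * exp (- pi * (norm z)\<^sup>2 / 2))"
    by (simp only: complex_mod_cnj[of "stft f _", symmetric] cnj_stft norm_mult norm_phase mult.commute)
  moreover have "bargmann f \<in> borel_measurable borel" using sq by (auto simp: square_integrable_def intro: bargmann_measurable)
  ultimately show ?thesis
    unfolding reproduced_def by (intro conjI allI bargmann_reproducing[OF sq]) (simp_all only:)
qed

text \<open>After complex conjugation the terms are those of the weak interpolation of the Bargmann transform of \<open>f\<close>,
  tested against the short-time Fourier transform of \<open>h\<close>.\<close>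

theorem gabor_expansion:
  assumes f: "f \<in> mod1" and h: "h \<in> mod1"
  defines "c \<equiv> \<lambda>l. l2_inner f (tf_shift l gaussian) * mod_pair (tf_shift_distr l (fun_distr dual_gaussian)) h"
  shows "(\<lambda>l. norm (c l)) summable_on matrix_lattice S" and "(c has_sum l2_inner f h) (matrix_lattice S)"
proof -
  obtain f' where f': "borel_rep f f'" "mod1_borel f'" using mod1_borel_rep_ex[OF f] by blast
  obtain h' where h': "borel_rep h h'" "mod1_borel h'" using mod1_borel_rep_ex[OF h] by blast
  obtain C where C: "\<And>x. cmod (dual_gaussian x) \<le> C" using dual_gaussian_bound by blast
  have [measurable]: "stft h' \<in> borel_measurable borel" and hi: "integrable lborel (\<lambda>z. cmod (stft h' z))"
    using h'(2) by (auto simp: mod1_borel_def square_integrable_def intro: stft_measurable)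
  define K where "K z = phase z * stft h' z" for z
  have Km: "K \<in> borel_measurable borel" unfolding K_def by measurable
  have "exp (- pi * (norm z)\<^sup>2 / 2) * exp (pi * (norm z)\<^sup>2 / 2) = 1" for z :: "(complex, 'd) vec"
    by (simp flip: exp_add)
  then have "cmod (K z) * exp (pi * (norm z)\<^sup>2 / 2) = cmod (stft h' z)" for z
    unfolding K_def norm_mult norm_phase by (metis mult.commute mult.left_commute mult.right_neutral)
  then have Ki: "integrable lborel (\<lambda>z. cmod (K z) * exp (pi * (norm z)\<^sup>2 / 2))" using hi by simp
  have "cnj (c l) = of_real vol * (bargmann f' l * (\<integral>z. atom l z * K z \<partial>lborel))" for l
  proof -
    have "cnj (c l) = cnj (stft f' l) * (\<integral>z. cnj (stft (tf_shift l dual_gaussian) z) * stft h' z \<partial>lborel)"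
      unfolding c_def l2_inner_tf_gaussian[OF f'(1)] mod_pair_tf_shift[OF dual_gaussian_measurable C h']
        complex_cnj_mult Bochner_Integration.integral_cnj[symmetric] complex_cnj_cnj ..
    also have "\<dots> = bargmann f' l * (phase l * (\<integral>z. bargmann (tf_shift l dual_gaussian) z * K z \<partial>lborel))"
      unfolding cnj_stft K_def by (simp only: mult_ac)
    also have "phase l * (\<integral>z. bargmann (tf_shift l dual_gaussian) z * K z \<partial>lborel) = (\<integral>z. of_real vol * (atom l z * K z) \<partial>lborel)"
      unfolding integral_mult_right_zero[symmetric] mult.assoc[symmetric] phase_bargmann_tf_shift ..
    finally show ?thesis unfolding integral_mult_right_zero by (simp only: mult_ac)
  qed
  note W = weak_interpolation[OF bargmann_reproduced[OF f'(2)] Km Ki, folded this]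
  show "(\<lambda>l. norm (c l)) summable_on matrix_lattice S" using W(1) by simp
  have "(\<integral>z. bargmann f' z * K z \<partial>lborel) = cnj (\<integral>z. stft f' z * cnj (stft h' z) \<partial>lborel)"
  proof -
    have "cnj (\<integral>z. stft f' z * cnj (stft h' z) \<partial>lborel) = (\<integral>z. cnj (stft f' z) * stft h' z \<partial>lborel)"
      by (simp only: Bochner_Integration.integral_cnj[symmetric] complex_cnj_mult complex_cnj_cnj)
    then show ?thesis unfolding cnj_stft K_def by (simp only: mult_ac)
  qed
  also have "(\<integral>z. stft f' z * cnj (stft h' z) \<partial>lborel) = l2_inner f h"
    unfolding l2_inner_borel_rep[OF f'(1) h'(1)] using f'(2) by (intro moyal[symmetric] h'(2)) (simp add: mod1_borel_def)
  finally show "(c has_sum l2_inner f h) (matrix_lattice S)" using W(2) by simp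
qed

text \<open>The conjugate transpose is lower triangular, so here the smallest index of a nonzero entry is used.\<close>

lemma conj_transpose_mult_bottom:
  assumes "\<mu> \<noteq> 0"
  shows "\<exists>j. \<mu> $ j \<noteq> 0 \<and> (conj_transpose S *v \<mu>) $ j = of_real (gam j) * \<mu> $ j"
proof -
  have ne: "{j. \<mu> $ j \<noteq> 0} \<noteq> {}" using assms by (auto simp: vec_eq_iff)
  define j where "j = Min {j. \<mu> $ j \<noteq> 0}"
  have j: "\<mu> $ j \<noteq> 0" using Min_in[OF _ ne] by (simp add: j_def)
  have lt: "\<mu> $ i = 0" if "i < j" for i
  proof (rule ccontr)
    assume "\<mu> $ i \<noteq> 0"
    then have "j \<le> i" unfolding j_def by (intro Min_le) auto
    with that show False by simp
  qed
  have "cnj (S $ i $ j) * \<mu> $ i = (if i = j then of_real (gam j) * \<mu> $ j else 0)" for i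
    using lt[of i] upper_zero[of j i] diag[of j] by (cases i j rule: linorder_cases) auto
  then have "(conj_transpose S *v \<mu>) $ j = of_real (gam j) * \<mu> $ j"
    by (simp add: matrix_vector_mult_def conj_transpose_def)
  with j show ?thesis by blast
qed

text \<open>At its first nonzero coordinate \<open>j\<close>, a point of the adjoint lattice is a nonzero Gaussian integer divided by
  \<open>gam j\<close>, and there the factor of \<open>interp\<close> vanishes.\<close>

lemma interp_adjoint_lattice:
  assumes "\<mu> \<in> matrix_lattice (matrix_inv (conj_transpose S))"
  shows "interp \<mu> = (if \<mu> = 0 then 1 else 0)"
proof -
  let ?A = "conj_transpose S"
  obtain k where k: "\<mu> = matrix_inv ?A *v k" "\<And>j. k $ j \<in> gauss_int" using assms by (auto simp: matrix_lattice_def)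
  have "x = 0" if "?A *v x = 0" for x
  proof (rule ccontr)
    assume "x \<noteq> 0"
    then obtain j where "x $ j \<noteq> 0" "(?A *v x) $ j = of_real (gam j) * x $ j" using conj_transpose_mult_bottom by blast
    then show False using that pos[of j] by simp
  qed
  then have "inj ((*v) ?A)" by (intro injI) (metis eq_iff_diff_eq_0 matrix_vector_mult_diff_distrib)
  then have "invertible ?A" using matrix_left_invertible_injective invertible_left_inverse by blast
  then have "?A ** matrix_inv ?A = mat 1" unfolding invertible_def matrix_inv_def by (rule someI2_ex) simp
  then have A: "?A *v \<mu> = k" unfolding k(1) by (simp add: matrix_vector_mul_assoc)
  show ?thesis
  proof (cases "\<mu> = 0")
    case True
    have "interp_1 (gam j) 0 = 1" for j
      using interp_1_lattice[OF pos le1, of 0 j] by (simp add: mem_gauss_int_iff)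
    then show ?thesis using True by (simp add: interp_def)
  next
    case False
    then obtain j where j: "\<mu> $ j \<noteq> 0" "(?A *v \<mu>) $ j = of_real (gam j) * \<mu> $ j" using conj_transpose_mult_bottom by blast
    then have "\<mu> $ j = k $ j / of_real (gam j)" "k $ j \<noteq> 0" using pos[of j] by (auto simp: A)
    then have "interp_1 (gam j) (\<mu> $ j) = 0" using interp_1_lattice[OF pos le1 k(2), of j j] by simp
    then show ?thesis using False by (auto simp: interp_def)
  qed
qed

lemma interp_fock_inf: "interp \<in> fock_inf"
proof -
  obtain C where C: "\<And>z. cmod (interp z) \<le> C * exp (pi * (norm z)\<^sup>2 / 2)" using interp_bound by blast
  have "cmod (interp z) * exp (- pi * (norm z)\<^sup>2 / 2) \<le> C" for z
  proof -
    have "cmod (interp z) * exp (- pi * (norm z)\<^sup>2 / 2) \<le> C * exp (pi * (norm z)\<^sup>2 / 2) * exp (- pi * (norm z)\<^sup>2 / 2)"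
      by (intro mult_right_mono C) simp
    also have "\<dots> = C" by (simp add: mult.assoc flip: exp_add)
    finally show ?thesis .
  qed
  then show ?thesis unfolding fock_inf_def mem_Collect_eq by (intro conjI interp_entire bdd_aboveI2)
qed

theorem weak_lagrange_interpolation:
  assumes F: "F \<in> fock1" and H: "H \<in> fock1"
  shows "((\<lambda>l. of_real vol * (F l * complex_of_real (exp (- pi * (norm l)\<^sup>2)) *
            integral\<^sup>L lebesgue (\<lambda>z. exp (complex_of_real pi * cdot (cnj_vec l) z) * interp (z - l)
                      * cnj (H z) * complex_of_real (exp (- pi * (norm z)\<^sup>2)))))
         has_sum integral\<^sup>L lebesgue (\<lambda>z. F z * cnj (H z) * complex_of_real (exp (- pi * (norm z)\<^sup>2)))) (matrix_lattice S)"
proof -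
  define K where "K z = cnj (H z) * complex_of_real (exp (- pi * (norm z)\<^sup>2))" for z
  have Fm[measurable]: "F \<in> borel_measurable borel" and Hm[measurable]: "H \<in> borel_measurable borel"
    using F H by (auto simp: fock1_def intro: entire_measurable)
  have im[measurable]: "interp \<in> borel_measurable borel" by (rule entire_measurable[OF interp_entire])
  have Km[measurable]: "K \<in> borel_measurable borel" unfolding K_def by measurable
  have "cmod (K z) * exp (pi * (norm z)\<^sup>2 / 2) = cmod (H z) * exp (- pi * (norm z)\<^sup>2 / 2)" for z
    unfolding K_def by (simp add: norm_mult mult.assoc field_simps flip: exp_add)
  moreover have "integrable lborel (\<lambda>z. cmod (H z) * exp (- pi * (norm z)\<^sup>2 / 2))"
    using fock1_reproduced[OF H] unfolding reproduced_def by blast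
  ultimately have Ki: "integrable lborel (\<lambda>z. cmod (K z) * exp (pi * (norm z)\<^sup>2 / 2))" by simp
  have *: "of_real vol * (F l * (\<integral>z. atom l z * K z \<partial>lborel)) = of_real vol * (F l * complex_of_real (exp (- pi * (norm l)\<^sup>2)) *
       integral\<^sup>L lebesgue (\<lambda>z. exp (complex_of_real pi * cdot (cnj_vec l) z) * interp (z - l)
                      * cnj (H z) * complex_of_real (exp (- pi * (norm z)\<^sup>2))))" for l
  proof -
    have m: "(\<lambda>z. exp (complex_of_real pi * cdot (cnj_vec l) z)) \<in> borel_measurable borel"
      by (intro borel_measurable_continuous_onI continuous_intros)
    have "(\<integral>z. atom l z * K z \<partial>lborel) = (\<integral>z. complex_of_real (exp (- pi * (norm l)\<^sup>2)) * (exp (complex_of_real pi * cdot (cnj_vec l) z) * interp (z - l)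
                      * cnj (H z) * complex_of_real (exp (- pi * (norm z)\<^sup>2))) \<partial>lborel)"
      unfolding atom_def K_def by (simp only: mult_ac)
    also have "\<dots> = complex_of_real (exp (- pi * (norm l)\<^sup>2)) * integral\<^sup>L lebesgue (\<lambda>z. exp (complex_of_real pi * cdot (cnj_vec l) z) * interp (z - l)
                      * cnj (H z) * complex_of_real (exp (- pi * (norm z)\<^sup>2)))"
      unfolding integral_mult_right_zero using m by (subst integral_completion) auto
    finally show ?thesis by (simp only: mult.assoc)
  qed
  have "(\<integral>z. F z * K z \<partial>lborel) = integral\<^sup>L lebesgue (\<lambda>z. F z * cnj (H z) * complex_of_real (exp (- pi * (norm z)\<^sup>2)))"
    unfolding K_def mult.assoc by (rule integral_completion[symmetric]) simp
  then show ?thesis using weak_interpolation(2)[OF fock1_reproduced[OF F] Km Ki] unfolding * by simp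
qed

theorem lattice_uniqueness:
  assumes F: "F \<in> fock1" and 0: "\<And>l. l \<in> matrix_lattice S \<Longrightarrow> F l = 0"
  shows "F z = 0"
proof -
  have "((\<lambda>l. of_real vol * (F l * atom l z)) has_sum F z) (matrix_lattice S)"
    by (rule interpolation_formula[OF fock1_reproduced[OF F]])
  moreover have "((\<lambda>l. of_real vol * (F l * atom l z)) has_sum 0) (matrix_lattice S)"
    by (rule has_sum_0) (simp add: 0)
  ultimately show ?thesis by (rule has_sum_unique)
qed

end

theorem theorem5p3:
  fixes S :: "complex ^ ('d :: {finite, linorder}) ^ ('d :: {finite, linorder})"
    and gam :: "'d \<Rightarrow> real"
    and L L0 :: "(complex, 'd) vec set"
  assumes "upper_triangular S"
    and "\<And>j. S $ j $ j = complex_of_real (gam j)"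
    and "\<And>j. gam j > 0"
    and "Max (range gam) = 1"
    and "L = matrix_lattice S"
    and "L0 = matrix_lattice (matrix_inv (conj_transpose S))"
  shows
    "(\<exists>\<gamma> \<in> mod_inf.
        (\<forall>\<mu>\<in>L0. complex_of_real (1 / lattice_vol L) * distr_pair \<gamma> (tf_shift \<mu> gaussian)
                    = (if \<mu> = 0 then 1 else 0)) \<and>
        (\<forall>f\<in>mod1. \<forall>h\<in>mod1.
           (\<lambda>l. norm (l2_inner f (tf_shift l gaussian) * mod_pair (tf_shift_distr l \<gamma>) h))
             summable_on L \<and>
           ((\<lambda>l. l2_inner f (tf_shift l gaussian) * mod_pair (tf_shift_distr l \<gamma>) h)
             has_sum l2_inner f h) L)) \<and>
     (\<exists>\<tau> \<in> fock_inf.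
        (\<forall>\<mu>\<in>L0. \<tau> \<mu> = (if \<mu> = 0 then 1 else 0)) \<and>
        (\<forall>F\<in>fock1. \<forall>H\<in>fock1.
           ((\<lambda>l. complex_of_real (lattice_vol L) *
                  (F l * complex_of_real (exp (- pi * (norm l)\<^sup>2)) *
                    integral\<^sup>L lebesgue (\<lambda>z. exp (complex_of_real pi * cdot (cnj_vec l) z) * \<tau> (z - l)
                      * cnj (H z) * complex_of_real (exp (- pi * (norm z)\<^sup>2)))))
             has_sum
               integral\<^sup>L lebesgue (\<lambda>z. F z * cnj (H z) * complex_of_real (exp (- pi * (norm z)\<^sup>2)))) L)) \<and>
     (\<forall>F\<in>fock1. (\<forall>l\<in>L. F l = 0) \<longrightarrow> (\<forall>z. F z = 0))"
proof -
  interpret triangular_lattice S gam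
  proof
    show "upper_triangular S" by fact
    show "S $ j $ j = complex_of_real (gam j)" "0 < gam j" for j by fact+
    show "gam j \<le> 1" for j using Max_ge[of "range gam" "gam j"] assms(4) by simp
  qed
  have L: "L = matrix_lattice S" and L0: "\<And>\<mu>. \<mu> \<in> L0 \<Longrightarrow> interp \<mu> = (if \<mu> = 0 then 1 else 0)"
    using assms(5,6) interp_adjoint_lattice by auto
  have vol: "lattice_vol L = vol" unfolding L vol_def by (rule lattice_vol_eq)
  obtain C where C: "\<And>x. cmod (dual_gaussian x) \<le> C" using dual_gaussian_bound by blast
  have gabor: "complex_of_real (1 / lattice_vol L) * distr_pair (fun_distr dual_gaussian) (tf_shift \<mu> gaussian) = (if \<mu> = 0 then 1 else 0)"
    if "\<mu> \<in> L0" for \<mu>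
  proof -
    have "stft dual_gaussian \<mu> = cnj (phase \<mu> * (of_real vol * interp \<mu>))"
      unfolding bargmann_dual_gaussian[symmetric] cnj_stft[symmetric] by simp
    moreover have "phase (0 :: (complex, 'd) vec) = 1" by (simp add: phase_def Re_vec_def Im_vec_def inner_vec_def)
    ultimately show ?thesis
      using vol_pos unfolding distr_pair_tf_gaussian[OF dual_gaussian_measurable C] vol L0[OF that] by simp
  qed
  show ?thesis
    unfolding vol
  proof (intro conjI bexI[of _ "fun_distr dual_gaussian"] bexI[of _ interp] ballI allI impI)
    fix \<mu> assume "\<mu> \<in> L0"
    then show "complex_of_real (1 / vol) * distr_pair (fun_distr dual_gaussian) (tf_shift \<mu> gaussian) = (if \<mu> = 0 then 1 else 0)"
      and "interp \<mu> = (if \<mu> = 0 then 1 else 0)"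
      using gabor L0 unfolding vol by blast+
  next
    show "fun_distr dual_gaussian \<in> mod_inf" by (rule fun_distr_mod_inf[OF dual_gaussian_measurable C])
    show "interp \<in> fock_inf" by (rule interp_fock_inf)
  next
    fix f h :: "(real, 'd) vec \<Rightarrow> complex" assume "f \<in> mod1" "h \<in> mod1"
    from gabor_expansion[OF this, folded L]
    show "(\<lambda>l. norm (l2_inner f (tf_shift l gaussian) * mod_pair (tf_shift_distr l (fun_distr dual_gaussian)) h)) summable_on L"
      and "((\<lambda>l. l2_inner f (tf_shift l gaussian) * mod_pair (tf_shift_distr l (fun_distr dual_gaussian)) h) has_sum l2_inner f h) L" .
  next
    fix F H :: "(complex, 'd) vec \<Rightarrow> complex" assume "F \<in> fock1" "H \<in> fock1"
    from weak_lagrange_interpolation[OF this, folded L]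
    show "((\<lambda>l. complex_of_real vol * (F l * complex_of_real (exp (- pi * (norm l)\<^sup>2)) *
                    integral\<^sup>L lebesgue (\<lambda>z. exp (complex_of_real pi * cdot (cnj_vec l) z) * interp (z - l)
                      * cnj (H z) * complex_of_real (exp (- pi * (norm z)\<^sup>2)))))
             has_sum integral\<^sup>L lebesgue (\<lambda>z. F z * cnj (H z) * complex_of_real (exp (- pi * (norm z)\<^sup>2)))) L" .
  next
    fix F :: "(complex, 'd) vec \<Rightarrow> complex" and z assume "F \<in> fock1" "\<forall>l\<in>L. F l = 0"
    then show "F z = 0" using lattice_uniqueness[of F z] unfolding L by blast
  qed
qed

end
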